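(* Let $N,p,q,\sigma$ be real numbers with $q>p-1>0$ and $-\sigma>p>N$. Consider the positive solutions of $$(\mathrm E_\varepsilon)\qquad -(|w'|^{p-2}w')'-\frac{N-1}{r}|w'|^{p-2}w'=\varepsilon r^{\sigma}w^{q},\qquad \varepsilon=\pm1 .$$ For $\varepsilon=\pm1$ and any $C>0$ there exists a unique local solution near $\infty$ such that $$\lim_{r\to\infty}w=C,\qquad \lim_{r\to\infty}r^{-\frac{\sigma+1}{p-1}}w'=\varepsilon d(C),\quad d(C)>0.$$ (1) Let $p-1<q<q_c$. For $\varepsilon=\pm1$ and any $k>0$ there exist infinitely many local solutions near $\infty$ such that $\lim_{r\to\infty}r^{\frac{N-p}{p-1}}w=k$ and $\lim_{r\to\infty}r^{\frac{N-1}{p-1}}w'=c(k)>0$. For $\varepsilon=1$ there is no positive solution in $(0,r_0)$, $r_0>0$. For $\varepsilon=-1$ there exists the global particular solution $w^*=a^*r^{-\gamma}$, and there exist solutions such that $\lim_{r\to\infty}r^{\frac{N-p}{p-1}}w=k>0$ and $\lim_{r\to0}r^\gamma w=a^*$. (2) Let $q>q_c$. For $\varepsilon=\pm1$ and $k>0$ there exists a local solution near $0$, unique up to a scaling, such that $\lim_{r\to0}r^{\frac{N-p}{p-1}}w=k$ and $\lim_{r\to0}r^{\frac{N-1}{p-1}}w'=c(k)>0$. For $\varepsilon=-1$ all the local solutions near $\infty$ have a finite limit as $r\to\infty$, and are not global. For $\varepsilon=1$ there is the particular solution $w^*=a^*r^{-\gamma}$; moreover: (i) if $q<q_S$, there exists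 no global solution with a finite limit as $r\to\infty$, and there exist solutions such that $\lim_{r\to\infty}r^\gamma w=a^*$ and $\lim_{r\to0}r^{\frac{N-p}{p-1}}w=k>0$; (ii) if $q>q_S$, there exist global solutions such that $\lim_{r\to\infty}w=C>0$ and $\lim_{r\to0}r^\gamma w=a^*$; (iii) if $q=q_S$, there are explicit solutions $$w=c\bigl(d+r^{\frac{p+\sigma}{p-1}}\bigr)^{\frac{p-N}{p+\sigma}},\quad c>0,\qquad d=c^{\,q-p+1}|N+\sigma|^{-1}\Bigl(\frac{p-N}{p-1}\Bigr)^{1-p},$$ satisfying $\lim_{r\to0}w=0$, with $w\sim c\,r^{\frac{p-N}{p-1}}$ as $r\to0$, and $\lim_{r\to\infty}w=c\,d^{\frac{p-N}{p+\sigma}}$. (3) Let $q=q_c$, and set $\kappa=\Bigl(\bigl(\tfrac{p-N}{p-1}\bigr)^{p}\,\tfrac{p-1}{|p+\sigma|}\Bigr)^{\frac{p-N}{(p-1)|p+\sigma|}}$. For $\varepsilon=\pm1$ there exist infinitely many local solutions near $\infty$ such that $$\lim_{r\to\infty}\bigl(r^{-1}|\ln r|^{\frac1{|p+\sigma|}}\bigr)^{\frac{p-N}{p-1}}w=\kappa,\qquad \lim_{r\to\infty}r^{\frac{N-1}{p-1}}|\ln r|^{\frac{p-N}{|p+\sigma|(p-1)}}w'=\frac{p-N}{p-1}\kappa .$$ For $\varepsilon=1$ there is no positive solution in $(0,r_0)$, $r_0>0$. For $\varepsilon=-1$ there exist infinitely many solutions such that $$\lim_{r\to0}\bigl(r^{-1}|\ln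 r|^{\frac1{|p+\sigma|}}\bigr)^{\frac{p-N}{p-1}}w=\kappa,\qquad \lim_{r\to0}r^{\frac{N-1}{p-1}}|\ln r|^{\frac{p-N}{|p+\sigma|(p-1)}}|w'|=\frac{p-N}{p-1}\kappa .$$
   Context: $N$ is not necessarily an integer. $q_c=\frac{(N+\sigma)(p-1)}{N-p}$, $q_S=\frac{N(p-1)+p+p\sigma}{N-p}$, $\gamma=\frac{p+\sigma}{q+1-p}$ (negative here), and $a^*>0$ is defined by $(a^* )^{q-p+1}=\varepsilon|\gamma|^{p-2}\gamma\,(N-p-(p-1)\gamma)$ (when the right side is positive). A local solution near $0$ (resp. near $\infty$) is a positive solution on $(0,r_0)$ (resp. $(r_0,\infty)$) for some $r_0>0$; a solution is global if it is a positive solution on $(0,\infty)$. $c(\cdot),d(\cdot)$ denote positive constants depending on their argument (and on the parameters). Scaling means $w\mapsto\lambda^\gamma w(\lambda r)$, $\lambda>0$, which preserves the equation. $f\sim g$ means $f/g\to1$.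
   Formalization: In (3), the infinitely many local solutions near ∞ with the logarithmic behaviour are claimed only for ε=1; for ε=−1 none exist, since r^{N-1}|w'|^{p-2}w' is then strictly increasing while the stated limit of w' would make it eventually positive and tend to 0. *)

theory Defs
  imports "HOL-Analysis.Analysis" "HOL-Library.Landau_Symbols"
begin

definition q_crit :: "real \<Rightarrow> real \<Rightarrow> real \<Rightarrow> real" where
  "q_crit N p \<sigma> = (N + \<sigma>) * (p - 1) / (N - p)"

definition q_sob :: "real \<Rightarrow> real \<Rightarrow> real \<Rightarrow> real" where
  "q_sob N p \<sigma> = (N * (p - 1) + p + p * \<sigma>) / (N - p)"

definition gam :: "real \<Rightarrow> real \<Rightarrow> real \<Rightarrow> real" where
  "gam p q \<sigma> = (p + \<sigma>) / (q + 1 - p)"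

text \<open>Meaningful only when the right-hand side of the defining equation is positive.\<close>
definition a_star :: "real \<Rightarrow> real \<Rightarrow> real \<Rightarrow> real \<Rightarrow> real \<Rightarrow> real" where
  "a_star N p q \<sigma> \<epsilon> =
    (THE a. a > 0 \<and>
       a powr (q - p + 1) =
         \<epsilon> * \<bar>gam p q \<sigma>\<bar> powr (p - 2) * gam p q \<sigma> * (N - p - (p - 1) * gam p q \<sigma>))"

definition w_star :: "real \<Rightarrow> real \<Rightarrow> real \<Rightarrow> real \<Rightarrow> real \<Rightarrow> real \<Rightarrow> real" where
  "w_star N p q \<sigma> \<epsilon> = (\<lambda>r. a_star N p q \<sigma> \<epsilon> * r powr (- gam p q \<sigma>))"

definition kap :: "real \<Rightarrow> real \<Rightarrow> real \<Rightarrow> real" where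
  "kap N p \<sigma> = (((p - N) / (p - 1)) powr p * ((p - 1) / \<bar>p + \<sigma>\<bar>))
                 powr ((p - N) / ((p - 1) * \<bar>p + \<sigma>\<bar>))"

text \<open>At a critical point of \<open>w\<close> the flux is \<open>0\<close> for every \<open>p\<close>, because \<open>0 powr (p - 2) = 0\<close>.\<close>
definition flux :: "real \<Rightarrow> (real \<Rightarrow> real) \<Rightarrow> real \<Rightarrow> real" where
  "flux p w = (\<lambda>r. \<bar>deriv w r\<bar> powr (p - 2) * deriv w r)"

text \<open>Classical positive solutions. Differentiability of the flux makes it, and hence the
  derivative of \<open>w\<close>, continuous, so the solutions are of class \<open>C\<^sup>1\<close>.\<close>
definition pos_solution_on ::
    "real \<Rightarrow> real \<Rightarrow> real \<Rightarrow> real \<Rightarrow> real \<Rightarrow> real set \<Rightarrow> (real \<Rightarrow> real) \<Rightarrow> bool" where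
  "pos_solution_on N p q \<sigma> \<epsilon> I w \<longleftrightarrow>
    (\<forall>r\<in>I. w r > 0 \<and> w differentiable (at r) \<and> flux p w differentiable (at r) \<and>
       - deriv (flux p w) r - (N - 1) / r * flux p w r = \<epsilon> * r powr \<sigma> * w r powr q)"

definition sol_near_zero ::
    "real \<Rightarrow> real \<Rightarrow> real \<Rightarrow> real \<Rightarrow> real \<Rightarrow> (real \<Rightarrow> real) \<Rightarrow> bool" where
  "sol_near_zero N p q \<sigma> \<epsilon> w \<longleftrightarrow> (\<exists>r0>0. pos_solution_on N p q \<sigma> \<epsilon> {0<..<r0} w)"

definition sol_near_infty ::
    "real \<Rightarrow> real \<Rightarrow> real \<Rightarrow> real \<Rightarrow> real \<Rightarrow> (real \<Rightarrow> real) \<Rightarrow> bool" where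
  "sol_near_infty N p q \<sigma> \<epsilon> w \<longleftrightarrow> (\<exists>r0>0. pos_solution_on N p q \<sigma> \<epsilon> {r0<..} w)"

definition global_sol ::
    "real \<Rightarrow> real \<Rightarrow> real \<Rightarrow> real \<Rightarrow> real \<Rightarrow> (real \<Rightarrow> real) \<Rightarrow> bool" where
  "global_sol N p q \<sigma> \<epsilon> w \<longleftrightarrow> pos_solution_on N p q \<sigma> \<epsilon> {0<..} w"

definition scaling :: "real \<Rightarrow> real \<Rightarrow> (real \<Rightarrow> real) \<Rightarrow> real \<Rightarrow> real" where
  "scaling \<gamma> \<mu> w = (\<lambda>r. \<mu> powr \<gamma> * w (\<mu> * r))"

text \<open>Functions are total here, so two functions represent the same local solution iff they agree
  eventually (near infinity, or near \<open>0\<close>). Uniqueness and infinitude of local solutions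
  are therefore counted up to eventual equality; counting functions would make the
  former false and the latter trivial.\<close>
definition unique_germ :: "real filter \<Rightarrow> ((real \<Rightarrow> real) \<Rightarrow> bool) \<Rightarrow> bool" where
  "unique_germ F P \<longleftrightarrow>
    (\<exists>w. P w) \<and> (\<forall>u v. P u \<and> P v \<longrightarrow> (\<forall>\<^sub>F r in F. u r = v r))"

definition infinitely_many_germs :: "real filter \<Rightarrow> ((real \<Rightarrow> real) \<Rightarrow> bool) \<Rightarrow> bool" where
  "infinitely_many_germs F P \<longleftrightarrow>
    (\<exists>S. infinite S \<and> (\<forall>w\<in>S. P w) \<and> pairwise (\<lambda>u v. \<not> (\<forall>\<^sub>F r in F. u r = v r)) S)"

text \<open>For \<open>\<epsilon> = -1\<close> no local solution near infinity has the logarithmic behaviour of the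
  critical case: the weighted flux \<open>r\<^sup>N\<^sup>-\<^sup>1 |w'|\<^sup>p\<^sup>-\<^sup>2 w'\<close> is then
  increasing, whereas that behaviour would make it positive with limit \<open>0\<close>. This is
  why only \<open>\<epsilon> = 1\<close> can be claimed there.\<close>
lemma no_log_behaviour_near_infty:
  assumes p: "p > 1" and pN: "p > N" and \<sigma>: "- \<sigma> > p"
    and sol: "sol_near_infty N p q \<sigma> (-1) w"
    and lim: "((\<lambda>r. r powr ((N - 1) / (p - 1)) * \<bar>ln r\<bar> powr ((p - N) / (\<bar>p + \<sigma>\<bar> * (p - 1)))
                     * deriv w r) \<longlongrightarrow> (p - N) / (p - 1) * kap N p \<sigma>) at_top"
  shows False
proof -
  define \<theta> where "\<theta> = (p - N) / (\<bar>p + \<sigma>\<bar> * (p - 1))"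
  define L where "L = (p - N) / (p - 1) * kap N p \<sigma>"
  define g where "g = (\<lambda>r. r powr ((N - 1) / (p - 1)) * deriv w r)"
  define Y where "Y = (\<lambda>r. r powr (N - 1) * flux p w r)"
  have \<theta>: "\<theta> > 0" using p pN \<sigma> by (simp add: \<theta>_def)
  have L: "L > 0" using p pN \<sigma> by (simp add: L_def kap_def)
  obtain r0 where r0: "r0 > 0" and S: "pos_solution_on N p q \<sigma> (-1) {r0<..} w"
    using sol by (auto simp: sol_near_infty_def)
  have Yder: "\<exists>D. (Y has_real_derivative D) (at r) \<and> D > 0" if r: "r > r0" for r
  proof -
    have f: "flux p w differentiable (at r)" and w: "w r > 0"
      and eq: "- deriv (flux p w) r - (N - 1) / r * flux p w r = - (r powr \<sigma> * w r powr q)"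
      using S r by (auto simp: pos_solution_on_def)
    have rpos: "r > 0" using r r0 by simp
    have fd: "(flux p w has_real_derivative deriv (flux p w) r) (at r)"
      using f by (metis DERIV_imp_deriv real_differentiableE)
    have "(Y has_real_derivative
        r powr (N - 1) * deriv (flux p w) r + (N - 1) * r powr (N - 1 - 1) * flux p w r) (at r)"
      unfolding Y_def by (rule derivative_eq_intros fd refl | use rpos in simp)+
    moreover have "r powr (N - 1 - 1) = r powr (N - 1) / r"
      using rpos by (simp add: powr_diff power2_eq_square)
    then have "r powr (N - 1) * deriv (flux p w) r + (N - 1) * r powr (N - 1 - 1) * flux p w r
        = r powr (N - 1) * (deriv (flux p w) r + (N - 1) / r * flux p w r)"
      by (simp add: algebra_simps)
    moreover have "deriv (flux p w) r + (N - 1) / r * flux p w r = r powr \<sigma> * w r powr q"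
      using eq by simp
    moreover have "r powr (N - 1) * (r powr \<sigma> * w r powr q) > 0"
      using rpos w by simp
    ultimately show ?thesis by metis
  qed
  have mono: "Y a < Y b" if "r0 < a" "a < b" for a b
    by (rule DERIV_pos_imp_increasing[OF that(2)]) (use that Yder in auto)
  have lim': "((\<lambda>r. g r * \<bar>ln r\<bar> powr \<theta>) \<longlongrightarrow> L) at_top"
    using lim by (simp add: g_def \<theta>_def L_def mult_ac)
  have inv0: "((\<lambda>r::real. \<bar>ln r\<bar> powr (- \<theta>)) \<longlongrightarrow> 0) at_top"
    by (rule tendsto_neg_powr)
       (use \<theta> in \<open>auto intro: filterlim_compose[OF filterlim_abs_real ln_at_top]\<close>)
  have "((\<lambda>r. (g r * \<bar>ln r\<bar> powr \<theta>) * \<bar>ln r\<bar> powr (- \<theta>)) \<longlongrightarrow> L * 0) at_top"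
    by (intro tendsto_mult lim' inv0)
  moreover have "\<forall>\<^sub>F r in at_top. (g r * \<bar>ln r\<bar> powr \<theta>) * \<bar>ln r\<bar> powr (- \<theta>) = g r"
    using eventually_gt_at_top[of 1] by eventually_elim (simp add: powr_minus)
  ultimately have g0: "(g \<longlongrightarrow> 0) at_top"
    by (simp add: tendsto_cong)
  have gpos: "\<forall>\<^sub>F r in at_top. g r > 0"
    using order_tendstoD(1)[OF lim' L] by eventually_elim (simp add: zero_less_mult_iff)
  have YY: "\<forall>\<^sub>F r in at_top. Y r = g r powr (p - 1) \<and> Y r > 0 \<and> r > r0"
    using gpos eventually_gt_at_top[of r0]
  proof eventually_elim
    case (elim r)
    then have rpos: "r > 0" and d: "deriv w r > 0" using r0 by (auto simp: g_def zero_less_mult_iff)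
    have "deriv w r powr (p - 2) * deriv w r = deriv w r powr (p - 2 + 1)"
      using d by (subst powr_add) simp
    then have "Y r = r powr (N - 1) * deriv w r powr (p - 1)"
      using d by (simp add: Y_def flux_def)
    also have "\<dots> = g r powr (p - 1)"
      using rpos d p by (simp add: g_def powr_mult powr_powr)
    finally show ?case using elim by simp
  qed
  have "((\<lambda>r. g r powr (p - 1)) \<longlongrightarrow> 0 powr (p - 1)) at_top"
    by (rule tendsto_powr2[OF g0 tendsto_const])
       (use gpos p in \<open>auto elim: eventually_mono\<close>)
  then have Y0: "(Y \<longlongrightarrow> 0) at_top"
    using YY p by (auto elim!: Lim_transform_eventually eventually_mono)
  obtain a where a: "Y a > 0" "a > r0"
    using eventually_happens[OF YY] by auto
  have "\<forall>\<^sub>F r in at_top. Y a \<le> Y r"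
    using eventually_gt_at_top[of a] by eventually_elim (use mono a in \<open>auto intro: less_imp_le\<close>)
  then have "Y a \<le> 0" by (rule tendsto_lowerbound[OF Y0]) simp
  with a show False by simp
qed

end

theory Submission
  imports Defs
begin

text \<open>Put \<open>a = p - 1\<close>, \<open>\<beta> = (p - N) / a\<close>, \<open>t = \<beta> ln r\<close>, \<open>V t = w r\<close>, and let \<open>\<Phi>\<close> be \<open>r\<^sup>N\<^sup>-\<^sup>1\<close> times the flux,
  up to a constant factor. The equation becomes \<open>V' = exp t |\<Phi>|\<^sup>1\<^sup>/\<^sup>a sgn \<Phi>\<close>, \<open>\<Phi>' = - \<epsilon> K exp (- Q t) V\<^sup>q\<close>, where \<open>Q\<close> is the
  critical exponent. The quotients \<open>x = V' / V\<close> and \<open>y = - \<Phi>' / \<Phi>\<close> solve the autonomous system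
  \<open>x' = x (1 - x - y / a)\<close>, \<open>y' = y (- Q + q x + y)\<close>, and \<open>V\<close> is an algebraic function of \<open>x\<close>, \<open>y\<close> and \<open>t\<close>. Each behaviour
  of \<open>w\<close> is convergence of an orbit to an equilibrium: \<open>(0, Q)\<close> means a positive limit of \<open>w\<close>, \<open>(1, 0)\<close> means
  \<open>w \<sim> k r\<^sup>\<beta>\<close>, and the interior equilibrium \<open>(\<delta>, a (1 - \<delta>))\<close> is the self-similar solution. Translation in \<open>t\<close> is the scaling of
  \<open>w\<close>; it adjusts the constants \<open>k\<close> and \<open>C\<close>. For \<open>q = Q\<close> the interior equilibrium merges with \<open>(1, 0)\<close>, and the
  resulting centre direction produces the logarithms.

  Orbits that leave an equilibrium come from compactness: orbits started ever closer to the apex of a cone climb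
  through the cone to a fixed section (\<open>backward_orbit_exists\<close>, \<open>cone_orbit_exists\<close>). Orbits entering one are obtained by
  reversing time or, at the stable node, by a trapping box. The connections to the interior equilibrium for \<open>q > Q\<close>
  stay in the triangle below the Pohozaev line, which is crossed in one direction only, according to the side of the Sobolev exponent;
  a Lyapunov function identifies their limit (\<open>triangle_convergence\<close>). For \<open>q < Q\<close> the connection runs between the two
  nullclines, where \<open>x\<close> is monotone.

  Uniqueness compares two solutions through the differences of \<open>ln V\<close> and \<open>ln |\<Phi>|\<close>, which form a linear system with one
  relaxing and one slow component (\<open>vanishing_pair\<close>). Nonexistence rests on three devices: concavity of the
  solution as a function of \<open>exp t\<close> makes the flux blow up when \<open>\<epsilon> = 1\<close> and \<open>q \<le> Q\<close> (\<open>no_solution_near_bot\<close>); in the two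
  quadrants met by \<open>\<epsilon> = - 1\<close>, \<open>q > Q\<close>, orbits blow up in finite time (\<open>finite_time_blow_up\<close>); and below the Sobolev exponent
  the Pohozaev function is strictly monotone but tends to zero at both ends (\<open>no_global_solution_with_limit\<close>).\<close>

section \<open>Flows of globally Lipschitz vector fields\<close>

lemma antiderivative_on_reals_exists:
 fixes g :: "real => 'a::euclidean_space"
 assumes "continuous_on UNIV g"
 shows "\<exists>G. G 0 = 0 \<and> (\<forall>t. (G has_vector_derivative g t) (at t))"
proof -
 have "\<exists>F. \<forall>x::real. - \<infinity> < ereal x --> ereal x < \<infinity> --> (F has_vector_derivative g x) (at x)"
  by (rule einterval_antiderivative) (use assms continuous_on_eq_continuous_at in auto)
 then obtain F where F: "!!x. (F has_vector_derivative g x) (at x)" by auto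
 have "((%t. F t - F 0) has_vector_derivative g x) (at x)" for x
  using has_vector_derivative_diff[OF F[of x] has_vector_derivative_const[of "F 0"]] by simp
 then show ?thesis by (intro exI[of _ "%t. F t - F 0"]) auto
qed

lemma norm_antiderivative_le_exp:
 fixes G :: "real => 'a::euclidean_space"
 assumes G0: "G 0 = 0" and G: "!!t. (G has_vector_derivative g t) (at t)"
  and g: "!!t. norm (g t) <= M * exp (l * \<bar>t\<bar>)" and l: "l > 0"
 shows "norm (G t) <= M / l * exp (l * \<bar>t\<bar>)"
proof -
 have M: "M >= 0" using g[of 0] norm_ge_zero[of "g 0"] by (simp del: norm_ge_zero)
 have *: "norm (H t) <= M / l * exp (l * t)"
  if t: "t > 0" and H0: "H 0 = 0" and H: "!!t. (H has_vector_derivative h t) (at t)"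
   and h: "!!t. t > 0 ==> norm (h t) <= M * exp (l * t)"
  for H :: "real => 'a" and h t
 proof -
  have "norm (H t - H 0) <= M / l * exp (l * t) - M / l * exp (l * 0)"
  proof (rule differentiable_bound_general[OF t])
   show "continuous_on {0..t} H"
    by (intro continuous_at_imp_continuous_on ballI has_vector_derivative_continuous[OF H])
   show "continuous_on {0..t} (%t. M / l * exp (l * t))"
    by (intro continuous_intros)
   show "(H has_vector_derivative h x) (at x)" for x by (rule H)
   show "((%t. M / l * exp (l * t)) has_vector_derivative M * exp (l * x)) (at x)" for x
    by (rule has_real_derivative_iff_has_vector_derivative[THEN iffD1])
      (rule derivative_eq_intros refl | use l in \<open>simp add: field_simps\<close>)+
  qed (use h in auto)
  moreover have "M / l >= 0" using M l by simp
  ultimately show ?thesis using H0 by simp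
 qed
 consider "t = 0" | "t > 0" | "t < 0" by linarith
 then show ?thesis
 proof cases
  case 1 then show ?thesis using G0 M l by simp
 next
  case 2 then show ?thesis using *[OF 2 G0 G, of ] g by simp (metis abs_of_pos)
 next
  case 3
  have "((%s. G (- s)) has_vector_derivative - g (- s)) (at s)" for s
   using vector_diff_chain_at[of uminus "-1" s G "g (- s)"] G[of "-s"]
   by (simp add: o_def has_vector_derivative_minus[of "%x. x" 1, simplified] has_vector_derivative_id)
  then have "norm (G (- (- t))) <= M / l * exp (l * (- t))"
   using 3 G0 g by (intro *[where H="%s. G (- s)" and h = "%s. - g (- s)"]) (auto, metis abs_minus_cancel abs_of_pos)
  then show ?thesis using 3 by simp
 qed
qed

locale lipschitz_field =
 fixes f :: "'a::euclidean_space => 'a" and L :: real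
 assumes L: "L > 0" and lip: "!!x y. norm (f x - f y) <= L * norm (x - y)"
begin

definition orbit :: "(real => 'a) => bool" where
 "orbit z \<longleftrightarrow> (\<forall>t. (z has_vector_derivative f (z t)) (at t))"

lemma continuous_field: "continuous_on UNIV f"
 by (rule lipschitz_on_continuous_on[of L], rule lipschitz_onI)
   (use lip L in \<open>auto simp: dist_norm\<close>)

text \<open>The Picard operator contracts the space of curves growing at most like \<open>exp (2 L |t|)\<close>,
 so a single fixed point is an orbit defined for all times.\<close>

lemma orbit_exists: "\<exists>z. orbit z \<and> z 0 = x0"
proof -
 define l where "l = 2 * L"
 have l: "l > 0" using L by (simp add: l_def)
 define E where "E = (%t::real. exp (l * \<bar>t\<bar>))"
 have E1: "E t >= 1" and E0: "E t > 0" for t using l by (auto simp: E_def)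
 have EC: "continuous_on UNIV E" unfolding E_def by (intro continuous_intros)
 define c where "c = (%(y::real \<Rightarrow>\<^sub>C 'a) t. x0 + E t *\<^sub>R apply_bcontfun y t)"
 have cC: "continuous_on UNIV (%t. f (c y t))" for y
  unfolding c_def
  by (intro continuous_on_compose2[OF continuous_field] continuous_intros EC) auto
 define J where "J = (%y. SOME G. G 0 = 0 \<and> (\<forall>t. (G has_vector_derivative f (c y t)) (at t)))"
 have J: "J y 0 = 0 \<and> (\<forall>t. (J y has_vector_derivative f (c y t)) (at t))" for y
  unfolding J_def by (rule someI_ex[OF antiderivative_on_reals_exists[OF cC]])
 have J0: "J y 0 = 0" and JD: "(J y has_vector_derivative f (c y t)) (at t)" for y t
  using J by auto
 have Jdiff: "norm (J y t - J z t) <= dist y z / 2 * E t" for y z t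
 proof -
  have "norm (J y t - J z t) <= (L * dist y z) / l * exp (l * \<bar>t\<bar>)"
  proof (rule norm_antiderivative_le_exp[where g="%t. f (c y t) - f (c z t)"])
   show "((%t. J y t - J z t) has_vector_derivative f (c y t) - f (c z t)) (at t)" for t
    by (intro has_vector_derivative_diff JD)
   fix t
   have "norm (f (c y t) - f (c z t)) <= L * norm (c y t - c z t)" by (rule lip)
   also have "c y t - c z t = E t *\<^sub>R (apply_bcontfun y t - apply_bcontfun z t)"
    by (simp add: c_def algebra_simps)
   also have "norm \<dots> = E t * dist (apply_bcontfun y t) (apply_bcontfun z t)"
    using E0[of t] by (simp add: dist_norm)
   also have "\<dots> <= E t * dist y z" using E0[of t] by (intro mult_left_mono dist_bounded) auto
   finally show "norm (f (c y t) - f (c z t)) <= L * dist y z * exp (l * \<bar>t\<bar>)"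
    using L by (simp add: E_def mult_ac)
  qed (use J0 l in auto)
  then show ?thesis using L by (simp add: l_def E_def)
 qed
 have JC: "continuous_on UNIV (J y)" for y
  by (intro continuous_at_imp_continuous_on ballI has_vector_derivative_continuous[OF JD])
 define T where "T = (%y t. (1 / E t) *\<^sub>R J y t)"
 have TC: "T y \<in> bcontfun" for y
 proof -
  define M where "M = norm (f x0) + L * norm y"
  have M: "M >= 0" using L by (simp add: M_def)
  have fb: "norm (f (c y t)) <= M * exp (l * \<bar>t\<bar>)" for t
  proof -
   have "norm (f (c y t)) <= norm (f x0) + norm (f (c y t) - f x0)"
    using norm_triangle_sub by blast
   also have "norm (f (c y t) - f x0) <= L * (E t * norm (apply_bcontfun y t))"
    using lip[of "c y t" x0] E0[of t] by (simp add: c_def)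
   also have "\<dots> <= L * (E t * norm y)"
    using L E0[of t] by (intro mult_left_mono norm_bounded) auto
   also have "norm (f x0) <= norm (f x0) * E t"
    using E1[of t] by (simp add: mult_le_cancel_left1)
   finally show ?thesis by (simp add: M_def E_def algebra_simps)
  qed
  have "norm (J y t) <= M / l * E t" for t
   unfolding E_def by (rule norm_antiderivative_le_exp[OF J0 JD fb l])
  then have "norm (T y t) <= M / l" for t
   using E0[of t] by (simp add: T_def divide_le_eq)
  moreover have "continuous_on UNIV (T y)"
   unfolding T_def by (intro continuous_intros JC EC) (use E0 in \<open>metis less_irrefl\<close>)
  ultimately show ?thesis by (intro bcontfun_normI)
 qed
 define S where "S = (%y. Bcontfun (T y))"
 have Sapp: "apply_bcontfun (S y) t = T y t" for y t
  by (simp add: S_def Bcontfun_inverse[OF TC])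
 have "\<exists>!y. S y = y"
 proof (rule banach_fix_type[of "1/2"])
  show "\<forall>y z. dist (S y) (S z) <= 1 / 2 * dist y z"
  proof (intro allI dist_bound)
   fix y z t
   have "dist (T y t) (T z t) = norm (J y t - J z t) / E t"
    using E0[of t] by (simp add: T_def dist_norm flip: scaleR_diff_right)
   also have "\<dots> <= dist y z / 2" using Jdiff[of y t z] E0[of t] by (simp add: divide_le_eq)
   finally show "dist (apply_bcontfun (S y) t) (apply_bcontfun (S z) t) <= 1 / 2 * dist y z"
    by (simp add: Sapp)
  qed
 qed auto
 then obtain y where y: "S y = y" by auto
 have "c y t = x0 + J y t" for t
  using Sapp[of y t] E0[of t] unfolding y by (simp add: c_def T_def)
 then have "c y = (%t. x0 + J y t)" by auto
 moreover have "((%t. x0 + J y t) has_vector_derivative f (c y t)) (at t)" for t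
  using has_vector_derivative_add[OF has_vector_derivative_const JD] by simp
 ultimately have "orbit (c y)" "c y 0 = x0" using J0 by (auto simp: orbit_def)
 then show ?thesis by blast
qed

lemma orbit_shift: "orbit z ==> orbit (%t. z (t + h))"
 unfolding orbit_def
proof
 fix t
 assume z: "\<forall>t. (z has_vector_derivative f (z t)) (at t)"
 have "((%t. t + h) has_vector_derivative 1) (at t)"
  by (rule has_real_derivative_iff_has_vector_derivative[THEN iffD1])
    (rule derivative_eq_intros refl | simp)+
 from vector_diff_chain_at[OF this, of z "f (z (t + h))"] z
 show "((%t. z (t + h)) has_vector_derivative f (z (t + h))) (at t)" by (simp add: o_def)
qed

lemma orbit_const: "f e = 0 ==> orbit (%_. e)"
 by (simp add: orbit_def)

text \<open>Gronwall: \<open>|u - v|\<^sup>2 exp (-2 L t)\<close> is nonincreasing and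
 \<open>|u - v|\<^sup>2 exp (2 L t)\<close> is nondecreasing.\<close>

lemma orbit_dist_le:
 assumes u: "orbit u" and v: "orbit v"
 shows "norm (u t - v t) <= exp (L * \<bar>t - s\<bar>) * norm (u s - v s)"
proof -
 define D where "D = (%t. (u t - v t) \<bullet> (u t - v t))"
 define D' where "D' = (%t. 2 * ((u t - v t) \<bullet> (f (u t) - f (v t))))"
 have "((%t. u t - v t) has_vector_derivative f (u t) - f (v t)) (at t)" for t
  using u v by (auto simp: orbit_def intro: has_vector_derivative_diff)
 note d = this
 have "(D has_vector_derivative D' t) (at t)" for t
  unfolding D_def D'_def
  using bounded_bilinear.has_vector_derivative[OF bounded_bilinear_inner d d, of t]
  by (simp add: inner_commute)
 then have D: "(D has_real_derivative D' t) (at t)" for t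
  by (simp add: has_real_derivative_iff_has_vector_derivative)
 have D': "\<bar>D' t\<bar> <= 2 * L * D t" for t
 proof -
  have "\<bar>(u t - v t) \<bullet> (f (u t) - f (v t))\<bar> <= norm (u t - v t) * norm (f (u t) - f (v t))"
   by (rule Cauchy_Schwarz_ineq2)
  also have "\<dots> <= norm (u t - v t) * (L * norm (u t - v t))"
   by (intro mult_left_mono lip) auto
  finally show ?thesis by (simp add: D'_def D_def dot_square_norm power2_eq_square abs_mult mult_ac)
 qed
 have sq: "norm (u t - v t) <= exp (L * r) * norm (u s - v s)"
  if "D t <= exp (2 * L * r) * D s" for r
 proof -
  have "(norm (u t - v t))\<^sup>2 <= (exp (L * r) * norm (u s - v s))\<^sup>2"
   using that by (simp add: D_def dot_square_norm power_mult_distrib mult.assoc flip: exp_double)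
  then show ?thesis by (rule power2_le_imp_le) auto
 qed
 show ?thesis
 proof (cases "s <= t")
  case True
  have "exp (- 2 * L * t) * D t <= exp (- 2 * L * s) * D s"
  proof (rule DERIV_nonpos_imp_nonincreasing[OF True])
   fix r
   have "((%t. exp (- 2 * L * t) * D t) has_real_derivative exp (- 2 * L * r) * (D' r - 2 * L * D r)) (at r)"
    by (rule derivative_eq_intros D refl | simp add: algebra_simps)+
   moreover have "exp (- 2 * L * r) * (D' r - 2 * L * D r) <= 0"
    using D'[of r] by (intro mult_nonneg_nonpos) auto
   ultimately show "\<exists>y. ((%t. exp (- 2 * L * t) * D t) has_real_derivative y) (at r) \<and> y <= 0" by blast
  qed
  then have "exp (2 * L * t) * (exp (- 2 * L * t) * D t) <= exp (2 * L * t) * (exp (- 2 * L * s) * D s)"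
   by (intro mult_left_mono) auto
  moreover have "exp (2 * L * t) * (exp (- 2 * L * t) * D t) = D t"
   "exp (2 * L * t) * (exp (- 2 * L * s) * D s) = exp (2 * L * (t - s)) * D s"
   by (simp_all add: right_diff_distrib flip: mult.assoc exp_add)
  ultimately have "D t <= exp (2 * L * (t - s)) * D s" by (simp only:)
  then show ?thesis using sq True by auto
 next
  case False
  then have "t <= s" by simp
  then have "exp (2 * L * t) * D t <= exp (2 * L * s) * D s"
  proof (rule DERIV_nonneg_imp_nondecreasing)
   fix r
   have "((%t. exp (2 * L * t) * D t) has_real_derivative exp (2 * L * r) * (D' r + 2 * L * D r)) (at r)"
    by (rule derivative_eq_intros D refl | simp add: algebra_simps)+
   moreover have "exp (2 * L * r) * (D' r + 2 * L * D r) >= 0"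
    using D'[of r] by (intro mult_nonneg_nonneg) auto
   ultimately show "\<exists>y. ((%t. exp (2 * L * t) * D t) has_real_derivative y) (at r) \<and> y >= 0" by blast
  qed
  then have "exp (- 2 * L * t) * (exp (2 * L * t) * D t) <= exp (- 2 * L * t) * (exp (2 * L * s) * D s)"
   by (intro mult_left_mono) auto
  moreover have "exp (- 2 * L * t) * (exp (2 * L * t) * D t) = D t"
   "exp (- 2 * L * t) * (exp (2 * L * s) * D s) = exp (2 * L * (s - t)) * D s"
   by (simp_all add: right_diff_distrib flip: mult.assoc exp_add)
  ultimately have "D t <= exp (2 * L * (s - t)) * D s" by (simp only:)
  then show ?thesis using sq[of "s - t"] False by (simp add: abs_minus_commute)
 qed
qed

corollary orbit_unique:
 assumes "orbit u" "orbit v" "u s = v s"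
 shows "u t = v t"
 using orbit_dist_le[OF assms(1,2), of t s] assms(3) by simp

text \<open>Construction of an orbit of the unstable set of \<open>e\<close>: orbits issued from points close to \<open>e\<close>
 need a long time to reach the section \<open>C\<close>; looking back from their points of
 arrival, which accumulate on \<open>C\<close>, gives in the limit an orbit that has stayed in \<open>R\<close> for ever.\<close>

lemma backward_orbit_exists:
 assumes e: "f e = 0" "p \<longlonglongrightarrow> e" "e \<notin> C" and C: "compact C" and R: "closed R"
  and reach: "!!n u. orbit u ==> u 0 = p n ==> \<exists>T\<ge>0. u T \<in> C \<and> (\<forall>t\<in>{0..T}. u t \<in> R)"
 shows "\<exists>z. orbit z \<and> z 0 \<in> C \<and> (\<forall>t\<le>0. z t \<in> R)"
proof -
 obtain u where u: "!!n. orbit (u n)" "!!n. u n 0 = p n"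
  using that[of "%n. SOME u. orbit u \<and> u 0 = p n"] someI_ex[OF orbit_exists] by blast
 have "\<forall>n. \<exists>T\<ge>0. u n T \<in> C \<and> (\<forall>t\<in>{0..T}. u n t \<in> R)" using reach u by blast
 then obtain T where T: "!!n. T n >= 0" "!!n. u n (T n) \<in> C" "!!n t. t \<in> {0..T n} ==> u n t \<in> R"
  by metis
 obtain d where d: "d > 0" "!!x. x \<in> C ==> d <= dist e x"
  using separate_point_closed[OF compact_imp_closed[OF C] e(3)] by auto
 have late: "\<forall>\<^sub>F n in sequentially. r <= T n" for r
 proof -
  have "\<forall>\<^sub>F n in sequentially. dist (p n) e < d / exp (L * \<bar>r\<bar>)"
   using e(2) d by (intro tendstoD) auto
  then show ?thesis
  proof eventually_elim
   case (elim n)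
   have "d <= norm (u n (T n) - e)" using d(2)[OF T(2)[of n]] by (simp add: dist_norm norm_minus_commute)
   also have "\<dots> <= exp (L * \<bar>T n - 0\<bar>) * norm (u n 0 - e)"
    by (rule orbit_dist_le[OF u(1) orbit_const[OF e(1)]])
   also have "\<dots> = exp (L * T n) * dist (p n) e" using T(1)[of n] by (simp add: u(2) dist_norm)
   finally have 1: "d <= exp (L * T n) * dist (p n) e" .
   have "exp (L * \<bar>r\<bar>) * dist (p n) e < d" using elim by (simp add: field_simps)
   with 1 have "exp (L * \<bar>r\<bar>) * dist (p n) e < exp (L * T n) * dist (p n) e" by linarith
   then have "exp (L * \<bar>r\<bar>) < exp (L * T n)" by (simp add: mult_less_cancel_right)
   then have "\<bar>r\<bar> < T n" using L by simp
   then show ?case by linarith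
  qed
 qed
 obtain c \<phi> where c: "c \<in> C" "strict_mono \<phi>" "((%n. u n (T n)) \<circ> \<phi>) \<longlonglongrightarrow> c"
  using C T(2) unfolding compact_def by meson
 obtain z where z: "orbit z" "z 0 = c" using orbit_exists by blast
 have "z t \<in> R" if t: "t <= 0" for t
 proof -
  have *: "norm (u n (T n + t) - z t) <= exp (L * \<bar>t\<bar>) * norm (u n (T n) - c)" for n
   using orbit_dist_le[OF orbit_shift[OF u(1), of n "T n"] z(1), of t 0] z(2) by (simp add: add.commute)
  have "(%n. exp (L * \<bar>t\<bar>) * norm (u (\<phi> n) (T (\<phi> n)) - c)) \<longlonglongrightarrow> exp (L * \<bar>t\<bar>) * norm (c - c)"
   using c(3) unfolding o_def by (intro tendsto_intros)
  then have **: "(%n. exp (L * \<bar>t\<bar>) * norm (u (\<phi> n) (T (\<phi> n)) - c)) \<longlonglongrightarrow> 0" by simp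
  have "(%n. u (\<phi> n) (T (\<phi> n) + t) - z t) \<longlonglongrightarrow> 0"
   by (rule Lim_null_comparison[OF always_eventually **]) (intro allI *)
  then have lim: "(%n. u (\<phi> n) (T (\<phi> n) + t)) \<longlonglongrightarrow> z t" by (simp add: LIM_zero_iff)
  have "\<forall>\<^sub>F n in sequentially. - t <= T (\<phi> n)"
   by (rule eventually_subseq[OF c(2) late])
  then have "\<forall>\<^sub>F n in sequentially. u (\<phi> n) (T (\<phi> n) + t) \<in> R"
   by eventually_elim (use t T(3) in auto)
  then show ?thesis by (rule Lim_in_closed_set[OF R _ _ lim]) simp
 qed
 then show ?thesis using z c(1) by blast
qed

text \<open>LaSalle's principle: along the orbit of any accumulation point the function \<open>W\<close> keeps
 its limit value.\<close>

lemma lasalle_convergence: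
 fixes W :: "'a => real"
 assumes z: "orbit z" and S: "compact S" and zS: "!!t. t >= t0 ==> z t \<in> S"
  and W: "continuous_on S W" "((%t. W (z t)) \<longlongrightarrow> c) at_top"
  and rigid: "!!u. orbit u ==> (!!t. u t \<in> S) ==> (!!t. W (u t) = c) ==> u 0 = m"
 shows "(z \<longlongrightarrow> m) at_top"
proof (rule ccontr)
 assume "\<not> ?thesis"
 then obtain e where e: "e > 0" "\<not> (\<forall>\<^sub>F t in at_top. dist (z t) m < e)"
  by (auto simp: tendsto_iff)
 have "\<exists>t\<ge>real n. dist (z t) m >= e" for n
  using e(2) by (auto simp: eventually_at_top_linorder not_less)
 then obtain \<tau> where \<tau>: "!!n. \<tau> n >= real n" "!!n. dist (z (\<tau> n)) m >= e" by metis
 obtain n0 where n0: "t0 <= real n0" using real_arch_simple by blast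
 have "\<forall>n. z (\<tau> (n + n0)) \<in> S" using \<tau>(1) n0 by (intro allI zS) (smt (verit) of_nat_add of_nat_0_le_iff)
 then obtain k \<phi> where k: "k \<in> S" "strict_mono \<phi>" "((%n. z (\<tau> (n + n0))) \<circ> \<phi>) \<longlonglongrightarrow> k"
  using S unfolding compact_def by (metis (lifting))
 define s where "s = (%n. \<tau> (\<phi> n + n0))"
 have sn: "s n >= real n" for n
  using \<tau>(1)[of "\<phi> n + n0"] strict_mono_imp_increasing[OF k(2), of n] unfolding s_def by linarith
 have stop: "filterlim s at_top sequentially"
  by (rule filterlim_at_top_mono[OF filterlim_real_sequentially]) (use sn in auto)
 have zs: "(%n. z (s n)) \<longlonglongrightarrow> k" using k(3) by (simp add: s_def o_def)
 obtain u where u: "orbit u" "u 0 = k" using orbit_exists by blast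
 have lim: "(%n. z (s n + t)) \<longlonglongrightarrow> u t" for t
 proof -
  have *: "norm (z (s n + t) - u t) <= exp (L * \<bar>t\<bar>) * norm (z (s n) - k)" for n
   using orbit_dist_le[OF orbit_shift[OF z, of "s n"] u(1), of t 0] u(2) by (simp add: add.commute)
  have "(%n. exp (L * \<bar>t\<bar>) * norm (z (s n) - k)) \<longlonglongrightarrow> exp (L * \<bar>t\<bar>) * norm (k - k)"
   by (intro tendsto_intros zs)
  then have **: "(%n. exp (L * \<bar>t\<bar>) * norm (z (s n) - k)) \<longlonglongrightarrow> 0" by simp
  have "(%n. z (s n + t) - u t) \<longlonglongrightarrow> 0"
   by (rule Lim_null_comparison[OF always_eventually **]) (intro allI *)
  then show ?thesis by (simp add: LIM_zero_iff)
 qed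
 have ev: "\<forall>\<^sub>F n in sequentially. z (s n + t) \<in> S" for t
 proof -
  have "\<forall>\<^sub>F n in sequentially. s n >= t0 - t" using stop by (simp add: filterlim_at_top)
  then show ?thesis by eventually_elim (auto intro: zS)
 qed
 have uS: "u t \<in> S" for t
  by (rule Lim_in_closed_set[OF compact_imp_closed[OF S] ev _ lim]) auto
 have "W (u t) = c" for t
 proof -
  have "((%n. W (z (s n + t))) \<longlongrightarrow> W (u t)) sequentially"
   by (rule continuous_on_tendsto_compose[OF W(1) lim uS ev])
  moreover have "((%n. W (z (s n + t))) \<longlongrightarrow> c) sequentially"
  proof (rule filterlim_compose[OF W(2)])
   show "filterlim (%n. s n + t) at_top sequentially"
    unfolding filterlim_at_top
   proof
    fix b
    have "\<forall>\<^sub>F n in sequentially. s n >= b - t" using stop by (simp add: filterlim_at_top)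
    then show "\<forall>\<^sub>F n in sequentially. s n + t >= b" by eventually_elim simp
   qed
  qed
  ultimately show ?thesis by (rule LIMSEQ_unique)
 qed
 then have "k = m" using rigid[OF u(1) uS] u(2) by simp
 moreover have "dist k m >= e"
  by (rule tendsto_lowerbound[OF tendsto_dist[OF zs tendsto_const]]) (use \<tau>(2) in \<open>auto simp: s_def\<close>)
 ultimately show False using e by simp
qed

end

section \<open>Trapping regions\<close>

text \<open>At the first time some barrier would become negative it vanishes while all others are nonnegative; there its derivative
 is positive, a contradiction.\<close>

lemma trapping:
 fixes G :: "(real => real) set"
 assumes fin: "finite G" and cont: "!!g t. g \<in> G ==> isCont g t" and init: "!!g. g \<in> G ==> g 0 >= 0"
  and inward: "!!t g. 0 <= t ==> t < T ==> \<forall>h\<in>G. h t >= 0 ==> g \<in> G ==> g t = 0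
    ==> \<exists>D>0. (g has_real_derivative D) (at t)"
  and t: "0 <= t" "t <= T" and g: "g \<in> G"
 shows "g t >= 0"
proof (rule ccontr)
 assume neg: "\<not> g t >= 0"
 define B where "B = {t. 0 <= t \<and> t <= T \<and> (\<exists>g\<in>G. g t < 0)}"
 have tB: "t \<in> B" unfolding B_def using neg t g by (intro CollectI conjI bexI[of _ g]) linarith+
 have bdd: "bdd_below B" by (rule bdd_belowI[of _ 0]) (auto simp: B_def)
 define s where "s = Inf B"
 have s0: "0 <= s" unfolding s_def by (rule cInf_greatest) (use tB in \<open>auto simp: B_def\<close>)
 have st: "s <= t" unfolding s_def by (rule cInf_lower[OF tB bdd])
 have before: "h r >= 0" if "h \<in> G" "0 <= r" "r < s" for h r
 proof (rule ccontr)
  assume "\<not> h r >= 0"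
  then have "h r < 0" by simp
  then have "r \<in> B" unfolding B_def using that st t by (intro CollectI conjI bexI[of _ h]) linarith+
  then show False using cInf_lower[OF _ bdd, of r] that(3) by (simp add: s_def)
 qed
 have at_s: "h s >= 0" if h: "h \<in> G" for h
 proof (cases "s = 0")
  case False
  then have s: "s > 0" using s0 by simp
  have "(h \<longlongrightarrow> h s) (at_left s)" using cont[OF h] by (simp add: isCont_def filterlim_at_split)
  moreover have "\<forall>\<^sub>F r in at_left s. 0 <= h r"
   using eventually_at_left_real[OF s] by eventually_elim (use before[OF h] in auto)
  ultimately show ?thesis by (rule tendsto_lowerbound) auto
 qed (use init h in auto)
 have "s \<notin> B" using at_s by (auto simp: B_def not_less)
 then have sT: "s < T" using st t tB by (cases "s = t") auto
 have "\<forall>\<^sub>F r in at_right s. h r > 0" if h: "h \<in> G" for h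
 proof (cases "h s = 0")
  case True
  obtain D where D: "D > 0" "(h has_real_derivative D) (at s)"
   using inward[OF s0 sT _ h True] at_s by auto
  obtain d where d: "d > 0" "!!k. 0 < k ==> k < d ==> h s < h (s + k)"
   using DERIV_pos_inc_right[OF D(2,1)] by auto
  have "\<forall>\<^sub>F r in at_right s. r \<in> {s<..<s + d}" using d by (intro eventually_at_right_real) auto
  then show ?thesis
  proof eventually_elim
   case (elim r) then show ?case using d(2)[of "r - s"] True by auto
  qed
 next
  case False
  then have "h s > 0" using at_s[OF h] by simp
  moreover have "(h \<longlongrightarrow> h s) (at_right s)" using cont[OF h] by (simp add: isCont_def filterlim_at_split)
  ultimately show ?thesis by (rule order_tendstoD(1)[rotated])
 qed
 then have "\<forall>\<^sub>F r in at_right s. \<forall>h\<in>G. h r > 0" using fin by (simp add: eventually_ball_finite)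
 then obtain b where b: "b > s" "!!r. s < r ==> r < b ==> \<forall>h\<in>G. h r > 0"
  by (auto simp: eventually_at_right[OF sT])
 have "b <= r" if "r \<in> B" for r
 proof (rule ccontr)
  assume "\<not> b <= r"
  moreover have "s <= r" unfolding s_def by (rule cInf_lower[OF that bdd])
  moreover have "r ~= s" using that \<open>s \<notin> B\<close> by auto
  ultimately have "\<forall>h\<in>G. h r > 0" using b by auto
  then show False using that by (auto simp: B_def)
 qed
 then have "b <= s" unfolding s_def using tB by (intro cInf_greatest) auto
 then show False using b by simp
qed

text \<open>A curve trapped between the barriers \<open>G\<close> as long as the height \<open>h\<close> is at most \<open>h1\<close>, and whose
 height increases at a positive rate meanwhile, does reach height \<open>h1\<close>.\<close>

lemma trapped_reach:
 fixes G :: "(real => real) set"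
 assumes fin: "finite G" and cont: "!!g t. g \<in> G ==> isCont g t" and init: "!!g. g \<in> G ==> g 0 >= 0"
  and h: "!!t. (h has_real_derivative h' t) (at t)" and h01: "h 0 < h1" and \<mu>: "\<mu> > 0"
  and inward: "!!t g. 0 <= t ==> \<forall>g\<in>G. g t >= 0 ==> h 0 <= h t ==> h t <= h1 ==> g \<in> G ==> g t = 0
    ==> \<exists>D>0. (g has_real_derivative D) (at t)"
  and rate: "!!t. 0 <= t ==> \<forall>g\<in>G. g t >= 0 ==> h 0 <= h t ==> h t <= h1 ==> h' t >= \<mu>"
 shows "\<exists>T\<ge>0. h T = h1 \<and> (\<forall>t\<in>{0..T}. (\<forall>g\<in>G. g t >= 0) \<and> h 0 <= h t \<and> h t <= h1)"
proof -
 have hc: "isCont h t" for t using h by (rule DERIV_isCont)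
 define G' where "G' = insert (%t. h t - h 0) G"
 have trap: "g t >= 0" if T: "!!t. 0 <= t ==> t < T ==> h t <= h1" and t: "0 <= t" "t <= T" and g: "g \<in> G'"
  for T t g
 proof (rule trapping[of G' T t])
  show "finite G'" using fin by (simp add: G'_def)
  show "isCont g t" if "g \<in> G'" for g t using that cont hc[of t] by (auto simp: G'_def intro: continuous_intros)
  show "g 0 >= 0" if "g \<in> G'" for g using that init by (auto simp: G'_def)
  fix s k assume s: "0 <= s" "s < T" and G: "\<forall>h\<in>G'. 0 <= h s" and k: "k \<in> G'" "k s = 0"
  have pre: "\<forall>g\<in>G. 0 <= g s" "h 0 <= h s" "h s <= h1" using G T[OF s] by (auto simp: G'_def)
  show "\<exists>D>0. (k has_real_derivative D) (at s)"
  proof (cases "k \<in> G")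
   case True then show ?thesis using inward[OF s(1) pre True k(2)] by simp
  next
   case False
   then have "k = (%t. h t - h 0)" using k by (simp add: G'_def)
   moreover have "((%t. h t - h 0) has_real_derivative h' s) (at s)"
    by (rule derivative_eq_intros h refl | simp)+
   ultimately show ?thesis using rate[OF s(1) pre] \<mu> by (intro exI[of _ "h' s"]) auto
  qed
 qed (use t g in auto)
 have "\<exists>t\<ge>0. h t >= h1"
 proof (rule ccontr)
  assume "\<not> ?thesis"
  then have below: "h t <= h1" if "t >= 0" for t using that by force
  have all: "(\<forall>g\<in>G. g t >= 0) \<and> h 0 <= h t" if "t >= 0" for t
  proof -
   have "g t >= 0" if "g \<in> G'" for g
    by (rule trap[of t]) (use below that \<open>t >= 0\<close> in auto)
   from this[of "%t. h t - h 0"] this show ?thesis by (auto simp: G'_def)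
  qed
  define t where "t = (h1 - h 0) / \<mu> + 1"
  have t: "t > 0" using h01 \<mu> by (simp add: t_def add_pos_pos)
  have "h 0 - \<mu> * 0 <= h t - \<mu> * t"
  proof (rule DERIV_nonneg_imp_nondecreasing[where f="%t. h t - \<mu> * t"])
   fix s assume "0 <= s" "s <= t"
   moreover have "((%t. h t - \<mu> * t) has_real_derivative h' s - \<mu>) (at s)"
    by (rule derivative_eq_intros h refl | simp)+
   moreover have "h' s >= \<mu>" using rate[of s] all[of s] below[of s] \<open>0 <= s\<close> by blast
   ultimately show "\<exists>y. ((%t. h t - \<mu> * t) has_real_derivative y) (at s) \<and> 0 <= y"
    by (intro exI[of _ "h' s - \<mu>"]) auto
  qed (use t in auto)
  moreover have "\<mu> * t = h1 - h 0 + \<mu>" using \<mu> by (simp add: t_def field_simps)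
  ultimately show False using below[of t] t \<mu> by auto
 qed
 then obtain t1 where t1: "t1 >= 0" "h t1 >= h1" by blast
 define T where "T = Inf {t. 0 <= t \<and> h1 <= h t}"
 have closed: "closed {t. 0 <= t \<and> h1 <= h t}"
  using hc by (intro closed_Collect_conj closed_Collect_le continuous_intros continuous_at_imp_continuous_on) auto
 have bdd: "bdd_below {t. 0 <= t \<and> h1 <= h t}" by (rule bdd_belowI[of _ 0]) auto
 have "T \<in> {t. 0 <= t \<and> h1 <= h t}" unfolding T_def
  by (rule closed_contains_Inf[OF _ bdd closed]) (use t1 in auto)
 then have T: "T >= 0" "h T >= h1" by auto
 have bel: "h t < h1" if "0 <= t" "t < T" for t
 proof (rule ccontr)
  assume "\<not> h t < h1"
  then have "T <= t" unfolding T_def by (intro cInf_lower bdd) (use that in auto)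
  then show False using that by simp
 qed
 have "T > 0" using T h01 by (cases "T = 0") auto
 have "(h \<longlongrightarrow> h T) (at_left T)" using hc by (simp add: isCont_def filterlim_at_split)
 moreover have "\<forall>\<^sub>F t in at_left T. h t <= h1"
  using eventually_at_left_real[OF \<open>T > 0\<close>] by eventually_elim (use bel in \<open>auto intro: less_imp_le\<close>)
 ultimately have "h T <= h1" by (rule tendsto_upperbound) auto
 then have hT: "h T = h1" using T by simp
 have "g t >= 0" if "t \<in> {0..T}" "g \<in> G'" for t g
  by (rule trap[of T]) (use bel that in \<open>auto intro: less_imp_le\<close>)
 note G'nonneg = this
 have "h 0 <= h t" if "t \<in> {0..T}" for t
  using G'nonneg[OF that, of "%t. h t - h 0"] by (simp add: G'_def)
 moreover have "h t <= h1" if "t \<in> {0..T}" for t using bel[of t] hT that by (cases "t = T") auto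
 ultimately show ?thesis using T hT G'nonneg by (intro exI[of _ T]) (simp add: G'_def)
qed

section \<open>Orbits issuing from the apex of a cone\<close>

context lipschitz_field
begin

text \<open>The cone with apex \<open>e\<close> is cut out by the inward normals in \<open>G\<close>; heights are measured
 along \<open>\<eta>\<close>. Each orbit starting inside on the ray in direction \<open>d\<close> climbs to the height of \<open>e + d\<close>
 without leaving the cone.\<close>

lemma cone_orbit_exists:
 fixes G :: "'a set" and d e \<eta> :: 'a
 defines "Cn \<equiv> {z. \<forall>\<nu>\<in>G. \<nu> \<bullet> (z - e) >= 0}"
 assumes fin: "finite G" and e: "f e = 0" and d: "!!\<nu>. \<nu> \<in> G ==> \<nu> \<bullet> d >= 0" "\<eta> \<bullet> d > 0"
  and bnd: "bounded {z \<in> Cn. 0 <= \<eta> \<bullet> (z - e) \<and> \<eta> \<bullet> (z - e) <= \<eta> \<bullet> d}"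
  and inward: "!!z \<nu>. z \<in> Cn ==> 0 < \<eta> \<bullet> (z - e) ==> \<eta> \<bullet> (z - e) <= \<eta> \<bullet> d ==> \<nu> \<in> G
    ==> \<nu> \<bullet> (z - e) = 0 ==> \<nu> \<bullet> f z > 0"
  and rate: "!!c. c > 0 ==> \<exists>\<mu>>0. \<forall>z\<in>Cn. c <= \<eta> \<bullet> (z - e) --> \<eta> \<bullet> (z - e) <= \<eta> \<bullet> d --> \<mu> <= \<eta> \<bullet> f z"
 shows "\<exists>z. orbit z \<and> \<eta> \<bullet> (z 0 - e) = \<eta> \<bullet> d \<and>
  (\<forall>t\<le>0. z t \<in> Cn \<and> 0 <= \<eta> \<bullet> (z t - e) \<and> \<eta> \<bullet> (z t - e) <= \<eta> \<bullet> d)"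
proof -
 define R where "R = {z \<in> Cn. 0 <= \<eta> \<bullet> (z - e) \<and> \<eta> \<bullet> (z - e) <= \<eta> \<bullet> d}"
 define C where "C = R \<inter> {z. \<eta> \<bullet> (z - e) = \<eta> \<bullet> d}"
 define p where "p = (%n. e + inverse (real (Suc (Suc n))) *\<^sub>R d)"
 have coneC: "closed Cn"
  unfolding Cn_def Collect_ball_eq by (intro closed_INT ballI closed_Collect_le continuous_intros)
 have R: "closed R"
 proof -
  have "R = Cn \<inter> ({z. 0 <= \<eta> \<bullet> (z - e)} \<inter> {z. \<eta> \<bullet> (z - e) <= \<eta> \<bullet> d})" by (auto simp: R_def)
  then show ?thesis
   using coneC by (auto intro!: closed_Int closed_Collect_le continuous_intros)
 qed
 have "compact C" unfolding C_def compact_eq_bounded_closed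
  using R bnd by (auto simp: R_def[symmetric] intro!: closed_Int closed_Collect_eq continuous_intros bounded_Int)
 have inv_le: "inverse (real (Suc (Suc n))) < 1" for n by (simp add: field_simps)
 have "\<exists>z. orbit z \<and> z 0 \<in> C \<and> (\<forall>t\<le>0. z t \<in> R)"
 proof (rule backward_orbit_exists[where p=p and e=e, OF e _ _ \<open>compact C\<close> R])
  have "p \<longlonglongrightarrow> e + 0 *\<^sub>R d" unfolding p_def
   by (intro tendsto_intros LIMSEQ_Suc[OF LIMSEQ_inverse_real_of_nat])
  then show "p \<longlonglongrightarrow> e" by simp
  show "e \<notin> C" using d by (auto simp: C_def)
  fix n u assume u: "orbit u" "u 0 = p n"
  define r where "r = inverse (real (Suc (Suc n)))"
  have r: "r > 0" "r < 1" using inv_le[of n] by (auto simp: r_def)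
  have u0: "u 0 = e + r *\<^sub>R d" using u by (simp add: p_def r_def)
  have der: "((%t. \<nu> \<bullet> (u t - e)) has_real_derivative \<nu> \<bullet> f (u t)) (at t)" for \<nu> t
  proof -
   have "((%t. u t - e) has_vector_derivative f (u t)) (at t)"
    using has_vector_derivative_diff[OF u(1)[unfolded orbit_def, rule_format] has_vector_derivative_const[of e], of t]
    by simp
   from bounded_linear.has_vector_derivative[OF bounded_linear_inner_right this]
   show ?thesis by (simp add: has_real_derivative_iff_has_vector_derivative)
  qed
  obtain \<mu> where \<mu>: "\<mu> > 0" "!!z. z \<in> Cn ==> r * (\<eta> \<bullet> d) <= \<eta> \<bullet> (z - e) ==> \<eta> \<bullet> (z - e) <= \<eta> \<bullet> d ==> \<mu> <= \<eta> \<bullet> f z"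
   using rate[of "r * (\<eta> \<bullet> d)"] r d(2) by auto
  define H where "H = (%\<nu> t. \<nu> \<bullet> (u t - e)) ` G"
  have coneI: "u t \<in> Cn" if "\<forall>g\<in>H. g t >= 0" for t using that by (auto simp: H_def Cn_def)
  have "\<exists>T\<ge>0. \<eta> \<bullet> (u T - e) = \<eta> \<bullet> d \<and> (\<forall>t\<in>{0..T}. (\<forall>g\<in>H. g t >= 0) \<and>
    \<eta> \<bullet> (u 0 - e) <= \<eta> \<bullet> (u t - e) \<and> \<eta> \<bullet> (u t - e) <= \<eta> \<bullet> d)"
  proof (rule trapped_reach[where h="%t. \<eta> \<bullet> (u t - e)", OF _ _ _ der _ \<mu>(1)])
   show "finite H" using fin by (simp add: H_def)
   show "isCont g t" if "g \<in> H" for g t using that DERIV_isCont[OF der] by (auto simp: H_def)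
   show "g 0 >= 0" if "g \<in> H" for g using that d(1) r by (auto simp: H_def u0)
   show "\<eta> \<bullet> (u 0 - e) < \<eta> \<bullet> d" using r d(2) by (simp add: u0)
   fix t assume A: "\<forall>g\<in>H. 0 <= g t" "\<eta> \<bullet> (u 0 - e) <= \<eta> \<bullet> (u t - e)" "\<eta> \<bullet> (u t - e) <= \<eta> \<bullet> d"
   then have A2: "r * (\<eta> \<bullet> d) <= \<eta> \<bullet> (u t - e)" by (simp add: u0)
   then show "\<mu> <= \<eta> \<bullet> f (u t)" using \<mu>(2)[OF coneI[OF A(1)]] A(3) by simp
   fix g assume g: "g \<in> H" "g t = 0"
   then obtain \<nu> where \<nu>: "\<nu> \<in> G" "g = (%t. \<nu> \<bullet> (u t - e))" by (auto simp: H_def)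
   have "r * (\<eta> \<bullet> d) > 0" using r d(2) by simp
   then have "\<nu> \<bullet> f (u t) > 0" using inward[OF coneI[OF A(1)] _ A(3) \<nu>(1)] A2 g(2) \<nu>(2) by auto
   then show "\<exists>D>0. (g has_real_derivative D) (at t)" using der \<nu>(2) by blast
  qed
  then obtain T where T: "T >= 0" "\<eta> \<bullet> (u T - e) = \<eta> \<bullet> d" "!!t. t \<in> {0..T} ==> (\<forall>g\<in>H. g t >= 0) \<and>
    \<eta> \<bullet> (u 0 - e) <= \<eta> \<bullet> (u t - e) \<and> \<eta> \<bullet> (u t - e) <= \<eta> \<bullet> d" by blast
  have "0 <= \<eta> \<bullet> (u 0 - e)" using r d(2) by (simp add: u0)
  then have "u t \<in> R" if "t \<in> {0..T}" for t
   using T(3)[OF that] coneI[of t] by (auto simp: R_def)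
  then show "\<exists>T\<ge>0. u T \<in> C \<and> (\<forall>t\<in>{0..T}. u t \<in> R)"
   using T by (intro exI[of _ T]) (auto simp: C_def)
 qed
 then show ?thesis by (auto simp: C_def R_def)
qed

end

section \<open>The Lotka-Volterra system\<close>

definition clamp_real :: "real => real => real" where
 "clamp_real R u = max (- R) (min R u)"

lemma clamp_real_id: "\<bar>u\<bar> <= R ==> clamp_real R u = u"
 by (auto simp: clamp_real_def)

lemma clamp_real_abs_le: "\<bar>clamp_real R u\<bar> <= \<bar>u\<bar>" if "R >= 0"
 using that by (auto simp: clamp_real_def max_def min_def)

lemma clamp_real_bound: "\<bar>clamp_real R u\<bar> <= R" if "R >= 0"
 using that by (auto simp: clamp_real_def max_def min_def)

lemma clamp_real_dist: "\<bar>clamp_real R u - clamp_real R v\<bar> <= \<bar>u - v\<bar>"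
 by (auto simp: clamp_real_def max_def min_def)

locale lotka_volterra =
 fixes a q Q :: real
 assumes a: "0 < a" and aq: "a < q" and aQ: "a < Q"
begin

definition lv :: "(real => real) => (real => real) => real => bool" where
 "lv x y t \<longleftrightarrow> (x has_real_derivative x t * (1 - x t - y t / a)) (at t) \<and>
        (y has_real_derivative y t * (- Q + q * x t + y t)) (at t)"

text \<open>The field is cut off outside a box of size \<open>R\<close>, to make it globally Lipschitz; \<open>s = -1\<close> reverses
 time.\<close>

definition field :: "real => real => real \<times> real => real \<times> real" where
 "field s R z = (let x = clamp_real R (fst z); y = clamp_real R (snd z)
   in (s * (x * (1 - x - y / a)), s * (y * (- Q + q * x + y))))"

lemma field_in_box: "\<bar>x\<bar> <= R ==> \<bar>y\<bar> <= R ==>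
  field s R (x, y) = (s * (x * (1 - x - y / a)), s * (y * (- Q + q * x + y)))"
 by (simp add: field_def clamp_real_id Let_def)

lemma field_lipschitz:
 assumes R: "R > 0" and s: "\<bar>s\<bar> = 1"
 shows "\<exists>L. lipschitz_field (field s R) L"
proof -
 define L1 where "L1 = 1 + 2 * R + R / a + R / a"
 define L2 where "L2 = Q + q * R + q * R + 2 * R"
 have Rpos: "R / a > 0" "q * R > 0" "Q > 0" using R a aq aQ by auto
 have pos: "L1 > 0" "L2 > 0" using R Rpos unfolding L1_def L2_def by linarith+
 show ?thesis
 proof (intro exI[of _ "2 * (L1 + L2)"], unfold_locales)
  show "2 * (L1 + L2) > 0" using pos by simp
  fix z w :: "real \<times> real"
  define x y x' y' where d: "x = clamp_real R (fst z)" "y = clamp_real R (snd z)"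
   "x' = clamp_real R (fst w)" "y' = clamp_real R (snd w)"
  have b: "\<bar>x\<bar> <= R" "\<bar>y\<bar> <= R" "\<bar>x'\<bar> <= R" "\<bar>y'\<bar> <= R" using clamp_real_bound R by (auto simp: d)
  define n where "n = norm (z - w)"
  have n: "\<bar>x - x'\<bar> <= n" "\<bar>y - y'\<bar> <= n"
  proof -
   have "\<bar>x - x'\<bar> <= \<bar>fst z - fst w\<bar>" by (simp add: d clamp_real_dist)
   also have "\<dots> <= n" unfolding n_def using norm_fst_le[of "fst z - fst w" "snd z - snd w"] by (simp add: prod_eq_iff minus_prod_def)
   finally show "\<bar>x - x'\<bar> <= n" .
   have "\<bar>y - y'\<bar> <= \<bar>snd z - snd w\<bar>" by (simp add: d clamp_real_dist)
   also have "\<dots> <= n" unfolding n_def using norm_snd_le[of "snd z - snd w" "fst z - fst w"] by (simp add: minus_prod_def)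
   finally show "\<bar>y - y'\<bar> <= n" .
  qed
  have m: "\<bar>A * B\<bar> <= K * n" if "\<bar>A\<bar> <= K" "\<bar>B\<bar> <= n" for A B K
   unfolding abs_mult using that by (intro mult_mono) auto
  have e1: "x * (1 - x - y / a) - x' * (1 - x' - y' / a)
    = (1 - x - x' - y / a) * (x - x') - (x' / a) * (y - y')"
   using a by (simp add: field_simps)
  have ya: "\<bar>y / a\<bar> <= R / a" "\<bar>x' / a\<bar> <= R / a" using b a by (auto simp: abs_divide divide_right_mono)
  have "\<bar>(1 - x - x' - y / a) * (x - x')\<bar> <= (1 + 2 * R + R / a) * n"
   by (rule m[OF _ n(1)]) (use b ya in linarith)
  moreover have "\<bar>(x' / a) * (y - y')\<bar> <= (R / a) * n"
   by (rule m[OF _ n(2)]) (use ya in linarith)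
  ultimately have c1: "\<bar>x * (1 - x - y / a) - x' * (1 - x' - y' / a)\<bar> <= L1 * n"
   unfolding e1 L1_def distrib_right[of _ "R / a" n] by (intro order_trans[OF abs_triangle_ineq4 add_mono])
  have e2: "y * (- Q + q * x + y) - y' * (- Q + q * x' + y')
    = (- Q + q * x + y + y') * (y - y') + (q * y') * (x - x')"
   by (simp add: algebra_simps)
  have qx: "\<bar>q * x\<bar> <= q * R" "\<bar>q * y'\<bar> <= q * R" using b a aq by (auto simp: abs_mult)
  have "\<bar>(- Q + q * x + y + y') * (y - y')\<bar> <= (Q + q * R + 2 * R) * n"
   by (rule m[OF _ n(2)]) (use b qx Rpos in linarith)
  moreover have "\<bar>(q * y') * (x - x')\<bar> <= (q * R) * n"
   by (rule m[OF _ n(1)]) (use qx in linarith)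
  ultimately have c2: "\<bar>y * (- Q + q * x + y) - y' * (- Q + q * x' + y')\<bar> <= L2 * n"
   unfolding e2 by (intro order_trans[OF abs_triangle_ineq add_mono[THEN order_trans]]) (auto simp: L2_def algebra_simps)
  have "norm (field s R z - field s R w)
    <= \<bar>s * (x * (1 - x - y / a)) - s * (x' * (1 - x' - y' / a))\<bar>
     + \<bar>s * (y * (- Q + q * x + y)) - s * (y' * (- Q + q * x' + y'))\<bar>"
   unfolding field_def Let_def d[symmetric] diff_Pair by (rule order_trans[OF norm_Pair_le]) simp
  also have "\<dots> = \<bar>x * (1 - x - y / a) - x' * (1 - x' - y' / a)\<bar>
     + \<bar>y * (- Q + q * x + y) - y' * (- Q + q * x' + y')\<bar>"
   using s by (simp add: abs_mult flip: right_diff_distrib)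
  also have "\<dots> <= L1 * n + L2 * n" using c1 c2 by linarith
  also have "\<dots> <= 2 * (L1 + L2) * n"
  proof -
   have "0 <= n" by (simp add: n_def)
   then have "0 <= L1 * n" "0 <= L2 * n" using pos by auto
   then show ?thesis by (simp add: algebra_simps)
  qed
  finally show "norm (field s R z - field s R w) <= 2 * (L1 + L2) * norm (z - w)" by (simp add: n_def)
 qed
qed

definition lvorbit :: "real => real => (real => real \<times> real) => bool" where
 "lvorbit s R z \<longleftrightarrow> (\<forall>t. (z has_vector_derivative field s R (z t)) (at t))"

lemma orbit_eq_lvorbit: "lipschitz_field (field s R) L ==> lipschitz_field.orbit (field s R) = lvorbit s R"
 by (auto simp: lipschitz_field.orbit_def lvorbit_def fun_eq_iff)

lemma lvorbit_components:
 assumes "lvorbit s R z"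
 shows "((%t. fst (z t)) has_real_derivative fst (field s R (z t))) (at t)"
  "((%t. snd (z t)) has_real_derivative snd (field s R (z t))) (at t)"
 using assms bounded_linear.has_vector_derivative[OF bounded_linear_fst]
  bounded_linear.has_vector_derivative[OF bounded_linear_snd]
 unfolding lvorbit_def has_real_derivative_iff_has_vector_derivative by blast+

lemma lvorbit_in_box:
 assumes "lvorbit s R z" "\<bar>fst (z t)\<bar> <= R" "\<bar>snd (z t)\<bar> <= R"
 shows "((%t. fst (z t)) has_real_derivative s * (fst (z t) * (1 - fst (z t) - snd (z t) / a))) (at t)"
  "((%t. snd (z t)) has_real_derivative s * (snd (z t) * (- Q + q * fst (z t) + snd (z t)))) (at t)"
 using lvorbit_components[OF assms(1), of t] field_in_box[OF assms(2,3), of s] by auto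

lemma lvorbit_lv:
 assumes "lvorbit 1 R z" "\<bar>fst (z t)\<bar> <= R" "\<bar>snd (z t)\<bar> <= R"
 shows "lv (%t. fst (z t)) (%t. snd (z t)) t"
 using lvorbit_in_box[OF assms] by (simp add: lv_def)

lemma lvorbit_lv_reversed:
 assumes "lvorbit (- 1) R z" "\<bar>fst (z (- t))\<bar> <= R" "\<bar>snd (z (- t))\<bar> <= R"
 shows "lv (%t. fst (z (- t))) (%t. snd (z (- t))) t"
 unfolding lv_def
proof
 have m: "(uminus has_real_derivative - 1) (at t)" by (rule derivative_eq_intros refl)+
 show "((%t. fst (z (- t))) has_real_derivative
   fst (z (- t)) * (1 - fst (z (- t)) - snd (z (- t)) / a)) (at t)"
  using DERIV_chain2[OF lvorbit_in_box(1)[OF assms] m] by simp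
 show "((%t. snd (z (- t))) has_real_derivative
   snd (z (- t)) * (- Q + q * fst (z (- t)) + snd (z (- t)))) (at t)"
  using DERIV_chain2[OF lvorbit_in_box(2)[OF assms] m] by simp
qed

end

text \<open>A function satisfying \<open>|u'| \<le> M |u|\<close> vanishes either everywhere or nowhere, so it keeps its
 sign.\<close>

lemma sign_preserved:
 fixes u :: "real => real"
 assumes u: "!!t. (u has_real_derivative u' t) (at t)" and u': "!!t. \<bar>u' t\<bar> <= M * \<bar>u t\<bar>"
  and u0: "u s > 0"
 shows "u t > 0"
proof -
 have M: "M >= 0"
 proof -
  have "0 <= M * \<bar>u s\<bar>" using u'[of s] by linarith
  then show ?thesis using u0 by (simp add: zero_le_mult_iff)
 qed
 have sq: "\<bar>2 * u r * u' r\<bar> <= 2 * M * (u r)\<^sup>2" for r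
  using mult_left_mono[OF u'[of r], of "2 * \<bar>u r\<bar>"]
  by (simp add: abs_mult power2_eq_square mult_ac)
 have d: "((%t. (u t)\<^sup>2) has_real_derivative 2 * u r * u' r) (at r)" for r
  by (rule derivative_eq_intros u refl | simp)+
 have zero: "u s = 0" if "u r = 0" for r
 proof -
  have "(u s)\<^sup>2 <= 0"
  proof (cases "r <= s")
   case True
   have "exp (- (2 * M * s)) * (u s)\<^sup>2 <= exp (- (2 * M * r)) * (u r)\<^sup>2"
   proof (rule DERIV_nonpos_imp_nonincreasing[OF True, where f="%r. exp (- (2 * M * r)) * (u r)\<^sup>2"])
    fix x
    have "((%r. exp (- (2 * M * r)) * (u r)\<^sup>2) has_real_derivative
     exp (- (2 * M * x)) * (2 * u x * u' x - 2 * M * (u x)\<^sup>2)) (at x)"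
     by (rule derivative_eq_intros d refl | simp add: algebra_simps)+
    moreover have "exp (- (2 * M * x)) * (2 * u x * u' x - 2 * M * (u x)\<^sup>2) <= 0"
     using sq[of x] by (intro mult_nonneg_nonpos) auto
    ultimately show "\<exists>y. ((%r. exp (- (2 * M * r)) * (u r)\<^sup>2) has_real_derivative y) (at x) \<and> y <= 0"
     by blast
   qed
   then have "exp (- (2 * M * s)) * (u s)\<^sup>2 <= 0" using that by simp
   then show ?thesis by (simp add: mult_le_0_iff not_le[symmetric])
  next
   case False
   then have "s <= r" by simp
   then have "exp (2 * M * s) * (u s)\<^sup>2 <= exp (2 * M * r) * (u r)\<^sup>2"
   proof (rule DERIV_nonneg_imp_nondecreasing[where f="%r. exp (2 * M * r) * (u r)\<^sup>2"])
    fix x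
    have "((%r. exp (2 * M * r) * (u r)\<^sup>2) has_real_derivative
     exp (2 * M * x) * (2 * u x * u' x + 2 * M * (u x)\<^sup>2)) (at x)"
     by (rule derivative_eq_intros d refl | simp add: algebra_simps)+
    moreover have "exp (2 * M * x) * (2 * u x * u' x + 2 * M * (u x)\<^sup>2) >= 0"
     using sq[of x] by (intro mult_nonneg_nonneg) auto
    ultimately show "\<exists>y. ((%r. exp (2 * M * r) * (u r)\<^sup>2) has_real_derivative y) (at x) \<and> y >= 0"
     by blast
   qed
   then have "exp (2 * M * s) * (u s)\<^sup>2 <= 0" using that by simp
   then show ?thesis by (simp add: mult_le_0_iff not_le[symmetric])
  qed
  then show ?thesis by simp
 qed
 have cont: "\<forall>x. isCont u x" using u DERIV_isCont by blast
 show ?thesis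
 proof (rule ccontr)
  assume "\<not> u t > 0"
  then have "\<exists>r. u r = 0"
   using IVT2[of u t 0 s] IVT[of u s 0 t] IVT[of u t 0 s] IVT2[of u s 0 t] cont u0
   by (cases "s <= t") (auto simp: not_less)
  then show False using zero u0 by auto
 qed
qed

context lotka_volterra
begin

lemma lvorbit_x_sign:
 assumes z: "lvorbit s R z" and R: "R > 0" and s: "\<bar>s\<bar> = 1" and \<epsilon>: "\<epsilon> * fst (z t0) > 0"
 shows "\<epsilon> * fst (z t) > 0"
proof (rule sign_preserved[where u="%t. \<epsilon> * fst (z t)" and M="1 + R + R / a" and s=t0])
 show "((%t. \<epsilon> * fst (z t)) has_real_derivative \<epsilon> * fst (field s R (z t))) (at t)" for t
  by (rule DERIV_cmult lvorbit_components[OF z])+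
 fix t
 define x y where d: "x = clamp_real R (fst (z t))" "y = clamp_real R (snd (z t))"
 have b: "\<bar>x\<bar> <= R" "\<bar>y\<bar> <= R" using clamp_real_bound R by (auto simp: d)
 have "\<bar>y / a\<bar> <= R / a" using b a by (auto simp: abs_divide divide_right_mono)
 then have "\<bar>x * (1 - x - y / a)\<bar> <= \<bar>fst (z t)\<bar> * (1 + R + R / a)"
  unfolding abs_mult using b clamp_real_abs_le[of R "fst (z t)", folded d] R
  by (intro mult_mono) linarith+
 then have "\<bar>\<epsilon>\<bar> * \<bar>x * (1 - x - y / a)\<bar> <= \<bar>\<epsilon>\<bar> * (\<bar>fst (z t)\<bar> * (1 + R + R / a))"
  by (rule mult_left_mono) simp
 then show "\<bar>\<epsilon> * fst (field s R (z t))\<bar> <= (1 + R + R / a) * \<bar>\<epsilon> * fst (z t)\<bar>"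
  using s by (simp add: field_def Let_def d abs_mult mult_ac)
qed (rule \<epsilon>)

lemma lvorbit_y_sign:
 assumes z: "lvorbit s R z" and R: "R > 0" and s: "\<bar>s\<bar> = 1" and \<epsilon>: "\<epsilon> * snd (z t0) > 0"
 shows "\<epsilon> * snd (z t) > 0"
proof (rule sign_preserved[where u="%t. \<epsilon> * snd (z t)" and M="Q + q * R + R" and s=t0])
 show "((%t. \<epsilon> * snd (z t)) has_real_derivative \<epsilon> * snd (field s R (z t))) (at t)" for t
  by (rule DERIV_cmult lvorbit_components[OF z])+
 fix t
 define x y where d: "x = clamp_real R (fst (z t))" "y = clamp_real R (snd (z t))"
 have b: "\<bar>x\<bar> <= R" "\<bar>y\<bar> <= R" using clamp_real_bound R by (auto simp: d)
 have "\<bar>q * x\<bar> <= q * R" using b a aq by (auto simp: abs_mult)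
 then have "\<bar>- Q + q * x + y\<bar> <= Q + q * R + R" using b a aQ by linarith
 moreover have "\<bar>y\<bar> <= \<bar>snd (z t)\<bar>" using clamp_real_abs_le[of R "snd (z t)"] R by (simp add: d)
 ultimately have "\<bar>y * (- Q + q * x + y)\<bar> <= \<bar>snd (z t)\<bar> * (Q + q * R + R)"
  unfolding abs_mult by (intro mult_mono) auto
 then have "\<bar>\<epsilon>\<bar> * \<bar>y * (- Q + q * x + y)\<bar> <= \<bar>\<epsilon>\<bar> * (\<bar>snd (z t)\<bar> * (Q + q * R + R))"
  by (rule mult_left_mono) simp
 then show "\<bar>\<epsilon> * snd (field s R (z t))\<bar> <= (Q + q * R + R) * \<bar>\<epsilon> * snd (z t)\<bar>"
  using s by (simp add: field_def Let_def d abs_mult mult_ac)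
qed (rule \<epsilon>)

end

section \<open>Linear inequalities with small perturbations\<close>

lemma eventually_small_multiple: "d > 0 ==> \<forall>\<^sub>F h in at_right 0. h * c < (d::real)"
proof -
 assume d: "d > 0"
 have "((%h. h * c) \<longlongrightarrow> 0 * c) (at_right 0)" by (intro tendsto_intros)
 then show ?thesis using d by (intro order_tendstoD(2)[of _ 0]) auto
qed

lemma exp_decay_at_top: "l > 0 ==> ((%t::real. exp (- (l * t))) \<longlongrightarrow> 0) at_top"
 by (rule filterlim_compose[OF exp_at_bot])
   (auto simp: filterlim_uminus_at_bot intro!: filterlim_tendsto_pos_mult_at_top[OF tendsto_const] filterlim_ident)

lemma exp_decay_at_bot: "l > 0 ==> ((%t::real. exp (l * t)) \<longlongrightarrow> 0) at_bot"
 by (rule filterlim_compose[OF exp_at_bot])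
   (auto intro!: filterlim_tendsto_pos_mult_at_bot[OF tendsto_const] filterlim_ident)

text \<open>The dissipative term wins as soon as \<open>|u| \<ge> e\<close>, so that \<open>exp (b0 t) (u\<^sup>2 - e\<^sup>2)\<close> is nonincreasing.\<close>

lemma damped_square_bound:
 fixes u :: "real => real"
 assumes u: "!!t. t \<in> {s..r} ==> (u has_real_derivative - b t * u t + g t) (at t)"
  and b: "!!t. t \<in> {s..r} ==> b0 <= b t" and b0: "b0 > 0"
  and g: "!!t. t \<in> {s..r} ==> \<bar>g t\<bar> <= b0 * e" and sr: "s <= r"
 shows "(u r)\<^sup>2 <= e\<^sup>2 + exp (- (b0 * (r - s))) * (u s)\<^sup>2"
proof -
 have "exp (b0 * r) * ((u r)\<^sup>2 - e\<^sup>2) <= exp (b0 * s) * ((u s)\<^sup>2 - e\<^sup>2)"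
 proof (rule DERIV_nonpos_imp_nonincreasing[OF sr, where f="%t. exp (b0 * t) * ((u t)\<^sup>2 - e\<^sup>2)"])
  fix t assume "s <= t" "t <= r"
  then have t: "t \<in> {s..r}" by simp
  have "((%t. exp (b0 * t) * ((u t)\<^sup>2 - e\<^sup>2)) has_real_derivative
    exp (b0 * t) * (b0 * ((u t)\<^sup>2 - e\<^sup>2) + 2 * u t * (- b t * u t + g t))) (at t)"
   by (rule derivative_eq_intros u[OF t] refl | simp add: algebra_simps)+
  moreover have "b0 * ((u t)\<^sup>2 - e\<^sup>2) + 2 * u t * (- b t * u t + g t) <= 0"
  proof -
   have "2 * u t * g t <= 2 * (\<bar>u t\<bar> * \<bar>g t\<bar>)" by (metis abs_ge_self abs_mult mult.assoc mult_le_cancel_left_pos zero_less_numeral)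
   also have "\<dots> <= 2 * (\<bar>u t\<bar> * (b0 * e))" using g[OF t] by (intro mult_left_mono) auto
   also have "\<dots> <= b0 * ((u t)\<^sup>2 + e\<^sup>2)"
   proof -
    have "0 <= b0 * (\<bar>u t\<bar> - e)\<^sup>2" using b0 by simp
    then show ?thesis by (simp add: power2_diff algebra_simps)
   qed
   finally have 1: "2 * u t * g t <= b0 * ((u t)\<^sup>2 + e\<^sup>2)" .
   have "b0 * (u t)\<^sup>2 <= b t * (u t)\<^sup>2" using b[OF t] by (intro mult_right_mono) auto
   then show ?thesis using 1 by (simp add: algebra_simps power2_eq_square)
  qed
  ultimately show "\<exists>y. ((%t. exp (b0 * t) * ((u t)\<^sup>2 - e\<^sup>2)) has_real_derivative y) (at t) \<and> y <= 0"
   by (meson exp_ge_zero mult_nonneg_nonpos)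
 qed
 then have "exp (- (b0 * r)) * (exp (b0 * r) * ((u r)\<^sup>2 - e\<^sup>2)) <= exp (- (b0 * r)) * (exp (b0 * s) * ((u s)\<^sup>2 - e\<^sup>2))"
  by (rule mult_left_mono) simp
 moreover have "exp (- (b0 * r)) * (exp (b0 * r) * ((u r)\<^sup>2 - e\<^sup>2)) = (u r)\<^sup>2 - e\<^sup>2"
  by (simp add: exp_minus field_simps)
 moreover have "exp (- (b0 * r)) * exp (b0 * s) = exp (- (b0 * (r - s)))"
  unfolding exp_add[symmetric] by (simp add: algebra_simps)
 ultimately have "(u r)\<^sup>2 - e\<^sup>2 <= exp (- (b0 * (r - s))) * ((u s)\<^sup>2 - e\<^sup>2)"
  by (metis mult.assoc)
 also have "\<dots> <= exp (- (b0 * (r - s))) * (u s)\<^sup>2" by (intro mult_left_mono) auto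
 finally show ?thesis by simp
qed

lemma damped_tendsto_0_at_top:
 fixes u :: "real => real"
 assumes u: "!!t. t >= t0 ==> (u has_real_derivative - b t * u t + g t) (at t)"
  and b: "!!t. t >= t0 ==> b0 <= b t" and b0: "b0 > 0" and g: "(g \<longlongrightarrow> 0) at_top"
 shows "(u \<longlongrightarrow> 0) at_top"
proof (rule tendstoI)
 fix e :: real assume e: "e > 0"
 have "\<forall>\<^sub>F t in at_top. \<bar>g t\<bar> < b0 * (e / 2)"
  using tendstoD[OF g, of "b0 * (e / 2)"] e b0 by simp
 then obtain t1 where t1: "!!t. t >= t1 ==> \<bar>g t\<bar> < b0 * (e / 2)" by (auto simp: eventually_at_top_linorder)
 define s where "s = max t0 t1"
 have "((%r. exp (- (b0 * (r - s))) * (u s)\<^sup>2) \<longlongrightarrow> 0) at_top"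
 proof -
  have "((%r. exp (- (b0 * r)) * (exp (b0 * s) * (u s)\<^sup>2)) \<longlongrightarrow> 0 * (exp (b0 * s) * (u s)\<^sup>2)) at_top"
   by (intro tendsto_intros exp_decay_at_top b0)
  then show ?thesis by (simp add: right_diff_distrib exp_diff exp_minus field_simps)
 qed
 then have "\<forall>\<^sub>F r in at_top. exp (- (b0 * (r - s))) * (u s)\<^sup>2 < (e / 2)\<^sup>2"
  using e by (intro order_tendstoD(2)) auto
 then show "\<forall>\<^sub>F r in at_top. dist (u r) 0 < e"
  using eventually_ge_at_top[of s]
 proof eventually_elim
  case (elim r)
  have "(u r)\<^sup>2 <= (e / 2)\<^sup>2 + exp (- (b0 * (r - s))) * (u s)\<^sup>2"
   by (rule damped_square_bound[where b=b and g=g]) (use elim u b b0 t1 in \<open>auto simp: s_def intro: less_imp_le\<close>)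
  also have "\<dots> < (e / 2)\<^sup>2 + (e / 2)\<^sup>2" using elim(1) by simp
  also have "\<dots> <= e\<^sup>2" using e by (simp add: power2_eq_square)
  finally have "\<bar>u r\<bar>\<^sup>2 < e\<^sup>2" by simp
  then have "\<bar>u r\<bar> < e" using e by (intro power2_less_imp_less[of "\<bar>u r\<bar>" e]) auto
  then show ?case by simp
 qed
qed

lemma damped_bounded_tendsto_0_at_bot:
 fixes u :: "real => real"
 assumes u: "!!t. t <= t0 ==> (u has_real_derivative - b t * u t + g t) (at t)"
  and b: "!!t. t <= t0 ==> b0 <= b t" and b0: "b0 > 0" and g: "(g \<longlongrightarrow> 0) at_bot"
  and bnd: "!!t. t <= t0 ==> \<bar>u t\<bar> <= M"
 shows "(u \<longlongrightarrow> 0) at_bot"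
proof (rule tendstoI)
 fix e :: real assume e: "e > 0"
 have "\<forall>\<^sub>F t in at_bot. \<bar>g t\<bar> < b0 * (e / 2)"
  using tendstoD[OF g, of "b0 * (e / 2)"] e b0 by simp
 then obtain t1 where t1: "!!t. t <= t1 ==> \<bar>g t\<bar> < b0 * (e / 2)" by (auto simp: eventually_at_bot_linorder)
 have "dist (u r) 0 < e" if r: "r <= min t0 t1" for r
 proof -
  have M: "M\<^sup>2 >= (u s)\<^sup>2" if "s <= r" for s
   using bnd[of s] that r by (metis abs_ge_zero min.boundedE order_trans power2_abs power_mono)
  have le: "(u r)\<^sup>2 <= (e / 2)\<^sup>2 + exp (- (b0 * (r - s))) * M\<^sup>2" if s: "s <= r" for s
  proof -
   have "(u r)\<^sup>2 <= (e / 2)\<^sup>2 + exp (- (b0 * (r - s))) * (u s)\<^sup>2"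
    by (rule damped_square_bound[where b=b and g=g]) (use s r u b b0 t1 in \<open>auto intro: less_imp_le\<close>)
   also have "\<dots> <= (e / 2)\<^sup>2 + exp (- (b0 * (r - s))) * M\<^sup>2"
    using M[OF s] by (intro add_left_mono mult_left_mono) auto
   finally show ?thesis .
  qed
  have "((%s. (e / 2)\<^sup>2 + exp (b0 * s) * (exp (- (b0 * r)) * M\<^sup>2)) \<longlongrightarrow> (e / 2)\<^sup>2 + 0 * (exp (- (b0 * r)) * M\<^sup>2)) at_bot"
   by (intro tendsto_intros exp_decay_at_bot b0)
  then have lim: "((%s. (e / 2)\<^sup>2 + exp (- (b0 * (r - s))) * M\<^sup>2) \<longlongrightarrow> (e / 2)\<^sup>2) at_bot"
   by (simp add: right_diff_distrib exp_diff exp_minus field_simps)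
  have "\<forall>\<^sub>F s in at_bot. (u r)\<^sup>2 <= (e / 2)\<^sup>2 + exp (- (b0 * (r - s))) * M\<^sup>2"
   using eventually_le_at_bot[of r] by eventually_elim (rule le)
  then have "(u r)\<^sup>2 <= (e / 2)\<^sup>2" by (rule tendsto_lowerbound[OF lim]) simp
  then have "\<bar>u r\<bar> <= e / 2" using e by (metis abs_le_square_iff abs_of_pos half_gt_zero)
  then show ?thesis using e by simp
 qed
 then show "\<forall>\<^sub>F r in at_bot. dist (u r) 0 < e" unfolding eventually_at_bot_linorder by blast
qed

lemma exponential_growth_bound:
 fixes y :: "real => real"
 assumes "!!t. t <= r ==> (y has_real_derivative y t * g t) (at t)" "!!t. t <= r ==> y t > 0"
  "!!t. t <= r ==> l <= g t" and t: "t <= r"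
 shows "y t <= y r * exp (l * (t - r))"
proof -
 have "exp (- (l * t)) * y t <= exp (- (l * r)) * y r"
 proof (rule DERIV_nonneg_imp_nondecreasing[OF t, where f="%t. exp (- (l * t)) * y t"])
  fix s assume s: "t <= s" "s <= r"
  have "((%t. exp (- (l * t)) * y t) has_real_derivative exp (- (l * s)) * y s * (g s - l)) (at s)"
   by (rule derivative_eq_intros assms(1)[OF s(2)] refl | simp add: algebra_simps)+
  moreover have "exp (- (l * s)) * y s * (g s - l) >= 0"
   using assms(2,3)[OF s(2)] by (intro mult_nonneg_nonneg) auto
  ultimately show "\<exists>D. ((%t. exp (- (l * t)) * y t) has_real_derivative D) (at s) \<and> D >= 0" by blast
 qed
 then have "exp (l * t) * (exp (- (l * t)) * y t) <= exp (l * t) * (exp (- (l * r)) * y r)"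
  by (rule mult_left_mono) simp
 moreover have "exp (l * t) * (exp (- (l * t)) * y t) = y t" by (simp add: exp_minus field_simps)
 moreover have "exp (l * t) * (exp (- (l * r)) * y r) = y r * exp (l * (t - r))"
  by (simp add: right_diff_distrib exp_diff exp_minus field_simps)
 ultimately show ?thesis by simp
qed

lemma exponential_decay_bound:
 fixes y :: "real => real"
 assumes y: "!!t. t >= r ==> (y has_real_derivative y t * g t) (at t)" "!!t. t >= r ==> y t > 0"
  "!!t. t >= r ==> g t <= - l" and t: "t >= r"
 shows "y t <= y r * exp (- l * (t - r))"
proof -
 have "(%t. y (- t)) (- t) <= (%t. y (- t)) (- r) * exp (l * (- t - - r))"
 proof (rule exponential_growth_bound[where g="%t. - g (- t)"])
  fix t assume "t <= - r"
  then have t: "- t >= r" by simp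
  have m: "(uminus has_real_derivative - 1) (at t)" by (rule derivative_eq_intros refl)+
  show "((%t. y (- t)) has_real_derivative y (- t) * - g (- t)) (at t)"
   using DERIV_chain2[OF y(1)[OF t] m] by simp
  show "l <= - g (- t)" using y(3)[OF t] by simp
 qed (use y t in auto)
 then show ?thesis by (simp add: algebra_simps)
qed

context lotka_volterra
begin

section \<open>Orbits leaving or entering an equilibrium along a cone\<close>

lemma lv_cone_orbit:
 fixes G :: "(real \<times> real) set" and d e \<eta> :: "real \<times> real"
 defines "Cn \<equiv> {z. \<forall>\<nu>\<in>G. \<nu> \<bullet> (z - e) >= 0}"
 assumes R: "R > 0" and s: "\<bar>s\<bar> = 1"
  and fin: "finite G" and e: "field s R e = 0" and d: "!!\<nu>. \<nu> \<in> G ==> \<nu> \<bullet> d >= 0" "\<eta> \<bullet> d > 0"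
  and bnd: "{z \<in> Cn. 0 <= \<eta> \<bullet> (z - e) \<and> \<eta> \<bullet> (z - e) <= \<eta> \<bullet> d} \<subseteq> {- R..R} \<times> {- R..R}"
  and inward: "!!z \<nu>. z \<in> Cn ==> 0 < \<eta> \<bullet> (z - e) ==> \<eta> \<bullet> (z - e) <= \<eta> \<bullet> d ==> \<nu> \<in> G
    ==> \<nu> \<bullet> (z - e) = 0 ==> \<nu> \<bullet> field s R z > 0"
  and rate: "!!c. c > 0 ==> \<exists>\<mu>>0. \<forall>z\<in>Cn. c <= \<eta> \<bullet> (z - e) --> \<eta> \<bullet> (z - e) <= \<eta> \<bullet> d --> \<mu> <= \<eta> \<bullet> field s R z"
 shows "\<exists>z. lvorbit s R z \<and> \<eta> \<bullet> (z 0 - e) = \<eta> \<bullet> d \<and>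
  (\<forall>t\<le>0. z t \<in> Cn \<and> 0 <= \<eta> \<bullet> (z t - e) \<and> \<eta> \<bullet> (z t - e) <= \<eta> \<bullet> d)"
proof -
 obtain L where "lipschitz_field (field s R) L" using field_lipschitz[OF R s] by auto
 then interpret lf: lipschitz_field "field s R" L .
 have "bounded {z \<in> Cn. 0 <= \<eta> \<bullet> (z - e) \<and> \<eta> \<bullet> (z - e) <= \<eta> \<bullet> d}"
  by (rule bounded_subset[OF bounded_Times bnd]) auto
 note bounded = this
 have "\<exists>z. lf.orbit z \<and> \<eta> \<bullet> (z 0 - e) = \<eta> \<bullet> d \<and>
  (\<forall>t\<le>0. z t \<in> Cn \<and> 0 <= \<eta> \<bullet> (z t - e) \<and> \<eta> \<bullet> (z t - e) <= \<eta> \<bullet> d)"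
  unfolding Cn_def
  by (rule lf.cone_orbit_exists; (fold Cn_def)?) (fact fin e d bounded inward rate)+
 then show ?thesis unfolding orbit_eq_lvorbit[OF lf.lipschitz_field_axioms] .
qed

lemma lvorbit_reversed:
 assumes "lvorbit s R z" shows "lvorbit (- s) R (%t. z (- t))"
 unfolding lvorbit_def
proof
 fix t
 have "(uminus has_vector_derivative - 1) (at t)"
  by (rule has_real_derivative_iff_has_vector_derivative[THEN iffD1]) (rule derivative_eq_intros refl)+
 from vector_diff_chain_at[OF this, of z "field s R (z (- t))"] assms
 have "((%t. z (- t)) has_vector_derivative - field s R (z (- t))) (at t)"
  by (simp add: o_def lvorbit_def)
 also have "- field s R (z (- t)) = field (- s) R (z (- t))" by (simp add: field_def Let_def)
 finally show "((%t. z (- t)) has_vector_derivative field (- s) R (z (- t))) (at t)" .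
qed

text \<open>The unstable eigenvector at the saddle \<open>(1, 0)\<close> is \<open>(- 1 / (a (1 + q - Q)), 1)\<close>. The cone used here is bounded by the nullcline of \<open>x\<close>
 and by the line \<open>1 - x = \<kappa> y\<close>; the parameter \<open>\<kappa>\<close> lets the curve be placed below the Pohozaev line when \<open>Q\<close> exceeds \<open>sob\<close>.\<close>

lemma orbit_leaving_one_zero:
 assumes qQ: "Q < q" and \<epsilon>: "\<epsilon> = 1 \<or> \<epsilon> = - 1" and \<kappa>: "0 <= \<kappa>" "\<kappa> * (1 + q - Q) < 1 / a" and R: "R >= 2"
 shows "\<exists>z. lvorbit 1 R z \<and> (\<forall>t\<le>0. 0 < \<epsilon> * snd (z t) \<and> \<bar>snd (z t)\<bar> <= 1
   \<and> \<epsilon> * (1 - fst (z t) - \<kappa> * snd (z t)) >= 0 \<and> \<epsilon> * (fst (z t) - 1 + snd (z t) / a) >= 0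
   \<and> \<bar>fst (z t) - 1\<bar> <= 1 / 2 \<and> - Q + q * fst (z t) + snd (z t) >= (q - Q) / 2)"
proof -
 define D0 where "D0 = 1 / a - \<kappa> * (1 + q - Q)"
 define m where "m = \<kappa> * ((1 / a + \<kappa>) + 1 + q * \<kappa>)"
 have D0: "D0 > 0" using \<kappa> by (simp add: D0_def)
 have \<kappa>a: "\<kappa> < 1 / a"
 proof -
  have "\<kappa> * 1 <= \<kappa> * (1 + q - Q)" using \<kappa> qQ by (intro mult_left_mono) auto
  then show ?thesis using \<kappa> by simp
 qed
 have ia: "1 / a > 0" using a by simp
 have "\<forall>\<^sub>F h in at_right 0. h * 1 < 1 \<and> h * 2 < a \<and> h * ((q / a + 1) * 2) < q - Q \<and> h * m < D0 \<and> 0 < h"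
  using qQ a D0 by (intro eventually_conj eventually_small_multiple eventually_at_right_less) auto
 then obtain h where h: "h < 1" "h * 2 < a" "h * ((q / a + 1) * 2) < q - Q" "h * m < D0" "0 < h"
  using eventually_happens[of _ "at_right (0::real)"] by auto
 have \<epsilon>2: "\<epsilon> * \<epsilon> = 1" "\<bar>\<epsilon>\<bar> = 1" using \<epsilon> by auto
 have R0: "R > 0" using R by simp
 define e where "e = (1::real, 0::real)"
 define d where "d = (- \<epsilon> * h / a, \<epsilon> * h)"
 define G where "G = {(- \<epsilon>, - \<epsilon> * \<kappa>), (\<epsilon>, \<epsilon> / a)}"
 define \<eta> where "\<eta> = (0::real, \<epsilon>)"
 define Cn where "Cn = {z. \<forall>\<nu>\<in>G. \<nu> \<bullet> (z - e) >= 0}"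
 have \<eta>d: "\<eta> \<bullet> d = h" using \<epsilon>2 by (simp add: \<eta>_def d_def flip: mult.assoc)
 have Cn: "(x, y) \<in> Cn \<longleftrightarrow> \<epsilon> * (x - 1) + \<kappa> * (\<epsilon> * y) <= 0 \<and> \<epsilon> * (x - 1) + (\<epsilon> * y) / a >= 0" for x y
  by (auto simp: Cn_def G_def e_def algebra_simps)
 have \<eta>z: "\<eta> \<bullet> ((x, y) - e) = \<epsilon> * y" for x y by (simp add: \<eta>_def e_def)
 have bounds: "\<bar>x - 1\<bar> <= 1 / 2 \<and> \<bar>y\<bar> <= 1 \<and> \<bar>q * (x - 1) + y\<bar> <= (q - Q) / 2"
  if "(x, y) \<in> Cn" "0 <= \<epsilon> * y" "\<epsilon> * y <= h" for x y
 proof -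
  have y: "\<bar>y\<bar> = \<epsilon> * y" using \<epsilon> that by auto
  have "0 <= \<kappa> * (\<epsilon> * y)" using \<kappa> that by simp
  then have "\<bar>\<epsilon> * (x - 1)\<bar> <= (\<epsilon> * y) / a" using that(1) unfolding Cn by linarith
  then have x: "\<bar>x - 1\<bar> <= \<bar>y\<bar> / a" using \<epsilon>2 y by (simp add: abs_mult)
  also have "\<dots> <= h / a" using that y a by (simp add: divide_right_mono)
  also have "\<dots> <= 1 / 2" using h a by (simp add: field_simps)
  finally have x2: "\<bar>x - 1\<bar> <= 1 / 2" .
  have "\<bar>q * (x - 1) + y\<bar> <= q * \<bar>x - 1\<bar> + \<bar>y\<bar>"
   using abs_triangle_ineq[of "q * (x - 1)" y] a aq by (simp add: abs_mult)
  also have "\<dots> <= q * (\<bar>y\<bar> / a) + \<bar>y\<bar>" using x a aq by (intro add_mono mult_left_mono) auto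
  also have "\<dots> = \<bar>y\<bar> * (q / a + 1)" by (simp add: algebra_simps)
  also have "\<dots> <= h * (q / a + 1)" using that y a aq by (intro mult_right_mono) auto
  also have "\<dots> <= (q - Q) / 2" using h(3) by (metis less_imp_le mult.assoc pos_le_divide_eq zero_less_numeral)
  finally show ?thesis using x2 h y that by auto
 qed
 have f: "field 1 R (x, y) = (x * (1 - x - y / a), y * (- Q + q * x + y))"
  if "(x, y) \<in> Cn" "0 <= \<epsilon> * y" "\<epsilon> * y <= h" for x y
 proof -
  have "\<bar>x\<bar> <= R" "\<bar>y\<bar> <= R" using bounds[OF that] R by linarith+
  then show ?thesis by (simp add: field_in_box)
 qed
 have "\<exists>z. lvorbit 1 R z \<and> \<eta> \<bullet> (z 0 - e) = \<eta> \<bullet> d \<and>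
  (\<forall>t\<le>0. z t \<in> Cn \<and> 0 <= \<eta> \<bullet> (z t - e) \<and> \<eta> \<bullet> (z t - e) <= \<eta> \<bullet> d)"
  unfolding Cn_def
 proof (rule lv_cone_orbit; (fold Cn_def)?)
  show "R > 0" "\<bar>1::real\<bar> = 1" using R0 by auto
  show "finite G" by (simp add: G_def)
  show "field 1 R e = 0" using R by (simp add: e_def field_in_box zero_prod_def)
  show "\<nu> \<bullet> d >= 0" if "\<nu> \<in> G" for \<nu>
  proof -
   have "\<kappa> * h <= h / a" using \<kappa>a h mult_right_mono[of \<kappa> "1 / a" h] by simp
   then show ?thesis using that \<epsilon> by (auto simp: G_def d_def)
  qed
  show "\<eta> \<bullet> d > 0" using \<eta>d h by simp
  show "{z \<in> Cn. 0 <= \<eta> \<bullet> (z - e) \<and> \<eta> \<bullet> (z - e) <= \<eta> \<bullet> d} \<subseteq> {- R..R} \<times> {- R..R}"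
  proof
   fix z assume "z \<in> {z \<in> Cn. 0 <= \<eta> \<bullet> (z - e) \<and> \<eta> \<bullet> (z - e) <= \<eta> \<bullet> d}"
   then have "\<bar>fst z - 1\<bar> <= 1 / 2 \<and> \<bar>snd z\<bar> <= 1"
    using bounds[of "fst z" "snd z"] \<eta>z[of "fst z" "snd z"] \<eta>d by auto
   then show "z \<in> {- R..R} \<times> {- R..R}" using R unfolding mem_Times_iff atLeastAtMost_iff by argo
  qed
  fix z \<nu> assume z: "z \<in> Cn" "0 < \<eta> \<bullet> (z - e)" "\<eta> \<bullet> (z - e) <= \<eta> \<bullet> d" and \<nu>: "\<nu> \<in> G" "\<nu> \<bullet> (z - e) = 0"
  obtain x y where xy: "z = (x, y)" by (cases z)
  define X Y where "X = \<epsilon> * (x - 1)" and "Y = \<epsilon> * y"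
  have Y: "0 < Y" "Y <= h" using z \<eta>d by (auto simp: xy \<eta>z Y_def)
  have x: "x = 1 + \<epsilon> * X" and y: "y = \<epsilon> * Y" using \<epsilon> by (auto simp: X_def Y_def)
  note F = f[OF z(1)[unfolded xy], folded Y_def, OF less_imp_le[OF Y(1)] Y(2)]
  consider "\<nu> = (- \<epsilon>, - \<epsilon> * \<kappa>)" | "\<nu> = (\<epsilon>, \<epsilon> / a)" using \<nu> by (auto simp: G_def)
  then show "\<nu> \<bullet> field 1 R z > 0"
  proof cases
   case 1
   have X: "X = - \<kappa> * Y" using \<nu>(2) unfolding 1 xy e_def X_def Y_def by (simp add: algebra_simps)
   have "\<nu> \<bullet> field 1 R z = Y * (D0 - \<epsilon> * Y * (\<kappa> * ((1 / a - \<kappa>) + 1 - q * \<kappa>)))"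
    unfolding 1 xy F using \<epsilon> by (auto simp: x y X D0_def algebra_simps add_divide_distrib diff_divide_distrib)
   moreover have "\<bar>\<epsilon> * Y * (\<kappa> * ((1 / a - \<kappa>) + 1 - q * \<kappa>))\<bar> <= h * m"
   proof -
    have "0 <= q * \<kappa>" using \<kappa> a aq by simp
    then have "\<bar>(1 / a - \<kappa>) + 1 - q * \<kappa>\<bar> <= (1 / a + \<kappa>) + 1 + q * \<kappa>" using ia \<kappa> by linarith
    then have "\<bar>\<kappa> * ((1 / a - \<kappa>) + 1 - q * \<kappa>)\<bar> <= m" using \<kappa>(1)
     by (simp add: m_def abs_mult mult_left_mono)
    then show ?thesis using \<epsilon>2 Y by (simp add: abs_mult mult_mono)
   qed
   ultimately show ?thesis using Y h(4) by auto
  next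
   case 2
   have X: "X = - Y / a" using \<nu>(2) unfolding 2 xy e_def X_def Y_def by (simp add: algebra_simps)
   have "\<nu> \<bullet> field 1 R z = (Y / a) * ((q - Q) + (q * (x - 1) + y))"
    unfolding 2 xy F using \<epsilon> a by (auto simp: x y X field_simps)
   moreover have "\<bar>q * (x - 1) + y\<bar> <= (q - Q) / 2"
    using bounds[OF z(1)[unfolded xy]] Y by (simp add: Y_def)
   then have "0 < (q - Q) + (q * (x - 1) + y)" using qQ by argo
   ultimately show ?thesis using Y a by simp
  qed
 next
  fix c :: real assume c: "c > 0"
  show "\<exists>\<mu>>0. \<forall>z\<in>Cn. c <= \<eta> \<bullet> (z - e) --> \<eta> \<bullet> (z - e) <= \<eta> \<bullet> d --> \<mu> <= \<eta> \<bullet> field 1 R z"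
  proof (intro exI[of _ "c * ((q - Q) / 2)"] conjI ballI impI)
   show "c * ((q - Q) / 2) > 0" using c qQ by simp
   fix z assume z: "z \<in> Cn" "c <= \<eta> \<bullet> (z - e)" "\<eta> \<bullet> (z - e) <= \<eta> \<bullet> d"
   obtain x y where xy: "z = (x, y)" by (cases z)
   have Y: "c <= \<epsilon> * y" "0 <= \<epsilon> * y" "\<epsilon> * y <= h" using z c by (auto simp: xy \<eta>z \<eta>d)
   have "\<eta> \<bullet> field 1 R z = \<epsilon> * y * ((q - Q) + (q * (x - 1) + y))"
    unfolding xy f[OF z(1)[unfolded xy] Y(2,3)] by (simp add: \<eta>_def algebra_simps)
   also have "\<dots> >= c * ((q - Q) / 2)"
    using bounds[OF z(1)[unfolded xy] Y(2,3)] Y qQ c by (intro mult_mono) argo+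
   finally show "c * ((q - Q) / 2) <= \<eta> \<bullet> field 1 R z" .
  qed
 qed
 then obtain z where orb: "lvorbit 1 R z" and z: "\<eta> \<bullet> (z 0 - e) = h"
   "!!t. t <= 0 ==> z t \<in> Cn \<and> 0 <= \<eta> \<bullet> (z t - e) \<and> \<eta> \<bullet> (z t - e) <= h"
  unfolding \<eta>d by blast
 have "\<epsilon> * snd (z 0) > 0" using z(1) h \<eta>z[of "fst (z 0)" "snd (z 0)"] by simp
 then have pos: "\<epsilon> * snd (z t) > 0" for t using lvorbit_y_sign[OF orb R0] by simp
 show ?thesis
 proof (intro exI[of _ z] conjI allI impI orb pos)
  fix t :: real assume t: "t <= 0"
  have C: "(fst (z t), snd (z t)) \<in> Cn" "0 <= \<epsilon> * snd (z t)" "\<epsilon> * snd (z t) <= h"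
   using z(2)[OF t] \<eta>z[of "fst (z t)" "snd (z t)"] by auto
  show "\<bar>snd (z t)\<bar> <= 1" "\<bar>fst (z t) - 1\<bar> <= 1 / 2" using bounds[OF C] by auto
  show "- Q + q * fst (z t) + snd (z t) >= (q - Q) / 2"
   using bounds[OF C] unfolding right_diff_distrib by argo
  show "\<epsilon> * (1 - fst (z t) - \<kappa> * snd (z t)) >= 0" "\<epsilon> * (fst (z t) - 1 + snd (z t) / a) >= 0"
   using C(1) unfolding Cn by (auto simp: algebra_simps)
 qed
qed

text \<open>With time reversed, \<open>(0, Q)\<close> repels along its stable direction. The cone lies between the horizontal line \<open>y = Q\<close> and the nullcline
 \<open>y = Q - q x\<close>; in it \<open>x\<close> grows backwards at the rate \<open>x + y / a - 1 \<ge> l\<close>.\<close>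

lemma orbit_leaving_zero_Q:
 assumes \<epsilon>: "\<epsilon> = 1 \<or> \<epsilon> = - 1" and h0: "h0 > 0" and R: "R >= 2 * Q + 1"
 shows "\<exists>z l. l > 0 \<and> lvorbit (- 1) R z \<and> (\<forall>t\<le>0. 0 < \<epsilon> * fst (z t) \<and> \<bar>fst (z t)\<bar> <= h0 \<and> \<bar>fst (z t)\<bar> <= 1
   \<and> \<epsilon> * (Q - snd (z t)) >= 0 \<and> \<epsilon> * (snd (z t) - Q + q * fst (z t)) >= 0
   \<and> \<bar>snd (z t)\<bar> <= 2 * Q \<and> snd (z t) > 0 \<and> fst (z t) - 1 + snd (z t) / a >= l)"
proof -
 have Q0: "Q > 0" "q > 0" using a aQ aq by auto
 define l where "l = (Q / a - 1) / 2"
 have l: "l > 0" "Q / a - 1 = 2 * l" using a aQ by (auto simp: l_def field_simps)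
 have "\<forall>\<^sub>F h in at_right 0. h * 1 < 1 \<and> h * 1 < h0 \<and> h * q < Q \<and> h * (1 + q / a) < l \<and> 0 < h"
  using Q0 h0 l by (intro eventually_conj eventually_small_multiple eventually_at_right_less) auto
 then obtain h where h: "h < 1" "h < h0" "h * q < Q" "h * (1 + q / a) < l" "0 < h"
  using eventually_happens[of _ "at_right (0::real)"] by auto
 have R0: "R > 0" using R Q0 by simp
 define e where "e = (0::real, Q)"
 define d where "d = (\<epsilon> * h, 0::real)"
 define G where "G = {(0::real, - \<epsilon>), (\<epsilon> * q, \<epsilon>)}"
 define \<eta> where "\<eta> = (\<epsilon>, 0::real)"
 define Cn where "Cn = {z. \<forall>\<nu>\<in>G. \<nu> \<bullet> (z - e) >= 0}"
 have \<eta>d: "\<eta> \<bullet> d = h" using \<epsilon> by (auto simp: \<eta>_def d_def)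
 have Cn: "(x, y) \<in> Cn \<longleftrightarrow> \<epsilon> * (y - Q) <= 0 \<and> q * (\<epsilon> * x) + \<epsilon> * (y - Q) >= 0" for x y
  by (auto simp: Cn_def G_def e_def algebra_simps)
 have \<eta>z: "\<eta> \<bullet> ((x, y) - e) = \<epsilon> * x" for x y by (simp add: \<eta>_def e_def)
 have bounds: "\<bar>x\<bar> = \<epsilon> * x \<and> \<bar>x\<bar> <= 1 \<and> \<bar>y - Q\<bar> < Q \<and> x - 1 + y / a >= l"
  if "(x, y) \<in> Cn" "0 <= \<epsilon> * x" "\<epsilon> * x <= h" for x y
 proof -
  have x: "\<bar>x\<bar> = \<epsilon> * x" using \<epsilon> that by auto
  have y: "\<bar>y - Q\<bar> <= q * \<bar>x\<bar>" using that(1) \<epsilon> unfolding Cn x by auto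
  also have "\<dots> <= q * h" using that x Q0 by (intro mult_left_mono) auto
  finally have yQ: "\<bar>y - Q\<bar> < Q" using h by (simp add: mult.commute)
  have "\<bar>(y - Q) / a\<bar> <= q * \<bar>x\<bar> / a" using y a by (simp add: abs_divide divide_right_mono)
  moreover have "\<bar>x\<bar> + q * \<bar>x\<bar> / a <= h * (1 + q / a)"
  proof -
   have "\<bar>x\<bar> * (1 + q / a) <= h * (1 + q / a)" using that x Q0 a by (intro mult_right_mono) auto
   then show ?thesis by (simp add: algebra_simps)
  qed
  ultimately have "\<bar>x\<bar> + \<bar>(y - Q) / a\<bar> <= l" using h by linarith
  moreover have "y / a = (y - Q) / a + (2 * l + 1)" using l(2) by (simp add: diff_divide_distrib)
  ultimately show ?thesis using x yQ that h by linarith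
 qed
 have f: "field (- 1) R (x, y) = (x * (x - 1 + y / a), - y * (- Q + q * x + y))"
  if "(x, y) \<in> Cn" "0 <= \<epsilon> * x" "\<epsilon> * x <= h" for x y
 proof -
  have "\<bar>x\<bar> <= R" "\<bar>y\<bar> <= R" using bounds[OF that] R Q0 by linarith+
  then show ?thesis by (simp add: field_in_box algebra_simps)
 qed
 have "\<exists>z. lvorbit (- 1) R z \<and> \<eta> \<bullet> (z 0 - e) = \<eta> \<bullet> d \<and>
  (\<forall>t\<le>0. z t \<in> Cn \<and> 0 <= \<eta> \<bullet> (z t - e) \<and> \<eta> \<bullet> (z t - e) <= \<eta> \<bullet> d)"
  unfolding Cn_def
 proof (rule lv_cone_orbit; (fold Cn_def)?)
  show "R > 0" "\<bar>- 1::real\<bar> = 1" using R0 by auto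
  show "finite G" by (simp add: G_def)
  show "field (- 1) R e = 0" using R Q0 by (simp add: e_def field_in_box zero_prod_def)
  show "\<nu> \<bullet> d >= 0" if "\<nu> \<in> G" for \<nu>
   using that \<epsilon> h Q0 by (auto simp: G_def d_def)
  show "\<eta> \<bullet> d > 0" using \<eta>d h by simp
  show "{z \<in> Cn. 0 <= \<eta> \<bullet> (z - e) \<and> \<eta> \<bullet> (z - e) <= \<eta> \<bullet> d} \<subseteq> {- R..R} \<times> {- R..R}"
  proof
   fix z assume "z \<in> {z \<in> Cn. 0 <= \<eta> \<bullet> (z - e) \<and> \<eta> \<bullet> (z - e) <= \<eta> \<bullet> d}"
   then have "\<bar>fst z\<bar> <= 1 \<and> \<bar>snd z - Q\<bar> < Q"
    using bounds[of "fst z" "snd z"] \<eta>z[of "fst z" "snd z"] \<eta>d by auto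
   then show "z \<in> {- R..R} \<times> {- R..R}" using R Q0 unfolding mem_Times_iff atLeastAtMost_iff by argo
  qed
  fix z \<nu> assume z: "z \<in> Cn" "0 < \<eta> \<bullet> (z - e)" "\<eta> \<bullet> (z - e) <= \<eta> \<bullet> d" and \<nu>: "\<nu> \<in> G" "\<nu> \<bullet> (z - e) = 0"
  obtain x y where xy: "z = (x, y)" by (cases z)
  have X: "0 < \<epsilon> * x" "\<epsilon> * x <= h" using z \<eta>d by (auto simp: xy \<eta>z)
  note F = f[OF z(1)[unfolded xy] less_imp_le[OF X(1)] X(2)]
  note B = bounds[OF z(1)[unfolded xy] less_imp_le[OF X(1)] X(2)]
  consider "\<nu> = (0, - \<epsilon>)" | "\<nu> = (\<epsilon> * q, \<epsilon>)" using \<nu> by (auto simp: G_def)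
  then show "\<nu> \<bullet> field (- 1) R z > 0"
  proof cases
   case 1
   have "y = Q" using \<nu>(2) \<epsilon> unfolding 1 xy e_def by auto
   then have "\<nu> \<bullet> field (- 1) R z = Q * q * (\<epsilon> * x)" unfolding 1 xy F by (simp add: algebra_simps)
   then show ?thesis using X Q0 by simp
  next
   case 2
   have "- Q + q * x + y = 0" using \<nu>(2) \<epsilon> unfolding 2 xy e_def by auto
   then have "\<nu> \<bullet> field (- 1) R z = q * (\<epsilon> * x) * (x - 1 + y / a)" unfolding 2 xy F by simp
   moreover have "x - 1 + y / a > 0" using B l by linarith
   ultimately show ?thesis using X Q0 by simp
  qed
 next
  fix c :: real assume c: "c > 0"
  show "\<exists>\<mu>>0. \<forall>z\<in>Cn. c <= \<eta> \<bullet> (z - e) --> \<eta> \<bullet> (z - e) <= \<eta> \<bullet> d --> \<mu> <= \<eta> \<bullet> field (- 1) R z"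
  proof (intro exI[of _ "c * l"] conjI ballI impI)
   show "c * l > 0" using c l by simp
   fix z assume z: "z \<in> Cn" "c <= \<eta> \<bullet> (z - e)" "\<eta> \<bullet> (z - e) <= \<eta> \<bullet> d"
   obtain x y where xy: "z = (x, y)" by (cases z)
   have X: "c <= \<epsilon> * x" "0 <= \<epsilon> * x" "\<epsilon> * x <= h" using z c by (auto simp: xy \<eta>z \<eta>d)
   have "\<eta> \<bullet> field (- 1) R z = \<epsilon> * x * (x - 1 + y / a)"
    unfolding xy f[OF z(1)[unfolded xy] X(2,3)] by (simp add: \<eta>_def)
   also have "\<dots> >= c * l"
    using bounds[OF z(1)[unfolded xy] X(2,3)] X l c by (intro mult_mono) auto
   finally show "c * l <= \<eta> \<bullet> field (- 1) R z" .
  qed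
 qed
 then obtain z where orb: "lvorbit (- 1) R z" and z: "\<eta> \<bullet> (z 0 - e) = h"
   "!!t. t <= 0 ==> z t \<in> Cn \<and> 0 <= \<eta> \<bullet> (z t - e) \<and> \<eta> \<bullet> (z t - e) <= h"
  unfolding \<eta>d by blast
 have "\<epsilon> * fst (z 0) > 0" using z(1) h \<eta>z[of "fst (z 0)" "snd (z 0)"] by simp
 then have pos: "\<epsilon> * fst (z t) > 0" for t using lvorbit_x_sign[OF orb R0] by simp
 show ?thesis
 proof (intro exI[of _ z] exI[of _ l] conjI allI impI orb pos l)
  fix t :: real assume t: "t <= 0"
  have C: "(fst (z t), snd (z t)) \<in> Cn" "0 <= \<epsilon> * fst (z t)" "\<epsilon> * fst (z t) <= h"
   using z(2)[OF t] \<eta>z[of "fst (z t)" "snd (z t)"] by auto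
  show "\<bar>fst (z t)\<bar> <= h0" "\<bar>fst (z t)\<bar> <= 1" "fst (z t) - 1 + snd (z t) / a >= l"
   using bounds[OF C] C h by auto
  have "\<bar>snd (z t) - Q\<bar> < Q" using bounds[OF C] by simp
  then show "\<bar>snd (z t)\<bar> <= 2 * Q" "snd (z t) > 0" by linarith+
  show "\<epsilon> * (Q - snd (z t)) >= 0" "\<epsilon> * (snd (z t) - Q + q * fst (z t)) >= 0"
   using C(1) unfolding Cn by (auto simp: algebra_simps)
 qed
qed

text \<open>At the degenerate equilibrium \<open>(1, 0)\<close> of the critical case \<open>q = Q\<close> the cone must avoid the line
 \<open>- Q + q x + y = 0\<close>, whence the strict inequality \<open>1 / Q < \<theta>\<close>.\<close>

lemma orbit_leaving_degenerate:
 assumes qQ: "q = Q" and \<theta>: "1 / Q < \<theta>" "\<theta> < 1 / a" and R: "R >= 2"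
 shows "\<exists>z. lvorbit 1 R z \<and> (\<forall>t\<le>0. snd (z t) < 0 \<and> - 1 <= snd (z t)
   \<and> - \<theta> * snd (z t) <= fst (z t) - 1 \<and> fst (z t) - 1 <= - snd (z t) / a \<and> fst (z t) <= 2)"
proof -
 have Q0: "Q > 0" "q > 0" using a aQ aq by auto
 have Q\<theta>: "Q * \<theta> - 1 > 0" using \<theta>(1) Q0 by (simp add: field_simps)
 have \<theta>0: "\<theta> > 0" using \<theta>(1) Q0 by (smt (verit) divide_pos_pos)
 have "\<forall>\<^sub>F h in at_right 0. h * 1 < 1 \<and> h * 1 < a \<and> h * (\<theta> * (Q * \<theta> - 1)) < 1 / a - \<theta> \<and> 0 < h"
  using a \<theta> by (intro eventually_conj eventually_small_multiple eventually_at_right_less) auto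
 then obtain h where h: "h < 1" "h < a" "h * (\<theta> * (Q * \<theta> - 1)) < 1 / a - \<theta>" "0 < h"
  using eventually_happens[of _ "at_right (0::real)"] by auto
 have R0: "R > 0" using R by simp
 define e where "e = (1::real, 0::real)"
 define d where "d = (h / a, - h)"
 define G where "G = {(1::real, \<theta>), (- 1, - 1 / a)}"
 define \<eta> where "\<eta> = (0::real, - 1::real)"
 define Cn where "Cn = {z. \<forall>\<nu>\<in>G. \<nu> \<bullet> (z - e) >= 0}"
 have \<eta>d: "\<eta> \<bullet> d = h" by (auto simp: \<eta>_def d_def)
 have Cn: "(x, y) \<in> Cn \<longleftrightarrow> \<theta> * (- y) <= x - 1 \<and> x - 1 <= (- y) / a" for x y
  by (auto simp: Cn_def G_def e_def algebra_simps)
 have \<eta>z: "\<eta> \<bullet> ((x, y) - e) = - y" for x y by (simp add: \<eta>_def e_def)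
 have bounds: "1 <= x \<and> x <= 2 \<and> - 1 <= y"
  if "(x, y) \<in> Cn" "0 <= - y" "- y <= h" for x y
 proof -
  have "0 <= \<theta> * (- y)" using \<theta>0 that by (intro mult_nonneg_nonneg) auto
  moreover have "- y / a <= h / a" using divide_right_mono[of "- y" h a] that a by simp
  moreover have "h / a < 1" using h a by simp
  ultimately show ?thesis using that h unfolding Cn by linarith
 qed
 have f: "field 1 R (x, y) = (x * (1 - x - y / a), y * (Q * (x - 1) + y))"
  if "(x, y) \<in> Cn" "0 <= - y" "- y <= h" for x y
 proof -
  have "\<bar>x\<bar> <= R" "\<bar>y\<bar> <= R" using bounds[OF that] that R by linarith+
  then have "field 1 R (x, y) = (x * (1 - x - y / a), y * (- Q + q * x + y))" by (simp add: field_in_box)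
  then show ?thesis unfolding qQ by (simp add: algebra_simps)
 qed
 have "\<exists>z. lvorbit 1 R z \<and> \<eta> \<bullet> (z 0 - e) = \<eta> \<bullet> d \<and>
  (\<forall>t\<le>0. z t \<in> Cn \<and> 0 <= \<eta> \<bullet> (z t - e) \<and> \<eta> \<bullet> (z t - e) <= \<eta> \<bullet> d)"
  unfolding Cn_def
 proof (rule lv_cone_orbit; (fold Cn_def)?)
  show "R > 0" "\<bar>1::real\<bar> = 1" using R0 by auto
  show "finite G" by (simp add: G_def)
  have "field 1 R e = (0, - Q * 0 + q * 0)" using R by (simp add: e_def field_in_box)
  then show "field 1 R e = 0" by (simp add: zero_prod_def)
  show "\<nu> \<bullet> d >= 0" if "\<nu> \<in> G" for \<nu>
   using that h \<theta>(2) mult_right_mono[of \<theta> "1 / a" h] by (auto simp: G_def d_def)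
  show "\<eta> \<bullet> d > 0" using \<eta>d h by simp
  show "{z \<in> Cn. 0 <= \<eta> \<bullet> (z - e) \<and> \<eta> \<bullet> (z - e) <= \<eta> \<bullet> d} \<subseteq> {- R..R} \<times> {- R..R}"
  proof
   fix z assume z: "z \<in> {z \<in> Cn. 0 <= \<eta> \<bullet> (z - e) \<and> \<eta> \<bullet> (z - e) <= \<eta> \<bullet> d}"
   then have "1 <= fst z \<and> fst z <= 2 \<and> - 1 <= snd z" "0 <= - snd z"
    using bounds[of "fst z" "snd z"] \<eta>z[of "fst z" "snd z"] \<eta>d by auto
   then show "z \<in> {- R..R} \<times> {- R..R}" using R unfolding mem_Times_iff atLeastAtMost_iff by argo
  qed
  fix z \<nu> assume z: "z \<in> Cn" "0 < \<eta> \<bullet> (z - e)" "\<eta> \<bullet> (z - e) <= \<eta> \<bullet> d" and \<nu>: "\<nu> \<in> G" "\<nu> \<bullet> (z - e) = 0"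
  obtain x y where xy: "z = (x, y)" by (cases z)
  define V where "V = - y"
  have V: "0 < V" "V <= h" "y = - V" using z \<eta>d by (auto simp: xy \<eta>z V_def)
  note F = f[OF z(1)[unfolded xy], folded V_def, OF less_imp_le[OF V(1)] V(2)]
  note B = bounds[OF z(1)[unfolded xy], folded V_def, OF less_imp_le[OF V(1)] V(2)]
  consider "\<nu> = (1, \<theta>)" | "\<nu> = (- 1, - 1 / a)" using \<nu> by (auto simp: G_def)
  then show "\<nu> \<bullet> field 1 R z > 0"
  proof cases
   case 1
   have x: "x - 1 = \<theta> * V" using \<nu>(2) unfolding 1 xy e_def V_def by simp
   have "\<nu> \<bullet> field 1 R z = x * (V / a - (x - 1)) - \<theta> * V * (Q * (x - 1) - V)"
    unfolding 1 xy F by (simp add: V(3) algebra_simps)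
   also have "\<dots> = V * (x * (1 / a - \<theta>) - V * (\<theta> * (Q * \<theta> - 1)))"
    unfolding x by (simp add: algebra_simps)
   finally have eq: "\<nu> \<bullet> field 1 R z = V * (x * (1 / a - \<theta>) - V * (\<theta> * (Q * \<theta> - 1)))" .
   have "V * (\<theta> * (Q * \<theta> - 1)) <= h * (\<theta> * (Q * \<theta> - 1))" using V \<theta>0 Q\<theta> by (intro mult_right_mono) auto
   also have "\<dots> < 1 * (1 / a - \<theta>)" using h(3) by simp
   also have "\<dots> <= x * (1 / a - \<theta>)" using B \<theta> by (intro mult_right_mono) auto
   finally have "0 < x * (1 / a - \<theta>) - V * (\<theta> * (Q * \<theta> - 1))" by simp
   then show ?thesis using V(1) unfolding eq by (rule mult_pos_pos[rotated])
  next
   case 2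
   have x: "x - 1 = V / a" using \<nu>(2) unfolding 2 xy e_def V_def by simp
   have "\<nu> \<bullet> field 1 R z = x * ((x - 1) - V / a) + V * (Q * (x - 1) - V) / a"
    unfolding 2 xy F by (simp add: V(3) algebra_simps diff_divide_distrib add_divide_distrib)
   also have "\<dots> = V / a * (V * (Q / a - 1))" unfolding x by (simp add: algebra_simps diff_divide_distrib)
   also have "\<dots> > 0" using V a aQ by simp
   finally show ?thesis .
  qed
 next
  fix c :: real assume c: "c > 0"
  show "\<exists>\<mu>>0. \<forall>z\<in>Cn. c <= \<eta> \<bullet> (z - e) --> \<eta> \<bullet> (z - e) <= \<eta> \<bullet> d --> \<mu> <= \<eta> \<bullet> field 1 R z"
  proof (intro exI[of _ "c * (c * (Q * \<theta> - 1))"] conjI ballI impI)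
   show "c * (c * (Q * \<theta> - 1)) > 0" using c Q\<theta> by simp
   fix z assume z: "z \<in> Cn" "c <= \<eta> \<bullet> (z - e)" "\<eta> \<bullet> (z - e) <= \<eta> \<bullet> d"
   obtain x y where xy: "z = (x, y)" by (cases z)
   have Y: "c <= - y" "0 <= - y" "- y <= h" using z c by (auto simp: xy \<eta>z \<eta>d)
   have 1: "\<eta> \<bullet> field 1 R z = - y * (Q * (x - 1) + y)"
    unfolding xy f[OF z(1)[unfolded xy] Y(2,3)] by (simp add: \<eta>_def)
   have "Q * (\<theta> * (- y)) <= Q * (x - 1)"
    using z(1) Q0 unfolding xy Cn by (intro mult_left_mono) auto
   then have "- y * (Q * \<theta> - 1) <= Q * (x - 1) + y" by (simp add: algebra_simps)
   moreover have "c * (Q * \<theta> - 1) <= - y * (Q * \<theta> - 1)" using Y Q\<theta> by (intro mult_right_mono) auto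
   ultimately have "c * (Q * \<theta> - 1) <= Q * (x - 1) + y" by linarith
   then show "c * (c * (Q * \<theta> - 1)) <= \<eta> \<bullet> field 1 R z" unfolding 1
    using Y c Q\<theta> by (intro mult_mono) auto
  qed
 qed
 then obtain z where orb: "lvorbit 1 R z" and z: "\<eta> \<bullet> (z 0 - e) = h"
   "!!t. t <= 0 ==> z t \<in> Cn \<and> 0 <= \<eta> \<bullet> (z t - e) \<and> \<eta> \<bullet> (z t - e) <= h"
  unfolding \<eta>d by blast
 have "- 1 * snd (z 0) > 0" using z(1) h \<eta>z[of "fst (z 0)" "snd (z 0)"] by simp
 then have pos: "- 1 * snd (z t) > 0" for t by (rule lvorbit_y_sign[OF orb R0, rotated]) simp
 show ?thesis
 proof (intro exI[of _ z] conjI allI impI orb)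
  fix t :: real assume t: "t <= 0"
  show "snd (z t) < 0" using pos[of t] by simp
  have C: "(fst (z t), snd (z t)) \<in> Cn" "0 <= - snd (z t)" "- snd (z t) <= h"
   using z(2)[OF t] \<eta>z[of "fst (z t)" "snd (z t)"] by auto
  show "- 1 <= snd (z t)" "fst (z t) <= 2" using bounds[OF C] by auto
  show "- \<theta> * snd (z t) <= fst (z t) - 1" "fst (z t) - 1 <= - snd (z t) / a"
   using C(1) unfolding Cn by auto
 qed
qed

text \<open>The interior equilibrium; the coordinates \<open>\<delta> - x\<close> and \<open>y - a (1 - \<delta>)\<close> centre the field there.\<close>

definition \<delta> :: real where "\<delta> = (Q - a) / (q - a)"

lemma \<delta>_pos: "\<delta> > 0" using aq aQ by (simp add: \<delta>_def)

lemma \<delta>_eq: "\<delta> * (q - a) = Q - a" using aq by (simp add: \<delta>_def)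

lemma centred:
 "1 - x - y / a = (\<delta> - x) - (y - a * (1 - \<delta>)) / a"
 "- Q + q * x + y = (y - a * (1 - \<delta>)) - q * (\<delta> - x)"
proof -
 show "1 - x - y / a = (\<delta> - x) - (y - a * (1 - \<delta>)) / a" using a by (simp add: field_simps)
 show "- Q + q * x + y = (y - a * (1 - \<delta>)) - q * (\<delta> - x)"
  using \<delta>_eq by (simp add: algebra_simps)
qed

text \<open>For \<open>q < Q\<close> the interior equilibrium is a saddle whose unstable direction lies strictly between the two
 nullclines, which bound the cone.\<close>

lemma orbit_leaving_interior:
 assumes qQ: "q < Q" and R: "R >= \<delta> + a * (\<delta> - 1)"
 shows "\<exists>z. lvorbit 1 R z \<and> (\<forall>t\<le>0.
   a * (\<delta> - fst (z t)) <= snd (z t) - a * (1 - \<delta>) \<and> snd (z t) - a * (1 - \<delta>) <= q * (\<delta> - fst (z t))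
   \<and> fst (z t) <= \<delta> \<and> 1 < fst (z t) \<and> snd (z t) < a * (1 - \<delta>) / 2) \<and> fst (z 0) < \<delta>"
proof -
 have Q0: "Q > 0" "q > 0" using a aQ aq by auto
 have \<delta>1: "\<delta> > 1" using aq aQ qQ by (simp add: \<delta>_def)
 define m where "m = (a + q) / 2"
 have m: "a < m" "m < q" using aq by (auto simp: m_def)
 define vm where "vm = a * (\<delta> - 1)"
 have vm: "vm > 0" using \<delta>1 a by (simp add: vm_def)
 have yM: "a * (1 - \<delta>) = - vm" by (simp add: vm_def algebra_simps)
 define r where "r = vm / (4 * q)"
 have r: "r > 0" "q * r = vm / 4" using vm Q0 by (auto simp: r_def)
 have r1: "r < \<delta> - 1"
 proof -
  have "q * r < q * (\<delta> - 1)"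
  proof -
   have "vm < q * (\<delta> - 1)" unfolding vm_def using aq \<delta>1 by (intro mult_strict_right_mono) auto
   then show ?thesis using r vm by linarith
  qed
  then show ?thesis using Q0 by simp
 qed
 define \<xi> where "\<xi> = r * (1 + a) / (1 + m)"
 have \<xi>: "\<xi> > 0" "\<xi> * (1 + m) = r * (1 + a)" using r a m by (auto simp: \<xi>_def)
 have R0: "R > 0" using R vm \<delta>1 unfolding vm_def by linarith
 define e where "e = (\<delta>, a * (1 - \<delta>))"
 define d where "d = (- \<xi>, m * \<xi>)"
 define G where "G = {(a, 1), (- q, - 1::real)}"
 define \<eta> where "\<eta> = (- 1::real, 1::real)"
 define Cn where "Cn = {z. \<forall>\<nu>\<in>G. \<nu> \<bullet> (z - e) >= 0}"
 have \<eta>d: "\<eta> \<bullet> d = r * (1 + a)" unfolding \<xi>(2)[symmetric] by (simp add: \<eta>_def d_def algebra_simps)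
 have Cn: "(x, y) \<in> Cn \<longleftrightarrow> a * (\<delta> - x) <= y - a * (1 - \<delta>) \<and> y - a * (1 - \<delta>) <= q * (\<delta> - x)" for x y
  by (auto simp: Cn_def G_def e_def algebra_simps)
 have \<eta>z: "\<eta> \<bullet> ((x, y) - e) = (\<delta> - x) + (y - a * (1 - \<delta>))" for x y by (simp add: \<eta>_def e_def)
 have bounds: "0 <= u \<and> u <= r \<and> 1 < x \<and> x <= \<delta> \<and> 2 * y < - vm \<and> - vm <= y"
  if C: "(x, y) \<in> Cn" and h: "(\<delta> - x) + (y - a * (1 - \<delta>)) <= r * (1 + a)" and u: "u = \<delta> - x" for x y u
 proof -
  define w where "w = y - a * (1 - \<delta>)"
  have uw: "a * u <= w" "w <= q * u" using C unfolding Cn u w_def by auto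
  then have "0 <= (q - a) * u" by (simp add: algebra_simps)
  then have u0: "0 <= u" using aq by (simp add: zero_le_mult_iff)
  have "u * (1 + a) <= r * (1 + a)" using uw h unfolding w_def[symmetric] u[symmetric] by (simp add: algebra_simps)
  then have ur: "u <= r" using a by simp
  have "q * u <= q * r" using ur Q0 by simp
  then have "w <= vm / 4" using uw r by linarith
  moreover have "0 <= a * u" using a u0 by simp
  ultimately show ?thesis using u0 ur uw r1 vm unfolding w_def u yM by linarith
 qed
 have f: "field 1 R (x, y) = (x * ((\<delta> - x) - (y - a * (1 - \<delta>)) / a), y * ((y - a * (1 - \<delta>)) - q * (\<delta> - x)))"
  if "(x, y) \<in> Cn" "(\<delta> - x) + (y - a * (1 - \<delta>)) <= r * (1 + a)" for x y
 proof -
  have "\<bar>x\<bar> <= R" "\<bar>y\<bar> <= R" using bounds[OF that refl] R vm unfolding vm_def[symmetric] by linarith+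
  then show ?thesis unfolding centred[symmetric] by (simp add: field_in_box)
 qed
 have "\<exists>z. lvorbit 1 R z \<and> \<eta> \<bullet> (z 0 - e) = \<eta> \<bullet> d \<and>
  (\<forall>t\<le>0. z t \<in> Cn \<and> 0 <= \<eta> \<bullet> (z t - e) \<and> \<eta> \<bullet> (z t - e) <= \<eta> \<bullet> d)"
  unfolding Cn_def
 proof (rule lv_cone_orbit; (fold Cn_def)?)
  show "R > 0" "\<bar>1::real\<bar> = 1" using R0 by auto
  show "finite G" by (simp add: G_def)
  have "e \<in> Cn" by (simp add: Cn e_def)
  then show "field 1 R e = 0"
   using f[of \<delta> "a * (1 - \<delta>)"] r a by (simp add: e_def zero_prod_def)
  show "\<nu> \<bullet> d >= 0" if "\<nu> \<in> G" for \<nu>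
   using that \<xi> m by (auto simp: G_def d_def)
  show "\<eta> \<bullet> d > 0" using \<eta>d r a by simp
  show "{z \<in> Cn. 0 <= \<eta> \<bullet> (z - e) \<and> \<eta> \<bullet> (z - e) <= \<eta> \<bullet> d} \<subseteq> {- R..R} \<times> {- R..R}"
  proof
   fix z assume z: "z \<in> {z \<in> Cn. 0 <= \<eta> \<bullet> (z - e) \<and> \<eta> \<bullet> (z - e) <= \<eta> \<bullet> d}"
   then have "1 < fst z \<and> fst z <= \<delta> \<and> 2 * snd z < - vm \<and> - vm <= snd z"
    using bounds[of "fst z" "snd z", OF _ _ refl] \<eta>z[of "fst z" "snd z"] \<eta>d by auto
   then show "z \<in> {- R..R} \<times> {- R..R}" using R vm unfolding mem_Times_iff atLeastAtMost_iff vm_def[symmetric] by argo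
  qed
  fix z \<nu> assume z: "z \<in> Cn" "0 < \<eta> \<bullet> (z - e)" "\<eta> \<bullet> (z - e) <= \<eta> \<bullet> d" and \<nu>: "\<nu> \<in> G" "\<nu> \<bullet> (z - e) = 0"
  obtain x y where xy: "z = (x, y)" by (cases z)
  define u w where "u = \<delta> - x" and "w = y - a * (1 - \<delta>)"
  have h: "0 < u + w" "u + w <= r * (1 + a)" using z \<eta>d by (auto simp: xy \<eta>z u_def w_def)
  note F = f[OF z(1)[unfolded xy], folded u_def w_def, OF h(2)]
  note B = bounds[OF z(1)[unfolded xy], folded u_def w_def, OF h(2) refl]
  consider "\<nu> = (a, 1)" | "\<nu> = (- q, - 1)" using \<nu> by (auto simp: G_def)
  then show "\<nu> \<bullet> field 1 R z > 0"
  proof cases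
   case 1
   have w: "w = a * u" using \<nu>(2) unfolding 1 xy e_def u_def w_def by (simp add: algebra_simps)
   have "u > 0" using h B w by (cases "u = 0") auto
   have "\<nu> \<bullet> field 1 R z = a * (x * (u - w / a)) + y * (w - q * u)" unfolding 1 xy F by simp
   also have "\<dots> = - y * ((q - a) * u)" unfolding w using a by (simp add: algebra_simps)
   also have "\<dots> > 0" using \<open>u > 0\<close> B aq vm by (intro mult_pos_pos) auto
   finally show ?thesis .
  next
   case 2
   have w: "w = q * u" using \<nu>(2) unfolding 2 xy e_def u_def w_def by (simp add: algebra_simps)
   have "u > 0" using h B w by (cases "u = 0") auto
   have "\<nu> \<bullet> field 1 R z = - q * (x * (u - w / a)) - y * (w - q * u)" unfolding 2 xy F by simp
   also have "\<dots> = q * x * (u * (q / a - 1))" unfolding w by (simp add: algebra_simps)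
   also have "\<dots> > 0" using \<open>u > 0\<close> B aq a Q0 by (intro mult_pos_pos) auto
   finally show ?thesis .
  qed
 next
  fix c :: real assume c: "c > 0"
  define \<mu>0 where "\<mu>0 = min (1 / a) (vm / 2)"
  have \<mu>0: "\<mu>0 > 0" "\<mu>0 <= 1 / a" "\<mu>0 <= vm / 2" using a vm by (auto simp: \<mu>0_def)
  define \<mu> where "\<mu> = \<mu>0 * ((q - a) * (c / (1 + q)))"
  show "\<exists>\<mu>>0. \<forall>z\<in>Cn. c <= \<eta> \<bullet> (z - e) --> \<eta> \<bullet> (z - e) <= \<eta> \<bullet> d --> \<mu> <= \<eta> \<bullet> field 1 R z"
  proof (intro exI[of _ \<mu>] conjI ballI impI)
   show "\<mu> > 0" using c \<mu>0 aq Q0 by (simp add: \<mu>_def)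
   fix z assume z: "z \<in> Cn" "c <= \<eta> \<bullet> (z - e)" "\<eta> \<bullet> (z - e) <= \<eta> \<bullet> d"
   obtain x y where xy: "z = (x, y)" by (cases z)
   define u w where "u = \<delta> - x" and "w = y - a * (1 - \<delta>)"
   have h: "c <= u + w" "u + w <= r * (1 + a)" using z \<eta>d by (auto simp: xy \<eta>z u_def w_def)
   have uw: "a * u <= w" "w <= q * u" using z(1) unfolding xy Cn u_def w_def by auto
   note F = f[OF z(1)[unfolded xy], folded u_def w_def, OF h(2)]
   note B = bounds[OF z(1)[unfolded xy], folded u_def w_def, OF h(2) refl]
   have "c <= u * (1 + q)" using h(1) uw(2) by (simp add: algebra_simps)
   then have "c / (1 + q) <= u" using Q0 by (simp add: pos_divide_le_eq)
   then have "\<mu> <= \<mu>0 * ((q - a) * u)" unfolding \<mu>_def using \<mu>0 aq by (intro mult_left_mono) auto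
   also have "\<dots> = \<mu>0 * (w - a * u) + \<mu>0 * (q * u - w)" by (simp add: algebra_simps)
   also have "\<dots> <= x * (1 / a) * (w - a * u) + (- y) * (q * u - w)"
   proof (intro add_mono mult_right_mono)
    have "1 * (1 / a) <= x * (1 / a)" using B a by (intro mult_right_mono) auto
    then show "\<mu>0 <= x * (1 / a)" using \<mu>0 by linarith
    show "\<mu>0 <= - y" using \<mu>0 B by linarith
   qed (use uw in auto)
   also have "\<dots> = \<eta> \<bullet> field 1 R z" unfolding xy F using a by (simp add: \<eta>_def field_simps)
   finally show "\<mu> <= \<eta> \<bullet> field 1 R z" .
  qed
 qed
 then obtain z where orb: "lvorbit 1 R z" and z: "\<eta> \<bullet> (z 0 - e) = r * (1 + a)"
   "!!t. t <= 0 ==> z t \<in> Cn \<and> 0 <= \<eta> \<bullet> (z t - e) \<and> \<eta> \<bullet> (z t - e) <= r * (1 + a)"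
  unfolding \<eta>d by blast
 have B: "(fst (z t), snd (z t)) \<in> Cn \<and> 0 <= \<delta> - fst (z t) \<and> \<delta> - fst (z t) <= r \<and> 1 < fst (z t) \<and> fst (z t) <= \<delta>
   \<and> 2 * snd (z t) < - vm \<and> - vm <= snd (z t)" if "t <= 0" for t
  using bounds[of "fst (z t)" "snd (z t)", OF _ _ refl] z(2)[OF that] \<eta>z[of "fst (z t)" "snd (z t)"] by auto
 show ?thesis
 proof (intro exI[of _ z] conjI allI impI orb)
  fix t :: real assume t: "t <= 0"
  show "a * (\<delta> - fst (z t)) <= snd (z t) - a * (1 - \<delta>)" "snd (z t) - a * (1 - \<delta>) <= q * (\<delta> - fst (z t))"
   using B[OF t] unfolding Cn by auto
  show "fst (z t) <= \<delta>" "1 < fst (z t)" using B[OF t] by auto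
  show "snd (z t) < a * (1 - \<delta>) / 2" using B[OF t] unfolding yM by simp
 next
  have h: "(\<delta> - fst (z 0)) + (snd (z 0) - a * (1 - \<delta>)) = r * (1 + a)"
   using z(1) \<eta>z[of "fst (z 0)" "snd (z 0)"] by simp
  moreover have "snd (z 0) - a * (1 - \<delta>) <= q * (\<delta> - fst (z 0))" using B[of 0] unfolding Cn by simp
  ultimately have "r * (1 + a) <= (\<delta> - fst (z 0)) * (1 + q)" by (simp add: algebra_simps)
  moreover have "r * (1 + a) > 0" using r a by simp
  ultimately have "(\<delta> - fst (z 0)) * (1 + q) > 0" by linarith
  then show "fst (z 0) < \<delta>" using Q0 by (simp add: zero_less_mult_iff)
 qed
qed

lemma lvorbit_exists:
 assumes "R > 0" "\<bar>s\<bar> = 1" shows "\<exists>z. lvorbit s R z \<and> z 0 = p"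
proof -
 obtain L where L: "lipschitz_field (field s R) L" using field_lipschitz[OF assms] by blast
 show ?thesis using lipschitz_field.orbit_exists[OF L, of p] unfolding orbit_eq_lvorbit[OF L] .
qed

lemma lvorbit_unique:
 assumes "R > 0" "\<bar>s\<bar> = 1" "lvorbit s R u" "lvorbit s R v" "u r = v r"
 shows "u t = v t"
proof -
 obtain L where L: "lipschitz_field (field s R) L" using field_lipschitz[OF assms(1,2)] by blast
 show ?thesis
  using lipschitz_field.orbit_unique[OF L, unfolded orbit_eq_lvorbit[OF L], OF assms(3,4,5)] .
qed

lemma lvorbit_shift:
 assumes "R > 0" "\<bar>s\<bar> = 1" "lvorbit s R z" shows "lvorbit s R (%t. z (t + h))"
proof -
 obtain L where L: "lipschitz_field (field s R) L" using field_lipschitz[OF assms(1,2)] by blast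
 show ?thesis using lipschitz_field.orbit_shift[OF L, unfolded orbit_eq_lvorbit[OF L], OF assms(3)] .
qed

section \<open>The unstable curve of the equilibrium (1, 0)\<close>

text \<open>Inside the cone \<open>ln |y|\<close> grows at least at the rate \<open>(q - Q) / 2\<close>, which gives the exponential bound
 and, the cone being pointed, the convergence to its apex.\<close>

lemma curve_leaving_one_zero:
 assumes qQ: "Q < q" and \<epsilon>: "\<epsilon> = 1 \<or> \<epsilon> = - 1" and \<kappa>: "0 <= \<kappa>" "\<kappa> * (1 + q - Q) < 1 / a" and R: "R >= 2"
 shows "\<exists>z l c. l > 0 \<and> lvorbit 1 R z \<and> (\<forall>t\<le>0. lv (%t. fst (z t)) (%t. snd (z t)) t \<and> fst (z t) > 0
   \<and> 0 < \<epsilon> * snd (z t) \<and> \<epsilon> * snd (z t) <= c * exp (l * t) \<and> \<epsilon> * (1 - fst (z t) - \<kappa> * snd (z t)) >= 0)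
   \<and> (z \<longlongrightarrow> (1, 0)) at_bot"
proof -
 obtain z where orb: "lvorbit 1 R z" and z: "!!t. t <= 0 ==> 0 < \<epsilon> * snd (z t) \<and> \<bar>snd (z t)\<bar> <= 1
   \<and> \<epsilon> * (1 - fst (z t) - \<kappa> * snd (z t)) >= 0 \<and> \<epsilon> * (fst (z t) - 1 + snd (z t) / a) >= 0
   \<and> \<bar>fst (z t) - 1\<bar> <= 1 / 2 \<and> - Q + q * fst (z t) + snd (z t) >= (q - Q) / 2"
  using orbit_leaving_one_zero[OF assms] by auto
 define l where "l = (q - Q) / 2"
 have l: "l > 0" using qQ by (simp add: l_def)
 have box: "\<bar>fst (z t)\<bar> <= R" "\<bar>snd (z t)\<bar> <= R" "fst (z t) > 0" if "t <= 0" for t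
  using z[OF that] R by linarith+
 have "\<epsilon> * snd (z t) <= \<epsilon> * snd (z 0) * exp (l * (t - 0))" if t: "t <= 0" for t
 proof (rule exponential_growth_bound[OF _ _ _ t, where g="%t. - Q + q * fst (z t) + snd (z t)"])
  fix t :: real assume t: "t <= 0"
  show "((%t. \<epsilon> * snd (z t)) has_real_derivative \<epsilon> * snd (z t) * (- Q + q * fst (z t) + snd (z t))) (at t)"
   using DERIV_cmult[OF lvorbit_in_box(2)[OF orb box(1,2)[OF t]], of \<epsilon>] by (simp add: mult.assoc)
 qed (use z in \<open>auto simp: l_def\<close>)
 then have bnd: "\<epsilon> * snd (z t) <= \<epsilon> * snd (z 0) * exp (l * t)" if "t <= 0" for t
  using that by simp
 have e0: "((%t. \<epsilon> * snd (z 0) * exp (l * t)) \<longlongrightarrow> \<epsilon> * snd (z 0) * 0) at_bot"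
  by (intro tendsto_intros exp_decay_at_bot l)
 have y0: "((%t. snd (z t)) \<longlongrightarrow> 0) at_bot"
 proof (rule Lim_null_comparison[OF _ e0[simplified]])
  show "\<forall>\<^sub>F t in at_bot. norm (snd (z t)) <= \<epsilon> * snd (z 0) * exp (l * t)"
   using eventually_le_at_bot[of 0] by eventually_elim (use z bnd \<epsilon> in fastforce)
 qed
 have "((%t. fst (z t) - 1) \<longlongrightarrow> 0) at_bot"
 proof (rule Lim_null_comparison)
  show "((%t. \<bar>snd (z t)\<bar> / a) \<longlongrightarrow> 0) at_bot"
   using tendsto_divide[OF tendsto_rabs[OF y0] tendsto_const, of a] a by simp
  show "\<forall>\<^sub>F t in at_bot. norm (fst (z t) - 1) <= \<bar>snd (z t)\<bar> / a"
   using eventually_le_at_bot[of 0]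
  proof eventually_elim
   case (elim t)
   have "\<kappa> * (\<epsilon> * snd (z t)) >= 0" using z[OF elim] \<kappa> by simp
   then show ?case using z[OF elim] \<epsilon> by (auto simp: abs_if)
  qed
 qed
 then have x1: "((%t. fst (z t)) \<longlongrightarrow> 1) at_bot" by (simp add: LIM_zero_iff)
 have "((%t. (fst (z t), snd (z t))) \<longlongrightarrow> (1, 0)) at_bot" by (intro tendsto_Pair x1 y0)
 then have lim: "(z \<longlongrightarrow> (1, 0)) at_bot" by simp
 have "\<forall>t\<le>0. lv (%t. fst (z t)) (%t. snd (z t)) t \<and> fst (z t) > 0
   \<and> 0 < \<epsilon> * snd (z t) \<and> \<epsilon> * snd (z t) <= \<epsilon> * snd (z 0) * exp (l * t)
   \<and> \<epsilon> * (1 - fst (z t) - \<kappa> * snd (z t)) >= 0"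
  using z bnd box lvorbit_lv[OF orb box(1,2)] by simp
 with l orb lim show ?thesis by (intro exI[of _ z] exI[of _ l] exI[of _ "\<epsilon> * snd (z 0)"] conjI)
qed

theorem exists_curve_leaving_one_zero:
 assumes qQ: "Q < q" and \<epsilon>: "\<epsilon> = 1 \<or> \<epsilon> = - 1"
 shows "\<exists>x y l c. l > 0 \<and> (\<forall>t\<le>0. lv x y t \<and> x t > 0 \<and> 0 < \<epsilon> * y t \<and> \<epsilon> * y t <= c * exp (l * t))
   \<and> (x \<longlongrightarrow> 1) at_bot"
proof -
 have "0 * (1 + q - Q) < 1 / a" using a by simp
 from curve_leaving_one_zero[OF qQ \<epsilon> order_refl this order_refl]
 obtain z l c where z: "l > 0" "(\<forall>t\<le>0. lv (%t. fst (z t)) (%t. snd (z t)) t \<and> fst (z t) > 0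
   \<and> 0 < \<epsilon> * snd (z t) \<and> \<epsilon> * snd (z t) <= c * exp (l * t))" "(z \<longlongrightarrow> (1, 0)) at_bot" by blast
 have "((%t. fst (z t)) \<longlongrightarrow> 1) at_bot" using tendsto_fst[OF z(3)] by simp
 moreover have "\<forall>t\<le>0. lv (%t. fst (z t)) (%t. snd (z t)) t \<and> fst (z t) > 0
   \<and> 0 < \<epsilon> * snd (z t) \<and> \<epsilon> * snd (z t) <= c * exp (l * t)" using z(2) by simp
 ultimately show ?thesis using z(1)
  by (intro exI[of _ "%t. fst (z t)"] exI[of _ "%t. snd (z t)"] exI[of _ l] exI[of _ c] conjI)
qed

section \<open>The stable curve of the equilibrium (0, Q)\<close>

lemma curve_leaving_zero_Q:
 assumes \<epsilon>: "\<epsilon> = 1 \<or> \<epsilon> = - 1" and h0: "h0 > 0" and R: "R >= 2 * Q + 1"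
 shows "\<exists>z l c. l > 0 \<and> lvorbit (- 1) R z \<and> (\<forall>t\<le>0. \<bar>fst (z t)\<bar> <= R \<and> \<bar>snd (z t)\<bar> <= R \<and>
   0 < \<epsilon> * fst (z t) \<and> \<epsilon> * fst (z t) <= h0 \<and> \<epsilon> * fst (z t) <= c * exp (l * t)
   \<and> \<epsilon> * (Q - snd (z t)) >= 0 \<and> snd (z t) > 0) \<and> (z \<longlongrightarrow> (0, Q)) at_bot"
proof -
 obtain z l where l: "l > 0" and orb: "lvorbit (- 1) R z" and z: "!!t. t <= 0 ==>
   0 < \<epsilon> * fst (z t) \<and> \<bar>fst (z t)\<bar> <= h0 \<and> \<bar>fst (z t)\<bar> <= 1
   \<and> \<epsilon> * (Q - snd (z t)) >= 0 \<and> \<epsilon> * (snd (z t) - Q + q * fst (z t)) >= 0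
   \<and> \<bar>snd (z t)\<bar> <= 2 * Q \<and> snd (z t) > 0 \<and> fst (z t) - 1 + snd (z t) / a >= l"
  using orbit_leaving_zero_Q[OF assms] by blast
 have Q0: "Q > 0" "q > 0" using a aQ aq by auto
 have box: "\<bar>fst (z t)\<bar> <= R" "\<bar>snd (z t)\<bar> <= R" if "t <= 0" for t
  using z[OF that] R Q0 by linarith+
 have abs: "\<bar>fst (z t)\<bar> = \<epsilon> * fst (z t)" if "t <= 0" for t using z[OF that] \<epsilon> by auto
 have "\<epsilon> * fst (z t) <= \<epsilon> * fst (z 0) * exp (l * (t - 0))" if t: "t <= 0" for t
 proof (rule exponential_growth_bound[OF _ _ _ t, where g="%t. fst (z t) - 1 + snd (z t) / a"])
  fix t :: real assume t: "t <= 0"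
  show "((%t. \<epsilon> * fst (z t)) has_real_derivative \<epsilon> * fst (z t) * (fst (z t) - 1 + snd (z t) / a)) (at t)"
   using DERIV_cmult[OF lvorbit_in_box(1)[OF orb box[OF t]], of \<epsilon>] by (simp add: algebra_simps)
 qed (use z in auto)
 then have bnd: "\<epsilon> * fst (z t) <= \<epsilon> * fst (z 0) * exp (l * t)" if "t <= 0" for t
  using that by simp
 have e0: "((%t. \<epsilon> * fst (z 0) * exp (l * t)) \<longlongrightarrow> \<epsilon> * fst (z 0) * 0) at_bot"
  by (intro tendsto_intros exp_decay_at_bot l)
 have x0: "((%t. fst (z t)) \<longlongrightarrow> 0) at_bot"
 proof (rule Lim_null_comparison[OF _ e0[simplified]])
  show "\<forall>\<^sub>F t in at_bot. norm (fst (z t)) <= \<epsilon> * fst (z 0) * exp (l * t)"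
   using eventually_le_at_bot[of 0] by eventually_elim (use bnd abs in fastforce)
 qed
 have "((%t. snd (z t) - Q) \<longlongrightarrow> 0) at_bot"
 proof (rule Lim_null_comparison)
  show "((%t. q * \<bar>fst (z t)\<bar>) \<longlongrightarrow> 0) at_bot"
   using tendsto_mult[OF tendsto_const tendsto_rabs[OF x0], of q] by simp
  show "\<forall>\<^sub>F t in at_bot. norm (snd (z t) - Q) <= q * \<bar>fst (z t)\<bar>"
   using eventually_le_at_bot[of 0]
  proof eventually_elim
   case (elim t)
   show ?case using z[OF elim] \<epsilon> by (auto simp: abs_if)
  qed
 qed
 then have y1: "((%t. snd (z t)) \<longlongrightarrow> Q) at_bot" by (simp add: LIM_zero_iff)
 have "((%t. (fst (z t), snd (z t))) \<longlongrightarrow> (0, Q)) at_bot" by (intro tendsto_Pair x0 y1)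
 then have lim: "(z \<longlongrightarrow> (0, Q)) at_bot" by simp
 have "\<forall>t\<le>0. \<bar>fst (z t)\<bar> <= R \<and> \<bar>snd (z t)\<bar> <= R \<and> 0 < \<epsilon> * fst (z t) \<and> \<epsilon> * fst (z t) <= h0
   \<and> \<epsilon> * fst (z t) <= \<epsilon> * fst (z 0) * exp (l * t) \<and> \<epsilon> * (Q - snd (z t)) >= 0 \<and> snd (z t) > 0"
  using z box bnd abs by simp
 then show ?thesis using l orb lim by blast
qed

theorem exists_curve_entering_zero_Q:
 assumes \<epsilon>: "\<epsilon> = 1 \<or> \<epsilon> = - 1"
 shows "\<exists>x y l c. l > 0 \<and> (\<forall>t\<ge>0. lv x y t \<and> 0 < \<epsilon> * x t \<and> \<epsilon> * x t <= c * exp (- (l * t)) \<and> y t > 0)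
   \<and> (y \<longlongrightarrow> Q) at_top"
proof -
 obtain z l c where z: "l > 0" "lvorbit (- 1) (2 * Q + 1) z" "!!t. t <= 0 ==> \<bar>fst (z t)\<bar> <= 2 * Q + 1 \<and> \<bar>snd (z t)\<bar> <= 2 * Q + 1 \<and>
   0 < \<epsilon> * fst (z t) \<and> \<epsilon> * fst (z t) <= 1 \<and> \<epsilon> * fst (z t) <= c * exp (l * t)
   \<and> \<epsilon> * (Q - snd (z t)) >= 0 \<and> snd (z t) > 0" "(z \<longlongrightarrow> (0, Q)) at_bot"
  using curve_leaving_zero_Q[OF \<epsilon> zero_less_one order_refl] by blast
 have yQ: "((%t. snd (z (- t))) \<longlongrightarrow> Q) at_top"
  using tendsto_snd[OF z(4)] unfolding filterlim_at_bot_mirror by simp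
 have "lv (%t. fst (z (- t))) (%t. snd (z (- t))) t \<and> 0 < \<epsilon> * fst (z (- t))
   \<and> \<epsilon> * fst (z (- t)) <= c * exp (- (l * t)) \<and> snd (z (- t)) > 0" if "t >= 0" for t
 proof -
  have "\<bar>fst (z (- t))\<bar> <= 2 * Q + 1" "\<bar>snd (z (- t))\<bar> <= 2 * Q + 1" using z(3)[of "- t"] that by auto
  from lvorbit_lv_reversed[OF z(2) this] show ?thesis using z(3)[of "- t"] that by simp
 qed
 then have "\<forall>t\<ge>0. lv (%t. fst (z (- t))) (%t. snd (z (- t))) t \<and> 0 < \<epsilon> * fst (z (- t))
   \<and> \<epsilon> * fst (z (- t)) <= c * exp (- (l * t)) \<and> snd (z (- t)) > 0" by simp
 with yQ show ?thesis using z(1)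
  by (intro exI[of _ "%t. fst (z (- t))"] exI[of _ "%t. snd (z (- t))"] exI[of _ l] exI[of _ c] conjI)
qed

section \<open>The invariant triangle and a Lyapunov function\<close>

text \<open>The line through \<open>(1, 0)\<close> and \<open>(0, sob)\<close> is the image of the zero set of the Pohozaev function; it
 is crossed in one direction only, which depends on the sign of \<open>Q - sob\<close>.\<close>

definition sob :: real where "sob = a * (q + 1) / (a + 1)"

definition triangle :: "(real \<times> real) set" where
 "triangle = {z. 0 <= fst z \<and> 0 <= snd z \<and> fst z + snd z / sob <= 1}"

lemma sob_gt: "a < sob"
 using a aq by (simp add: sob_def field_simps)

lemma sob_eq: "(q + 1) / sob = 1 + 1 / a"
proof -
 have p: "q + 1 ~= 0" "a + 1 ~= 0" using a aq by auto
 have "(q + 1) / sob = (a + 1) / a" using p a by (simp add: sob_def)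
 then show ?thesis using a by (simp add: add_divide_distrib)
qed

lemma triangle_bounds: "z \<in> triangle ==> 0 <= fst z \<and> fst z <= 1 \<and> 0 <= snd z \<and> snd z <= sob"
proof -
 assume z: "z \<in> triangle"
 have s: "sob > 0" using sob_gt a by simp
 then have "snd z / sob >= 0" using z by (simp add: triangle_def)
 then have "fst z <= 1" "snd z / sob <= 1" using z unfolding triangle_def by auto
 then show ?thesis using z s by (simp add: triangle_def)
qed

lemma triangle_compact: "compact triangle"
proof -
 have "triangle = {z. 0 <= fst z} \<inter> ({z. 0 <= snd z} \<inter> {z. fst z + snd z / sob <= 1})"
  by (auto simp: triangle_def)
 moreover have "sob ~= 0" using sob_gt a by simp
 ultimately have "closed triangle"
  by (auto intro!: closed_Int closed_Collect_le continuous_intros)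
 moreover have "triangle \<subseteq> {0..1} \<times> {0..sob}" using triangle_bounds by (auto simp: mem_Times_iff)
 then have "bounded triangle" by (rule bounded_subset[OF bounded_Times, rotated 2]) auto
 ultimately show ?thesis by (simp add: compact_eq_bounded_closed)
qed

text \<open>The derivative of \<open>lam = 1 - x - y / sob\<close> along an orbit; \<open>lam\<close> vanishes on the Pohozaev line.\<close>

lemma lam_derivative:
 "- (x * (1 - x - y / a)) - y * (- Q + q * x + y) / sob
  = (1 - x - y / sob) * (y - x) + y * (Q / sob - 1)"
proof -
 have s: "sob > 0" using sob_gt a by simp
 have "(1 - x - y / sob) * (y - x) + y * (Q / sob - 1) + x * (1 - x - y / a) + y * (- Q + q * x + y) / sob
   = x * y * ((q + 1) / sob - (1 + 1 / a))"
  using s a by (simp add: field_simps)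
 also have "\<dots> = 0" unfolding sob_eq by simp
 finally show ?thesis by linarith
qed

text \<open>On the hypotenuse \<open>lam_derivative\<close> leaves only the term \<open>y (Q / sob - 1)\<close>, whose sign is that of \<open>Q - sob\<close>; the axes consist
 of orbits. For \<open>s = - 1\<close> the triangle is invariant backwards in time.\<close>

lemma triangle_invariant:
 assumes orb: "lvorbit s R z" and R: "R >= 1" "R >= sob" and s: "\<bar>s\<bar> = 1" "s * (Q - sob) > 0"
  and z0: "z 0 \<in> triangle" "fst (z 0) > 0" "snd (z 0) > 0" and t: "t >= 0"
 shows "z t \<in> triangle"
proof -
 have sb: "sob > 0" using sob_gt a by simp
 have R0: "R > 0" using R by simp
 have x: "fst (z t) > 0" for t using lvorbit_x_sign[OF orb R0 s(1), of 1] z0 by simp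
 have y: "snd (z t) > 0" for t using lvorbit_y_sign[OF orb R0 s(1), of 1] z0 by simp
 define g where "g = (%t. 1 - fst (z t) - snd (z t) / sob)"
 have tri: "z t \<in> triangle \<longleftrightarrow> g t >= 0" for t
  using x[of t] y[of t] by (auto simp: triangle_def g_def)
 have gd: "(g has_real_derivative - fst (field s R (z t)) - snd (field s R (z t)) / sob) (at t)" for t
  unfolding g_def
  by (rule derivative_eq_intros lvorbit_components[OF orb] refl | use sb in simp)+
 have "h t >= 0" if "h \<in> {g}" for h
 proof (rule trapping[of "{g}" t t h])
  fix r h assume r: "0 <= r" "r < t" "\<forall>h\<in>{g}. h r >= 0" "h \<in> {g}" "h r = 0"
  then have "z r \<in> triangle" using tri by simp
  then have "\<bar>fst (z r)\<bar> <= R" "\<bar>snd (z r)\<bar> <= R" using triangle_bounds[of "z r"] R by linarith+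
  then have f: "field s R (z r) = (s * (fst (z r) * (1 - fst (z r) - snd (z r) / a)),
    s * (snd (z r) * (- Q + q * fst (z r) + snd (z r))))"
   using field_in_box[of "fst (z r)" R "snd (z r)" s] by simp
  have "- fst (field s R (z r)) - snd (field s R (z r)) / sob
    = s * (- (fst (z r) * (1 - fst (z r) - snd (z r) / a)) - snd (z r) * (- Q + q * fst (z r) + snd (z r)) / sob)"
   unfolding f by (simp add: right_diff_distrib)
  also have "\<dots> = s * (g r * (snd (z r) - fst (z r)) + snd (z r) * (Q / sob - 1))"
   unfolding lam_derivative g_def ..
  also have "\<dots> = s * (Q - sob) * (snd (z r) / sob)" using r sb by (simp add: field_simps)
  also have "\<dots> > 0" using s y[of r] sb by simp
  finally show "\<exists>D>0. (h has_real_derivative D) (at r)" using gd r by blast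
 qed (use t z0 tri DERIV_isCont[OF gd] that in auto)
 then show ?thesis using tri by simp
qed

text \<open>The trace of the linearisation at the interior equilibrium, which therefore changes stability at the Sobolev
 exponent.\<close>

definition trace :: real where "trace = a - (a + 1) * \<delta>"

lemma trace_sign: "s * (Q - sob) > 0 \<longleftrightarrow> s * trace < 0"
proof -
 have "trace * (q - a) = a * (q - a) - (a + 1) * (\<delta> * (q - a))" by (simp add: trace_def algebra_simps)
 also have "\<dots> = (a + 1) * (sob - Q)" unfolding \<delta>_eq using a by (simp add: sob_def field_simps)
 finally have "s * (trace * (q - a)) = s * ((a + 1) * (sob - Q))" by simp
 then have "s * trace * (q - a) = (a + 1) * - (s * (Q - sob))" by (simp add: algebra_simps)
 moreover have "s * trace < 0 \<longleftrightarrow> s * trace * (q - a) < 0" using aq by (simp add: mult_less_0_iff)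
 moreover have "(a + 1) * - (s * (Q - sob)) < 0 \<longleftrightarrow> - (s * (Q - sob)) < 0"
  using a by (subst mult_less_0_iff) auto
 ultimately show ?thesis by simp
qed

definition weight :: "real \<times> real => real" where
 "weight z = (fst z powr a * snd z) powr ((a + 1) / (q - a))"

definition bracket :: "real \<times> real => real" where
 "bracket z = a / (a + 1) * fst z powr (a + 1) - \<delta> * fst z powr a + fst z powr a * snd z / (q + 1)
   - trace * \<delta> powr a / (a + 1)"

text \<open>The factor \<open>weight\<close> is the power of \<open>x\<^sup>a y\<close> to which \<open>V\<^sup>a\<^sup>+\<^sup>1\<close> is equal up to an exponential factor in \<open>t\<close>. The bracket is chosen such that the
 derivative along orbits is \<open>trace\<close> times a nonnegative function that in the open quadrant vanishes only for \<open>x = \<delta>\<close>, and such that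
 the product vanishes on the axes, hence at \<open>(1, 0)\<close> and \<open>(0, Q)\<close>.\<close>

definition lyap :: "real \<times> real => real" where
 "lyap z = weight z * bracket z"

lemma lyap_continuous: "continuous_on triangle lyap"
proof -
 have pos: "0 <= fst z" "0 <= snd z" if "z \<in> triangle" for z using that by (auto simp: triangle_def)
 have e: "(a + 1) / (q - a) > 0" using a aq by simp
 have P: "continuous_on triangle (%z. fst z powr b)" if "b > 0" for b
  by (rule continuous_on_powr'[OF continuous_on_fst[OF continuous_on_id] continuous_on_const]) (use pos that in auto)
 have Py: "continuous_on triangle (%z. fst z powr a * snd z)"
  by (intro continuous_on_mult P a continuous_on_snd continuous_on_id)
 have w: "continuous_on triangle (%z. (fst z powr a * snd z) powr ((a + 1) / (q - a)))"
  by (rule continuous_on_powr'[OF Py continuous_on_const]) (use pos e in auto)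
 have "a + 1 > 0" using a by simp
 then show ?thesis unfolding lyap_def weight_def bracket_def
  using a aq by (intro continuous_on_mult continuous_on_diff continuous_on_add continuous_on_divide
    continuous_on_const continuous_on_snd continuous_on_id P w) auto
qed

lemma lyap_derivative:
 assumes x: "(x has_real_derivative s * (x t * (1 - x t - y t / a))) (at t)"
  and y: "(y has_real_derivative s * (y t * (- Q + q * x t + y t))) (at t)"
  and pos: "x t > 0" "y t > 0"
 shows "((%t. lyap (x t, y t)) has_real_derivative
   s * trace * (weight (x t, y t) * ((x t - \<delta>) * (x t powr a - \<delta> powr a)))) (at t)"
proof -
 define X Y where "X = s * (1 - x t - y t / a)" and "Y = s * (- Q + q * x t + y t)"
 have dx: "(x has_real_derivative x t * X) (at t)" using x by (simp add: X_def algebra_simps)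
 have dy: "(y has_real_derivative y t * Y) (at t)" using y by (simp add: Y_def algebra_simps)
 define m where "m = (a + 1) / (q - a)"
 have XY: "a * X + Y = s * ((q - a) * (x t - \<delta>))"
 proof -
  have "a * X + Y = s * (a * (1 - x t - y t / a) + (- Q + q * x t + y t))"
   by (simp add: X_def Y_def algebra_simps)
  also have "a * (1 - x t - y t / a) + (- Q + q * x t + y t) = (q - a) * (x t - \<delta>)"
   using a \<delta>_eq by (simp add: algebra_simps)
  finally show ?thesis .
 qed
 define P where "P = x t powr a"
 have P: "P > 0" using pos by (simp add: P_def)
 have dP: "((%t. x t powr a) has_real_derivative P * (a * X)) (at t)"
  by (rule DERIV_cong[OF DERIV_powr[OF dx pos(1) DERIV_const]]) (use pos in \<open>simp add: P_def\<close>)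
 have P1: "x t powr (a + 1) = P * x t" using pos by (simp add: P_def powr_add)
 have dP1: "((%t. x t powr (a + 1)) has_real_derivative P * x t * ((a + 1) * X)) (at t)"
  by (rule DERIV_cong[OF DERIV_powr[OF dx pos(1) DERIV_const]]) (use pos in \<open>simp add: P1\<close>)
 have dPy: "((%t. x t powr a * y t) has_real_derivative P * y t * (a * X + Y)) (at t)"
  by (rule derivative_eq_intros dP dy refl | simp add: P_def algebra_simps)+
 define w where "w = weight (x t, y t)"
 have Py: "x t powr a * y t > 0" using pos by simp
 have dw: "((%t. weight (x t, y t)) has_real_derivative w * (m * (a * X + Y))) (at t)"
  unfolding weight_def w_def m_def[symmetric] fst_conv snd_conv
  by (rule DERIV_cong[OF DERIV_powr[OF dPy Py DERIV_const]]) (use pos P in \<open>simp add: P_def\<close>)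
 have db: "((%t. bracket (x t, y t)) has_real_derivative
   a * P * x t * X - \<delta> * (P * (a * X)) + P * y t * (a * X + Y) / (q + 1)) (at t)"
  unfolding bracket_def fst_conv snd_conv
 proof (rule DERIV_cong[OF DERIV_diff[OF DERIV_add[OF DERIV_diff[OF DERIV_cmult[OF dP1] DERIV_cmult[OF dP]]
     DERIV_cdivide[OF dPy]] DERIV_const]])
  have "a / (a + 1) * (P * x t * ((a + 1) * X)) = a * P * x t * X" using a by simp
  then show "a / (a + 1) * (P * x t * ((a + 1) * X)) - \<delta> * (P * (a * X)) + P * y t * (a * X + Y) / (q + 1) - 0
    = a * P * x t * X - \<delta> * (P * (a * X)) + P * y t * (a * X + Y) / (q + 1)" by simp
 qed
 have "((%t. lyap (x t, y t)) has_real_derivative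
   w * (m * (a * X + Y)) * bracket (x t, y t)
   + (a * P * x t * X - \<delta> * (P * (a * X)) + P * y t * (a * X + Y) / (q + 1)) * w) (at t)"
  unfolding lyap_def w_def using DERIV_mult[OF dw db] by (simp add: w_def)
 moreover have "w * (m * (a * X + Y)) * bracket (x t, y t)
   + (a * P * x t * X - \<delta> * (P * (a * X)) + P * y t * (a * X + Y) / (q + 1)) * w
   = s * trace * (w * ((x t - \<delta>) * (P - \<delta> powr a)))"
 proof -
  define D where "D = x t - \<delta>"
  have mXY: "m * (a * X + Y) = s * ((a + 1) * D)"
   unfolding XY m_def D_def using aq by (simp add: field_simps)
  have b: "(a + 1) * bracket (x t, y t) = a * (P * x t) - (a + 1) * \<delta> * P + (a + 1) * (P * y t) / (q + 1) - trace * \<delta> powr a"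
  proof -
   have "A * (a / A * T1 - T2 + T3 / B - T4 / A) = a * T1 - A * T2 + A * T3 / B - T4" if "A ~= 0" for A B T1 T2 T3 T4 :: real
    using that by (simp add: algebra_simps)
   from this[of "a + 1"] a show ?thesis
    unfolding bracket_def fst_conv snd_conv P1 P_def[symmetric] by (simp add: mult.assoc)
  qed
  have q1: "q + 1 > 0" using a aq by simp
  have "w * (m * (a * X + Y)) * bracket (x t, y t)
   + (a * P * x t * X - \<delta> * (P * (a * X)) + P * y t * (a * X + Y) / (q + 1)) * w
   = w * s * D * ((a + 1) * bracket (x t, y t)) + w * (a * P * X * D + P * y t * (s * ((q - a) * D)) / (q + 1))"
   unfolding mXY unfolding XY D_def[symmetric] by (simp add: algebra_simps D_def)
  also have "\<dots> = w * s * D * ((a + 1) * bracket (x t, y t) + a * P * (1 - x t - y t / a) + P * y t * (q - a) / (q + 1))"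
   unfolding X_def by (simp add: algebra_simps)
  also have "(a + 1) * bracket (x t, y t) + a * P * (1 - x t - y t / a) + P * y t * (q - a) / (q + 1)
    = trace * (P - \<delta> powr a) + P * y t * ((a + 1) / (q + 1) + (q - a) / (q + 1) - 1)"
   unfolding b trace_def using a by (simp add: algebra_simps add_divide_distrib diff_divide_distrib)
  also have "(a + 1) / (q + 1) + (q - a) / (q + 1) - 1 = 0"
   using q1 by (simp flip: add_divide_distrib)
  finally show ?thesis by (simp add: D_def mult_ac)
 qed
 ultimately show ?thesis by (simp add: w_def P_def)
qed

lemma powr_diff_sign: "x > 0 ==> (x - \<delta>) * (x powr a - \<delta> powr a) >= 0 \<and> (x ~= \<delta> --> (x - \<delta>) * (x powr a - \<delta> powr a) > 0)"
 using \<delta>_pos a powr_less_mono2[of a x \<delta>] powr_less_mono2[of a \<delta> x]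
 by (cases x \<delta> rule: linorder_cases) (auto intro: mult_neg_neg mult_nonpos_nonpos)

text \<open>An orbit inside the triangle that comes from a point other than \<open>M = (\<delta>, a (1 - \<delta>))\<close> where the Lyapunov
 function vanishes must go to \<open>M\<close>: the function becomes negative, and it is only stationary at
 \<open>M\<close> or on the axes, where it vanishes.\<close>

lemma triangle_convergence:
 assumes orb: "lvorbit s R z" and R: "R >= 1" "R >= sob" and s: "\<bar>s\<bar> = 1" "s * (Q - sob) > 0"
  and tri: "!!t. z t \<in> triangle" and pos: "!!t. fst (z t) > 0" "!!t. snd (z t) > 0"
  and z0: "(z \<longlongrightarrow> p) at_bot" "p \<in> triangle" "lyap p = 0" "fst p ~= \<delta>"
 shows "(z \<longlongrightarrow> (\<delta>, a * (1 - \<delta>))) at_top"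
proof -
 have st: "s * trace < 0" using s trace_sign by simp
 have R0: "R > 0" using R by simp
 have box: "\<bar>fst w\<bar> <= R" "\<bar>snd w\<bar> <= R" if "w \<in> triangle" for w
  using triangle_bounds[OF that] R by linarith+
 have wpos: "weight w > 0" if "fst w > 0" "snd w > 0" for w using that by (simp add: weight_def)
 have der: "((%t. lyap (u t)) has_real_derivative
   s * trace * (weight (u t) * ((fst (u t) - \<delta>) * (fst (u t) powr a - \<delta> powr a)))) (at t)"
  if "lvorbit s R u" "u t \<in> triangle" "fst (u t) > 0" "snd (u t) > 0" for u t
  using lyap_derivative[OF lvorbit_in_box[OF that(1) box[OF that(2)]]] that by simp
 define D where "D = (%t. s * trace * (weight (z t) * ((fst (z t) - \<delta>) * (fst (z t) powr a - \<delta> powr a))))"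
 have zd: "((%t. lyap (z t)) has_real_derivative D t) (at t)" for t
  unfolding D_def by (rule der[OF orb tri pos])
 have D: "D t <= 0" "fst (z t) ~= \<delta> ==> D t < 0" for t
 proof -
  note p = powr_diff_sign[OF pos(1)[of t]]
  have w: "weight (z t) > 0" by (rule wpos[OF pos])
  show "D t <= 0" unfolding D_def
   by (rule mult_nonpos_nonneg[OF less_imp_le[OF st] mult_nonneg_nonneg[OF less_imp_le[OF w]]]) (use p in blast)
  show "D t < 0" if "fst (z t) ~= \<delta>" unfolding D_def
   by (rule mult_neg_pos[OF st mult_pos_pos[OF w]]) (use p that in blast)
 qed
 have dec: "lyap (z t) <= lyap (z r)" if "r <= t" for r t
  by (rule DERIV_nonpos_imp_nonincreasing[OF that]) (use zd D in blast)
 have lim0: "((%t. lyap (z t)) \<longlongrightarrow> 0) at_bot"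
  using continuous_on_tendsto_compose[OF lyap_continuous z0(1,2)] tri z0(3) by simp
 have le0: "lyap (z t) <= 0" for t
 proof (rule tendsto_lowerbound[OF lim0])
  show "\<forall>\<^sub>F r in at_bot. lyap (z t) <= lyap (z r)"
   using eventually_le_at_bot[of t] by eventually_elim (rule dec)
 qed simp
 have "\<exists>t. lyap (z t) < 0"
 proof (rule ccontr)
  assume "\<not> ?thesis"
  then have 0: "lyap (z t) = 0" for t using le0[of t] by (metis antisym_conv2)
  have "D t = 0" for t
   using DERIV_unique[OF zd[of t]] 0 by auto
  then have "fst (z t) = \<delta>" for t using D(2)[of t] by force
  then have "((%t. fst (z t)) \<longlongrightarrow> \<delta>) at_bot" by simp
  moreover have "((%t. fst (z t)) \<longlongrightarrow> fst p) at_bot" using z0(1) by (rule tendsto_fst)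
  ultimately have "fst p = \<delta>" by (intro tendsto_unique[of at_bot]) auto
  then show False using z0(4) by simp
 qed
 then obtain t1 where t1: "lyap (z t1) < 0" by blast
 have "bounded (lyap ` triangle)"
  by (intro compact_imp_bounded compact_continuous_image lyap_continuous triangle_compact)
 then obtain B where B: "!!w. w \<in> triangle ==> \<bar>lyap w\<bar> <= B" by (auto simp: bounded_iff)
 define c where "c = (INF t. lyap (z t))"
 have bdd: "bdd_below (range (%t. lyap (z t)))"
  using B[OF tri] by (intro bdd_belowI[of _ "- B"]) (auto simp: abs_le_iff minus_le_iff)
 have c: "c < 0" using cINF_lower[OF bdd, of t1] t1 by (simp add: c_def)
 have lim: "((%t. lyap (z t)) \<longlongrightarrow> c) at_top"
 proof (rule order_tendstoI)
  fix b assume "b < c"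
  then show "\<forall>\<^sub>F t in at_top. b < lyap (z t)"
   using cINF_lower[OF bdd] unfolding c_def[symmetric] by (auto intro!: always_eventually intro: less_le_trans)
 next
  fix b assume "c < b"
  then obtain r where r: "lyap (z r) < b" unfolding c_def using cINF_less_iff[OF _ bdd] by auto
  show "\<forall>\<^sub>F t in at_top. lyap (z t) < b"
   using eventually_ge_at_top[of r] by eventually_elim (use dec r in \<open>auto intro: le_less_trans\<close>)
 qed
 obtain L where "lipschitz_field (field s R) L" using field_lipschitz[OF R0 s(1)] by auto
 then interpret lf: lipschitz_field "field s R" L .
 have orb': "lf.orbit = lvorbit s R" by (rule orbit_eq_lvorbit[OF lf.lipschitz_field_axioms])
 show ?thesis
 proof (rule lf.lasalle_convergence[OF _ triangle_compact tri lyap_continuous lim, unfolded orb', OF orb])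
  fix u assume u: "lvorbit s R u" "!!t. u t \<in> triangle" "!!t. lyap (u t) = c"
  have upos: "fst (u t) > 0" "snd (u t) > 0" for t
  proof -
   have "fst (u t) ~= 0" "snd (u t) ~= 0" using u(3)[of t] c by (auto simp: lyap_def weight_def)
   then show "fst (u t) > 0" "snd (u t) > 0" using triangle_bounds[OF u(2)[of t]] by auto
  qed
  have "s * trace * (weight (u t) * ((fst (u t) - \<delta>) * (fst (u t) powr a - \<delta> powr a))) = 0" for t
   using der[OF u(1,2) upos, of t] DERIV_unique[OF _ DERIV_const, of c _ t] unfolding u(3) by blast
  then have x: "fst (u t) = \<delta>" for t
   using st wpos[OF upos, of t] powr_diff_sign[OF upos(1), of t] by (metis mult_eq_0_iff less_irrefl)
  have "s * (fst (u 0) * (1 - fst (u 0) - snd (u 0) / a)) = 0"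
   using DERIV_unique[OF lvorbit_in_box(1)[OF u(1) box[OF u(2)]], of 0 0] x by simp
  then have "1 - \<delta> - snd (u 0) / a = 0" using s x[of 0] \<delta>_pos by auto
  then have "snd (u 0) = a * (1 - \<delta>)" using a by (simp add: field_simps)
  then show "u 0 = (\<delta>, a * (1 - \<delta>))" using x by (simp add: prod_eq_iff)
 qed
qed

text \<open>The slope \<open>\<kappa> = 1 / sob\<close> of the Pohozaev line is admissible exactly because \<open>sob < Q\<close>: the unstable curve of
 \<open>(1, 0)\<close> starts inside the triangle and stays there.\<close>

theorem exists_connection_one_zero_interior:
 assumes qQ: "Q < q" and sub: "sob < Q"
 shows "\<exists>x y l c. l > 0 \<and> (\<forall>t. lv x y t \<and> x t > 0 \<and> y t > 0) \<and> (\<forall>t\<le>0. y t <= c * exp (l * t))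
   \<and> (x \<longlongrightarrow> 1) at_bot \<and> (x \<longlongrightarrow> \<delta>) at_top \<and> (y \<longlongrightarrow> a * (1 - \<delta>)) at_top"
proof -
 define R where "R = 2 + sob"
 have sb: "sob > 0" using sob_gt a by simp
 have R: "R >= 2" "R >= 1" "R >= sob" "R > 0" using sb by (auto simp: R_def)
 have "1 / sob * (1 + q - Q) < 1 / a"
 proof -
  have "1 / sob * (1 + q - Q) = (q + 1) / sob - Q / sob" by (simp add: diff_divide_distrib add_divide_distrib)
  also have "\<dots> < 1 + 1 / a - 1" unfolding sob_eq using sub sb by simp
  finally show ?thesis by simp
 qed
 from curve_leaving_one_zero[OF qQ _ _ this R(1), of 1] sb
 obtain z l c where z: "l > 0" "lvorbit 1 R z" "!!t. t <= 0 ==> fst (z t) > 0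
   \<and> 0 < snd (z t) \<and> snd (z t) <= c * exp (l * t) \<and> 1 - fst (z t) - 1 / sob * snd (z t) >= 0"
   "(z \<longlongrightarrow> (1, 0)) at_bot" by auto
 have pos: "fst (z t) > 0" "snd (z t) > 0" for t
  using lvorbit_x_sign[OF z(2) R(4), of 1 0 t] lvorbit_y_sign[OF z(2) R(4), of 1 0 t] z(3)[of 0] by auto
 have neg: "z t \<in> triangle" if "t <= 0" for t using z(3)[OF that] by (simp add: triangle_def)
 have tri: "z t \<in> triangle" for t
  using neg[of t] triangle_invariant[OF z(2) R(2,3), of t] neg[of 0] pos sub by (cases "t <= 0") auto
 have box: "\<bar>fst (z t)\<bar> <= R" "\<bar>snd (z t)\<bar> <= R" for t
  using triangle_bounds[OF tri[of t]] R by linarith+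
 have \<delta>1: "\<delta> ~= 1" using aq qQ by (auto simp: \<delta>_def)
 have lim: "(z \<longlongrightarrow> (\<delta>, a * (1 - \<delta>))) at_top"
  by (rule triangle_convergence[OF z(2) R(2,3) _ _ tri pos z(4)])
    (use sub \<delta>1 sb in \<open>auto simp: triangle_def lyap_def weight_def\<close>)
 show ?thesis
  using z(1,3) pos lvorbit_lv[OF z(2) box] tendsto_fst[OF z(4)] tendsto_fst[OF lim] tendsto_snd[OF lim]
  by (intro exI[of _ "%t. fst (z t)"] exI[of _ "%t. snd (z t)"] exI[of _ l] exI[of _ c]) auto
qed

text \<open>The mirror image with time reversed: \<open>(0, Q)\<close> lies in the triangle because \<open>Q < sob\<close>, and the triangle is
 invariant backwards.\<close>

theorem exists_connection_interior_zero_Q: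
 assumes qQ: "Q < q" and sup: "Q < sob"
 shows "\<exists>x y l c. l > 0 \<and> (\<forall>t. lv x y t \<and> x t > 0 \<and> y t > 0) \<and> (\<forall>t\<ge>0. x t <= c * exp (- (l * t)))
   \<and> (y \<longlongrightarrow> Q) at_top \<and> (x \<longlongrightarrow> \<delta>) at_bot \<and> (y \<longlongrightarrow> a * (1 - \<delta>)) at_bot"
proof -
 define R where "R = 2 * Q + 1 + sob"
 have sb: "sob > 0" "Q > 0" using sob_gt a aQ by auto
 have R: "R >= 2 * Q + 1" "R >= 1" "R >= sob" "R > 0" using sb by (auto simp: R_def)
 have "1 - Q / sob > 0" using sup sb by simp
 from curve_leaving_zero_Q[OF _ this R(1), of 1]
 obtain z l c where z: "l > 0" "lvorbit (- 1) R z" "!!t. t <= 0 ==> 0 < fst (z t) \<and> fst (z t) <= 1 - Q / sob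
   \<and> fst (z t) <= c * exp (l * t) \<and> snd (z t) <= Q \<and> snd (z t) > 0"
   "(z \<longlongrightarrow> (0, Q)) at_bot" by auto
 have pos: "fst (z t) > 0" "snd (z t) > 0" for t
  using lvorbit_x_sign[OF z(2) R(4), of 1 0 t] lvorbit_y_sign[OF z(2) R(4), of 1 0 t] z(3)[of 0] by auto
 have neg: "z t \<in> triangle" if "t <= 0" for t
  using z(3)[OF that] divide_right_mono[of "snd (z t)" Q sob] sb by (simp add: triangle_def)
 have tri: "z t \<in> triangle" for t
  using neg[of t] triangle_invariant[OF z(2) R(2,3), of t] neg[of 0] pos sup by (cases "t <= 0") auto
 have box: "\<bar>fst (z t)\<bar> <= R" "\<bar>snd (z t)\<bar> <= R" for t
  using triangle_bounds[OF tri[of t]] R by linarith+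
 have lim: "(z \<longlongrightarrow> (\<delta>, a * (1 - \<delta>))) at_top"
  by (rule triangle_convergence[OF z(2) R(2,3) _ _ tri pos z(4)])
    (use sup \<delta>_pos sb a in \<open>auto simp: triangle_def lyap_def weight_def\<close>)
 have "((%t. fst (z (- t))) \<longlongrightarrow> \<delta>) at_bot" "((%t. snd (z (- t))) \<longlongrightarrow> a * (1 - \<delta>)) at_bot"
  using tendsto_fst[OF lim] tendsto_snd[OF lim] unfolding filterlim_at_top_mirror by auto
 moreover have "((%t. snd (z (- t))) \<longlongrightarrow> Q) at_top"
  using tendsto_snd[OF z(4)] unfolding filterlim_at_bot_mirror by simp
 moreover have "fst (z (- t)) <= c * exp (- (l * t))" if "t >= 0" for t using z(3)[of "- t"] that by simp
 ultimately show ?thesis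
  using z(1) pos lvorbit_lv_reversed[OF z(2) box]
  by (intro exI[of _ "%t. fst (z (- t))"] exI[of _ "%t. snd (z (- t))"] exI[of _ l] exI[of _ c]) auto
qed

section \<open>The connection between the interior equilibrium and (1, 0)\<close>

text \<open>The region between the nullclines \<open>y = a (1 - x)\<close> and \<open>y = Q - q x\<close>, which meet at the interior equilibrium, below the
 \<open>x\<close>-axis.\<close>

definition wedge :: "(real \<times> real) set" where
 "wedge = {z. a * (\<delta> - fst z) <= snd z - a * (1 - \<delta>) \<and> snd z - a * (1 - \<delta>) <= q * (\<delta> - fst z) \<and> snd z <= 0}"

lemma wedge_bounds:
 assumes "q < Q" "z \<in> wedge"
 shows "fst z <= \<delta>" "1 <= fst z" "- a * (\<delta> - 1) <= snd z" "snd z <= 0" "snd z < 0 ==> 1 < fst z"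
proof -
 have A: "a * (\<delta> - fst z) <= snd z - a * (1 - \<delta>)" "snd z - a * (1 - \<delta>) <= q * (\<delta> - fst z)" and y: "snd z <= 0"
  using assms(2) by (auto simp: wedge_def)
 have "0 <= (q - a) * (\<delta> - fst z)" using A by (simp add: algebra_simps)
 then show x: "fst z <= \<delta>" using aq by (simp add: zero_le_mult_iff)
 have *: "- snd z <= a * (fst z - 1)" using A(1) by (simp add: algebra_simps)
 then have "0 <= a * (fst z - 1)" using y by simp
 then show "1 <= fst z" using a by (simp add: zero_le_mult_iff)
 have "0 <= a * (\<delta> - fst z)" using x a by simp
 then show "- a * (\<delta> - 1) <= snd z" using A(1) by (simp add: algebra_simps)
 show "1 < fst z" if "snd z < 0"
 proof -
  have "0 < a * (fst z - 1)" using * that by simp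
  then show ?thesis using a by (simp add: zero_less_mult_iff)
 qed
qed (use assms in \<open>auto simp: wedge_def\<close>)

lemma wedge_compact: assumes "q < Q" shows "compact wedge"
proof -
 have "wedge = {z. a * (\<delta> - fst z) <= snd z - a * (1 - \<delta>)} \<inter> ({z. snd z - a * (1 - \<delta>) <= q * (\<delta> - fst z)} \<inter> {z. snd z <= 0})"
  by (auto simp: wedge_def)
 then have "closed wedge"
  by (auto intro!: closed_Int closed_Collect_le continuous_intros)
 moreover have "wedge \<subseteq> {1..\<delta>} \<times> {- a * (\<delta> - 1)..0}"
  using wedge_bounds[OF assms] unfolding mem_Times_iff by (auto simp: mem_Times_iff)
 then have "bounded wedge" by (rule bounded_subset[OF bounded_Times, rotated 2]) auto
 ultimately show ?thesis by (simp add: compact_eq_bounded_closed)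
qed

lemma wedge_invariant:
 assumes qQ: "q < Q" and orb: "lvorbit 1 R z" and R: "R >= \<delta> + a * (\<delta> - 1)"
  and z0: "z 0 \<in> wedge" "snd (z 0) < 0" "fst (z 0) < \<delta>" and t: "t >= 0"
 shows "z t \<in> wedge"
proof -
 have \<delta>1: "\<delta> > 1" using aq aQ qQ by (simp add: \<delta>_def)
 have "a * (\<delta> - 1) > 0" using \<delta>1 a by simp
 then have R0: "R > 0" using R \<delta>1 by linarith
 have y: "snd (z t) < 0" for t using lvorbit_y_sign[OF orb R0, of "- 1" 0 t] z0 by simp
 define u w where "u = (%t. \<delta> - fst (z t))" and "w = (%t. snd (z t) - a * (1 - \<delta>))"
 define h0 where "h0 = u 0 + w 0"
 define G where "G = {%t. w t - a * u t, %t. q * u t - w t, %t. u t + w t - h0}"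
 have uw0: "a * u 0 <= w 0" "w 0 <= q * u 0" "u 0 > 0" using z0 by (auto simp: wedge_def u_def w_def)
 then have h0: "h0 > 0" using a unfolding h0_def by (smt (verit) mult_pos_pos)
 have W: "z t \<in> wedge \<longleftrightarrow> a * u t <= w t \<and> w t <= q * u t" for t
  using y[of t] by (auto simp: wedge_def u_def w_def)
 have ud: "(u has_real_derivative - fst (field 1 R (z t))) (at t)" for t
  unfolding u_def by (rule derivative_eq_intros lvorbit_components[OF orb] refl | simp)+
 have wd: "(w has_real_derivative snd (field 1 R (z t))) (at t)" for t
  unfolding w_def by (rule derivative_eq_intros lvorbit_components[OF orb] refl | simp)+
 have dG: "((%t. w t - a * u t) has_real_derivative snd (field 1 R (z t)) - a * - fst (field 1 R (z t))) (at t)"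
  "((%t. q * u t - w t) has_real_derivative q * - fst (field 1 R (z t)) - snd (field 1 R (z t))) (at t)"
  "((%t. u t + w t - h0) has_real_derivative - fst (field 1 R (z t)) + snd (field 1 R (z t))) (at t)" for t
  by (rule derivative_eq_intros ud wd refl | simp)+
 have "g t >= 0" if "g \<in> G" for g
 proof (rule trapping[of G t t g])
  show "finite G" by (simp add: G_def)
  show "isCont g t" if "g \<in> G" for g t using that DERIV_isCont[OF dG(1)] DERIV_isCont[OF dG(2)] DERIV_isCont[OF dG(3)]
   by (auto simp: G_def)
  show "g 0 >= 0" if "g \<in> G" for g using that uw0 by (auto simp: G_def h0_def)
  fix r g assume r: "0 <= r" "r < t" "\<forall>h\<in>G. h r >= 0" and g: "g \<in> G" "g r = 0"
  have uw: "a * u r <= w r" "w r <= q * u r" "u r + w r >= h0" using r by (auto simp: G_def)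
  then have zw: "z r \<in> wedge" using W by simp
  note B = wedge_bounds[OF qQ zw]
  have "\<bar>fst (z r)\<bar> <= R" "\<bar>snd (z r)\<bar> <= R" using B \<delta>1 R \<open>a * (\<delta> - 1) > 0\<close> by linarith+
  then have f: "field 1 R (z r) = (fst (z r) * (u r - w r / a), snd (z r) * (w r - q * u r))"
   using field_in_box[of "fst (z r)" R "snd (z r)" 1] unfolding u_def w_def centred[symmetric] by simp
  have u0: "u r > 0"
  proof (rule ccontr)
   assume "\<not> u r > 0"
   then have "u r = 0" using B(1) by (simp add: u_def)
   then show False using uw h0 by simp
  qed
  have x1: "fst (z r) > 1" using B(5)[OF y] .
  consider "g = (%t. w t - a * u t)" | "g = (%t. q * u t - w t)" | "g = (%t. u t + w t - h0)"
   using g by (auto simp: G_def)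
  then show "\<exists>D>0. (g has_real_derivative D) (at r)"
  proof cases
   case 1
   then have w: "w r = a * u r" using g by simp
   have "snd (field 1 R (z r)) - a * - fst (field 1 R (z r)) = - snd (z r) * ((q - a) * u r)"
    unfolding f w using a by (simp add: algebra_simps)
   also have "\<dots> > 0" using y[of r] u0 aq by (intro mult_pos_pos) auto
   finally show ?thesis using dG(1) 1 by blast
  next
   case 2
   then have w: "w r = q * u r" using g by simp
   have "q * - fst (field 1 R (z r)) - snd (field 1 R (z r)) = q * fst (z r) * (u r * (q / a - 1))"
    unfolding f w by (simp add: algebra_simps)
   also have "\<dots> > 0" using x1 u0 aq a by (intro mult_pos_pos) auto
   finally show ?thesis using dG(2) 2 by blast
  next
   case 3
   have eq: "- fst (field 1 R (z r)) + snd (field 1 R (z r))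
     = fst (z r) * ((w r - a * u r) / a) + - snd (z r) * (q * u r - w r)"
    unfolding f using a by (simp add: field_simps)
   have n: "fst (z r) * ((w r - a * u r) / a) >= 0" "- snd (z r) * (q * u r - w r) >= 0"
    using uw a x1 y[of r] by (auto intro!: mult_nonneg_nonneg mult_nonpos_nonneg divide_nonneg_pos)
   have "0 < (q - a) * u r" using aq u0 by simp
   then have "w r - a * u r > 0 \<or> q * u r - w r > 0" using uw by (auto simp: algebra_simps)
   then have "fst (z r) * ((w r - a * u r) / a) > 0 \<or> - snd (z r) * (q * u r - w r) > 0"
    using x1 a y[of r] by (metis divide_pos_pos less_trans mult_pos_pos neg_0_less_iff_less zero_less_one)
   then show ?thesis using dG(3)[of r] 3 n unfolding eq by (intro exI conjI) auto
  qed
 qed (use t that in auto)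
 from this[of "%t. w t - a * u t"] this[of "%t. q * u t - w t"]
 show ?thesis using W[of t] by (simp add: G_def)
qed

text \<open>In the wedge \<open>x\<close> is monotone, so it serves as the Lyapunov function at both ends.\<close>

theorem exists_connection_interior_one_zero:
 assumes qQ: "q < Q"
 shows "\<exists>x y. (\<forall>t. lv x y t \<and> x t > 0 \<and> y t < 0)
   \<and> (x \<longlongrightarrow> 1) at_top \<and> (y \<longlongrightarrow> 0) at_top \<and> (x \<longlongrightarrow> \<delta>) at_bot \<and> (y \<longlongrightarrow> a * (1 - \<delta>)) at_bot"
proof -
 have \<delta>1: "\<delta> > 1" using aq aQ qQ by (simp add: \<delta>_def)
 define vm where "vm = a * (\<delta> - 1)"
 have vm: "vm > 0" using \<delta>1 a by (simp add: vm_def)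
 define R where "R = \<delta> + vm"
 have R: "R >= \<delta> + a * (\<delta> - 1)" "R > 0" using vm \<delta>1 by (auto simp: R_def vm_def)
 obtain z where orb: "lvorbit 1 R z" and z: "!!t. t <= 0 ==> a * (\<delta> - fst (z t)) <= snd (z t) - a * (1 - \<delta>) \<and>
   snd (z t) - a * (1 - \<delta>) <= q * (\<delta> - fst (z t))
   \<and> fst (z t) <= \<delta> \<and> 1 < fst (z t) \<and> snd (z t) < a * (1 - \<delta>) / 2" and z0: "fst (z 0) < \<delta>"
  using orbit_leaving_interior[OF qQ R(1)] by blast
 have half: "a * (1 - \<delta>) / 2 < 0" using vm by (simp add: vm_def algebra_simps)
 have neg: "z t \<in> wedge" if "t <= 0" for t using z[OF that] half by (simp add: wedge_def)
 have y0: "snd (z 0) < 0" using z[of 0] half by linarith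
 have y: "snd (z t) < 0" for t using lvorbit_y_sign[OF orb R(2), of "- 1" 0 t] y0 by simp
 have wz: "z t \<in> wedge" for t
  using neg[of t] wedge_invariant[OF qQ orb R(1) neg[of 0] y0 z0, of t] by (cases "t <= 0") auto
 have box: "\<bar>fst p\<bar> <= R" "\<bar>snd p\<bar> <= R" if "p \<in> wedge" for p
  using wedge_bounds(1-4)[OF qQ that] vm \<delta>1 unfolding R_def vm_def by linarith+
 have comp: "compact wedge" by (rule wedge_compact[OF qQ])
 have xd: "((%t. fst (z t)) has_real_derivative fst (z t) * ((\<delta> - fst (z t)) - (snd (z t) - a * (1 - \<delta>)) / a)) (at t)" for t
  using lvorbit_in_box(1)[OF orb box[OF wz], of t] by (simp add: centred)
 have dec: "fst (z t) <= fst (z r)" if "r <= t" for r t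
 proof (rule DERIV_nonpos_imp_nonincreasing[OF that])
  fix s
  have "\<delta> - fst (z s) <= (snd (z s) - a * (1 - \<delta>)) / a"
   using wz[of s] a by (simp add: wedge_def field_simps)
  then have "fst (z s) * ((\<delta> - fst (z s)) - (snd (z s) - a * (1 - \<delta>)) / a) <= 0"
   using wedge_bounds(2)[OF qQ wz[of s]] by (intro mult_nonneg_nonpos) auto
  then show "\<exists>D. ((%t. fst (z t)) has_real_derivative D) (at s) \<and> D <= 0" using xd by blast
 qed
 have fc: "continuous_on wedge fst" by (intro continuous_intros)
 \<comment> \<open>A constant \<open>x\<close> along an orbit in the wedge forces an equilibrium.\<close>
 have rigid: "u 0 = (\<delta>, a * (1 - \<delta>)) \<or> u 0 = (1, 0)"
  if u: "lvorbit s R u" "!!t. u t \<in> wedge" "!!t. fst (u t) = c" and s: "\<bar>s\<bar> = 1" for u s c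
 proof -
  have c1: "c >= 1" using wedge_bounds(2)[OF qQ u(2)[of 0]] u(3) by simp
  have "s * (c * (1 - c - snd (u t) / a)) = 0" for t
   using lvorbit_in_box(1)[OF u(1) box[OF u(2)], of t] DERIV_unique[OF _ DERIV_const, of c _ t]
   unfolding u(3) by blast
  then have "1 - c - snd (u t) / a = 0" for t using s c1 by (metis abs_zero mult_eq_0_iff not_one_le_zero zero_neq_one)
  then have yc: "snd (u t) = a * (1 - c)" for t using a by (simp add: field_simps)
  have "s * (a * (1 - c) * (- Q + q * c + a * (1 - c))) = 0"
   using lvorbit_in_box(2)[OF u(1) box[OF u(2)], of 0] DERIV_unique[OF _ DERIV_const, of "a * (1 - c)" _ 0]
   unfolding u(3) yc by blast
  then have "s * (snd (u 0) * (- Q + q * fst (u 0) + snd (u 0))) = 0" unfolding u(3) yc .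
  then have "snd (u 0) = 0 \<or> - Q + q * fst (u 0) + snd (u 0) = 0" using s by auto
  then show ?thesis
  proof
   assume "snd (u 0) = 0"
   then show ?thesis using yc[of 0] a u(3)[of 0] by (auto simp: prod_eq_iff)
  next
   assume "- Q + q * fst (u 0) + snd (u 0) = 0"
   then have "(q - a) * (c - \<delta>) = 0" using yc[of 0] u(3)[of 0] \<delta>_eq by (simp add: algebra_simps)
   then have "c = \<delta>" using aq by simp
   then show ?thesis using yc[of 0] u(3)[of 0] by (simp add: prod_eq_iff)
  qed
 qed
 have mono_lim: "\<exists>c. ((%t. fst (z t)) \<longlongrightarrow> c) at_top \<and> c <= fst (z 0)"
 proof -
  define c where "c = (INF t. fst (z t))"
  have bdd: "bdd_below (range (%t. fst (z t)))"
   using wedge_bounds(2)[OF qQ wz] by (intro bdd_belowI[of _ 1]) auto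
  have "((%t. fst (z t)) \<longlongrightarrow> c) at_top"
  proof (rule order_tendstoI)
   fix b assume "b < c"
   then show "\<forall>\<^sub>F t in at_top. b < fst (z t)"
    using cINF_lower[OF bdd] unfolding c_def[symmetric] by (auto intro!: always_eventually intro: less_le_trans)
  next
   fix b assume "c < b"
   then obtain r where r: "fst (z r) < b" unfolding c_def using cINF_less_iff[OF _ bdd] by auto
   show "\<forall>\<^sub>F t in at_top. fst (z t) < b"
    using eventually_ge_at_top[of r] by eventually_elim (use dec r in \<open>auto intro: le_less_trans\<close>)
  qed
  then show ?thesis using cINF_lower[OF bdd, of 0] by (auto simp: c_def)
 qed
 have mono_lim': "\<exists>c. ((%t. fst (z (- t))) \<longlongrightarrow> c) at_top \<and> c >= fst (z 0)"
 proof -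
  define c where "c = (SUP t. fst (z t))"
  have bdd: "bdd_above (range (%t. fst (z t)))"
   using wedge_bounds(1)[OF qQ wz] by (intro bdd_aboveI[of _ \<delta>]) auto
  have "((%t. fst (z (- t))) \<longlongrightarrow> c) at_top"
  proof (rule order_tendstoI)
   fix b assume "c < b"
   then show "\<forall>\<^sub>F t in at_top. fst (z (- t)) < b"
    using cSUP_upper[OF _ bdd] unfolding c_def[symmetric] by (auto intro!: always_eventually intro: le_less_trans)
  next
   fix b assume "b < c"
   then obtain r where r: "b < fst (z r)" unfolding c_def using less_cSUP_iff[OF _ bdd] by auto
   show "\<forall>\<^sub>F t in at_top. b < fst (z (- t))"
    using eventually_ge_at_top[of "- r"]
   proof eventually_elim
    case (elim t)
    have "fst (z r) <= fst (z (- t))" by (rule dec) (use elim in simp)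
    then show ?case using r by simp
   qed
  qed
  then show ?thesis using cSUP_upper[OF _ bdd, of 0] by (auto simp: c_def)
 qed
 have top: "(z \<longlongrightarrow> (1, 0)) at_top"
 proof -
  obtain c where c: "((%t. fst (z t)) \<longlongrightarrow> c) at_top" "c <= fst (z 0)" using mono_lim by blast
  obtain L where "lipschitz_field (field 1 R) L" using field_lipschitz[OF R(2), of 1] by auto
  then interpret lf: lipschitz_field "field 1 R" L .
  have orb': "lf.orbit = lvorbit 1 R" by (rule orbit_eq_lvorbit[OF lf.lipschitz_field_axioms])
  show ?thesis
  proof (rule lf.lasalle_convergence[OF _ comp wz fc c(1), unfolded orb', OF orb])
   fix u assume u: "lvorbit 1 R u" "!!t. u t \<in> wedge" "!!t. fst (u t) = c"
   have "fst (u 0) < \<delta>" using u(3)[of 0] c(2) z0 by simp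
   then show "u 0 = (1, 0)" using rigid[OF u] by auto
  qed
 qed
 have bot: "((%t. z (- t)) \<longlongrightarrow> (\<delta>, a * (1 - \<delta>))) at_top"
 proof -
  obtain c where c: "((%t. fst (z (- t))) \<longlongrightarrow> c) at_top" "c >= fst (z 0)" using mono_lim' by blast
  obtain L where "lipschitz_field (field (- 1) R) L" using field_lipschitz[OF R(2), of "- 1"] by auto
  then interpret lf: lipschitz_field "field (- 1) R" L .
  have orb': "lf.orbit = lvorbit (- 1) R" by (rule orbit_eq_lvorbit[OF lf.lipschitz_field_axioms])
  show ?thesis
  proof (rule lf.lasalle_convergence[OF _ comp wz fc c(1), unfolded orb', OF lvorbit_reversed[OF orb]])
   fix u assume u: "lvorbit (- 1) R u" "!!t. u t \<in> wedge" "!!t. fst (u t) = c"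
   have "fst (u 0) > 1" using u(3)[of 0] z[of 0] c(2) by linarith
   then show "u 0 = (\<delta>, a * (1 - \<delta>))" using rigid[OF u] by auto
  qed
 qed
 have b: "((%t. fst (z t)) \<longlongrightarrow> \<delta>) at_bot" "((%t. snd (z t)) \<longlongrightarrow> a * (1 - \<delta>)) at_bot"
  using tendsto_fst[OF bot] tendsto_snd[OF bot] unfolding filterlim_at_bot_mirror by auto
 have "lv (%t. fst (z t)) (%t. snd (z t)) t \<and> fst (z t) > 0 \<and> snd (z t) < 0" for t
  using lvorbit_lv[OF orb box[OF wz]] y[of t] wedge_bounds(2)[OF qQ wz[of t]] by simp
 then show ?thesis using b tendsto_fst[OF top] tendsto_snd[OF top]
  by (intro exI[of _ "%t. fst (z t)"] exI[of _ "%t. snd (z t)"]) auto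
qed

section \<open>Orbits attracted by the stable node (1, 0)\<close>

text \<open>The orbits start on one horizontal segment, which each of them meets only once because \<open>y\<close> is monotone;
 therefore no two are translates of each other.\<close>

theorem exists_orbits_entering_one_zero:
 assumes qQ: "q < Q" and \<epsilon>: "\<epsilon> = 1 \<or> \<epsilon> = - 1"
 shows "\<exists>X Y l c. l > 0 \<and> (\<forall>n::nat. (\<forall>t\<ge>0. lv (X n) (Y n) t \<and> X n t > 0 \<and> 0 < \<epsilon> * Y n t \<and> \<epsilon> * Y n t <= c * exp (- (l * t)))
    \<and> (X n \<longlongrightarrow> 1) at_top)
   \<and> (\<forall>m n h T. (\<forall>t\<ge>T. X m (t + h) = X n t \<and> Y m (t + h) = Y n t) --> m = n)"
proof -
 define l where "l = (Q - q) / 2"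
 have l: "l > 0" "Q - q = 2 * l" using qQ by (auto simp: l_def)
 have "\<forall>\<^sub>F \<eta> in at_right 0. \<eta> * 2 < 1 \<and> \<eta> * a < 1 \<and> \<eta> * (q + a) < l \<and> 0 < \<eta>"
  using l by (intro eventually_conj eventually_small_multiple eventually_at_right_less) auto
 then obtain \<eta> where \<eta>: "\<eta> * 2 < 1" "\<eta> * a < 1" "\<eta> * (q + a) < l" "0 < \<eta>"
  using eventually_happens[of _ "at_right (0::real)"] by auto
 have \<eta>q: "\<eta> * q + \<eta> * a < l" using \<eta>(3) by (simp add: distrib_left)
 define c where "c = a * \<eta> / 2"
 have "0 < \<eta> * a" using \<eta> a by simp
 then have c: "0 < c" "c / a < \<eta>" "c <= 1" "c <= \<eta> * a" using \<eta> a by (auto simp: c_def mult.commute)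
 define p where "p = (%n::nat. (1 + \<eta> * inverse (real (Suc n)), \<epsilon> * c))"
 have "\<exists>z. lvorbit 1 2 z \<and> z 0 = p n" for n by (rule lvorbit_exists) auto
 then obtain z where z: "!!n. lvorbit 1 2 (z n)" "!!n. z n 0 = p n" by metis
 have ypos: "0 < \<epsilon> * snd (z n t)" for n t
  by (rule lvorbit_y_sign[OF z(1)[of n], of \<epsilon> 0]) (use \<epsilon> c in \<open>auto simp: z(2) p_def\<close>)
 have yabs: "\<bar>snd (z n t)\<bar> = \<epsilon> * snd (z n t)" for n t using ypos[of n t] \<epsilon> by auto
 have trap: "1 - \<eta> <= fst (z n t) \<and> fst (z n t) <= 1 + \<eta> \<and> \<epsilon> * snd (z n t) <= c" if t: "t >= 0" for n t
 proof -
  define G where "G = {%t. fst (z n t) - (1 - \<eta>), %t. 1 + \<eta> - fst (z n t), %t. c - \<epsilon> * snd (z n t)}"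
  have dG: "((%t. fst (z n t) - (1 - \<eta>)) has_real_derivative fst (field 1 2 (z n t))) (at t)"
   "((%t. 1 + \<eta> - fst (z n t)) has_real_derivative - fst (field 1 2 (z n t))) (at t)"
   "((%t. c - \<epsilon> * snd (z n t)) has_real_derivative - (\<epsilon> * snd (field 1 2 (z n t)))) (at t)" for t
   by (rule derivative_eq_intros lvorbit_components[OF z(1)] refl | simp)+
  have "g t >= 0" if "g \<in> G" for g
  proof (rule trapping[of G t t g])
   show "finite G" by (simp add: G_def)
   show "isCont g t" if "g \<in> G" for g t using that DERIV_isCont[OF dG(1)] DERIV_isCont[OF dG(2)] DERIV_isCont[OF dG(3)]
    by (auto simp: G_def)
   have "inverse (real (Suc n)) <= 1" "0 <= inverse (real (Suc n))" by (auto simp: field_simps)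
   then have "0 <= \<eta> * inverse (real (Suc n))" "\<eta> * inverse (real (Suc n)) <= \<eta> * 1" using \<eta> by (auto intro!: mult_left_mono simp del: of_nat_Suc)
   then show "g 0 >= 0" if "g \<in> G" for g using that \<eta> \<epsilon> by (auto simp: G_def z(2) p_def)
   fix r g assume r: "0 <= r" "r < t" "\<forall>h\<in>G. h r >= 0" and g: "g \<in> G" "g r = 0"
   have x: "1 - \<eta> <= fst (z n r)" "fst (z n r) <= 1 + \<eta>" and y: "\<bar>snd (z n r)\<bar> <= c"
    using r yabs by (auto simp: G_def)
   have "\<bar>fst (z n r)\<bar> <= 2" "\<bar>snd (z n r)\<bar> <= 2" using x y \<eta> c by linarith+
   then have f: "field 1 2 (z n r) = (fst (z n r) * (1 - fst (z n r) - snd (z n r) / a), snd (z n r) * (- Q + q * fst (z n r) + snd (z n r)))"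
    using field_in_box[of "fst (z n r)" 2 "snd (z n r)" 1] by simp
   have xp: "fst (z n r) > 0" using x \<eta> by linarith
   have ya: "\<bar>snd (z n r) / a\<bar> < \<eta>"
   proof -
    have "\<bar>snd (z n r) / a\<bar> <= c / a" using y a by (simp add: abs_divide divide_right_mono)
    then show ?thesis using c by simp
   qed
   consider "g = (%t. fst (z n t) - (1 - \<eta>))" | "g = (%t. 1 + \<eta> - fst (z n t))" | "g = (%t. c - \<epsilon> * snd (z n t))"
    using g by (auto simp: G_def)
   then show "\<exists>D>0. (g has_real_derivative D) (at r)"
   proof cases
    case 1
    then have "fst (z n r) = 1 - \<eta>" using g by simp
    then have "1 - fst (z n r) - snd (z n r) / a > 0" using ya by linarith
    then have "fst (field 1 2 (z n r)) > 0" unfolding f using xp by simp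
    then show ?thesis using dG(1) 1 by blast
   next
    case 2
    then have "fst (z n r) = 1 + \<eta>" using g by simp
    then have "1 - fst (z n r) - snd (z n r) / a < 0" using ya by linarith
    then have "- fst (field 1 2 (z n r)) > 0" unfolding f using xp by (simp add: mult_less_0_iff)
    then show ?thesis using dG(2) 2 by blast
   next
    case 3
    have "q * fst (z n r) <= q * (1 + \<eta>)" using x a aq by (intro mult_left_mono) auto
    also have "\<dots> = q + \<eta> * q" by (simp add: algebra_simps)
    finally have "q * fst (z n r) <= q + \<eta> * q" .
    then have "- Q + q * fst (z n r) + snd (z n r) < 0"
     using y c(4) \<eta>q l by argo
    then have "\<epsilon> * snd (z n r) * (- Q + q * fst (z n r) + snd (z n r)) < 0"
     using ypos[of n r] by (intro mult_pos_neg)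
    then have "- (\<epsilon> * snd (field 1 2 (z n r))) > 0" unfolding f by (simp add: mult.assoc)
    then show ?thesis using dG(3) 3 by blast
   qed
  qed (use t that in auto)
  from this[of "%t. fst (z n t) - (1 - \<eta>)"] this[of "%t. 1 + \<eta> - fst (z n t)"] this[of "%t. c - \<epsilon> * snd (z n t)"]
  show ?thesis by (simp add: G_def)
 qed
 have rate: "- Q + q * fst (z n t) + snd (z n t) <= - l" if "t >= 0" for n t
 proof -
  have "q * fst (z n t) <= q * (1 + \<eta>)" using trap[OF that, of n] a aq by (intro mult_left_mono) auto
  also have "\<dots> = q + \<eta> * q" by (simp add: algebra_simps)
  finally have "q * fst (z n t) <= q + \<eta> * q" .
  moreover have "snd (z n t) <= c" using trap[OF that, of n] yabs[of n t] by linarith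
  ultimately show ?thesis using c(4) \<eta>q l by argo
 qed
 have box: "\<bar>fst (z n t)\<bar> <= 2" "\<bar>snd (z n t)\<bar> <= 2" "fst (z n t) >= 1 / 2" if "t >= 0" for n t
  using trap[OF that, of n] yabs[of n t] \<eta> c by linarith+
 have yd: "((%t. \<epsilon> * snd (z n t)) has_real_derivative \<epsilon> * snd (z n t) * (- Q + q * fst (z n t) + snd (z n t))) (at t)"
  if "t >= 0" for n t
  using DERIV_cmult[OF lvorbit_in_box(2)[OF z(1) box(1,2)[OF that]], of \<epsilon>] by (simp add: mult.assoc)
 have bnd: "\<epsilon> * snd (z n t) <= c * exp (- (l * t))" if t: "t >= 0" for n t
 proof -
  have "\<epsilon> * snd (z n t) <= \<epsilon> * snd (z n 0) * exp (- l * (t - 0))"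
   by (rule exponential_decay_bound[OF yd _ _ t]) (use ypos rate in auto)
  moreover have "\<epsilon> * snd (z n 0) = c" using \<epsilon> by (auto simp: z(2) p_def)
  ultimately show ?thesis by simp
 qed
 have lim: "((%t. fst (z n t)) \<longlongrightarrow> 1) at_top" for n
 proof -
  have e0: "((%t. 2 * (c * exp (- (l * t))) / a) \<longlongrightarrow> 2 * (c * 0) / a) at_top"
   using a by (intro tendsto_intros exp_decay_at_top l) auto
  have "((%t. fst (z n t) - 1) \<longlongrightarrow> 0) at_top"
  proof (rule damped_tendsto_0_at_top[of 0 "%t. fst (z n t) - 1" "%t. fst (z n t)" "%t. - (fst (z n t) * snd (z n t) / a)" "1 / 2"])
   fix t :: real assume t: "t >= 0"
   show "((%t. fst (z n t) - 1) has_real_derivative - fst (z n t) * (fst (z n t) - 1) + - (fst (z n t) * snd (z n t) / a)) (at t)"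
    using DERIV_diff[OF lvorbit_in_box(1)[OF z(1) box(1,2)[OF t]] DERIV_const[of 1]] by (simp add: algebra_simps)
   show "1 / 2 <= fst (z n t)" using box[OF t] by simp
  next
   show "((%t. - (fst (z n t) * snd (z n t) / a)) \<longlongrightarrow> 0) at_top"
   proof (rule Lim_null_comparison[OF _ e0[simplified]])
    show "\<forall>\<^sub>F t in at_top. norm (- (fst (z n t) * snd (z n t) / a)) <= 2 * (c * exp (- (l * t))) / a"
     using eventually_ge_at_top[of 0]
    proof eventually_elim
     case (elim t)
     have "\<bar>fst (z n t)\<bar> * \<bar>snd (z n t)\<bar> <= 2 * (c * exp (- (l * t)))"
      using box[OF elim, of n] bnd[OF elim, of n] yabs[of n t] by (intro mult_mono) auto
     then show ?case using a by (simp add: abs_mult abs_divide divide_right_mono)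
    qed
   qed
  qed auto
  then show ?thesis by (simp add: LIM_zero_iff)
 qed
 have dec: "\<epsilon> * snd (z n t) < c" if "t > 0" for n t
 proof -
  have "\<epsilon> * snd (z n t) < \<epsilon> * snd (z n 0)"
  proof (rule DERIV_neg_imp_decreasing[OF that])
   fix r assume "0 <= r" "r <= t"
   moreover have "\<epsilon> * snd (z n r) * (- Q + q * fst (z n r) + snd (z n r)) < 0"
    using rate[OF \<open>0 <= r\<close>, of n] l ypos[of n r] by (intro mult_pos_neg) auto
   ultimately show "\<exists>D. ((%t. \<epsilon> * snd (z n t)) has_real_derivative D) (at r) \<and> D < 0" using yd by blast
  qed
  moreover have "\<epsilon> * snd (z n 0) = c" using \<epsilon> by (auto simp: z(2) p_def)
  ultimately show ?thesis by simp
 qed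
 have y0: "\<epsilon> * snd (z n 0) = c" for n using \<epsilon> by (auto simp: z(2) p_def)
 have distinct: "m = n" if eq: "\<forall>t\<ge>T. fst (z m (t + h)) = fst (z n t) \<and> snd (z m (t + h)) = snd (z n t)" for m n h T
 proof -
  have "z m (T + h) = z n T" using eq by (simp add: prod_eq_iff)
  then have all: "z m (t + h) = z n t" for t
   using lvorbit_unique[OF _ _ lvorbit_shift[OF _ _ z(1)[of m], of h] z(1)[of n], of T t] by simp
  have "\<not> h > 0" using all[of 0] dec[of h m] y0[of n] by auto
  moreover have "\<not> h < 0" using all[of "- h"] dec[of "- h" n] y0[of m] by auto
  ultimately have "z m 0 = z n 0" using all[of 0] by simp
  then show ?thesis using \<eta> by (simp add: z(2) p_def)
 qed
 have "lv (%t. fst (z n t)) (%t. snd (z n t)) t \<and> fst (z n t) > 0 \<and> 0 < \<epsilon> * snd (z n t) \<and> \<epsilon> * snd (z n t) <= c * exp (- (l * t))"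
  if t: "t >= 0" for n t
  using lvorbit_lv[OF z(1) box(1,2)[OF t]] box(3)[OF t, of n] ypos[of n t] bnd[OF t, of n] by simp
 then have all: "\<forall>n. (\<forall>t\<ge>0. lv (%t. fst (z n t)) (%t. snd (z n t)) t \<and> fst (z n t) > 0 \<and> 0 < \<epsilon> * snd (z n t)
    \<and> \<epsilon> * snd (z n t) <= c * exp (- (l * t))) \<and> ((%t. fst (z n t)) \<longlongrightarrow> 1) at_top"
  using lim by simp
 have "\<forall>m n h T. (\<forall>t\<ge>T. fst (z m (t + h)) = fst (z n t) \<and> snd (z m (t + h)) = snd (z n t)) --> m = n"
  using distinct by blast
 with all l(1) show ?thesis
  by (intro exI[of _ "%n t. fst (z n t)"] exI[of _ "%n t. snd (z n t)"] exI[of _ l] exI[of _ c] conjI)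
qed

section \<open>The degenerate equilibrium of the critical case\<close>

text \<open>The slope \<open>(1 - x) / y\<close> under which the orbit is seen from \<open>(1, 0)\<close> tends to that of the centre
 direction, \<open>1 / a\<close>; then \<open>1 / y\<close> has the limit derivative \<open>Q / a - 1\<close>, whence \<open>y \<sim> a / ((Q - a) t)\<close>.\<close>

lemma degenerate_derivatives:
 assumes qQ: "q = Q" and lv: "lv x y t" and y: "y t ~= 0"
 shows "((%t. (1 - x t) / y t) has_real_derivative
   - x t * ((1 - x t) / y t - 1 / a) + (1 - x t) / y t * (Q * ((1 - x t) / y t) - 1) * y t) (at t)"
  "((%t. 1 / y t) has_real_derivative Q * ((1 - x t) / y t) - 1) (at t)"
proof -
 define \<rho> where "\<rho> = (1 - x t) / y t"
 have x: "x t = 1 - \<rho> * y t" using y by (simp add: \<rho>_def)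
 have dx: "(x has_real_derivative x t * (1 - x t - y t / a)) (at t)"
  and dy: "(y has_real_derivative y t * (Q * (x t - 1) + y t)) (at t)"
  using lv[unfolded lv_def] by (auto simp: qQ algebra_simps)
 have "(0 - x t * (1 - x t - y t / a)) * y t - (1 - x t) * (y t * (Q * (x t - 1) + y t))
   = (- x t * (\<rho> - 1 / a) + \<rho> * (Q * \<rho> - 1) * y t) * (y t * y t)"
 proof -
  have "1 - x t - y t / a = y t * (\<rho> - 1 / a)" by (simp add: x algebra_simps)
  moreover have "Q * (x t - 1) + y t = - ((Q * \<rho> - 1) * y t)" by (simp add: x algebra_simps)
  moreover have "1 - x t = \<rho> * y t" by (simp add: x)
  ultimately show ?thesis by (simp only:) (simp add: algebra_simps)
 qed
 then have "((0 - x t * (1 - x t - y t / a)) * y t - (1 - x t) * (y t * (Q * (x t - 1) + y t))) / (y t * y t)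
   = - x t * (\<rho> - 1 / a) + \<rho> * (Q * \<rho> - 1) * y t" using y by simp
 then show "((%t. (1 - x t) / y t) has_real_derivative
   - x t * ((1 - x t) / y t - 1 / a) + (1 - x t) / y t * (Q * ((1 - x t) / y t) - 1) * y t) (at t)"
  unfolding \<rho>_def[symmetric] using DERIV_divide[OF DERIV_diff[OF DERIV_const dx] dy y, of 1] by simp
 have "(0 * y t - 1 * (y t * (Q * (x t - 1) + y t))) / (y t * y t) = Q * \<rho> - 1"
  using y by (simp add: x field_simps)
 then show "((%t. 1 / y t) has_real_derivative Q * ((1 - x t) / y t) - 1) (at t)"
  unfolding \<rho>_def[symmetric] using DERIV_divide[OF DERIV_const dy y, of 1] by simp
qed

lemma linear_growth_from_slope:
 fixes f :: "real => real"
 assumes "!!t. t >= 0 ==> (f has_real_derivative f' t) (at t)" "(f' \<longlongrightarrow> c) at_top"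
 shows "((%t. f t / t) \<longlongrightarrow> c) at_top"
proof (rule lhospital_at_top_at_top[where g'="%_. 1"])
 show "\<forall>\<^sub>F t in at_top. (f has_real_derivative f' t) (at t)"
  using eventually_ge_at_top[of 0] by eventually_elim (rule assms(1))
qed (use assms(2) in \<open>auto simp: filterlim_ident\<close>)

lemma cesaro_inverse:
 fixes y :: "real => real"
 assumes "((%t. 1 / y t / t) \<longlongrightarrow> Q / a - 1) F"
 shows "((%t. y t * t) \<longlongrightarrow> a / (Q - a)) F"
proof -
 have c: "Q / a - 1 = (Q - a) / a" using a by (simp add: diff_divide_distrib)
 have "Q / a - 1 ~= 0" using a aQ by simp
 from tendsto_inverse[OF assms this] show ?thesis unfolding c by simp
qed

theorem exists_orbit_entering_degenerate:
 assumes qQ: "q = Q"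
 shows "\<exists>x y. (\<forall>t\<ge>0. lv x y t \<and> x t > 0 \<and> y t > 0) \<and> strict_antimono_on {0..} y
   \<and> (x \<longlongrightarrow> 1) at_top \<and> ((%t. y t * t) \<longlongrightarrow> a / (Q - a)) at_top"
proof -
 have Q0: "Q > 0" using a aQ by simp
 \<comment> \<open>The orbit is confined to \<open>\<theta> y \<le> 1 - x \<le> \<theta>' y\<close>, about the centre direction \<open>1 / a\<close>; \<open>\<theta> > 1 / Q\<close> makes \<open>y\<close> decrease.\<close>
 define \<theta> \<theta>' where "\<theta> = (1 / Q + 1 / a) / 2" and "\<theta>' = 2 / a"
 have QA: "1 / Q < 1 / a" using a aQ by (simp add: frac_less2)
 have \<theta>: "1 / Q < \<theta>" "\<theta> < 1 / a" "1 / a < \<theta>'" using QA a by (auto simp: \<theta>_def \<theta>'_def divide_strict_right_mono)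
 have pos: "\<theta> > 0" "\<theta>' > 0" using \<theta> a Q0 by (auto simp: \<theta>_def \<theta>'_def add_pos_pos)
 have Q\<theta>: "Q * \<theta> > 1" "Q * \<theta>' > 1"
 proof -
  show 1: "Q * \<theta> > 1" using \<theta>(1) Q0 by (simp add: field_simps)
  have "Q * \<theta> < Q * \<theta>'" using \<theta> Q0 by (intro mult_strict_left_mono) auto
  then show "Q * \<theta>' > 1" using 1 by simp
 qed
 have "\<forall>\<^sub>F h in at_right 0. h * 1 < 1 \<and> h * \<theta>' < 1 / 2 \<and> h * (2 * \<theta>' * (Q * \<theta>' - 1)) < \<theta>' - 1 / a \<and> 0 < h"
  using \<theta> by (intro eventually_conj eventually_small_multiple eventually_at_right_less) auto
 then obtain h where h: "h < 1" "h * \<theta>' < 1 / 2" "h * (2 * \<theta>' * (Q * \<theta>' - 1)) < \<theta>' - 1 / a" "0 < h"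
  using eventually_happens[of _ "at_right (0::real)"] by auto
 obtain z where orb: "lvorbit 1 2 z" and z0: "z 0 = (1 - h / a, h)"
  using lvorbit_exists[of 2 1 "(1 - h / a, h)"] by auto
 have y: "snd (z t) > 0" for t using lvorbit_y_sign[OF orb, of 1 0 t] z0 h by simp
 have trap: "1 - \<theta>' * snd (z t) <= fst (z t) \<and> fst (z t) <= 1 - \<theta> * snd (z t) \<and> snd (z t) <= h" if t: "t >= 0" for t
 proof -
  define G where "G = {%t. fst (z t) - 1 + \<theta>' * snd (z t), %t. 1 - \<theta> * snd (z t) - fst (z t), %t. h - snd (z t)}"
  have dG: "((%t. fst (z t) - 1 + \<theta>' * snd (z t)) has_real_derivative fst (field 1 2 (z t)) + \<theta>' * snd (field 1 2 (z t))) (at t)"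
   "((%t. 1 - \<theta> * snd (z t) - fst (z t)) has_real_derivative - (\<theta> * snd (field 1 2 (z t))) - fst (field 1 2 (z t))) (at t)"
   "((%t. h - snd (z t)) has_real_derivative - snd (field 1 2 (z t))) (at t)" for t
   by (rule derivative_eq_intros lvorbit_components[OF orb] refl | simp)+
  have "g t >= 0" if "g \<in> G" for g
  proof (rule trapping[of G t t g])
   show "finite G" by (simp add: G_def)
   show "isCont g t" if "g \<in> G" for g t using that DERIV_isCont[OF dG(1)] DERIV_isCont[OF dG(2)] DERIV_isCont[OF dG(3)]
    by (auto simp: G_def)
   have "\<theta> * h <= h / a" "h / a <= \<theta>' * h" using mult_right_mono[of \<theta> "1 / a" h] mult_right_mono[of "1 / a" \<theta>' h] \<theta> h by auto
   then show "g 0 >= 0" if "g \<in> G" for g using that by (auto simp: G_def z0)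
   fix r g assume r: "0 <= r" "r < t" "\<forall>h\<in>G. h r >= 0" and g: "g \<in> G" "g r = 0"
   define X Y where "X = fst (z r)" and "Y = snd (z r)"
   have XY: "1 - \<theta>' * Y <= X" "X <= 1 - \<theta> * Y" "Y <= h" "0 < Y" using r y[of r] by (auto simp: G_def X_def Y_def)
   have tY: "\<theta>' * Y <= 1 / 2"
   proof -
    have "\<theta>' * Y <= \<theta>' * h" using XY pos by (intro mult_left_mono) auto
    then show ?thesis using h by (simp add: mult.commute)
   qed
   have "0 < \<theta> * Y" using XY pos by simp
   then have X: "1 / 2 <= X" "X < 1" using XY tY by linarith+
   have "\<bar>X\<bar> <= 2" "\<bar>Y\<bar> <= 2" using X XY h by linarith+
   then have f: "field 1 2 (z r) = (X * (1 - X - Y / a), Y * (Q * (X - 1) + Y))"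
    using field_in_box[of X 2 Y 1] qQ by (simp add: X_def Y_def algebra_simps)
   have "Q * (X - 1) + Y <= - ((Q * \<theta> - 1) * Y)"
    using mult_left_mono[OF XY(2), of Q] Q0 by (simp add: algebra_simps)
   moreover have "0 < (Q * \<theta> - 1) * Y" using XY Q\<theta> by simp
   ultimately have dec: "Q * (X - 1) + Y < 0" by linarith
   consider "g = (%t. fst (z t) - 1 + \<theta>' * snd (z t))" | "g = (%t. 1 - \<theta> * snd (z t) - fst (z t))" | "g = (%t. h - snd (z t))"
    using g by (auto simp: G_def)
   then show "\<exists>D>0. (g has_real_derivative D) (at r)"
   proof cases
    case 1
    then have e: "1 - X = \<theta>' * Y" using g by (simp add: X_def Y_def)
    have "fst (field 1 2 (z r)) + \<theta>' * snd (field 1 2 (z r)) = X * ((1 - X) - Y / a) + \<theta>' * Y * (Y - Q * (1 - X))"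
     unfolding f by (simp add: algebra_simps)
    also have "\<dots> = Y * (X * (\<theta>' - 1 / a) - Y * (\<theta>' * (Q * \<theta>' - 1)))" unfolding e by (simp add: algebra_simps)
    finally have eq: "fst (field 1 2 (z r)) + \<theta>' * snd (field 1 2 (z r)) = Y * (X * (\<theta>' - 1 / a) - Y * (\<theta>' * (Q * \<theta>' - 1)))" .
    have "Y * (\<theta>' * (Q * \<theta>' - 1)) <= h * (\<theta>' * (Q * \<theta>' - 1))" using XY pos Q\<theta> by (intro mult_right_mono) auto
    also have "\<dots> < 1 / 2 * (\<theta>' - 1 / a)"
    proof -
     have "h * (2 * \<theta>' * (Q * \<theta>' - 1)) = 2 * (h * (\<theta>' * (Q * \<theta>' - 1)))" by simp
     then show ?thesis using h(3) by argo
    qed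
    also have "\<dots> <= X * (\<theta>' - 1 / a)" using X \<theta> by (intro mult_right_mono) auto
    finally have "0 < X * (\<theta>' - 1 / a) - Y * (\<theta>' * (Q * \<theta>' - 1))" by simp
    then have "0 < fst (field 1 2 (z r)) + \<theta>' * snd (field 1 2 (z r))" unfolding eq using XY by simp
    then show ?thesis using dG(1) 1 by blast
   next
    case 2
    then have e: "1 - X = \<theta> * Y" using g by (simp add: X_def Y_def)
    have "- (\<theta> * snd (field 1 2 (z r))) - fst (field 1 2 (z r)) = X * (Y / a - (1 - X)) + \<theta> * Y * (Q * (1 - X) - Y)"
     unfolding f by (simp add: algebra_simps)
    also have "\<dots> = Y * (X * (1 / a - \<theta>) + Y * (\<theta> * (Q * \<theta> - 1)))" unfolding e by (simp add: algebra_simps)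
    also have "\<dots> > 0" using XY X \<theta> Q\<theta> pos by (intro mult_pos_pos add_pos_pos) auto
    finally show ?thesis using dG(2) 2 by blast
   next
    case 3
    have "- snd (field 1 2 (z r)) = Y * - (Q * (X - 1) + Y)" unfolding f by (simp add: algebra_simps)
    also have "\<dots> > 0" using dec XY by (intro mult_pos_pos) auto
    finally show ?thesis using dG(3) 3 by blast
   qed
  qed (use t that in auto)
  from this[of "%t. fst (z t) - 1 + \<theta>' * snd (z t)"] this[of "%t. 1 - \<theta> * snd (z t) - fst (z t)"] this[of "%t. h - snd (z t)"]
  show ?thesis by (simp add: G_def)
 qed
 define x y where "x = (%t. fst (z t))" and "y = (%t. snd (z t))"
 have yp: "y t > 0" for t using y by (simp add: y_def)
 have tr: "1 - \<theta>' * y t <= x t" "x t <= 1 - \<theta> * y t" "y t <= h" if "t >= 0" for t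
  using trap[OF that] by (auto simp: x_def y_def)
 have xb: "1 / 2 <= x t" "x t <= 1" if "t >= 0" for t
 proof -
  have "\<theta>' * y t <= \<theta>' * h" using tr[OF that] pos by (intro mult_left_mono) auto
  then show "1 / 2 <= x t" using tr[OF that] h by (simp add: mult.commute)
  have "0 <= \<theta> * y t" using pos yp[of t] by simp
  then show "x t <= 1" using tr[OF that] by linarith
 qed
 have lv: "lv x y t" if "t >= 0" for t
 proof -
  have "\<bar>x t\<bar> <= 2" "\<bar>y t\<bar> <= 2" using xb[OF that] tr(3)[OF that] yp[of t] h by linarith+
  then show ?thesis unfolding x_def y_def by (intro lvorbit_lv[OF orb])
 qed
 define \<rho> where "\<rho> = (%t. (1 - x t) / y t)"
 have \<rho>: "\<theta> <= \<rho> t" "\<rho> t <= \<theta>'" if "t >= 0" for t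
  using tr[OF that] yp[of t] by (auto simp: \<rho>_def field_simps)
 have d\<rho>: "(\<rho> has_real_derivative - x t * (\<rho> t - 1 / a) + \<rho> t * (Q * \<rho> t - 1) * y t) (at t)"
  and dy: "((%t. 1 / y t) has_real_derivative Q * \<rho> t - 1) (at t)" if "t >= 0" for t
  using degenerate_derivatives[OF qQ lv[OF that] less_imp_neq[OF yp, symmetric]] by (auto simp: \<rho>_def)
 have slope: "Q * \<theta> - 1 <= Q * \<rho> t - 1" if "t >= 0" for t using \<rho>(1)[OF that] Q0 by (simp add: mult_left_mono)
 have grow: "1 / y r + (Q * \<theta> - 1) * (t - r) <= 1 / y t" if "0 <= r" "r <= t" for r t
 proof -
  have "1 / y r - (Q * \<theta> - 1) * r <= 1 / y t - (Q * \<theta> - 1) * t"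
  proof (rule DERIV_nonneg_imp_nondecreasing[where f="%t. 1 / y t - (Q * \<theta> - 1) * t", OF that(2)])
   fix s assume "r <= s" "s <= t"
   then have s: "s >= 0" using that by simp
   have "((%t. 1 / y t - (Q * \<theta> - 1) * t) has_real_derivative (Q * \<rho> s - 1) - (Q * \<theta> - 1)) (at s)"
    by (rule derivative_eq_intros dy[OF s] refl | simp)+
   then show "\<exists>D. ((%t. 1 / y t - (Q * \<theta> - 1) * t) has_real_derivative D) (at s) \<and> 0 <= D"
    using slope[OF s] by (intro exI conjI) auto
  qed
  then show ?thesis by (simp add: algebra_simps)
 qed
 have anti: "y t < y r" if "0 <= r" "r < t" for r t
 proof -
  have "0 < (Q * \<theta> - 1) * (t - r)" using that Q\<theta> by simp
  then have "1 / y r < 1 / y t" using grow[of r t] that by linarith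
  then show ?thesis using yp[of r] yp[of t] by (simp add: field_simps)
 qed
 have ytop: "filterlim (%t. 1 / y t) at_top at_top"
 proof (rule filterlim_at_top_mono)
  show "filterlim (%t. 1 / y 0 + (Q * \<theta> - 1) * t) at_top at_top" using Q\<theta>
   by (intro filterlim_tendsto_add_at_top[OF tendsto_const] filterlim_tendsto_pos_mult_at_top[OF tendsto_const _ filterlim_ident]) auto
  show "\<forall>\<^sub>F t in at_top. 1 / y 0 + (Q * \<theta> - 1) * t <= 1 / y t"
   using eventually_ge_at_top[of 0] by eventually_elim (use grow[of 0] in simp)
 qed
 have y0: "(y \<longlongrightarrow> 0) at_top"
  using tendsto_inverse_0_at_top[OF ytop] by simp
 have "((%t. x t - 1) \<longlongrightarrow> 0) at_top"
 proof (rule Lim_null_comparison)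
  show "((%t. \<theta>' * y t) \<longlongrightarrow> 0) at_top" using tendsto_mult_right_zero[OF y0] .
  show "\<forall>\<^sub>F t in at_top. norm (x t - 1) <= \<theta>' * y t"
   using eventually_ge_at_top[of 0] by eventually_elim (use tr xb in force)
 qed
 then have x1: "(x \<longlongrightarrow> 1) at_top" by (simp add: LIM_zero_iff)
 have "((%t. \<rho> t - 1 / a) \<longlongrightarrow> 0) at_top"
 proof (rule damped_tendsto_0_at_top[of 0 _ x "%t. \<rho> t * (Q * \<rho> t - 1) * y t" "1 / 2"])
  fix t :: real assume t: "t >= 0"
  show "((%t. \<rho> t - 1 / a) has_real_derivative - x t * (\<rho> t - 1 / a) + \<rho> t * (Q * \<rho> t - 1) * y t) (at t)"
   using DERIV_diff[OF d\<rho>[OF t] DERIV_const[of "1 / a"]] by simp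
  show "1 / 2 <= x t" by (rule xb[OF t])
 next
  have l0: "((%t. \<theta>' * (Q * \<theta>' - 1) * y t) \<longlongrightarrow> 0) at_top" using tendsto_mult_right_zero[OF y0] .
  show "((%t. \<rho> t * (Q * \<rho> t - 1) * y t) \<longlongrightarrow> 0) at_top"
  proof (rule Lim_null_comparison[OF _ l0])
   show "\<forall>\<^sub>F t in at_top. norm (\<rho> t * (Q * \<rho> t - 1) * y t) <= \<theta>' * (Q * \<theta>' - 1) * y t"
    using eventually_ge_at_top[of 0]
   proof eventually_elim
    case (elim t)
    have "0 <= Q * \<rho> t - 1" using slope[OF elim] Q\<theta> by linarith
    moreover have "Q * \<rho> t - 1 <= Q * \<theta>' - 1" using \<rho>[OF elim] Q0 by simp
    moreover have "0 <= \<rho> t" using \<rho>[OF elim] pos by linarith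
    ultimately have m: "\<rho> t * (Q * \<rho> t - 1) <= \<theta>' * (Q * \<theta>' - 1)" "0 <= \<rho> t * (Q * \<rho> t - 1)"
     using \<rho>[OF elim] by (auto intro!: mult_mono)
    have "norm (\<rho> t * (Q * \<rho> t - 1) * y t) = \<rho> t * (Q * \<rho> t - 1) * y t"
     unfolding real_norm_def abs_mult[of "\<rho> t * (Q * \<rho> t - 1)"] abs_of_nonneg[OF m(2)] abs_of_pos[OF yp] ..
    also have "\<dots> <= \<theta>' * (Q * \<theta>' - 1) * y t" by (rule mult_right_mono[OF m(1) less_imp_le[OF yp]])
    finally show ?case .
   qed
  qed
 qed auto
 then have "(\<rho> \<longlongrightarrow> 1 / a) at_top" by (simp add: LIM_zero_iff)
 then have sl: "((%t. Q * \<rho> t - 1) \<longlongrightarrow> Q * (1 / a) - 1) at_top" by (intro tendsto_intros)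
 have "((%t. 1 / y t / t) \<longlongrightarrow> Q * (1 / a) - 1) at_top"
  by (rule linear_growth_from_slope[OF _ sl]) (rule dy)
 then have "((%t. y t * t) \<longlongrightarrow> a / (Q - a)) at_top" by (intro cesaro_inverse) simp
 moreover have "strict_antimono_on {0..} y" using anti by (auto simp: monotone_on_def)
 moreover have "\<forall>t\<ge>0. lv x y t \<and> x t > 0 \<and> y t > 0" using lv xb(1) yp by (metis half_gt_zero_iff less_le_trans zero_less_one)
 ultimately show ?thesis using x1 by blast
qed

theorem exists_orbit_leaving_degenerate:
 assumes qQ: "q = Q"
 shows "\<exists>x y. (\<forall>t\<le>0. lv x y t \<and> x t > 0 \<and> y t < 0) \<and> strict_antimono_on {..0} y
   \<and> (x \<longlongrightarrow> 1) at_bot \<and> ((%t. y t * t) \<longlongrightarrow> a / (Q - a)) at_bot"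
proof -
 have Q0: "Q > 0" using a aQ by simp
 define \<theta> where "\<theta> = (1 / Q + 1 / a) / 2"
 have QA: "1 / Q < 1 / a" using a aQ by (simp add: frac_less2)
 have \<theta>: "1 / Q < \<theta>" "\<theta> < 1 / a" using QA by (auto simp: \<theta>_def)
 have pos: "\<theta> > 0" using a Q0 by (auto simp: \<theta>_def add_pos_pos)
 have Q\<theta>: "Q * \<theta> > 1" using \<theta>(1) Q0 by (simp add: field_simps)
 obtain z where orb: "lvorbit 1 2 z" and z: "!!t. t <= 0 ==> snd (z t) < 0 \<and> - 1 <= snd (z t)
   \<and> - \<theta> * snd (z t) <= fst (z t) - 1 \<and> fst (z t) - 1 <= - snd (z t) / a \<and> fst (z t) <= 2"
  using orbit_leaving_degenerate[OF qQ \<theta>, of 2] by auto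
 define x y where "x = (%t. fst (z t))" and "y = (%t. snd (z t))"
 have yn: "y t < 0" "- 1 <= y t" if "t <= 0" for t using z[OF that] by (auto simp: y_def)
 have tr: "- \<theta> * y t <= x t - 1" "x t - 1 <= - y t / a" "x t <= 2" if "t <= 0" for t
  using z[OF that] by (auto simp: x_def y_def)
 have xb: "1 <= x t" if "t <= 0" for t
 proof -
  have "0 <= - \<theta> * y t" using pos yn[OF that] by (simp add: mult_nonneg_nonpos)
  then show ?thesis using tr(1)[OF that] by linarith
 qed
 have lv: "lv x y t" if "t <= 0" for t
 proof -
  have "\<bar>x t\<bar> <= 2" "\<bar>y t\<bar> <= 2" using xb[OF that] tr(3)[OF that] yn[OF that] by linarith+
  then show ?thesis unfolding x_def y_def by (intro lvorbit_lv[OF orb])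
 qed
 define \<rho> where "\<rho> = (%t. (1 - x t) / y t)"
 have \<rho>: "\<theta> <= \<rho> t" "\<rho> t <= 1 / a" if "t <= 0" for t
  using tr[OF that] yn[OF that] a by (auto simp: \<rho>_def field_simps)
 have d\<rho>: "(\<rho> has_real_derivative - x t * (\<rho> t - 1 / a) + \<rho> t * (Q * \<rho> t - 1) * y t) (at t)"
  and dy: "((%t. 1 / y t) has_real_derivative Q * \<rho> t - 1) (at t)" if "t <= 0" for t
  using degenerate_derivatives[OF qQ lv[OF that] less_imp_neq[OF yn(1)[OF that]]] by (auto simp: \<rho>_def)
 have slope: "Q * \<theta> - 1 <= Q * \<rho> t - 1" if "t <= 0" for t using \<rho>(1)[OF that] Q0 by (simp add: mult_left_mono)
 have grow: "1 / y r + (Q * \<theta> - 1) * (t - r) <= 1 / y t" if "t <= 0" "r <= t" for r t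
 proof -
  have "1 / y r - (Q * \<theta> - 1) * r <= 1 / y t - (Q * \<theta> - 1) * t"
  proof (rule DERIV_nonneg_imp_nondecreasing[where f="%t. 1 / y t - (Q * \<theta> - 1) * t", OF that(2)])
   fix s assume "r <= s" "s <= t"
   then have s: "s <= 0" using that by simp
   have "((%t. 1 / y t - (Q * \<theta> - 1) * t) has_real_derivative (Q * \<rho> s - 1) - (Q * \<theta> - 1)) (at s)"
    by (rule derivative_eq_intros dy[OF s] refl | simp)+
   then show "\<exists>D. ((%t. 1 / y t - (Q * \<theta> - 1) * t) has_real_derivative D) (at s) \<and> 0 <= D"
    using slope[OF s] by (intro exI conjI) auto
  qed
  then show ?thesis by (simp add: algebra_simps)
 qed
 have anti: "y t < y r" if "t <= 0" "r < t" for r t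
 proof -
  have "0 < (Q * \<theta> - 1) * (t - r)" using that Q\<theta> by simp
  then have "1 / y r < 1 / y t" using grow[of t r] that by linarith
  then show ?thesis using yn(1)[of r] yn(1)[of t] that by (simp add: field_simps)
 qed
 have ytop: "filterlim (%t. - (1 / y t)) at_top at_bot"
 proof (rule filterlim_at_top_mono)
  have "filterlim (%t. - (1 / y 0) + (Q * \<theta> - 1) * (- t)) at_top at_bot" using Q\<theta>
   by (intro filterlim_tendsto_add_at_top[OF tendsto_const] filterlim_tendsto_pos_mult_at_top[OF tendsto_const _ filterlim_uminus_at_top_at_bot]) auto
  then show "filterlim (%t. - (1 / y 0) + (Q * \<theta> - 1) * (- t)) at_top at_bot" .
  show "\<forall>\<^sub>F t in at_bot. - (1 / y 0) + (Q * \<theta> - 1) * (- t) <= - (1 / y t)"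
   using eventually_le_at_bot[of 0] by eventually_elim (use grow[of 0] in force)
 qed
 have y0: "(y \<longlongrightarrow> 0) at_bot"
  using tendsto_minus[OF tendsto_inverse_0_at_top[OF ytop]] by simp
 have "((%t. x t - 1) \<longlongrightarrow> 0) at_bot"
 proof (rule Lim_null_comparison)
  show "((%t. - y t / a) \<longlongrightarrow> 0) at_bot" using tendsto_divide[OF tendsto_minus[OF y0] tendsto_const, of a] a by simp
  show "\<forall>\<^sub>F t in at_bot. norm (x t - 1) <= - y t / a"
   using eventually_le_at_bot[of 0]
  proof eventually_elim
   case (elim t) then show ?case using tr(2)[OF elim] xb[OF elim] by simp
  qed
 qed
 then have x1: "(x \<longlongrightarrow> 1) at_bot" by (simp add: LIM_zero_iff)
 have "((%t. \<rho> t - 1 / a) \<longlongrightarrow> 0) at_bot"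
 proof (rule damped_bounded_tendsto_0_at_bot[of 0 _ x "%t. \<rho> t * (Q * \<rho> t - 1) * y t" 1 "1 / a"])
  fix t :: real assume t: "t <= 0"
  show "((%t. \<rho> t - 1 / a) has_real_derivative - x t * (\<rho> t - 1 / a) + \<rho> t * (Q * \<rho> t - 1) * y t) (at t)"
   using DERIV_diff[OF d\<rho>[OF t] DERIV_const[of "1 / a"]] by simp
  show "1 <= x t" by (rule xb[OF t])
  show "\<bar>\<rho> t - 1 / a\<bar> <= 1 / a" using \<rho>[OF t] pos by linarith
 next
  have l0: "((%t. 1 / a * (Q * (1 / a) - 1) * - y t) \<longlongrightarrow> 0) at_bot"
   using tendsto_minus[OF y0] by (intro tendsto_mult_right_zero) simp
  show "((%t. \<rho> t * (Q * \<rho> t - 1) * y t) \<longlongrightarrow> 0) at_bot"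
  proof (rule Lim_null_comparison[OF _ l0])
   show "\<forall>\<^sub>F t in at_bot. norm (\<rho> t * (Q * \<rho> t - 1) * y t) <= 1 / a * (Q * (1 / a) - 1) * - y t"
    using eventually_le_at_bot[of 0]
   proof eventually_elim
    case (elim t)
    have "0 <= Q * \<rho> t - 1" using slope[OF elim] Q\<theta> by linarith
    moreover have "Q * \<rho> t - 1 <= Q * (1 / a) - 1" using mult_left_mono[OF \<rho>(2)[OF elim], of Q] Q0 by simp
    moreover have "0 <= \<rho> t" using \<rho>[OF elim] pos by linarith
    ultimately have m: "\<rho> t * (Q * \<rho> t - 1) <= 1 / a * (Q * (1 / a) - 1)" "0 <= \<rho> t * (Q * \<rho> t - 1)"
     using \<rho>[OF elim] a by (auto intro!: mult_mono simp del: times_divide_eq_left times_divide_eq_right)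
    have "norm (\<rho> t * (Q * \<rho> t - 1) * y t) = \<rho> t * (Q * \<rho> t - 1) * - y t"
     unfolding real_norm_def abs_mult[of "\<rho> t * (Q * \<rho> t - 1)"] abs_of_nonneg[OF m(2)] abs_of_neg[OF yn(1)[OF elim]] ..
    also have "\<dots> <= 1 / a * (Q * (1 / a) - 1) * - y t"
     by (rule mult_right_mono[OF m(1)]) (use yn(1)[OF elim] in simp)
    finally show ?case .
   qed
  qed
 qed auto
 then have "(\<rho> \<longlongrightarrow> 1 / a) at_bot" by (simp add: LIM_zero_iff)
 then have "((%t. Q * \<rho> t - 1) \<longlongrightarrow> Q * (1 / a) - 1) at_bot" by (intro tendsto_intros)
 then have sl: "((%t. Q * \<rho> (- t) - 1) \<longlongrightarrow> Q * (1 / a) - 1) at_top" unfolding filterlim_at_bot_mirror .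
 have "((%t. - (1 / y (- t)) / t) \<longlongrightarrow> Q * (1 / a) - 1) at_top"
 proof (rule linear_growth_from_slope[OF _ sl])
  fix t :: real assume t: "t >= 0"
  have m: "(uminus has_real_derivative - 1) (at t)" by (rule derivative_eq_intros refl)+
  have "- t <= 0" using t by simp
  from DERIV_minus[OF DERIV_chain2[OF dy[OF this] m]]
  show "((%t. - (1 / y (- t))) has_real_derivative Q * \<rho> (- t) - 1) (at t)" by simp
 qed
 then have "((%t. 1 / y t / t) \<longlongrightarrow> Q * (1 / a) - 1) at_bot" unfolding filterlim_at_bot_mirror by simp
 then have "((%t. y t * t) \<longlongrightarrow> a / (Q - a)) at_bot" by (intro cesaro_inverse) simp
 moreover have "strict_antimono_on {..0} y" using anti by (auto simp: monotone_on_def)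
 moreover have "\<forall>t\<le>0. lv x y t \<and> x t > 0 \<and> y t < 0" using lv xb yn(1) by (metis less_le_trans zero_less_one)
 ultimately show ?thesis using x1 by blast
qed

end

section \<open>Scalar differential inequalities\<close>

lemma decreasing_where_positive:
 fixes H :: "real => real"
 assumes H: "!!t. t <= r ==> (H has_real_derivative H' t) (at t)" and H': "!!t. t <= r ==> H t > 0 ==> H' t < 0"
  and pos: "H r > 0" and s: "s <= r"
 shows "H r <= H s"
proof -
 have "continuous_on {s..r} H"
  by (intro continuous_at_imp_continuous_on ballI DERIV_isCont[OF H]) auto
 then obtain x where x: "x \<in> {s..r}" "!!t. t \<in> {s..r} ==> H t <= H x"
  using continuous_attains_sup[of "{s..r}" H] s by auto
 have "H x > 0" using x(2)[of r] pos s by simp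
 then have neg: "H' x < 0" using H' x(1) by simp
 have "x = s"
 proof (rule ccontr)
  assume "x ~= s"
  then have xs: "x > s" using x(1) by simp
  have "x <= r" using x(1) by simp
  from DERIV_neg_dec_left[OF H[OF this] neg] obtain d where d: "d > 0" "!!h. 0 < h ==> h < d ==> H x < H (x - h)"
   by auto
  define h where "h = min (d / 2) (x - s)"
  have h: "0 < h" "h < d" "h <= x - s" using d xs by (auto simp: h_def)
  then have "H x < H (x - h)" using d by simp
  moreover have "H (x - h) <= H x" using h x(1) by (intro x(2)) auto
  ultimately show False by simp
 qed
 then show ?thesis using x(2)[of r] s by simp
qed

text \<open>The component \<open>u\<close> relaxes towards \<open>c w\<close> while \<open>w\<close> is nearly constant near \<open>- \<infinity>\<close>. Backwards in time
 \<open>u - c w\<close> would grow, so a pair that tends to zero has \<open>|u| \<le> 2 c |w|\<close>; then \<open>w\<close> varies too little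
 to tend to zero.\<close>

lemma vanishing_pair:
 fixes u w :: "real => real"
 assumes u: "!!t. t <= T ==> (u has_real_derivative - b t * (u t - c * w t)) (at t)"
  and w: "!!t. t <= T ==> (w has_real_derivative w' t) (at t)"
  and b: "!!t. t <= T ==> b0 <= b t" and b0: "b0 > 0" and c: "c > 0"
  and w': "!!t. t <= T ==> \<bar>w' t\<bar> <= M * exp (l * t) * (\<bar>u t\<bar> + \<bar>w t\<bar>)" and l: "l > 0" and M: "M >= 0"
  and lim: "(u \<longlongrightarrow> 0) at_bot" "(w \<longlongrightarrow> 0) at_bot"
 shows "\<exists>T1\<le>T. \<forall>t\<le>T1. u t = 0 \<and> w t = 0"
proof -
 have "((%t. M * exp (l * t) * (4 * c + 2)) \<longlongrightarrow> M * 0 * (4 * c + 2)) at_bot"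
  by (intro tendsto_intros exp_decay_at_bot l)
 then have "\<forall>\<^sub>F t in at_bot. M * exp (l * t) * (4 * c + 2) < b0" using b0 by (intro order_tendstoD(2)) auto
 then obtain T0 where T0: "!!t. t <= T0 ==> M * exp (l * t) * (4 * c + 2) < b0"
  by (auto simp: eventually_at_bot_linorder)
 define T1 where "T1 = min T0 T"
 define H where "H = (%t. (u t)\<^sup>2 - 4 * c\<^sup>2 * (w t)\<^sup>2)"
 define H' where "H' = (%t. 2 * u t * (- b t * (u t - c * w t)) - 4 * c\<^sup>2 * (2 * w t * w' t))"
 have Hd: "(H has_real_derivative H' t) (at t)" if "t <= T1" for t
 proof -
  have "t <= T" using that by (simp add: T1_def)
  show ?thesis unfolding H_def H'_def
   by (rule derivative_eq_intros u[OF \<open>t <= T\<close>] w[OF \<open>t <= T\<close>] refl | simp)+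
 qed
 have le: "2 * c * \<bar>w t\<bar> <= \<bar>u t\<bar>" if "H t >= 0" for t
 proof -
  have "(2 * c * \<bar>w t\<bar>)\<^sup>2 <= \<bar>u t\<bar>\<^sup>2" using that by (simp add: H_def power_mult_distrib)
  then show ?thesis by (rule power2_le_imp_le) simp
 qed
 have neg: "H' t < 0" if t: "t <= T1" and H: "H t > 0" for t
 proof -
  have tT: "t <= T" "t <= T0" using t by (auto simp: T1_def)
  define U where "U = \<bar>u t\<bar>"
  define g where "g = M * exp (l * t)"
  have g: "g >= 0" "g * (4 * c + 2) < b0" using M T0[OF tT(2)] by (auto simp: g_def)
  have cw: "2 * c * \<bar>w t\<bar> <= U" using le[of t] H by (simp add: U_def)
  have U: "U > 0"
  proof (rule ccontr)
   assume "\<not> U > 0"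
   then have "u t = 0" by (simp add: U_def)
   then show False using H by (simp add: H_def) (smt (verit) mult_nonneg_nonneg zero_le_power2)
  qed
  have "2 * (u t * (c * w t)) <= U * U"
  proof -
   have "u t * (c * w t) <= U * (c * \<bar>w t\<bar>)"
    using abs_ge_self[of "u t * (c * w t)"] c by (simp add: abs_mult U_def)
   moreover have "U * (2 * c * \<bar>w t\<bar>) <= U * U" using cw U by (intro mult_left_mono) auto
   ultimately show ?thesis by simp
  qed
  then have "U * U <= 2 * (u t * (u t - c * w t))" by (simp add: U_def right_diff_distrib)
  then have "b t * (U * U) <= b t * (2 * (u t * (u t - c * w t)))"
   using b[OF tT(1)] b0 by (intro mult_left_mono) auto
  moreover have "b0 * (U * U) <= b t * (U * U)" using b[OF tT(1)] by (intro mult_right_mono) auto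
  ultimately have 1: "b0 * (U * U) <= b t * (2 * (u t * (u t - c * w t)))" by simp
  have "\<bar>w' t\<bar> <= g * (U + \<bar>w t\<bar>)" using w'[OF tT(1)] by (simp add: g_def U_def)
  have 2: "\<bar>4 * c\<^sup>2 * (2 * w t * w' t)\<bar> <= g * (4 * c + 2) * (U * U)"
  proof -
   have "\<bar>4 * c\<^sup>2 * (2 * w t * w' t)\<bar> = 4 * c * (2 * c * \<bar>w t\<bar>) * \<bar>w' t\<bar>"
    using c by (simp add: abs_mult power2_eq_square)
   also have "\<dots> <= 4 * c * U * \<bar>w' t\<bar>" using cw c by (intro mult_right_mono mult_left_mono) auto
   also have "\<dots> <= 4 * c * U * (g * (U + \<bar>w t\<bar>))"
    using \<open>\<bar>w' t\<bar> <= g * (U + \<bar>w t\<bar>)\<close> c U by (intro mult_left_mono) auto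
   also have "\<dots> = g * (4 * c * U * U + 2 * U * (2 * c * \<bar>w t\<bar>))" by (simp add: algebra_simps)
   also have "\<dots> <= g * (4 * c * U * U + 2 * U * U)"
    using cw U g by (intro mult_left_mono add_left_mono) auto
   finally show ?thesis by (simp add: algebra_simps)
  qed
  have "g * (4 * c + 2) * (U * U) < b0 * (U * U)" using g U by (intro mult_strict_right_mono) auto
  moreover have "H' t = - (b t * (2 * (u t * (u t - c * w t)))) - 4 * c\<^sup>2 * (2 * w t * w' t)"
   by (simp add: H'_def algebra_simps)
  ultimately show ?thesis using 1 2 by linarith
 qed
 have H0: "(H \<longlongrightarrow> 0\<^sup>2 - 4 * c\<^sup>2 * 0\<^sup>2) at_bot" unfolding H_def by (intro tendsto_intros lim)
 have Hle: "H t <= 0" if t: "t <= T1" for t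
 proof (rule ccontr)
  assume "\<not> H t <= 0"
  then have pos: "H t > 0" by simp
  have "\<forall>\<^sub>F s in at_bot. H t <= H s"
   using eventually_le_at_bot[of t]
   by eventually_elim (rule decreasing_where_positive[OF Hd neg pos], use t in auto)
  then have "H t <= 0" using tendsto_lowerbound[OF H0] by simp
  then show False using pos by simp
 qed
 have uw: "\<bar>u t\<bar> <= 2 * c * \<bar>w t\<bar>" if "t <= T1" for t
 proof -
  have "\<bar>u t\<bar>\<^sup>2 <= (2 * c * \<bar>w t\<bar>)\<^sup>2" using Hle[OF that] by (simp add: H_def power_mult_distrib)
  then show ?thesis by (rule power2_le_imp_le) (use c in simp)
 qed
 define k where "k = 2 * (M * (2 * c + 1))"
 define Z where "Z = (%t. (w t)\<^sup>2 * exp (- (k / l * exp (l * t))))"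
 have dec: "Z t <= Z s" if "s <= t" "t <= T1" for s t
 proof (rule DERIV_nonpos_imp_nonincreasing[OF that(1)])
  fix r assume r: "s <= r" "r <= t"
  then have rT: "r <= T" "r <= T1" using that by (auto simp: T1_def)
  have "(Z has_real_derivative exp (- (k / l * exp (l * r))) * (2 * w r * w' r - k * exp (l * r) * (w r)\<^sup>2)) (at r)"
   unfolding Z_def
   by (rule derivative_eq_intros w[OF rT(1)] refl | use l in \<open>simp add: algebra_simps power2_eq_square\<close>)+
  moreover have "2 * w r * w' r - k * exp (l * r) * (w r)\<^sup>2 <= 0"
  proof -
   have "\<bar>w' r\<bar> <= M * exp (l * r) * (\<bar>u r\<bar> + \<bar>w r\<bar>)" by (rule w'[OF rT(1)])
   also have "\<dots> <= M * exp (l * r) * ((2 * c + 1) * \<bar>w r\<bar>)"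
    using uw[OF rT(2)] M by (intro mult_left_mono) (auto simp: algebra_simps)
   finally have "\<bar>w r\<bar> * \<bar>w' r\<bar> <= \<bar>w r\<bar> * (M * exp (l * r) * ((2 * c + 1) * \<bar>w r\<bar>))"
    by (rule mult_left_mono) simp
   also have "\<dots> = M * exp (l * r) * (2 * c + 1) * (w r)\<^sup>2"
    by (simp add: power2_eq_square)
   finally have "\<bar>w r * w' r\<bar> <= M * exp (l * r) * (2 * c + 1) * (w r)\<^sup>2" by (simp add: abs_mult)
   then have "w r * w' r <= M * exp (l * r) * (2 * c + 1) * (w r)\<^sup>2" by linarith
   then show ?thesis by (simp add: k_def algebra_simps)
  qed
  ultimately show "\<exists>D. (Z has_real_derivative D) (at r) \<and> D <= 0" by (meson exp_ge_zero mult_nonneg_nonpos)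
 qed
 have "((%t. (w t)\<^sup>2 * exp (- (k / l * exp (l * t)))) \<longlongrightarrow> 0\<^sup>2 * exp (- (k / l * 0))) at_bot"
  by (intro tendsto_intros lim exp_decay_at_bot l)
 then have Z0: "(Z \<longlongrightarrow> 0) at_bot" by (simp add: Z_def)
 have wz: "w t = 0" if "t <= T1" for t
 proof -
  have "\<forall>\<^sub>F s in at_bot. Z t <= Z s" using eventually_le_at_bot[of t] by eventually_elim (rule dec[OF _ that])
  then have "Z t <= 0" by (rule tendsto_lowerbound[OF Z0]) simp
  then show ?thesis by (simp add: Z_def mult_le_0_iff not_le[symmetric])
 qed
 then have "u t = 0 \<and> w t = 0" if "t <= T1" for t using uw[OF that] that by simp
 then show ?thesis by (intro exI[of _ T1]) (auto simp: T1_def)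
qed

lemma exp_difference: "\<exists>b. exp x - exp y = b * (x - y) \<and> min (exp x) (exp y) <= b \<and> b <= max (exp x) (exp (y::real))"
proof -
 have *: "\<exists>b. exp x - exp y = b * (x - y) \<and> exp y <= b \<and> b <= exp x" if "y < x" for x y :: real
 proof -
  have "\<exists>z>y. z < x \<and> exp x - exp y = (x - y) * exp z" by (rule MVT2[OF that]) (rule DERIV_exp)
  then obtain z where z: "z > y" "z < x" "exp x - exp y = (x - y) * exp z" by blast
  then show ?thesis by (intro exI[of _ "exp z"]) (auto simp: mult.commute)
 qed
 consider "x = y" | "y < x" | "x < y" by linarith
 then show ?thesis
 proof cases
  case 1 then show ?thesis by auto
 next
  case 2 then show ?thesis using *[OF 2] by auto
 next
  case 3
  then obtain b where "exp y - exp x = b * (y - x)" "exp x <= b" "b <= exp y" using *[OF 3] by auto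
  then show ?thesis by (intro exI[of _ b]) (auto simp: algebra_simps)
 qed
qed

text \<open>Superlinear growth of \<open>X + Y\<close> leads to blow-up in finite time.\<close>

lemma finite_time_blow_up:
 fixes X Y :: "real => real"
 assumes pos: "!!t. t >= T ==> X t > 0" "!!t. t >= T ==> Y t > 0"
  and A: "!!t. t >= T ==> ((%t. ln (X t) + ln (Y t) / a) has_real_derivative \<alpha> + c * X t) (at t)"
  and B: "!!t. t >= T ==> ((%t. q * ln (X t) + ln (Y t)) has_real_derivative \<alpha>' + c * Y t) (at t)"
  and a: "a > 0" and q: "q > 0" and c: "c > 0" and \<alpha>: "\<alpha> > 0 \<or> \<alpha>' > 0"
 shows False
proof -
 define n where "n = (1 + q) + (1 + 1 / a)"
 have n: "n > 0" using a q by (simp add: n_def add_pos_pos)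
 define S where "S = (%t. (ln (X t) + ln (Y t) / a) + (q * ln (X t) + ln (Y t)))"
 have S: "(S has_real_derivative (\<alpha> + \<alpha>') + c * (X t + Y t)) (at t)" if "t >= T" for t
  unfolding S_def by (rule DERIV_cong[OF DERIV_add[OF A[OF that] B[OF that]]]) (simp add: algebra_simps)
 have lnle: "ln (X t) <= ln (X t + Y t)" "ln (Y t) <= ln (X t + Y t)" if "t >= T" for t
  using pos[OF that] by auto
 have bA: "ln (X t) + ln (Y t) / a <= (1 + 1 / a) * ln (X t + Y t)" if "t >= T" for t
  using lnle[OF that] divide_right_mono[OF lnle(2)[OF that], of a] a by (simp add: algebra_simps add_divide_distrib)
 have bB: "q * ln (X t) + ln (Y t) <= (1 + q) * ln (X t + Y t)" if "t >= T" for t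
 proof -
  have "q * ln (X t) <= q * ln (X t + Y t)" using lnle(1)[OF that] q by (intro mult_left_mono) auto
  then show ?thesis using lnle(2)[OF that] by (simp add: distrib_right)
 qed
 have bS: "exp (S t / n) <= X t + Y t" if "t >= T" for t
 proof -
  have "S t <= n * ln (X t + Y t)" using bA[OF that] bB[OF that] by (simp add: S_def n_def algebra_simps)
  then have "S t / n <= ln (X t + Y t)" using n by (simp add: divide_le_eq mult.commute)
  then have "exp (S t / n) <= exp (ln (X t + Y t))" by simp
  then show ?thesis using pos[OF that] by simp
 qed
 have grow: "f T + \<gamma> * (t - T) <= f t" if "t >= T" "!!t. t >= T ==> (f has_real_derivative \<gamma> + c * g t) (at t)" "!!t. t >= T ==> g t > 0"
  for f g :: "real => real" and \<gamma> t
 proof -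
  have "f T - \<gamma> * T <= f t - \<gamma> * t"
  proof (rule DERIV_nonneg_imp_nondecreasing[where f="%t. f t - \<gamma> * t", OF that(1)])
   fix s assume s: "T <= s" "s <= t"
   have "((%t. f t - \<gamma> * t) has_real_derivative (\<gamma> + c * g s) - \<gamma>) (at s)"
    by (rule derivative_eq_intros that(2)[OF s(1)] refl | simp)+
   then show "\<exists>D. ((%t. f t - \<gamma> * t) has_real_derivative D) (at s) \<and> 0 <= D"
    using that(3)[OF s(1)] c by (intro exI conjI) auto
  qed
  then show ?thesis by (simp add: algebra_simps)
 qed
 have "\<exists>k m. k > 0 \<and> (\<forall>t\<ge>T. m + k * (t - T) <= ln (X t + Y t))"
  using \<alpha>
 proof
  assume \<alpha>: "\<alpha> > 0"
  define i where "i = 1 + 1 / a"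
  have i: "i > 0" using a by (simp add: i_def add_pos_pos)
  have "(ln (X T) + ln (Y T) / a) / i + \<alpha> / i * (t - T) <= ln (X t + Y t)" if t: "t >= T" for t
  proof -
   have "((ln (X T) + ln (Y T) / a) + \<alpha> * (t - T)) / i <= ln (X t + Y t)"
    using order_trans[OF grow[OF t A pos(1)] bA[OF t]] i by (simp add: divide_le_eq i_def mult.commute)
   then show ?thesis by (simp add: add_divide_distrib)
  qed
  then show ?thesis using i \<alpha> by (intro exI[of _ "\<alpha> / i"] exI) auto
 next
  assume \<alpha>: "\<alpha>' > 0"
  define i where "i = 1 + q"
  have i: "i > 0" using q by (simp add: i_def)
  have "(q * ln (X T) + ln (Y T)) / i + \<alpha>' / i * (t - T) <= ln (X t + Y t)" if t: "t >= T" for t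
  proof -
   have "((q * ln (X T) + ln (Y T)) + \<alpha>' * (t - T)) / i <= ln (X t + Y t)"
    using order_trans[OF grow[OF t B pos(2)] bB[OF t]] i by (simp add: divide_le_eq i_def mult.commute)
   then show ?thesis by (simp add: add_divide_distrib)
  qed
  then show ?thesis using i \<alpha> by (intro exI[of _ "\<alpha>' / i"] exI) auto
 qed
 then obtain k m where k: "k > 0" "!!t. t >= T ==> m + k * (t - T) <= ln (X t + Y t)" by blast
 define Z0 where "Z0 = max 1 (- (2 * (\<alpha> + \<alpha>') / c))"
 define T1 where "T1 = T + max 0 ((ln Z0 - m) / k)"
 have big: "X t + Y t >= Z0" "t >= T" if t: "t >= T1" for t
 proof -
  show tT: "t >= T" using t by (simp add: T1_def)
  have "(ln Z0 - m) / k <= t - T" using t by (simp add: T1_def)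
  then have "ln Z0 - m <= (t - T) * k" using pos_divide_le_eq[OF k(1)] by blast
  then have "ln Z0 <= m + k * (t - T)" by (simp add: mult.commute)
  then have "ln Z0 <= ln (X t + Y t)" using k(2)[OF tT] by linarith
  then show "X t + Y t >= Z0" using pos[OF tT] by (subst (asm) ln_le_cancel_iff) (auto simp: Z0_def)
 qed
 have Srate: "c / 2 * exp (S t / n) <= (\<alpha> + \<alpha>') + c * (X t + Y t)" if t: "t >= T1" for t
 proof -
  have "- (2 * (\<alpha> + \<alpha>') / c) <= X t + Y t" using big(1)[OF t] by (simp add: Z0_def)
  then have "- (2 * (\<alpha> + \<alpha>')) <= c * (X t + Y t)" using c by (simp add: minus_divide_left divide_le_eq mult.commute)
  moreover have "c * exp (S t / n) <= c * (X t + Y t)" using bS[OF big(2)[OF t]] c by (intro mult_left_mono) auto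
  ultimately show ?thesis by simp
 qed
 define E where "E = (%t. exp (- (S t / n)))"
 have Edec: "E t + c / (2 * n) * t <= E T1 + c / (2 * n) * T1" if t: "t >= T1" for t
 proof (rule DERIV_nonpos_imp_nonincreasing[where f="%t. E t + c / (2 * n) * t", OF t])
  fix s assume s: "T1 <= s" "s <= t"
  have "((%t. E t + c / (2 * n) * t) has_real_derivative
    - (((\<alpha> + \<alpha>') + c * (X s + Y s)) / n * E s) + c / (2 * n)) (at s)"
   unfolding E_def by (rule derivative_eq_intros S[OF big(2)[OF s(1)]] refl | use n in simp)+
  moreover have "c / (2 * n) <= ((\<alpha> + \<alpha>') + c * (X s + Y s)) / n * E s"
  proof -
   have "c / (2 * n) = (c / 2 * exp (S s / n)) / n * E s" by (simp add: E_def exp_minus)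
   also have "\<dots> <= ((\<alpha> + \<alpha>') + c * (X s + Y s)) / n * E s"
    using Srate[OF s(1)] n by (intro mult_right_mono divide_right_mono) (auto simp: E_def)
   finally show ?thesis .
  qed
  ultimately show "\<exists>D. ((%t. E t + c / (2 * n) * t) has_real_derivative D) (at s) \<and> D <= 0"
   by (intro exI conjI) auto
 qed
 define t where "t = T1 + 2 * n * E T1 / c + 1"
 have tt: "t >= T1" using n c by (simp add: t_def E_def)
 have "c / (2 * n) * (t - T1) = E T1 + c / (2 * n)" using n c by (simp add: t_def field_simps)
 then have "E t <= - (c / (2 * n))" using Edec[OF tt] by (simp add: right_diff_distrib)
 moreover have "c / (2 * n) > 0" using n c by simp
 moreover have "E t > 0" by (simp add: E_def)
 ultimately show False by linarith
qed

section \<open>The logarithmic form of the equation\<close>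

locale emden_fowler = lotka_volterra +
 fixes K :: real
 assumes K: "K > 0"
begin

text \<open>The inverse of \<open>x \<mapsto> |x|\<^sup>a\<^sup>-\<^sup>1 x\<close>.\<close>

definition psi :: "real => real" where
 "psi x = sgn x * \<bar>x\<bar> powr (1 / a)"

lemma psi_pos: "x > 0 ==> psi x = x powr (1 / a)"
 by (simp add: psi_def)

lemma psi_sgn: "sgn (psi x) = sgn x"
 by (auto simp: psi_def sgn_real_def)

lemma psi_pos_iff: "psi x > 0 \<longleftrightarrow> x > 0"
 using psi_sgn[of x] by (auto simp: sgn_real_def split: if_splits)

lemma psi_minus: "psi (- x) = - psi x"
 by (simp add: psi_def sgn_minus)

lemma psi_mult: "c > 0 ==> psi (c * x) = c powr (1 / a) * psi x"
 by (simp add: psi_def sgn_mult abs_mult powr_mult)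

lemma psi_mono: "x < y ==> psi x < psi y"
proof -
 assume xy: "x < y"
 have pos: "psi x < psi y" if "0 <= x" "x < y" for x y
  using that a by (cases "x = 0") (auto simp: psi_def intro!: powr_less_mono2)
 show ?thesis
 proof (cases "0 <= x")
  case False
  show ?thesis
  proof (cases "0 < y")
   case True
   then have "psi y > 0" "\<not> psi x > 0" using False by (auto simp: psi_pos_iff)
   then show ?thesis by linarith
  next
   case False
   then have "psi (- y) < psi (- x)" using xy by (intro pos) auto
   then show ?thesis by (simp add: psi_minus)
  qed
 qed (use pos xy in auto)
qed

lemma psi_mono_le: "x <= y ==> psi x <= psi y"
 using psi_mono[of x y] by (cases "x = y") auto

lemma psi_eq: "psi (\<bar>d\<bar> powr (a - 1) * d) = d"
proof (cases "d = 0")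
 case False
 have "\<bar>\<bar>d\<bar> powr (a - 1) * d\<bar> = \<bar>d\<bar> powr a"
  using False by (simp add: abs_mult powr_mult_base[symmetric] powr_add[symmetric] powr_diff)
 then show ?thesis using False a by (simp add: psi_def powr_powr sgn_mult sgn_mult_abs)
qed (simp add: psi_def)

lemma psi_derivative:
 assumes f: "(f has_real_derivative f') (at t)" and ft: "f t ~= 0"
 shows "((%t. psi (f t)) has_real_derivative psi (f t) * (f' / (a * f t))) (at t)"
proof -
 have *: "((%t. psi (f t)) has_real_derivative psi (f t) * (f' / (a * f t))) (at t)"
  if f: "(f has_real_derivative f') (at t)" and ft: "f t > 0" for f f'
 proof -
  have "((%t. f t powr (1 / a)) has_real_derivative f t powr (1 / a) * (f' / (a * f t))) (at t)"
   by (rule DERIV_cong[OF DERIV_powr[OF f ft DERIV_const]]) simp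
  moreover have "\<forall>\<^sub>F s in nhds t. psi (f s) = f s powr (1 / a)"
  proof -
   have "isCont f t" using f by (rule DERIV_isCont)
   then have "\<forall>\<^sub>F s in nhds t. f s > 0"
    using ft by (auto simp: isCont_def tendsto_at_iff_tendsto_nhds dest: order_tendstoD(1))
   then show ?thesis by eventually_elim (rule psi_pos)
  qed
  ultimately show ?thesis using ft by (subst DERIV_cong_ev[OF refl _ refl]) (auto simp: psi_pos)
 qed
 show ?thesis
 proof (cases "f t > 0")
  case False
  then have "- f t > 0" using ft by simp
  from *[OF DERIV_minus[OF f] this] have
   "((%t. - psi (f t)) has_real_derivative - (psi (f t) * (f' / (a * f t)))) (at t)"
   by (simp add: psi_minus)
  from DERIV_minus[OF this] show ?thesis by simp
 qed (use * f in auto)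
qed

text \<open>With \<open>t = ln s\<close>, \<open>s\<close> being the power of \<open>r\<close> that is harmonic for the \<open>p\<close>-Laplacian, \<open>V\<close> is the solution and
 \<open>\<Phi>\<close> its flux.\<close>

definition ef :: "real => (real => real) => (real => real) => real => bool" where
 "ef \<epsilon> V \<Phi> t \<longleftrightarrow> V t > 0 \<and> (V has_real_derivative exp t * psi (\<Phi> t)) (at t) \<and>
   (\<Phi> has_real_derivative - \<epsilon> * K * exp (- (Q * t)) * V t powr q) (at t)"

definition lvX :: "(real => real) => (real => real) => real => real" where
 "lvX V \<Phi> t = exp t * psi (\<Phi> t) / V t"

definition lvY :: "real => (real => real) => (real => real) => real => real" where
 "lvY \<epsilon> V \<Phi> t = \<epsilon> * K * exp (- (Q * t)) * V t powr q / \<Phi> t"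

lemma ef_derivatives:
 assumes e: "ef \<epsilon> V \<Phi> t" and \<Phi>: "\<Phi> t ~= 0"
 shows "(V has_real_derivative V t * lvX V \<Phi> t) (at t)"
  "(\<Phi> has_real_derivative - (\<Phi> t * lvY \<epsilon> V \<Phi> t)) (at t)"
 using e \<Phi> by (auto simp: ef_def lvX_def lvY_def)

lemma ef_imp_lv:
 assumes e: "ef \<epsilon> V \<Phi> t" and \<Phi>: "\<Phi> t ~= 0"
 shows "lv (lvX V \<Phi>) (lvY \<epsilon> V \<Phi>) t"
proof -
 note d = ef_derivatives[OF assms]
 have V: "V t > 0" using e by (simp add: ef_def)
 define X Y where "X = lvX V \<Phi> t" and "Y = lvY \<epsilon> V \<Phi> t"
 have dX: "(lvX V \<Phi> has_real_derivative X * (1 - X - Y / a)) (at t)"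
 proof -
  have dpsi: "((%t. psi (\<Phi> t)) has_real_derivative psi (\<Phi> t) * (- Y / a)) (at t)"
   by (rule DERIV_cong[OF psi_derivative[OF d(2) \<Phi>]]) (use \<Phi> a in \<open>simp add: Y_def\<close>)
  have "((%t. exp t * psi (\<Phi> t) / V t) has_real_derivative
    ((exp t * psi (\<Phi> t) + psi (\<Phi> t) * (- Y / a) * exp t) * V t - exp t * psi (\<Phi> t) * (V t * X)) / (V t * V t)) (at t)"
   using DERIV_divide[OF DERIV_mult[OF DERIV_exp dpsi] d(1)] V by (simp add: X_def)
  moreover have "((exp t * psi (\<Phi> t) + psi (\<Phi> t) * (- Y / a) * exp t) * V t - exp t * psi (\<Phi> t) * (V t * X)) / (V t * V t)
    = exp t * psi (\<Phi> t) / V t * (1 - X - Y / a)" using V a by (simp add: field_simps)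
  ultimately show ?thesis unfolding lvX_def[abs_def] X_def by (simp add: lvX_def)
 qed
 have dY: "(lvY \<epsilon> V \<Phi> has_real_derivative Y * (- Q + q * X + Y)) (at t)"
 proof -
  have dq: "((%t. V t powr q) has_real_derivative V t powr q * (q * X)) (at t)"
   by (rule DERIV_cong[OF DERIV_powr[OF d(1) V DERIV_const]]) (use V in \<open>simp add: X_def\<close>)
  have de: "((%t. \<epsilon> * K * exp (- (Q * t))) has_real_derivative \<epsilon> * K * exp (- (Q * t)) * - Q) (at t)"
   by (rule derivative_eq_intros refl | simp)+
  define N where "N = \<epsilon> * K * exp (- (Q * t)) * V t powr q"
  have "((%t. \<epsilon> * K * exp (- (Q * t)) * V t powr q / \<Phi> t) has_real_derivative
    ((\<epsilon> * K * exp (- (Q * t)) * - Q * V t powr q + V t powr q * (q * X) * (\<epsilon> * K * exp (- (Q * t)))) * \<Phi> t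
     - N * (- (\<Phi> t * Y))) / (\<Phi> t * \<Phi> t)) (at t)"
   using DERIV_divide[OF DERIV_mult[OF de dq] d(2) \<Phi>] by (simp add: Y_def N_def)
  moreover have "((\<epsilon> * K * exp (- (Q * t)) * - Q * V t powr q + V t powr q * (q * X) * (\<epsilon> * K * exp (- (Q * t)))) * \<Phi> t
     - N * (- (\<Phi> t * Y))) / (\<Phi> t * \<Phi> t) = N / \<Phi> t * (- Q + q * X + Y)"
  proof -
   have e: "\<epsilon> * K * exp (- (Q * t)) * - Q * V t powr q + V t powr q * (q * X) * (\<epsilon> * K * exp (- (Q * t))) = N * (- Q + q * X)"
    by (simp add: N_def algebra_simps)
   have "N * (- Q + q * X) * \<Phi> t - N * (- (\<Phi> t * Y)) = N * (- Q + q * X + Y) * \<Phi> t" by (simp add: algebra_simps)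
   then show ?thesis unfolding e using \<Phi> by simp
  qed
  ultimately show ?thesis unfolding lvY_def[abs_def] Y_def N_def by (simp add: lvY_def)
 qed
 show ?thesis using dX dY by (simp add: lv_def X_def Y_def)
qed

text \<open>Conversely \<open>X\<close> and \<open>Y\<close> determine the solution algebraically.\<close>

definition Vof :: "(real => real) => (real => real) => real => real" where
 "Vof x y t = (\<bar>x t\<bar> powr a * \<bar>y t\<bar> * exp ((Q - a) * t) / K) powr (1 / (q - a))"

definition Phiof :: "real => (real => real) => (real => real) => real => real" where
 "Phiof \<epsilon> x y t = \<epsilon> * K * exp (- (Q * t)) * Vof x y t powr q / y t"

lemma Vof_pos: "x t ~= 0 ==> y t ~= 0 ==> Vof x y t > 0"
 using K by (simp add: Vof_def)

lemma Vof_powr: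
 assumes "x t ~= 0" "y t ~= 0"
 shows "Vof x y t powr (q - a) = \<bar>x t\<bar> powr a * \<bar>y t\<bar> * exp ((Q - a) * t) / K"
 using assms K aq by (simp add: Vof_def powr_powr)

lemma lv_imp_ef:
 assumes lv: "lv x y t" and \<epsilon>: "\<epsilon> = 1 \<or> \<epsilon> = - 1" and pos: "\<epsilon> * (x t * y t) > 0"
 shows "ef \<epsilon> (Vof x y) (Phiof \<epsilon> x y) t" "exp t * psi (Phiof \<epsilon> x y t) = Vof x y t * x t"
proof -
 have x0: "x t ~= 0" and y0: "y t ~= 0" using pos by auto
 define V \<Phi> where "V = Vof x y t" and "\<Phi> = Phiof \<epsilon> x y t"
 have V: "V > 0" using Vof_pos[of x t y] x0 y0 by (simp add: V_def)
 have dx: "(x has_real_derivative x t * (1 - x t - y t / a)) (at t)"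
  and dy: "(y has_real_derivative y t * (- Q + q * x t + y t)) (at t)" using lv by (auto simp: lv_def)
 have dabs: "((%t. \<bar>f t\<bar>) has_real_derivative \<bar>f t\<bar> * g) (at t)"
  if "(f has_real_derivative f t * g) (at t)" "f t ~= 0" for f g
 proof -
  have ft: "(f \<longlongrightarrow> f t) (nhds t)"
   using DERIV_isCont[OF that(1)] by (simp add: isCont_def tendsto_at_iff_tendsto_nhds)
  have "\<forall>\<^sub>F s in nhds t. \<bar>f s\<bar> = sgn (f t) * f s"
  proof (cases "f t > 0")
   case True
   from order_tendstoD(1)[OF ft True] show ?thesis by eventually_elim (use True in simp)
  next
   case False
   then have n: "f t < 0" using that(2) by simp
   from order_tendstoD(2)[OF ft n] show ?thesis by eventually_elim (use n in simp)
  qed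
  moreover have "((%s. sgn (f t) * f s) has_real_derivative sgn (f t) * (f t * g)) (at t)"
   by (rule DERIV_cmult[OF that(1)])
  ultimately have "((%t. \<bar>f t\<bar>) has_real_derivative sgn (f t) * (f t * g)) (at t)"
   by (subst DERIV_cong_ev[OF refl _ refl])
  then show ?thesis by (simp add: abs_sgn mult_ac)
 qed
 define B where "B = (%t. \<bar>x t\<bar> powr a * \<bar>y t\<bar> * exp ((Q - a) * t) / K)"
 have B: "B t > 0" using x0 y0 K by (simp add: B_def)
 have dB: "(B has_real_derivative B t * ((q - a) * x t)) (at t)"
 proof -
  have d1: "((%t. \<bar>x t\<bar> powr a) has_real_derivative \<bar>x t\<bar> powr a * (a * (1 - x t - y t / a))) (at t)"
   by (rule DERIV_cong[OF DERIV_powr[OF dabs[OF dx x0] _ DERIV_const]]) (use x0 in auto)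
  have d3: "((%t. exp ((Q - a) * t)) has_real_derivative exp ((Q - a) * t) * (Q - a)) (at t)"
   by (rule derivative_eq_intros refl | simp)+
  show ?thesis unfolding B_def
   by (rule DERIV_cong[OF DERIV_cdivide[OF DERIV_mult[OF DERIV_mult[OF d1 dabs[OF dy y0]] d3]]])
     (use K a in \<open>simp add: field_simps\<close>)
 qed
 have dV: "(Vof x y has_real_derivative V * x t) (at t)"
 proof -
  have "((%t. B t powr (1 / (q - a))) has_real_derivative B t powr (1 / (q - a)) * x t) (at t)"
   by (rule DERIV_cong[OF DERIV_powr[OF dB B DERIV_const]]) (use B aq in simp)
  then show ?thesis by (simp add: Vof_def[abs_def] B_def V_def)
 qed
 have d\<Phi>: "(Phiof \<epsilon> x y has_real_derivative - \<epsilon> * K * exp (- (Q * t)) * V powr q) (at t)"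
 proof -
  have dq: "((%t. Vof x y t powr q) has_real_derivative V powr q * (q * x t)) (at t)"
   by (rule DERIV_cong[OF DERIV_powr[OF dV _ DERIV_const]]) (use V in \<open>auto simp: V_def\<close>)
  have de: "((%t. \<epsilon> * K * exp (- (Q * t))) has_real_derivative \<epsilon> * K * exp (- (Q * t)) * - Q) (at t)"
   by (rule derivative_eq_intros refl | simp)+
  define N where "N = \<epsilon> * K * exp (- (Q * t)) * V powr q"
  have "((%t. \<epsilon> * K * exp (- (Q * t)) * Vof x y t powr q / y t) has_real_derivative
    ((\<epsilon> * K * exp (- (Q * t)) * - Q * V powr q + V powr q * (q * x t) * (\<epsilon> * K * exp (- (Q * t)))) * y t
     - N * (y t * (- Q + q * x t + y t))) / (y t * y t)) (at t)"
   using DERIV_divide[OF DERIV_mult[OF de dq] dy y0] by (simp add: V_def N_def)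
  moreover have "((\<epsilon> * K * exp (- (Q * t)) * - Q * V powr q + V powr q * (q * x t) * (\<epsilon> * K * exp (- (Q * t)))) * y t
     - N * (y t * (- Q + q * x t + y t))) / (y t * y t) = - N"
  proof -
   have e: "\<epsilon> * K * exp (- (Q * t)) * - Q * V powr q + V powr q * (q * x t) * (\<epsilon> * K * exp (- (Q * t))) = N * (- Q + q * x t)"
    by (simp add: N_def algebra_simps)
   have "(N * (- Q + q * x t)) * y t - N * (y t * (- Q + q * x t + y t)) = - N * (y t * y t)"
    by (simp add: algebra_simps)
   then show ?thesis unfolding e using y0 by simp
  qed
  ultimately show ?thesis by (simp add: Phiof_def[abs_def] N_def)
 qed
 have key: "exp t * psi \<Phi> = V * x t"
 proof -
  have "\<epsilon> * \<Phi> * y t = K * exp (- (Q * t)) * V powr q" using \<epsilon> y0 by (auto simp: \<Phi>_def Phiof_def V_def)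
  then have "\<epsilon> * \<Phi> * y t > 0" using K V by simp
  then have sg: "sgn \<Phi> = sgn (x t)" using pos \<epsilon> by (auto simp: zero_less_mult_iff mult_less_0_iff sgn_real_def)
  have "\<bar>\<Phi>\<bar> = K * exp (- (Q * t)) * V powr q / \<bar>y t\<bar>" using \<epsilon> K by (auto simp: \<Phi>_def Phiof_def V_def abs_mult)
  also have "V powr q = V powr a * V powr (q - a)" by (simp flip: powr_add)
  also have "V powr (q - a) = \<bar>x t\<bar> powr a * \<bar>y t\<bar> * exp ((Q - a) * t) / K"
   unfolding V_def by (rule Vof_powr[of x t y, OF x0 y0])
  also have "K * exp (- (Q * t)) * (V powr a * (\<bar>x t\<bar> powr a * \<bar>y t\<bar> * exp ((Q - a) * t) / K)) / \<bar>y t\<bar>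
    = V powr a * \<bar>x t\<bar> powr a * (exp (- (Q * t)) * exp ((Q - a) * t))" using K y0 by (simp add: field_simps)
  also have "exp (- (Q * t)) * exp ((Q - a) * t) = exp (- t) powr a"
   by (simp add: powr_def algebra_simps flip: exp_add)
  finally have "\<bar>\<Phi>\<bar> = (V * \<bar>x t\<bar> * exp (- t)) powr a" using V by (simp add: powr_mult)
  then have "\<bar>\<Phi>\<bar> powr (1 / a) = V * \<bar>x t\<bar> * exp (- t)" using V a by (simp add: powr_powr)
  then have "psi \<Phi> = V * x t * exp (- t)"
   using mult_sgn_abs[of "x t"] unfolding psi_def sg by (metis mult.assoc mult.commute)
  then show ?thesis by (simp add: exp_minus)
 qed
 then show "exp t * psi (Phiof \<epsilon> x y t) = Vof x y t * x t" by (simp add: V_def \<Phi>_def)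
 show "ef \<epsilon> (Vof x y) (Phiof \<epsilon> x y) t"
  unfolding ef_def using V dV d\<Phi> key by (simp add: V_def \<Phi>_def)
qed

lemma lv_shift: "lv x y (t + h) ==> lv (%t. x (t + h)) (%t. y (t + h)) t"
 unfolding lv_def by (auto dest: DERIV_shift[THEN iffD1])

lemma Vof_shift:
 assumes "x (t + h) ~= 0" "y (t + h) ~= 0"
 shows "Vof (%t. x (t + h)) (%t. y (t + h)) t = exp (- (\<delta> * h)) * Vof x y (t + h)"
proof -
 have e: "(Q - a) * (t + h) + - ((Q - a) * h) = (Q - a) * t" by (simp add: algebra_simps)
 have "exp ((Q - a) * t) = exp ((Q - a) * (t + h)) * exp (- ((Q - a) * h))"
  using exp_add[of "(Q - a) * (t + h)" "- ((Q - a) * h)"] unfolding e .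
 then have "Vof (%t. x (t + h)) (%t. y (t + h)) t
   = ((\<bar>x (t + h)\<bar> powr a * \<bar>y (t + h)\<bar> * exp ((Q - a) * (t + h)) / K) * exp (- ((Q - a) * h))) powr (1 / (q - a))"
  by (simp add: Vof_def mult_ac)
 also have "\<dots> = Vof x y (t + h) * exp (- ((Q - a) * h)) powr (1 / (q - a))"
  using K by (subst powr_mult) (auto simp: Vof_def)
 also have "exp (- ((Q - a) * h)) powr (1 / (q - a)) = exp (- (\<delta> * h))"
  by (simp add: powr_def \<delta>_def)
 finally show ?thesis by simp
qed

end

section \<open>Limits of the solution along an orbit\<close>

lemma mono_bounded_tendsto:
 fixes f :: "real => real"
 assumes mono: "!!s t. t0 <= s ==> s <= t ==> f s <= f t" and bnd: "!!t. t0 <= t ==> f t <= B"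
 shows "\<exists>L. (f \<longlongrightarrow> L) at_top \<and> (\<forall>t\<ge>t0. f t <= L) \<and> L <= B"
proof -
 define L where "L = (SUP t\<in>{t0..}. f t)"
 have bdd: "bdd_above (f ` {t0..})" using bnd by (intro bdd_aboveI[of _ B]) auto
 have le: "f t <= L" if "t >= t0" for t unfolding L_def by (rule cSUP_upper[OF _ bdd]) (use that in simp)
 have "(f \<longlongrightarrow> L) at_top"
 proof (rule order_tendstoI)
  fix b assume "b < L"
  then obtain r where r: "r >= t0" "b < f r" unfolding L_def using less_cSUP_iff[OF _ bdd, of b] by auto
  show "\<forall>\<^sub>F t in at_top. b < f t"
   using eventually_ge_at_top[of r] by eventually_elim (use mono r in \<open>auto intro: less_le_trans\<close>)
 next
  fix b assume "L < b"
  then have "f t < b" if "t >= t0" for t using le[OF that] by simp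
  then show "\<forall>\<^sub>F t in at_top. f t < b"
   using eventually_ge_at_top[of t0] by (rule eventually_mono[rotated])
 qed
 moreover have "L <= B" unfolding L_def by (rule cSUP_least) (use bnd in auto)
 ultimately show ?thesis using le by blast
qed

lemma exp_bounded_slope_convergent:
 fixes f :: "real => real"
 assumes f: "!!t. t >= 0 ==> (f has_real_derivative f' t) (at t)"
  and f': "!!t. t >= 0 ==> \<bar>f' t\<bar> <= c * exp (- (l * t))" and l: "l > 0"
 shows "\<exists>L. (f \<longlongrightarrow> L) at_top"
proof -
 define E where "E = (%t. c / l * exp (- (l * t)))"
 have dE: "(E has_real_derivative - (c * exp (- (l * t)))) (at t)" for t
  unfolding E_def by (rule derivative_eq_intros refl | use l in simp)+
 have c: "c >= 0" using f'[of 0] by simp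
 have up: "f s - E s <= f t - E t" if "0 <= s" "s <= t" for s t
 proof (rule DERIV_nonneg_imp_nondecreasing[where f="%t. f t - E t", OF that(2)])
  fix r assume "s <= r" "r <= t"
  then have r: "r >= 0" using that by simp
  show "\<exists>D. ((%t. f t - E t) has_real_derivative D) (at r) \<and> 0 <= D"
   using DERIV_diff[OF f[OF r] dE] f'[OF r] by (intro exI conjI) auto
 qed
 have down: "f t + E t <= f 0 + E 0" if "0 <= t" for t
 proof (rule DERIV_nonpos_imp_nonincreasing[where f="%t. f t + E t", OF that])
  fix r :: real assume r: "0 <= r" "r <= t"
  show "\<exists>D. ((%t. f t + E t) has_real_derivative D) (at r) \<and> D <= 0"
   using DERIV_add[OF f[OF r(1)] dE] f'[OF r(1)] by (intro exI conjI) auto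
 qed
 have "f t - E t <= f 0 + E 0" if "0 <= t" for t
 proof -
  have "E t >= 0" using c l by (simp add: E_def)
  then show ?thesis using down[OF that] by linarith
 qed
 with mono_bounded_tendsto[of 0 "%t. f t - E t"] up
 obtain L where L: "((%t. f t - E t) \<longlongrightarrow> L) at_top" by blast
 have "(E \<longlongrightarrow> c / l * 0) at_top" unfolding E_def by (intro tendsto_intros exp_decay_at_top l)
 from tendsto_add[OF L this] show ?thesis by auto
qed

context emden_fowler
begin

lemma Vof_derivative:
 assumes lv: "lv x y t" and nz: "x t ~= 0" "y t ~= 0"
 shows "(Vof x y has_real_derivative Vof x y t * x t) (at t)"
proof -
 define \<epsilon> where "\<epsilon> = sgn (x t * y t)"
 have "\<epsilon> * (x t * y t) = \<bar>x t * y t\<bar>" by (simp add: \<epsilon>_def abs_sgn mult.commute)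
 then have \<epsilon>: "\<epsilon> = 1 \<or> \<epsilon> = - 1" "\<epsilon> * (x t * y t) > 0" using nz by (auto simp: \<epsilon>_def sgn_if)
 show ?thesis using lv_imp_ef[OF lv \<epsilon>] by (auto simp: ef_def)
qed

lemma ln_Vof_derivative:
 assumes lv: "lv x y t" and nz: "x t ~= 0" "y t ~= 0"
 shows "((%t. ln (Vof x y t)) has_real_derivative x t) (at t)"
 using DERIV_chain2[OF DERIV_ln_divide[OF Vof_pos[of x t y, OF nz]] Vof_derivative[OF assms]] Vof_pos[of x t y, OF nz] by simp

lemma Vof_finite_limit:
 assumes lv: "!!t. t >= 0 ==> lv x y t" and \<epsilon>: "\<epsilon> = 1 \<or> \<epsilon> = - 1"
  and x: "!!t. t >= 0 ==> 0 < \<epsilon> * x t \<and> \<epsilon> * x t <= c * exp (- (l * t))" and l: "l > 0"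
  and y: "!!t. t >= 0 ==> y t > 0"
 shows "\<exists>C>0. (Vof x y \<longlongrightarrow> C) at_top"
proof -
 have nz: "x t ~= 0" "y t ~= 0" if "t >= 0" for t using x[OF that] y[OF that] by auto
 have "\<exists>L. ((%t. ln (Vof x y t)) \<longlongrightarrow> L) at_top"
 proof (rule exp_bounded_slope_convergent[OF _ _ l])
  fix t :: real assume t: "t >= 0"
  show "((%t. ln (Vof x y t)) has_real_derivative x t) (at t)" by (rule ln_Vof_derivative[OF lv[OF t] nz[OF t]])
  show "\<bar>x t\<bar> <= c * exp (- (l * t))" using x[OF t] \<epsilon> by auto
 qed
 then obtain L where L: "((%t. ln (Vof x y t)) \<longlongrightarrow> L) at_top" by blast
 have "\<forall>\<^sub>F t in at_top. exp (ln (Vof x y t)) = Vof x y t"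
  using eventually_ge_at_top[of 0] by eventually_elim (simp add: Vof_pos nz)
 then have "(Vof x y \<longlongrightarrow> exp L) at_top" using tendsto_exp[OF L] by (rule Lim_transform_eventually[rotated])
 then show ?thesis by (intro exI[of _ "exp L"]) auto
qed

lemma Phiof_limit:
 assumes V: "(Vof x y \<longlongrightarrow> C) F" and C: "C > 0" and y: "(y \<longlongrightarrow> Q) F"
 shows "((%t. exp (Q * t) * Phiof \<epsilon> x y t) \<longlongrightarrow> \<epsilon> * (K * C powr q / Q)) F"
proof -
 have "((%t. \<epsilon> * K * Vof x y t powr q / y t) \<longlongrightarrow> \<epsilon> * K * C powr q / Q) F"
  using C a aQ by (intro tendsto_intros V y) auto
 moreover have "(%t. exp (Q * t) * Phiof \<epsilon> x y t) = (%t. \<epsilon> * K * Vof x y t powr q / y t)"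
  by (simp add: Phiof_def exp_minus field_simps)
 ultimately show ?thesis by (simp add: mult.assoc)
qed

text \<open>The logarithmic derivative of \<open>V exp (- t) x\<close> is \<open>- y / a\<close>, hence integrable.\<close>

lemma Vof_slope_derivative:
 assumes lv: "lv x y t" and nz: "x t > 0" "y t ~= 0"
 shows "((%t. ln (Vof x y t) - t + ln (x t)) has_real_derivative - y t / a) (at t)"
proof -
 have dx: "(x has_real_derivative x t * (1 - x t - y t / a)) (at t)" using lv by (simp add: lv_def)
 have nz': "x t ~= 0" using nz by simp
 show ?thesis
  by (rule DERIV_cong[OF DERIV_add[OF DERIV_diff[OF ln_Vof_derivative[OF lv nz' nz(2)] DERIV_ident]
     DERIV_chain2[OF DERIV_ln_divide[OF nz(1)] dx]]]) (use nz in simp)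
qed

lemma slope_limit_from_log:
 assumes L: "((%t. ln (V t) - t + ln (x t)) \<longlongrightarrow> L) F" and x: "(x \<longlongrightarrow> 1) F"
  and pos: "\<forall>\<^sub>F t in F. V t > 0 \<and> x t > (0::real)"
 shows "((%t. V t * exp (- t)) \<longlongrightarrow> exp L) F"
proof -
 have "((%t. exp (ln (V t) - t + ln (x t)) / x t) \<longlongrightarrow> exp L / 1) F"
  by (intro tendsto_intros L x) simp
 moreover have "\<forall>\<^sub>F t in F. exp (ln (V t) - t + ln (x t)) / x t = V t * exp (- t)"
  using pos by eventually_elim (simp add: exp_add exp_diff exp_minus field_simps)
 ultimately show ?thesis by (simp add: Lim_transform_eventually)
qed

lemma Vof_slope_limit_at_top:
 assumes lv: "!!t. t >= 0 ==> lv x y t" and \<epsilon>: "\<epsilon> = 1 \<or> \<epsilon> = - 1" and l: "l > 0"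
  and pos: "!!t. t >= 0 ==> x t > 0 \<and> 0 < \<epsilon> * y t \<and> \<epsilon> * y t <= c * exp (- (l * t))" and x: "(x \<longlongrightarrow> 1) at_top"
 shows "\<exists>k>0. ((%t. Vof x y t * exp (- t)) \<longlongrightarrow> k) at_top"
proof -
 have nz: "x t ~= 0" "y t ~= 0" if "t >= 0" for t using pos[OF that] by auto
 have "\<exists>L. ((%t. ln (Vof x y t) - t + ln (x t)) \<longlongrightarrow> L) at_top"
 proof (rule exp_bounded_slope_convergent[OF _ _ l])
  fix t :: real assume t: "t >= 0"
  show "((%t. ln (Vof x y t) - t + ln (x t)) has_real_derivative - y t / a) (at t)"
   using pos[OF t] by (intro Vof_slope_derivative lv t) auto
  have "\<bar>y t\<bar> <= c * exp (- (l * t))" using pos[OF t] \<epsilon> by auto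
  then have "\<bar>y t\<bar> / a <= c * exp (- (l * t)) / a" using a by (simp add: divide_right_mono)
  then show "\<bar>- y t / a\<bar> <= c / a * exp (- (l * t))" using a by (simp add: abs_divide)
 qed
 then obtain L where L: "((%t. ln (Vof x y t) - t + ln (x t)) \<longlongrightarrow> L) at_top" by blast
 have "\<forall>\<^sub>F t in at_top. Vof x y t > 0 \<and> x t > 0"
  using eventually_ge_at_top[of 0] by eventually_elim (simp add: Vof_pos nz pos)
 from slope_limit_from_log[OF L x this] show ?thesis by (intro exI[of _ "exp L"]) auto
qed

lemma Vof_slope_limit_at_bot:
 assumes lv: "!!t. t <= 0 ==> lv x y t" and \<epsilon>: "\<epsilon> = 1 \<or> \<epsilon> = - 1" and l: "l > 0"
  and pos: "!!t. t <= 0 ==> x t > 0 \<and> 0 < \<epsilon> * y t \<and> \<epsilon> * y t <= c * exp (l * t)" and x: "(x \<longlongrightarrow> 1) at_bot"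
 shows "\<exists>k>0. ((%t. Vof x y t * exp (- t)) \<longlongrightarrow> k) at_bot"
proof -
 have nz: "x t ~= 0" "y t ~= 0" if "t <= 0" for t using pos[OF that] by auto
 have "\<exists>L. ((%t. ln (Vof x y (- t)) - (- t) + ln (x (- t))) \<longlongrightarrow> L) at_top"
 proof (rule exp_bounded_slope_convergent[OF _ _ l])
  fix t :: real assume t: "t >= 0"
  then have t': "- t <= 0" by simp
  have m: "(uminus has_real_derivative - 1) (at t)" by (rule derivative_eq_intros refl)+
  have "((%t. ln (Vof x y t) - t + ln (x t)) has_real_derivative - y (- t) / a) (at (- t))"
   using pos[OF t'] by (intro Vof_slope_derivative lv t') auto
  from DERIV_chain2[OF this m]
  show "((%t. ln (Vof x y (- t)) - (- t) + ln (x (- t))) has_real_derivative - y (- t) / a * - 1) (at t)" .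
  have "\<bar>y (- t)\<bar> <= c * exp (- (l * t))" using pos[OF t'] \<epsilon> by auto
  then have "\<bar>y (- t)\<bar> / a <= c * exp (- (l * t)) / a" using a by (simp add: divide_right_mono)
  then show "\<bar>- y (- t) / a * - 1\<bar> <= c / a * exp (- (l * t))" using a by (simp add: abs_divide)
 qed
 then obtain L where "((%t. ln (Vof x y (- t)) - (- t) + ln (x (- t))) \<longlongrightarrow> L) at_top" by blast
 then have L: "((%t. ln (Vof x y t) - t + ln (x t)) \<longlongrightarrow> L) at_bot" unfolding filterlim_at_bot_mirror .
 have "\<forall>\<^sub>F t in at_bot. Vof x y t > 0 \<and> x t > 0"
  using eventually_le_at_bot[of 0] by eventually_elim (simp add: Vof_pos nz pos)
 from slope_limit_from_log[OF L x this] show ?thesis by (intro exI[of _ "exp L"]) auto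
qed

lemma Vof_self_similar_limit:
 assumes x: "(x \<longlongrightarrow> x0) F" "x0 ~= 0" and y: "(y \<longlongrightarrow> y0) F" "y0 ~= 0"
 shows "((%t. exp (- (\<delta> * t)) * Vof x y t) \<longlongrightarrow> (\<bar>x0\<bar> powr a * \<bar>y0\<bar> / K) powr (1 / (q - a))) F"
proof -
 have "exp (- (\<delta> * t)) * Vof x y t = (\<bar>x t\<bar> powr a * \<bar>y t\<bar> / K) powr (1 / (q - a))" for t
 proof -
  have "Vof x y t = ((\<bar>x t\<bar> powr a * \<bar>y t\<bar> / K) * exp ((Q - a) * t)) powr (1 / (q - a))"
   by (simp add: Vof_def mult_ac)
  also have "\<dots> = (\<bar>x t\<bar> powr a * \<bar>y t\<bar> / K) powr (1 / (q - a)) * exp ((Q - a) * t) powr (1 / (q - a))"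
   using K by (subst powr_mult) auto
  also have "exp ((Q - a) * t) powr (1 / (q - a)) = exp (\<delta> * t)" by (simp add: powr_def \<delta>_def)
  finally show ?thesis by (simp add: exp_minus)
 qed
 then show ?thesis
  using x y K a by (simp only:) (intro tendsto_intros, auto)
qed

text \<open>Two solutions built from orbits coincide only if the orbits do.\<close>

lemma Vof_inj:
 assumes S: "open S" "t \<in> S" and eq: "!!t. t \<in> S ==> Vof x y t = Vof x' y' t"
  and lv: "lv x y t" "lv x' y' t" and nz: "x t ~= 0" "x' t ~= 0" and \<epsilon>: "\<epsilon> * y t > 0" "\<epsilon> * y' t > 0"
 shows "x t = x' t" "y t = y' t"
proof -
 have nz': "y t ~= 0" "y' t ~= 0" using \<epsilon> by auto
 have V: "Vof x y t = Vof x' y' t" "Vof x y t > 0" using eq[OF S(2)] Vof_pos[of x t y, OF nz(1) nz'(1)] by auto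
 have "(Vof x y has_real_derivative Vof x' y' t * x' t) (at t)"
  by (rule has_field_derivative_transform_within_open[OF Vof_derivative[OF lv(2) nz(2) nz'(2)] S]) (simp add: eq)
 then have "Vof x y t * x t = Vof x' y' t * x' t" using DERIV_unique[OF Vof_derivative[OF lv(1) nz(1) nz'(1)]] by simp
 then show x: "x t = x' t" using V by simp
 have "\<bar>x t\<bar> powr a * \<bar>y t\<bar> * exp ((Q - a) * t) / K = \<bar>x' t\<bar> powr a * \<bar>y' t\<bar> * exp ((Q - a) * t) / K"
  using Vof_powr[of x t y, OF nz(1) nz'(1)] Vof_powr[of x' t y', OF nz(2) nz'(2)] V(1) by metis
 then have "\<bar>y t\<bar> = \<bar>y' t\<bar>" using x nz K by simp
 then show "y t = y' t" using \<epsilon> by (auto simp: abs_if zero_less_mult_iff split: if_splits)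
qed

section \<open>Uniqueness\<close>

text \<open>The scaling of the radial equation.\<close>

lemma ef_scale:
 assumes "ef \<epsilon> V \<Phi> (t + h)"
 shows "ef \<epsilon> (%t. exp (- (\<delta> * h)) * V (t + h)) (%t. exp (a * (1 - \<delta>) * h) * \<Phi> (t + h)) t"
proof -
 have V: "V (t + h) > 0" and dV: "((%t. V (t + h)) has_real_derivative exp (t + h) * psi (\<Phi> (t + h))) (at t)"
  and d\<Phi>: "((%t. \<Phi> (t + h)) has_real_derivative - \<epsilon> * K * exp (- (Q * (t + h))) * V (t + h) powr q) (at t)"
  using assms by (auto simp: ef_def dest: DERIV_shift[THEN iffD1])
 have "psi (exp (a * (1 - \<delta>) * h) * \<Phi> (t + h)) = exp ((1 - \<delta>) * h) * psi (\<Phi> (t + h))"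
  using a by (subst psi_mult) (auto simp: powr_def)
 moreover have "exp (- (\<delta> * h)) * exp (t + h) = exp t * exp ((1 - \<delta>) * h)"
  unfolding exp_add[symmetric] by (simp add: algebra_simps)
 ultimately have 1: "exp (- (\<delta> * h)) * (exp (t + h) * psi (\<Phi> (t + h))) = exp t * psi (exp (a * (1 - \<delta>) * h) * \<Phi> (t + h))"
  by (simp add: mult.assoc[symmetric])
 have "(exp (- (\<delta> * h)) * V (t + h)) powr q = exp (- (\<delta> * h) * q) * V (t + h) powr q"
  using V by (subst powr_mult) (auto simp: powr_def mult.commute)
 moreover have "exp (a * (1 - \<delta>) * h) * exp (- (Q * (t + h))) = exp (- (Q * t)) * exp (- (\<delta> * h) * q)"
 proof -
  have "a * (1 - \<delta>) * h + - (Q * (t + h)) = - (Q * t) + - (\<delta> * h) * q + h * (\<delta> * (q - a) - (Q - a))"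
   by (simp add: algebra_simps)
  then show ?thesis unfolding \<delta>_eq exp_add[symmetric] by simp
 qed
 ultimately have 2: "exp (a * (1 - \<delta>) * h) * (- \<epsilon> * K * exp (- (Q * (t + h))) * V (t + h) powr q)
   = - \<epsilon> * K * exp (- (Q * t)) * (exp (- (\<delta> * h)) * V (t + h)) powr q"
  by (simp add: mult_ac)
 show ?thesis unfolding ef_def using V DERIV_cmult[OF dV, of "exp (- (\<delta> * h))"]
   DERIV_cmult[OF d\<Phi>, of "exp (a * (1 - \<delta>) * h)"] unfolding 1 2 by simp
qed

lemma ef_log_derivatives:
 assumes e: "ef \<epsilon> V \<Phi> t" and s: "s * \<Phi> t > 0" "s = 1 \<or> s = - 1"
 shows "((%t. ln (V t)) has_real_derivative s * exp (t + ln (s * \<Phi> t) / a - ln (V t))) (at t)"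
  "((%t. ln (s * \<Phi> t)) has_real_derivative - s * \<epsilon> * K * exp (- (Q * t) + q * ln (V t) - ln (s * \<Phi> t))) (at t)"
proof -
 have V: "V t > 0" and dV: "(V has_real_derivative exp t * psi (\<Phi> t)) (at t)"
  and d\<Phi>: "(\<Phi> has_real_derivative - \<epsilon> * K * exp (- (Q * t)) * V t powr q) (at t)" using e by (auto simp: ef_def)
 have "psi (\<Phi> t) = s * (s * \<Phi> t) powr (1 / a)"
  using s psi_pos[of "\<Phi> t"] psi_pos[of "- \<Phi> t"] by (auto simp: psi_minus)
 also have "(s * \<Phi> t) powr (1 / a) = exp (ln (s * \<Phi> t) / a)" using s by (auto simp: powr_def)
 finally have p: "psi (\<Phi> t) = s * exp (ln (s * \<Phi> t) / a)" .
 have "exp t * psi (\<Phi> t) / V t = s * exp (t + ln (s * \<Phi> t) / a - ln (V t))"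
  using V by (simp add: p exp_add exp_diff)
 then show "((%t. ln (V t)) has_real_derivative s * exp (t + ln (s * \<Phi> t) / a - ln (V t))) (at t)"
  using DERIV_chain2[OF DERIV_ln_divide[OF V] dV] by simp
 have "V t powr q = exp (q * ln (V t))" using V by (simp add: powr_def)
 then have "s * (- \<epsilon> * K * exp (- (Q * t)) * V t powr q) / (s * \<Phi> t)
   = - s * \<epsilon> * K * exp (- (Q * t) + q * ln (V t) - ln (s * \<Phi> t))"
 proof -
  have "exp (- (Q * t) + q * ln (V t) - ln (s * \<Phi> t)) = exp (- (Q * t)) * exp (q * ln (V t)) / (s * \<Phi> t)"
   using s(1) by (simp only: exp_add exp_diff exp_ln)
  moreover have "s ~= 0" using s(2) by auto
  ultimately show ?thesis using \<open>V t powr q = exp (q * ln (V t))\<close> by (simp add: mult.assoc)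
 qed
 then show "((%t. ln (s * \<Phi> t)) has_real_derivative - s * \<epsilon> * K * exp (- (Q * t) + q * ln (V t) - ln (s * \<Phi> t))) (at t)"
  using DERIV_chain2[OF DERIV_ln_divide[OF s(1)] DERIV_cmult[OF d\<Phi>, of s]] by simp
qed

text \<open>Near \<open>- \<infinity>\<close>, with \<open>V exp (- t) \<rightarrow> k\<close>: \<open>ln V\<close> relaxes and \<open>ln \<Phi>\<close> is the slow component.\<close>

lemma unique_at_bot:
 assumes qQ: "Q < q" and \<epsilon>: "\<bar>\<epsilon>\<bar> = 1" and k: "k > 0"
  and e1: "!!t. t < T ==> ef \<epsilon> V1 \<Phi>1 t" and e2: "!!t. t < T ==> ef \<epsilon> V2 \<Phi>2 t"
  and V1: "((%t. V1 t * exp (- t)) \<longlongrightarrow> k) at_bot" and V2: "((%t. V2 t * exp (- t)) \<longlongrightarrow> k) at_bot"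
  and \<Phi>1: "((%t. psi (\<Phi>1 t)) \<longlongrightarrow> k) at_bot" and \<Phi>2: "((%t. psi (\<Phi>2 t)) \<longlongrightarrow> k) at_bot"
 shows "\<forall>\<^sub>F t in at_bot. V1 t = V2 t"
proof -
 define X where "X = (%V \<Phi> t. exp (t + ln (\<Phi> t) / a - ln (V t)))"
 define Y where "Y = (%V \<Phi> t. exp (- (Q * t) + q * ln (V t) - ln (\<Phi> t)))"
 have one: "(\<forall>\<^sub>F t in at_bot. \<Phi> t > 0 \<and> V t > 0 \<and> X V \<Phi> t >= 1 / 2 \<and> Y V \<Phi> t <= M * exp ((q - Q) * t)) \<and>
   ((%t. ln (V t) - t) \<longlongrightarrow> ln k) at_bot \<and> ((%t. ln (\<Phi> t)) \<longlongrightarrow> a * ln k) at_bot"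
  if e: "!!t. t < T ==> ef \<epsilon> V \<Phi> t" and V: "((%t. V t * exp (- t)) \<longlongrightarrow> k) at_bot"
   and \<Phi>: "((%t. psi (\<Phi> t)) \<longlongrightarrow> k) at_bot" and M: "M = 1 + k powr q / k powr a" for V \<Phi> M
 proof -
  have Vp: "\<forall>\<^sub>F t in at_bot. V t > 0"
   using eventually_gt_at_bot[of T] by eventually_elim (use e in \<open>auto simp: ef_def\<close>)
  have \<Phi>p: "\<forall>\<^sub>F t in at_bot. \<Phi> t > 0"
   using order_tendstoD(1)[OF \<Phi> k] by eventually_elim (simp add: psi_pos_iff)
  have lV: "((%t. ln (V t) - t) \<longlongrightarrow> ln k) at_bot"
  proof (rule Lim_transform_eventually)
   show "((%t. ln (V t * exp (- t))) \<longlongrightarrow> ln k) at_bot" using k by (intro tendsto_intros V) auto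
   show "\<forall>\<^sub>F t in at_bot. ln (V t * exp (- t)) = ln (V t) - t" using Vp by eventually_elim (simp add: ln_mult)
  qed
  have l\<Phi>: "((%t. ln (\<Phi> t)) \<longlongrightarrow> a * ln k) at_bot"
  proof (rule Lim_transform_eventually)
   show "((%t. a * ln (psi (\<Phi> t))) \<longlongrightarrow> a * ln k) at_bot" using k by (intro tendsto_intros \<Phi>) auto
   show "\<forall>\<^sub>F t in at_bot. a * ln (psi (\<Phi> t)) = ln (\<Phi> t)" using \<Phi>p by eventually_elim (use a in \<open>simp add: psi_pos ln_powr\<close>)
  qed
  have "((%t. exp (ln (\<Phi> t) / a - (ln (V t) - t))) \<longlongrightarrow> exp (a * ln k / a - ln k)) at_bot"
   using a by (intro tendsto_intros l\<Phi> lV) auto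
  then have "((%t. X V \<Phi> t) \<longlongrightarrow> 1) at_bot" using a by (simp add: X_def algebra_simps)
  then have Xe: "\<forall>\<^sub>F t in at_bot. X V \<Phi> t > 1 / 2" by (rule order_tendstoD(1)) simp
  have "((%t. exp (q * (ln (V t) - t) - ln (\<Phi> t))) \<longlongrightarrow> exp (q * ln k - a * ln k)) at_bot"
   by (intro tendsto_intros l\<Phi> lV)
  moreover have "exp (q * ln k - a * ln k) < M" using k by (simp add: M powr_def exp_diff)
  ultimately have "\<forall>\<^sub>F t in at_bot. exp (q * (ln (V t) - t) - ln (\<Phi> t)) < M" by (rule order_tendstoD(2))
  then have Ye: "\<forall>\<^sub>F t in at_bot. Y V \<Phi> t <= M * exp ((q - Q) * t)"
  proof eventually_elim
   case (elim t)
   have "Y V \<Phi> t = exp (q * (ln (V t) - t) - ln (\<Phi> t)) * exp ((q - Q) * t)"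
    unfolding Y_def exp_add[symmetric] by (simp add: algebra_simps)
   then show ?case using elim by (simp add: mult_right_mono)
  qed
  show ?thesis using lV l\<Phi> eventually_conj[OF \<Phi>p eventually_conj[OF Vp eventually_conj[OF Xe Ye]]]
   by (auto elim: eventually_mono)
 qed
 define M where "M = 1 + k powr q / k powr a"
 have M: "M > 0" by (simp add: M_def add_pos_nonneg)
 note o1 = one[OF e1 V1 \<Phi>1 M_def] and o2 = one[OF e2 V2 \<Phi>2 M_def]
 have "\<forall>\<^sub>F t in at_bot. t < T \<and> (\<Phi>1 t > 0 \<and> V1 t > 0 \<and> X V1 \<Phi>1 t >= 1 / 2 \<and> Y V1 \<Phi>1 t <= M * exp ((q - Q) * t))
   \<and> (\<Phi>2 t > 0 \<and> V2 t > 0 \<and> X V2 \<Phi>2 t >= 1 / 2 \<and> Y V2 \<Phi>2 t <= M * exp ((q - Q) * t))"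
  by (intro eventually_conj eventually_gt_at_bot conjunct1[OF o1] conjunct1[OF o2])
 then obtain T0 where T0: "!!t. t <= T0 ==> t < T \<and> (\<Phi>1 t > 0 \<and> V1 t > 0 \<and> X V1 \<Phi>1 t >= 1 / 2 \<and> Y V1 \<Phi>1 t <= M * exp ((q - Q) * t))
   \<and> (\<Phi>2 t > 0 \<and> V2 t > 0 \<and> X V2 \<Phi>2 t >= 1 / 2 \<and> Y V2 \<Phi>2 t <= M * exp ((q - Q) * t))"
  by (auto simp: eventually_at_bot_linorder)
 define u w where "u = (%t. ln (V1 t) - ln (V2 t))" and "w = (%t. ln (\<Phi>1 t) - ln (\<Phi>2 t))"
 have ulim: "(u \<longlongrightarrow> 0) at_bot" using tendsto_diff[of _ _ _ _ "ln k"] o1 o2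
  tendsto_diff[OF conjunct1[OF conjunct2[OF o1]] conjunct1[OF conjunct2[OF o2]]] by (simp add: u_def)
 have wlim: "(w \<longlongrightarrow> 0) at_bot"
  using tendsto_diff[OF conjunct2[OF conjunct2[OF o1]] conjunct2[OF conjunct2[OF o2]]] by (simp add: w_def)
 have "\<forall>t. \<exists>b. X V1 \<Phi>1 t - X V2 \<Phi>2 t = b * (w t / a - u t) \<and> min (X V1 \<Phi>1 t) (X V2 \<Phi>2 t) <= b"
 proof
  fix t
  from exp_difference[of "t + ln (\<Phi>1 t) / a - ln (V1 t)" "t + ln (\<Phi>2 t) / a - ln (V2 t)"]
  show "\<exists>b. X V1 \<Phi>1 t - X V2 \<Phi>2 t = b * (w t / a - u t) \<and> min (X V1 \<Phi>1 t) (X V2 \<Phi>2 t) <= b"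
   by (force simp: X_def u_def w_def algebra_simps diff_divide_distrib)
 qed
 then obtain b where b: "!!t. X V1 \<Phi>1 t - X V2 \<Phi>2 t = b t * (w t / a - u t)" "!!t. min (X V1 \<Phi>1 t) (X V2 \<Phi>2 t) <= b t"
  by metis
 have "\<exists>T1\<le>T0. \<forall>t\<le>T1. u t = 0 \<and> w t = 0"
 proof (rule vanishing_pair[where b=b and c="1 / a" and l="q - Q" and M="K * M * (q + 1)"])
  fix t assume t: "t <= T0"
  note t0 = T0[OF t]
  have d1: "((%t. ln (V1 t)) has_real_derivative X V1 \<Phi>1 t) (at t)" "((%t. ln (\<Phi>1 t)) has_real_derivative - \<epsilon> * K * Y V1 \<Phi>1 t) (at t)"
   using ef_log_derivatives[OF e1, of t 1] t0 by (auto simp: X_def Y_def)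
  have d2: "((%t. ln (V2 t)) has_real_derivative X V2 \<Phi>2 t) (at t)" "((%t. ln (\<Phi>2 t)) has_real_derivative - \<epsilon> * K * Y V2 \<Phi>2 t) (at t)"
   using ef_log_derivatives[OF e2, of t 1] t0 by (auto simp: X_def Y_def)
  show "(u has_real_derivative - b t * (u t - 1 / a * w t)) (at t)"
   unfolding u_def by (rule DERIV_cong[OF DERIV_diff[OF d1(1) d2(1)]]) (simp add: b(1) u_def algebra_simps)
  show "(w has_real_derivative - \<epsilon> * K * (Y V1 \<Phi>1 t - Y V2 \<Phi>2 t)) (at t)"
   unfolding w_def by (rule DERIV_cong[OF DERIV_diff[OF d1(2) d2(2)]]) (simp add: algebra_simps)
  show "1 / 2 <= b t" using b(2)[of t] t0 by auto
  obtain d where d: "Y V1 \<Phi>1 t - Y V2 \<Phi>2 t = d * (q * u t - w t)" "min (Y V1 \<Phi>1 t) (Y V2 \<Phi>2 t) <= d" "d <= max (Y V1 \<Phi>1 t) (Y V2 \<Phi>2 t)"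
   using exp_difference[of "- (Q * t) + q * ln (V1 t) - ln (\<Phi>1 t)" "- (Q * t) + q * ln (V2 t) - ln (\<Phi>2 t)"]
   by (force simp: Y_def u_def w_def algebra_simps)
  have "d > 0" using d(2) by (auto simp: Y_def min_def split: if_splits intro: less_le_trans[OF exp_gt_zero])
  moreover have "d <= M * exp ((q - Q) * t)" using d(3) t0 by auto
  moreover have "\<bar>q * u t - w t\<bar> <= (q + 1) * (\<bar>u t\<bar> + \<bar>w t\<bar>)"
  proof -
   have "\<bar>q * u t - w t\<bar> <= q * \<bar>u t\<bar> + \<bar>w t\<bar>" using abs_triangle_ineq4[of "q * u t" "w t"] a aq by (simp add: abs_mult)
   also have "\<dots> <= (q + 1) * (\<bar>u t\<bar> + \<bar>w t\<bar>)" using a aq by (simp add: algebra_simps)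
   finally show ?thesis .
  qed
  ultimately have "\<bar>d * (q * u t - w t)\<bar> <= M * exp ((q - Q) * t) * ((q + 1) * (\<bar>u t\<bar> + \<bar>w t\<bar>))"
   unfolding abs_mult using M by (intro mult_mono) auto
  then have "K * \<bar>d * (q * u t - w t)\<bar> <= K * (M * exp ((q - Q) * t) * ((q + 1) * (\<bar>u t\<bar> + \<bar>w t\<bar>)))"
   using K by (intro mult_left_mono) auto
  moreover have "\<bar>- \<epsilon> * K * (Y V1 \<Phi>1 t - Y V2 \<Phi>2 t)\<bar> = K * \<bar>d * (q * u t - w t)\<bar>"
   unfolding d(1) using \<epsilon> K by (simp add: abs_mult)
  ultimately show "\<bar>- \<epsilon> * K * (Y V1 \<Phi>1 t - Y V2 \<Phi>2 t)\<bar> <= K * M * (q + 1) * exp ((q - Q) * t) * (\<bar>u t\<bar> + \<bar>w t\<bar>)"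
   by (simp add: mult_ac)
 qed (use a aq qQ K M ulim wlim in auto)
 then obtain T1 where T1: "T1 <= T0" "!!t. t <= T1 ==> u t = 0" by blast
 show ?thesis using eventually_le_at_bot[of T1]
 proof eventually_elim
  case (elim t)
  then show ?case using T1(2)[OF elim] T0[of t] T1(1) by (simp add: u_def)
 qed
qed

text \<open>Near \<open>\<infinity>\<close>, with \<open>V \<rightarrow> C\<close>, the roles are exchanged and time is reversed.\<close>

lemma unique_at_top:
 assumes \<epsilon>: "\<epsilon> = 1 \<or> \<epsilon> = - 1" and C: "C > 0" and c0: "c0 > 0"
  and e1: "!!t. t > T ==> ef \<epsilon> V1 \<Phi>1 t" and e2: "!!t. t > T ==> ef \<epsilon> V2 \<Phi>2 t"
  and V1: "(V1 \<longlongrightarrow> C) at_top" and V2: "(V2 \<longlongrightarrow> C) at_top"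
  and \<Phi>1: "((%t. exp (Q * t) * \<Phi>1 t) \<longlongrightarrow> \<epsilon> * c0) at_top" and \<Phi>2: "((%t. exp (Q * t) * \<Phi>2 t) \<longlongrightarrow> \<epsilon> * c0) at_top"
 shows "\<forall>\<^sub>F t in at_top. V1 t = V2 t"
proof -
 define X where "X = (%V \<Phi> t. exp (t + ln (\<epsilon> * \<Phi> t) / a - ln (V t)))"
 define Y where "Y = (%V \<Phi> t. exp (- (Q * t) + q * ln (V t) - ln (\<epsilon> * \<Phi> t)))"
 define Y0 where "Y0 = exp (q * ln C - ln c0)"
 define M where "M = 1 + exp (ln c0 / a - ln C)"
 define l where "l = Q / a - 1"
 have l: "l > 0" using a aQ by (simp add: l_def)
 have Q0: "Q > 0" using a aQ by simp
 have one: "(\<forall>\<^sub>F t in at_top. \<epsilon> * \<Phi> t > 0 \<and> V t > 0 \<and> Y V \<Phi> t >= Y0 / 2 \<and> X V \<Phi> t <= M * exp (- (l * t))) \<and>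
   ((%t. ln (V t)) \<longlongrightarrow> ln C) at_top \<and> ((%t. Q * t + ln (\<epsilon> * \<Phi> t)) \<longlongrightarrow> ln c0) at_top"
  if e: "!!t. t > T ==> ef \<epsilon> V \<Phi> t" and V: "(V \<longlongrightarrow> C) at_top"
   and \<Phi>: "((%t. exp (Q * t) * \<Phi> t) \<longlongrightarrow> \<epsilon> * c0) at_top" for V \<Phi>
 proof -
  have \<Phi>': "((%t. exp (Q * t) * (\<epsilon> * \<Phi> t)) \<longlongrightarrow> c0) at_top"
   using tendsto_mult[OF tendsto_const[of \<epsilon>] \<Phi>] \<epsilon> by (auto simp: mult_ac)
  have Vp: "\<forall>\<^sub>F t in at_top. V t > 0" by (rule order_tendstoD(1)[OF V C])
  have \<Phi>p: "\<forall>\<^sub>F t in at_top. \<epsilon> * \<Phi> t > 0"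
   using order_tendstoD(1)[OF \<Phi>' c0] by eventually_elim (simp add: zero_less_mult_iff)
  have lV: "((%t. ln (V t)) \<longlongrightarrow> ln C) at_top" using C by (intro tendsto_intros V) auto
  have l\<Phi>: "((%t. Q * t + ln (\<epsilon> * \<Phi> t)) \<longlongrightarrow> ln c0) at_top"
  proof (rule Lim_transform_eventually)
   show "((%t. ln (exp (Q * t) * (\<epsilon> * \<Phi> t))) \<longlongrightarrow> ln c0) at_top" using c0 by (intro tendsto_intros \<Phi>') auto
   show "\<forall>\<^sub>F t in at_top. ln (exp (Q * t) * (\<epsilon> * \<Phi> t)) = Q * t + ln (\<epsilon> * \<Phi> t)"
    using \<Phi>p by eventually_elim (simp only: ln_mult_pos[OF exp_gt_zero] ln_exp)
  qed
  have "((%t. exp (q * ln (V t) - (Q * t + ln (\<epsilon> * \<Phi> t)))) \<longlongrightarrow> Y0) at_top"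
   unfolding Y0_def by (intro tendsto_intros l\<Phi> lV)
  then have "((%t. Y V \<Phi> t) \<longlongrightarrow> Y0) at_top" by (simp add: Y_def algebra_simps)
  then have Ye: "\<forall>\<^sub>F t in at_top. Y V \<Phi> t > Y0 / 2" by (rule order_tendstoD(1)) (simp add: Y0_def)
  have "((%t. exp ((Q * t + ln (\<epsilon> * \<Phi> t)) / a - ln (V t))) \<longlongrightarrow> exp (ln c0 / a - ln C)) at_top"
   using a by (intro tendsto_intros l\<Phi> lV) auto
  then have "\<forall>\<^sub>F t in at_top. exp ((Q * t + ln (\<epsilon> * \<Phi> t)) / a - ln (V t)) < M" by (rule order_tendstoD(2)) (simp add: M_def)
  then have Xe: "\<forall>\<^sub>F t in at_top. X V \<Phi> t <= M * exp (- (l * t))"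
  proof eventually_elim
   case (elim t)
   have "X V \<Phi> t = exp ((Q * t + ln (\<epsilon> * \<Phi> t)) / a - ln (V t)) * exp (- (l * t))"
    unfolding X_def l_def exp_add[symmetric] using a by (simp add: algebra_simps add_divide_distrib)
   then show ?case using elim by (simp add: mult_right_mono)
  qed
  show ?thesis using lV l\<Phi> eventually_conj[OF \<Phi>p eventually_conj[OF Vp eventually_conj[OF Ye Xe]]]
   by (auto elim: eventually_mono)
 qed
 have M: "M > 0" by (simp add: M_def add_pos_pos)
 note o1 = one[OF e1 V1 \<Phi>1] and o2 = one[OF e2 V2 \<Phi>2]
 have "\<forall>\<^sub>F t in at_top. t > T \<and> (\<epsilon> * \<Phi>1 t > 0 \<and> V1 t > 0 \<and> Y V1 \<Phi>1 t >= Y0 / 2 \<and> X V1 \<Phi>1 t <= M * exp (- (l * t)))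
   \<and> (\<epsilon> * \<Phi>2 t > 0 \<and> V2 t > 0 \<and> Y V2 \<Phi>2 t >= Y0 / 2 \<and> X V2 \<Phi>2 t <= M * exp (- (l * t)))"
  by (intro eventually_conj eventually_gt_at_top conjunct1[OF o1] conjunct1[OF o2])
 then obtain T0 where T0: "!!t. t >= T0 ==> t > T \<and> (\<epsilon> * \<Phi>1 t > 0 \<and> V1 t > 0 \<and> Y V1 \<Phi>1 t >= Y0 / 2 \<and> X V1 \<Phi>1 t <= M * exp (- (l * t)))
   \<and> (\<epsilon> * \<Phi>2 t > 0 \<and> V2 t > 0 \<and> Y V2 \<Phi>2 t >= Y0 / 2 \<and> X V2 \<Phi>2 t <= M * exp (- (l * t)))"
  by (auto simp: eventually_at_top_linorder)
 define u w where "u = (%t. ln (\<epsilon> * \<Phi>1 t) - ln (\<epsilon> * \<Phi>2 t))" and "w = (%t. ln (V1 t) - ln (V2 t))"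
 have "(u \<longlongrightarrow> 0) at_top"
  using tendsto_diff[OF conjunct2[OF conjunct2[OF o1]] conjunct2[OF conjunct2[OF o2]]] by (simp add: u_def)
 then have ulim: "((%t. u (- t)) \<longlongrightarrow> 0) at_bot" unfolding filterlim_at_top_mirror .
 have "(w \<longlongrightarrow> 0) at_top"
  using tendsto_diff[OF conjunct1[OF conjunct2[OF o1]] conjunct1[OF conjunct2[OF o2]]] by (simp add: w_def)
 then have wlim: "((%t. w (- t)) \<longlongrightarrow> 0) at_bot" unfolding filterlim_at_top_mirror .
 have "\<forall>t. \<exists>b. Y V1 \<Phi>1 t - Y V2 \<Phi>2 t = b * (q * w t - u t) \<and> min (Y V1 \<Phi>1 t) (Y V2 \<Phi>2 t) <= b"
 proof
  fix t
  from exp_difference[of "- (Q * t) + q * ln (V1 t) - ln (\<epsilon> * \<Phi>1 t)" "- (Q * t) + q * ln (V2 t) - ln (\<epsilon> * \<Phi>2 t)"]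
  show "\<exists>b. Y V1 \<Phi>1 t - Y V2 \<Phi>2 t = b * (q * w t - u t) \<and> min (Y V1 \<Phi>1 t) (Y V2 \<Phi>2 t) <= b"
   by (force simp: Y_def u_def w_def algebra_simps)
 qed
 then obtain b where b: "!!t. Y V1 \<Phi>1 t - Y V2 \<Phi>2 t = b t * (q * w t - u t)" "!!t. min (Y V1 \<Phi>1 t) (Y V2 \<Phi>2 t) <= b t"
  by metis
 have \<epsilon>2: "\<epsilon> * \<epsilon> = 1" using \<epsilon> by auto
 have "\<exists>T1\<le>- T0. \<forall>t\<le>T1. u (- t) = 0 \<and> w (- t) = 0"
 proof (rule vanishing_pair[where b="%t. K * b (- t)" and c=q and l=l and M="M * (1 / a + 1)"])
  fix t assume "t <= - T0"
  then have t: "- t >= T0" by simp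
  note t0 = T0[OF t]
  have m: "(uminus has_real_derivative - 1) (at t)" by (rule derivative_eq_intros refl)+
  have d1: "((%t. ln (V1 t)) has_real_derivative \<epsilon> * X V1 \<Phi>1 (- t)) (at (- t))" "((%t. ln (\<epsilon> * \<Phi>1 t)) has_real_derivative - K * Y V1 \<Phi>1 (- t)) (at (- t))"
  proof -
   have h: "- t > T" "\<epsilon> * \<Phi>1 (- t) > 0" using t0 by auto
   note l = ef_log_derivatives[OF e1[OF h(1)] h(2) \<epsilon>]
   show "((%t. ln (V1 t)) has_real_derivative \<epsilon> * X V1 \<Phi>1 (- t)) (at (- t))" using l(1) unfolding X_def .
   show "((%t. ln (\<epsilon> * \<Phi>1 t)) has_real_derivative - K * Y V1 \<Phi>1 (- t)) (at (- t))"
    by (rule DERIV_cong[OF l(2)]) (use \<epsilon> in \<open>auto simp: Y_def\<close>)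
  qed
  have d2: "((%t. ln (V2 t)) has_real_derivative \<epsilon> * X V2 \<Phi>2 (- t)) (at (- t))" "((%t. ln (\<epsilon> * \<Phi>2 t)) has_real_derivative - K * Y V2 \<Phi>2 (- t)) (at (- t))"
  proof -
   have h: "- t > T" "\<epsilon> * \<Phi>2 (- t) > 0" using t0 by auto
   note l = ef_log_derivatives[OF e2[OF h(1)] h(2) \<epsilon>]
   show "((%t. ln (V2 t)) has_real_derivative \<epsilon> * X V2 \<Phi>2 (- t)) (at (- t))" using l(1) unfolding X_def .
   show "((%t. ln (\<epsilon> * \<Phi>2 t)) has_real_derivative - K * Y V2 \<Phi>2 (- t)) (at (- t))"
    by (rule DERIV_cong[OF l(2)]) (use \<epsilon> in \<open>auto simp: Y_def\<close>)
  qed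
  have du: "(u has_real_derivative - (K * (b (- t) * (q * w (- t) - u (- t))))) (at (- t))"
  proof -
   have "(u has_real_derivative - K * Y V1 \<Phi>1 (- t) - - K * Y V2 \<Phi>2 (- t)) (at (- t))"
    unfolding u_def by (rule DERIV_diff[OF d1(2) d2(2)])
   moreover have bb: "b (- t) * (q * w (- t) - u (- t)) = Y V1 \<Phi>1 (- t) - Y V2 \<Phi>2 (- t)" using b(1)[of "- t"] by simp
   ultimately show ?thesis unfolding bb by (simp add: algebra_simps)
  qed
  show "((%t. u (- t)) has_real_derivative - (K * b (- t)) * (u (- t) - q * w (- t))) (at t)"
   by (rule DERIV_cong[OF DERIV_chain2[OF du m]]) (simp add: algebra_simps)
  have dw: "(w has_real_derivative \<epsilon> * (X V1 \<Phi>1 (- t) - X V2 \<Phi>2 (- t))) (at (- t))"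
   unfolding w_def by (rule DERIV_cong[OF DERIV_diff[OF d1(1) d2(1)]]) (simp add: algebra_simps)
  show "((%t. w (- t)) has_real_derivative - \<epsilon> * (X V1 \<Phi>1 (- t) - X V2 \<Phi>2 (- t))) (at t)"
   by (rule DERIV_cong[OF DERIV_chain2[OF dw m]]) simp
  have "Y0 / 2 <= b (- t)" using b(2)[of "- t"] t0 by auto
  then show "K * (Y0 / 2) <= K * b (- t)" using K by (intro mult_left_mono) auto
  obtain d where d: "X V1 \<Phi>1 (- t) - X V2 \<Phi>2 (- t) = d * (u (- t) / a - w (- t))"
    "min (X V1 \<Phi>1 (- t)) (X V2 \<Phi>2 (- t)) <= d" "d <= max (X V1 \<Phi>1 (- t)) (X V2 \<Phi>2 (- t))"
   using exp_difference[of "- t + ln (\<epsilon> * \<Phi>1 (- t)) / a - ln (V1 (- t))" "- t + ln (\<epsilon> * \<Phi>2 (- t)) / a - ln (V2 (- t))"]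
   by (force simp: X_def u_def w_def algebra_simps diff_divide_distrib)
  have "d > 0" using d(2) by (auto simp: X_def min_def split: if_splits intro: less_le_trans[OF exp_gt_zero])
  moreover have "d <= M * exp (l * t)" using d(3) t0 by auto
  moreover have "\<bar>u (- t) / a - w (- t)\<bar> <= (1 / a + 1) * (\<bar>u (- t)\<bar> + \<bar>w (- t)\<bar>)"
  proof -
   have "\<bar>u (- t) / a - w (- t)\<bar> <= \<bar>u (- t)\<bar> / a + \<bar>w (- t)\<bar>" using abs_triangle_ineq4[of "u (- t) / a" "w (- t)"] a by (simp add: abs_divide)
   also have "\<dots> <= (1 / a + 1) * (\<bar>u (- t)\<bar> + \<bar>w (- t)\<bar>)" using a by (simp add: algebra_simps)
   finally show ?thesis .
  qed
  ultimately have "\<bar>d * (u (- t) / a - w (- t))\<bar> <= M * exp (l * t) * ((1 / a + 1) * (\<bar>u (- t)\<bar> + \<bar>w (- t)\<bar>))"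
   unfolding abs_mult using M by (intro mult_mono) auto
  moreover have "\<bar>- \<epsilon> * (X V1 \<Phi>1 (- t) - X V2 \<Phi>2 (- t))\<bar> = \<bar>d * (u (- t) / a - w (- t))\<bar>"
   unfolding d(1) using \<epsilon> by (auto simp: abs_minus_commute)
  ultimately show "\<bar>- \<epsilon> * (X V1 \<Phi>1 (- t) - X V2 \<Phi>2 (- t))\<bar> <= M * (1 / a + 1) * exp (l * t) * (\<bar>u (- t)\<bar> + \<bar>w (- t)\<bar>)"
   by (simp only: mult_ac)
 next
  show "K * (Y0 / 2) > 0" using K by (simp add: Y0_def)
  show "q > 0" using a aq by simp
  show "M * (1 / a + 1) >= 0" using M a by simp
 qed (use l ulim wlim in auto)
 then obtain T1 where T1: "T1 <= - T0" "!!t. t <= T1 ==> w (- t) = 0" by blast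
 show ?thesis using eventually_ge_at_top[of "- T1"]
 proof eventually_elim
  case (elim t)
  then show ?case using T1(2)[of "- t"] T0[of t] T1(1) by (simp add: w_def)
 qed
qed

section \<open>Nonexistence\<close>

lemma ef_V_mono:
 assumes e: "!!r. s <= r ==> r <= t ==> ef \<epsilon> V \<Phi> r" and st: "s <= t"
 shows "(!!r. s <= r ==> r <= t ==> 0 <= \<Phi> r) ==> V s <= V t"
  "(!!r. s <= r ==> r <= t ==> \<Phi> r <= 0) ==> V t <= V s"
proof -
 have d: "(V has_real_derivative exp r * psi (\<Phi> r)) (at r)" if "s <= r" "r <= t" for r
  using e[OF that] by (simp add: ef_def)
 have z: "psi 0 = 0" by (simp add: psi_def)
 show "V s <= V t" if "!!r. s <= r ==> r <= t ==> 0 <= \<Phi> r"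
  using psi_mono_le[OF that] unfolding z
  by (intro DERIV_nonneg_imp_nondecreasing[OF st]) (use d in \<open>metis exp_ge_zero mult_nonneg_nonneg\<close>)
 show "V t <= V s" if "!!r. s <= r ==> r <= t ==> \<Phi> r <= 0"
  using psi_mono_le[OF that] unfolding z
  by (intro DERIV_nonpos_imp_nonincreasing[OF st]) (use d in \<open>metis exp_ge_zero mult_nonneg_nonpos\<close>)
qed

lemma ef_Phi_strict:
 assumes e: "!!r. s <= r ==> r <= t ==> ef \<epsilon> V \<Phi> r" and st: "s < t"
 shows "\<epsilon> = 1 ==> \<Phi> t < \<Phi> s" "\<epsilon> = - 1 ==> \<Phi> s < \<Phi> t"
proof -
 have d: "(\<Phi> has_real_derivative - \<epsilon> * (K * exp (- (Q * r)) * V r powr q)) (at r)" "K * exp (- (Q * r)) * V r powr q > 0"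
  if "s <= r" "r <= t" for r
  using e[OF that] K by (auto simp: ef_def mult.assoc)
 show "\<Phi> t < \<Phi> s" if "\<epsilon> = 1"
  by (rule DERIV_neg_imp_decreasing[OF st]) (use d that in force)
 show "\<Phi> s < \<Phi> t" if "\<epsilon> = - 1"
  by (rule DERIV_pos_imp_increasing[OF st]) (use d that in force)
qed

text \<open>For \<open>\<epsilon> = 1\<close> the solution is a concave function of \<open>s = exp t\<close>, positive up to \<open>s = 0\<close>; hence its slope is
 at most \<open>V / s\<close>.\<close>

lemma ef_concave:
 assumes e: "!!t. t <= T ==> ef 1 V \<Phi> t" and \<Phi>: "!!t. t <= T ==> \<Phi> t > 0" and t: "t <= T"
 shows "exp t * psi (\<Phi> t) <= V t"
proof (rule ccontr)
 assume neg: "\<not> exp t * psi (\<Phi> t) <= V t"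
 define d where "d = exp t * psi (\<Phi> t) - V t"
 have d: "d > 0" using neg by (simp add: d_def)
 have dV: "(V has_real_derivative exp r * psi (\<Phi> r)) (at r)" if "r <= T" for r using e[OF that] by (simp add: ef_def)
 have slope: "d <= exp r * psi (\<Phi> r) - V r" if r: "r <= t" for r
  unfolding d_def
 proof (rule DERIV_nonpos_imp_nonincreasing[OF r, where f="%r. exp r * psi (\<Phi> r) - V r"])
  fix u assume "r <= u" "u <= t"
  then have u: "u <= T" using t by simp
  define P where "P = K * exp (- (Q * u)) * V u powr q"
  have P: "P > 0" using e[OF u] K by (simp add: P_def ef_def)
  have d\<Phi>: "(\<Phi> has_real_derivative - P) (at u)" using e[OF u] by (simp add: ef_def P_def)
  have p: "psi (\<Phi> u) > 0" using \<Phi>[OF u] by (simp add: psi_pos_iff)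
  have "((%r. exp r * psi (\<Phi> r) - V r) has_real_derivative exp u * (psi (\<Phi> u) * (- P / (a * \<Phi> u)))) (at u)"
   by (rule DERIV_cong[OF DERIV_diff[OF DERIV_mult[OF DERIV_exp psi_derivative[OF d\<Phi>]] dV[OF u]]])
     (use \<Phi>[OF u] in \<open>auto simp: mult_ac\<close>)
  moreover have "exp u * (psi (\<Phi> u) * (- P / (a * \<Phi> u))) <= 0"
   using p P a \<Phi>[OF u] by (intro mult_nonneg_nonpos) (auto simp: divide_nonpos_pos)
  ultimately show "\<exists>D. ((%r. exp r * psi (\<Phi> r) - V r) has_real_derivative D) (at u) \<and> D <= 0" by blast
 qed
 define B where "B = (V t + d) * exp (- t)"
 have B: "(V r + d) * exp (- r) <= B" if r: "r <= t" for r
  unfolding B_def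
 proof (rule DERIV_nonneg_imp_nondecreasing[OF r, where f="%r. (V r + d) * exp (- r)"])
  fix u assume "r <= u" "u <= t"
  then have u: "u <= T" "u <= t" using t by auto
  have "((%r. (V r + d) * exp (- r)) has_real_derivative (exp u * psi (\<Phi> u) - (V u + d)) * exp (- u)) (at u)"
   by (rule derivative_eq_intros dV[OF u(1)] refl | simp add: algebra_simps)+
  moreover have "(exp u * psi (\<Phi> u) - (V u + d)) * exp (- u) >= 0" using slope[OF u(2)] by simp
  ultimately show "\<exists>D. ((%r. (V r + d) * exp (- r)) has_real_derivative D) (at u) \<and> 0 <= D" by blast
 qed
 define r where "r = min t (- ln (B / d + 1))"
 have Vt: "V t > 0" using e[OF t] by (simp add: ef_def)
 have Bp: "B / d + 1 > 0" using Vt d by (simp add: B_def add_pos_pos)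
 have "V r > 0" using e[of r] t by (simp add: r_def ef_def)
 then have "d * exp (- r) <= (V r + d) * exp (- r)" by simp
 also have "\<dots> <= B" by (rule B) (simp add: r_def)
 finally have "d * exp (- r) <= B" .
 moreover have "B / d + 1 <= exp (- r)"
 proof -
  have "ln (B / d + 1) <= - r" by (simp add: r_def)
  then have "exp (ln (B / d + 1)) <= exp (- r)" by (simp only: exp_le_cancel_iff)
  then show ?thesis using Bp by simp
 qed
 then have "d * (B / d + 1) <= d * exp (- r)" using d by (intro mult_left_mono) auto
 then have "B + d <= d * exp (- r)" using d by (simp add: distrib_left)
 ultimately show False using d by linarith
qed

lemma exp_unbounded_at_bot: "l > 0 ==> c > 0 ==> \<exists>t\<le>T. B < c * exp (- (l * t))" for B c l T :: real
proof -
 assume lc: "l > 0" "c > 0"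
 define t where "t = min T (- ln (\<bar>B\<bar> / c + 1) / l)"
 have p: "\<bar>B\<bar> / c + 1 > 0" using lc by (simp add: add_nonneg_pos)
 have "t <= - ln (\<bar>B\<bar> / c + 1) / l" by (simp add: t_def)
 then have "t * l <= - ln (\<bar>B\<bar> / c + 1)" using pos_le_divide_eq[OF lc(1)] by blast
 then have "exp (ln (\<bar>B\<bar> / c + 1)) <= exp (- (l * t))" by (simp add: mult.commute)
 then have "\<bar>B\<bar> / c + 1 <= exp (- (l * t))" using p by simp
 then have "c * (\<bar>B\<bar> / c + 1) <= c * exp (- (l * t))" using lc by (intro mult_left_mono) auto
 then have "\<bar>B\<bar> + c <= c * exp (- (l * t))" using lc by (simp add: distrib_left)
 then have "B < c * exp (- (l * t))" using lc by linarith
 then show ?thesis by (intro exI[of _ t]) (simp add: t_def)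
qed

text \<open>A solution bounded away from zero near \<open>- \<infinity>\<close> has an unbounded flux there, because \<open>exp (- Q t)\<close> is not integrable.\<close>

lemma flux_unbounded:
 assumes e: "!!t. t <= T ==> ef \<epsilon> V \<Phi> t" and \<epsilon>: "\<epsilon> = 1 \<or> \<epsilon> = - 1" and V: "!!t. t <= T ==> v <= V t" and v: "v > 0"
  and t: "t <= T"
 shows "\<epsilon> * \<Phi> T + K * v powr q / Q * (exp (- (Q * t)) - exp (- (Q * T))) <= \<epsilon> * \<Phi> t"
proof -
 have Q0: "Q > 0" "q > 0" using a aQ aq by auto
 define c where "c = K * v powr q / Q"
 have "\<epsilon> * \<Phi> T - c * exp (- (Q * T)) <= \<epsilon> * \<Phi> t - c * exp (- (Q * t))"
 proof (rule DERIV_nonpos_imp_nonincreasing[OF t, where f="%t. \<epsilon> * \<Phi> t - c * exp (- (Q * t))"])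
  fix r assume r: "t <= r" "r <= T"
  have d\<Phi>: "(\<Phi> has_real_derivative - \<epsilon> * K * exp (- (Q * r)) * V r powr q) (at r)" using e[OF r(2)] by (simp add: ef_def)
  have "((%t. \<epsilon> * \<Phi> t - c * exp (- (Q * t))) has_real_derivative
    \<epsilon> * (- \<epsilon> * K * exp (- (Q * r)) * V r powr q) - c * (exp (- (Q * r)) * - Q)) (at r)"
   by (rule derivative_eq_intros d\<Phi> refl | simp)+
  moreover have "\<epsilon> * (- \<epsilon> * K * exp (- (Q * r)) * V r powr q) - c * (exp (- (Q * r)) * - Q)
    = K * exp (- (Q * r)) * (v powr q - V r powr q)"
   using \<epsilon> Q0 by (auto simp: c_def algebra_simps)
  moreover have "v powr q <= V r powr q" using V[OF r(2)] v Q0 by (intro powr_mono2) auto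
  then have "K * exp (- (Q * r)) * (v powr q - V r powr q) <= 0" using K by (intro mult_nonneg_nonpos) auto
  ultimately show "\<exists>D. ((%t. \<epsilon> * \<Phi> t - c * exp (- (Q * t))) has_real_derivative D) (at r) \<and> D <= 0" by metis
 qed
 then show ?thesis by (simp add: c_def algebra_simps)
qed

text \<open>By concavity \<open>V \<ge> s \<Phi>\<^sup>1\<^sup>/\<^sup>a\<close>, so that \<open>\<Phi>' \<le> - K \<Phi>\<^sup>q\<^sup>/\<^sup>a\<close> near \<open>- \<infinity>\<close>: backwards in time the flux blows up.\<close>

theorem no_solution_near_bot:
 assumes qQ: "q <= Q" and e: "!!t. t < T ==> ef 1 V \<Phi> t"
 shows False
proof -
 have Q0: "Q > 0" "q > 0" using a aQ aq by auto
 have e': "ef 1 V \<Phi> t" if "t <= T - 1" for t using e that by simp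
 have "\<exists>t1\<le>T - 1. \<Phi> t1 > 0"
 proof (rule ccontr)
  assume "\<not> ?thesis"
  then have np: "\<Phi> t <= 0" if "t <= T - 1" for t using that by force
  have Vmono: "V (T - 1) <= V t" if "t <= T - 1" for t
   by (rule ef_V_mono(2)[OF _ that]) (use e' np that in auto)
  have V0: "V (T - 1) > 0" using e'[of "T - 1"] by (simp add: ef_def)
  define c where "c = K * V (T - 1) powr q / Q"
  have c: "c > 0" using K V0 Q0 by (simp add: c_def)
  obtain t where t: "t <= T - 1" "- \<Phi> (T - 1) + c * exp (- (Q * (T - 1))) < c * exp (- (Q * t))"
   using exp_unbounded_at_bot[OF Q0(1) c] by blast
  have "1 * \<Phi> (T - 1) + c * (exp (- (Q * t)) - exp (- (Q * (T - 1)))) <= 1 * \<Phi> t"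
   unfolding c_def by (rule flux_unbounded[OF e' _ Vmono V0 t(1)]) auto
  then show False using t(2) np[OF t(1)] by (simp add: right_diff_distrib)
 qed
 then obtain t1 where t1: "t1 <= T - 1" "\<Phi> t1 > 0" by blast
 define T0 where "T0 = min t1 0"
 have eT: "ef 1 V \<Phi> t" if "t <= T0" for t using e' that t1 by (simp add: T0_def)
 have pos: "\<Phi> t > 0" if "t <= T0" for t
 proof (cases "t = t1")
  case False
  then have lt: "t < t1" using that by (simp add: T0_def)
  have "\<Phi> t1 < \<Phi> t" by (rule ef_Phi_strict(1)[OF e' lt refl]) (use t1 in auto)
  then show ?thesis using t1 by simp
 qed (use t1 in simp)
 have Vge: "exp t * \<Phi> t powr (1 / a) <= V t" if "t <= T0" for t
  using ef_concave[OF eT pos that] psi_pos[OF pos[OF that]] by simp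
 define m where "m = q / a - 1"
 have m: "m > 0" using aq a by (simp add: m_def)
 \<comment> \<open>\<open>\<Phi>' \<le> - K \<Phi>\<^sup>m\<^sup>+\<^sup>1\<close> makes this positive function decrease at least linearly backwards in time.\<close>
 define G where "G = (%t. \<Phi> t powr (- m))"
 have grow: "G t <= G T0 + m * K * (t - T0)" if t: "t <= T0" for t
 proof -
  have "G t - m * K * t <= G T0 - m * K * T0"
  proof (rule DERIV_nonneg_imp_nondecreasing[OF t, where f="%t. G t - m * K * t"])
   fix r assume "t <= r" and r: "r <= T0"
   define P where "P = K * exp (- (Q * r)) * V r powr q"
   have d\<Phi>: "(\<Phi> has_real_derivative - P) (at r)" using eT[OF r] by (simp add: ef_def P_def)
   have dG: "(G has_real_derivative m * P * \<Phi> r powr (- m - 1)) (at r)"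
    unfolding G_def
    by (rule DERIV_cong[OF DERIV_powr[OF d\<Phi> pos[OF r] DERIV_const]]) (use pos[OF r] in \<open>simp add: powr_diff\<close>)
   have "(exp r * \<Phi> r powr (1 / a)) powr q <= V r powr q" using Vge[OF r] Q0 by (intro powr_mono2) auto
   then have "exp (q * r) * \<Phi> r powr (q / a) <= V r powr q"
    by (simp add: powr_mult powr_powr) (simp add: powr_def mult.commute)
   then have "K * exp (- (Q * r)) * (exp (q * r) * \<Phi> r powr (q / a)) <= P"
    unfolding P_def using K by (intro mult_left_mono) auto
   moreover have "1 <= exp (- (Q * r)) * exp (q * r)"
   proof -
    have "r <= 0" using r by (simp add: T0_def)
    then have "0 <= (Q - q) * - r" using qQ by (intro mult_nonneg_nonneg) auto
    then show ?thesis unfolding exp_add[symmetric] by (simp add: algebra_simps)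
   qed
   then have "K * 1 * \<Phi> r powr (q / a) <= K * (exp (- (Q * r)) * exp (q * r)) * \<Phi> r powr (q / a)"
    using K by (intro mult_right_mono mult_left_mono) auto
   ultimately have "K * \<Phi> r powr (q / a) <= P" by (simp add: mult.assoc)
   then have "K * \<Phi> r powr (q / a) * \<Phi> r powr (- m - 1) <= P * \<Phi> r powr (- m - 1)" by (rule mult_right_mono) simp
   moreover have "\<Phi> r powr (q / a) * \<Phi> r powr (- m - 1) = 1" using pos[OF r] by (simp add: m_def flip: powr_add)
   ultimately have "K <= P * \<Phi> r powr (- m - 1)" by (simp add: mult.assoc)
   then have "m * K <= m * P * \<Phi> r powr (- m - 1)" using m by (simp add: mult.assoc)
   moreover have "((%t. G t - m * K * t) has_real_derivative m * P * \<Phi> r powr (- m - 1) - m * K) (at r)"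
    by (rule derivative_eq_intros dG refl | simp)+
   ultimately show "\<exists>D. ((%t. G t - m * K * t) has_real_derivative D) (at r) \<and> 0 <= D"
    by (intro exI conjI) auto
  qed
  then show ?thesis by (simp add: algebra_simps)
 qed
 define t where "t = T0 - (G T0 / (m * K) + 1)"
 have "G T0 >= 0" by (simp add: G_def)
 then have "0 <= G T0 / (m * K)" using m K by simp
 then have tT: "t <= T0" by (simp add: t_def)
 have "m * K * (t - T0) = - G T0 - m * K" using m K by (simp add: t_def field_simps)
 then have "G t <= - (m * K)" using grow[OF tT] by simp
 moreover have "m * K > 0" using m K by simp
 moreover have "G t >= 0" by (simp add: G_def)
 ultimately show False by linarith
qed

lemma lv_log_derivatives:
 assumes lv: "lv x y t" and s: "sx * x t > 0" "sy * y t > 0"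
 shows "((%t. ln (sx * x t) + ln (sy * y t) / a) has_real_derivative - (Q / a - 1) + (q / a - 1) * x t) (at t)"
  "((%t. q * ln (sx * x t) + ln (sy * y t)) has_real_derivative (q - Q) - (q / a - 1) * y t) (at t)"
proof -
 have nz: "x t ~= 0" "y t ~= 0" "sx ~= 0" "sy ~= 0" using s by auto
 have dx: "((%t. ln (sx * x t)) has_real_derivative 1 - x t - y t / a) (at t)"
  using DERIV_chain2[OF DERIV_ln_divide[OF s(1)] DERIV_cmult[of x "x t * (1 - x t - y t / a)" t UNIV sx]] lv nz by (simp add: lv_def)
 have dy: "((%t. ln (sy * y t)) has_real_derivative - Q + q * x t + y t) (at t)"
  using DERIV_chain2[OF DERIV_ln_divide[OF s(2)] DERIV_cmult[of y "y t * (- Q + q * x t + y t)" t UNIV sy]] lv nz by (simp add: lv_def)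
 show "((%t. ln (sx * x t) + ln (sy * y t) / a) has_real_derivative - (Q / a - 1) + (q / a - 1) * x t) (at t)"
  by (rule DERIV_cong[OF DERIV_add[OF dx DERIV_cdivide[OF dy]]]) (use a in \<open>simp add: field_simps\<close>)
 show "((%t. q * ln (sx * x t) + ln (sy * y t)) has_real_derivative (q - Q) - (q / a - 1) * y t) (at t)"
  by (rule DERIV_cong[OF DERIV_add[OF DERIV_cmult[OF dx] dy]]) (use a in \<open>simp add: field_simps\<close>)
qed

text \<open>A positive flux would persist, and the orbit would stay in the quadrant \<open>x > 0 > y\<close>, where \<open>q > Q\<close> makes
 \<open>x\<close> and \<open>- y\<close> blow up in finite time.\<close>

theorem flux_nonpositive:
 assumes qQ: "Q < q" and e: "!!t. t > T ==> ef (- 1) V \<Phi> t" and t1: "t1 > T"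
 shows "\<Phi> t1 <= 0"
proof (rule ccontr)
 assume "\<not> \<Phi> t1 <= 0"
 then have \<Phi>1: "\<Phi> t1 > 0" by simp
 have pos: "\<Phi> t > 0" if "t >= t1" for t
 proof (cases "t = t1")
  case False
  then have lt: "t1 < t" using that by simp
  have "\<Phi> t1 < \<Phi> t" by (rule ef_Phi_strict(2)[OF e lt refl]) (use t1 in auto)
  then show ?thesis using \<Phi>1 by simp
 qed (use \<Phi>1 in simp)
 define x y where "x = lvX V \<Phi>" and "y = lvY (- 1) V \<Phi>"
 have lv: "lv x y t" if "t >= t1" for t
  unfolding x_def y_def using that e t1 pos[OF that] by (intro ef_imp_lv) auto
 have xp: "x t > 0" and yn: "y t < 0" if "t >= t1" for t
 proof -
  have "V t > 0" using e that t1 by (simp add: ef_def)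
  then show "x t > 0" "y t < 0" using pos[OF that] K
   by (auto simp: x_def y_def lvX_def lvY_def psi_pos_iff intro!: divide_neg_pos mult_pos_pos)
 qed
 have q0: "q > 0" "q / a - 1 > 0" using a aq by auto
 show False
 proof (rule finite_time_blow_up[where X=x and Y="%t. - y t" and T=t1 and a=a and q=q and c="q / a - 1"
    and \<alpha>="- (Q / a - 1)" and \<alpha>'="q - Q"])
  fix t assume t: "t >= t1"
  show "x t > 0" "- y t > 0" using xp[OF t] yn[OF t] by auto
  from lv_log_derivatives[OF lv[OF t], of 1 "- 1"] xp[OF t] yn[OF t]
  show "((%t. ln (x t) + ln (- y t) / a) has_real_derivative - (Q / a - 1) + (q / a - 1) * x t) (at t)"
   "((%t. q * ln (x t) + ln (- y t)) has_real_derivative (q - Q) + (q / a - 1) * - y t) (at t)" by simp_all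
 qed (use a q0 qQ in auto)
qed

text \<open>The flux of a global solution is negative throughout, so the orbit stays in the quadrant \<open>x < 0 < y\<close>, where blow-up
 occurs backwards in time.\<close>

theorem no_global_solution_absorption:
 assumes qQ: "Q < q" and e: "!!t. ef (- 1) V \<Phi> t"
 shows False
proof -
 have neg: "\<Phi> t < 0" for t
 proof -
  have "\<Phi> t < \<Phi> (t + 1)" by (rule ef_Phi_strict(2)[OF e _ refl]) auto
  moreover have "\<Phi> (t + 1) <= 0" by (rule flux_nonpositive[OF qQ e, of t]) simp
  ultimately show ?thesis by simp
 qed
 define x y where "x = lvX V \<Phi>" and "y = lvY (- 1) V \<Phi>"
 have lv: "lv x y t" for t unfolding x_def y_def using e neg[of t] by (intro ef_imp_lv) auto
 have xn: "x t < 0" and yp: "y t > 0" for t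
 proof -
  have V: "V t > 0" using e[of t] by (simp add: ef_def)
  have "psi (\<Phi> t) < 0" using psi_pos_iff[of "- \<Phi> t"] neg[of t] by (simp add: psi_minus)
  then show "x t < 0" "y t > 0" using V neg[of t] K
   by (auto simp: x_def y_def lvX_def lvY_def divide_less_0_iff zero_less_divide_iff mult_less_0_iff)
 qed
 have q0: "q > 0" "q / a - 1 > 0" "Q / a - 1 > 0" using a aq aQ by auto
 show False
 proof (rule finite_time_blow_up[where X="%t. - x (- t)" and Y="%t. y (- t)" and T=0 and a=a and q=q and c="q / a - 1"
    and \<alpha>="Q / a - 1" and \<alpha>'="Q - q"])
  fix t :: real
  show "- x (- t) > 0" "y (- t) > 0" using xn yp by auto
  have m: "(uminus has_real_derivative - 1) (at t)" by (rule derivative_eq_intros refl)+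
  have p: "- 1 * x (- t) > 0" "1 * y (- t) > 0" using xn yp by auto
  note l = lv_log_derivatives[OF lv p]
  show "((%t. ln (- x (- t)) + ln (y (- t)) / a) has_real_derivative Q / a - 1 + (q / a - 1) * - x (- t)) (at t)"
   using DERIV_chain2[OF l(1) m] by simp
  show "((%t. q * ln (- x (- t)) + ln (y (- t))) has_real_derivative Q - q + (q / a - 1) * y (- t)) (at t)"
   by (rule DERIV_cong[OF DERIV_chain2[OF l(2) m, simplified]]) simp
 qed (use a q0 in auto)
qed

theorem decreasing_solution_converges:
 assumes e: "!!t. t > T ==> ef \<epsilon> V \<Phi> t" and \<Phi>: "!!t. t > T ==> \<Phi> t <= 0"
 shows "\<exists>L. (V \<longlongrightarrow> L) at_top"
proof -
 have "\<exists>L. ((%t. - V t) \<longlongrightarrow> L) at_top \<and> (\<forall>t\<ge>T + 1. - V t <= L) \<and> L <= 0"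
 proof (rule mono_bounded_tendsto)
  show "- V s <= - V t" if "T + 1 <= s" "s <= t" for s t
   using ef_V_mono(2)[of s t \<epsilon> V \<Phi>] e \<Phi> that by simp
  show "- V t <= 0" if "T + 1 <= t" for t using e[of t] that by (simp add: ef_def)
 qed
 then obtain L where "((%t. - V t) \<longlongrightarrow> L) at_top" by blast
 from tendsto_minus[OF this] show ?thesis by auto
qed

text \<open>Below the Sobolev exponent the Pohozaev function \<open>V \<Phi> (1 - x - y / sob)\<close> is increasing. For a global solution with a
 finite limit it tends to zero at infinity, so it stays away from zero near \<open>- \<infinity>\<close>, where the a priori bounds \<open>x \<le> 1\<close>
 and \<open>y \<le> exp Q\<close> make it tend to zero.\<close>

theorem no_global_solution_with_limit:
 assumes qQ: "Q < q" and sub: "sob < Q" and e: "!!t. ef 1 V \<Phi> t" and lim: "(V \<longlongrightarrow> L) at_top"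
 shows False
proof -
 have Q0: "Q > 0" "q > 0" using a aQ aq by auto
 have sb: "sob > 0" using sob_gt a by simp
 have Vp: "V t > 0" for t using e[of t] by (simp add: ef_def)
 have dV: "(V has_real_derivative exp t * psi (\<Phi> t)) (at t)" for t using e[of t] by (simp add: ef_def)
 have \<Phi>dec: "\<Phi> t < \<Phi> s" if "s < t" for s t by (rule ef_Phi_strict(1)[OF _ that refl]) (use e in auto)
 \<comment> \<open>A flux bounded away from zero would make \<open>V\<close> unbounded.\<close>
 have lin: "V s + psi c * (exp t - exp s) <= V t" if "s <= t" "!!r. s <= r ==> c <= \<Phi> r" for s t c
 proof -
  have "V s - psi c * exp s <= V t - psi c * exp t"
  proof (rule DERIV_nonneg_imp_nondecreasing[OF that(1), where f="%t. V t - psi c * exp t"])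
   fix r assume r: "s <= r" "r <= t"
   have "((%t. V t - psi c * exp t) has_real_derivative exp r * (psi (\<Phi> r) - psi c)) (at r)"
    by (rule derivative_eq_intros dV refl | simp add: algebra_simps)+
   moreover have "psi c <= psi (\<Phi> r)" using that(2)[OF r(1)] by (rule psi_mono_le)
   ultimately show "\<exists>D. ((%t. V t - psi c * exp t) has_real_derivative D) (at r) \<and> 0 <= D"
    by (intro exI[of _ "exp r * (psi (\<Phi> r) - psi c)"]) auto
  qed
  then show ?thesis by (simp add: algebra_simps)
 qed
 have pos: "\<Phi> t > 0" for t
 proof (rule ccontr)
  assume "\<not> \<Phi> t > 0"
  then have n: "\<Phi> (t + 1) < 0" using \<Phi>dec[of t "t + 1"] by simp
  define c where "c = - psi (\<Phi> (t + 1))"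
  have c: "c > 0" using psi_pos_iff[of "- \<Phi> (t + 1)"] n by (simp add: c_def psi_minus)
  have up: "V r + c * exp r <= V (t + 1) + c * exp (t + 1)" if r: "t + 1 <= r" for r
  proof (rule DERIV_nonpos_imp_nonincreasing[OF r, where f="%r. V r + c * exp r"])
   fix u assume u: "t + 1 <= u" "u <= r"
   have "((%r. V r + c * exp r) has_real_derivative exp u * (psi (\<Phi> u) + c)) (at u)"
    by (rule derivative_eq_intros dV refl | simp add: algebra_simps)+
   moreover have "\<Phi> u <= \<Phi> (t + 1)" using \<Phi>dec[of "t + 1" u] u by (cases "u = t + 1") auto
   then have "psi (\<Phi> u) + c <= 0" using psi_mono_le[of "\<Phi> u" "\<Phi> (t + 1)"] by (simp add: c_def)
   then have "exp u * (psi (\<Phi> u) + c) <= 0" by (intro mult_nonneg_nonpos) auto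
   ultimately show "\<exists>D. ((%r. V r + c * exp r) has_real_derivative D) (at u) \<and> D <= 0" by blast
  qed
  obtain r where r: "r <= - (t + 1)" "V (t + 1) + c * exp (t + 1) < c * exp (- (1 * r))"
   using exp_unbounded_at_bot[OF zero_less_one c] by blast
  have "V (- r) + c * exp (- r) <= V (t + 1) + c * exp (t + 1)" using r by (intro up) simp
  then show False using r(2) Vp[of "- r"] by simp
 qed
 have Vmono: "V s <= V t" if "s <= t" for s t
  by (rule ef_V_mono(1)[OF _ that]) (use e pos in \<open>auto intro: less_imp_le\<close>)
 have VL: "V t <= L" for t
  by (rule tendsto_lowerbound[OF lim eventually_mono[OF eventually_ge_at_top[of t] Vmono]]) auto
 have \<Phi>0: "(\<Phi> \<longlongrightarrow> 0) at_top"
 proof (rule order_tendstoI)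
  fix b :: real assume "b < 0"
  then show "\<forall>\<^sub>F t in at_top. b < \<Phi> t" using pos by (auto intro!: always_eventually intro: less_trans)
 next
  fix b :: real assume b: "0 < b"
  have "\<exists>s. \<Phi> s < b"
  proof (rule ccontr)
   assume "\<not> ?thesis"
   then have ge: "b <= \<Phi> r" for r by (simp add: not_less)
   have pb: "psi b > 0" using b by (simp add: psi_pos_iff)
   obtain r where r: "r <= 0" "L + psi b < psi b * exp (- (1 * r))" using exp_unbounded_at_bot[OF zero_less_one pb] by blast
   have "V 0 + psi b * (exp (- r) - exp 0) <= V (- r)" using r ge by (intro lin) auto
   then show False using r(2) VL[of "- r"] Vp[of 0] by (simp add: right_diff_distrib)
  qed
  then obtain s where s: "\<Phi> s < b" by blast
  show "\<forall>\<^sub>F t in at_top. \<Phi> t < b"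
   using eventually_gt_at_top[of s] by eventually_elim (use \<Phi>dec s in \<open>auto intro: less_trans\<close>)
 qed
 have L0: "L > 0" using VL[of 0] Vp[of 0] by simp
 define c where "c = K * L powr q / Q"
 have c0: "c > 0" using K L0 Q0 by (simp add: c_def)
 have \<Phi>le: "\<Phi> t <= c * exp (- (Q * t))" for t
 proof -
  have mono: "\<Phi> s - c * exp (- (Q * s)) <= \<Phi> r - c * exp (- (Q * r))" if "s <= r" for s r
  proof (rule DERIV_nonneg_imp_nondecreasing[OF that, where f="%t. \<Phi> t - c * exp (- (Q * t))"])
   fix u
   have d\<Phi>: "(\<Phi> has_real_derivative - 1 * K * exp (- (Q * u)) * V u powr q) (at u)" using e[of u] by (simp add: ef_def)
   have "((%t. \<Phi> t - c * exp (- (Q * t))) has_real_derivative K * exp (- (Q * u)) * (L powr q - V u powr q)) (at u)"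
    by (rule derivative_eq_intros d\<Phi> refl | use Q0 in \<open>simp add: c_def algebra_simps\<close>)+
   moreover have "V u powr q <= L powr q" using VL[of u] Vp[of u] Q0 by (intro powr_mono2) auto
   ultimately show "\<exists>D. ((%t. \<Phi> t - c * exp (- (Q * t))) has_real_derivative D) (at u) \<and> 0 <= D"
    using K by (intro exI[of _ "K * exp (- (Q * u)) * (L powr q - V u powr q)"]) auto
  qed
  have "((%t. \<Phi> t - c * exp (- (Q * t))) \<longlongrightarrow> 0 - c * 0) at_top"
   by (intro tendsto_intros \<Phi>0 exp_decay_at_top Q0)
  then have "\<Phi> t - c * exp (- (Q * t)) <= 0 - c * 0"
   by (rule tendsto_lowerbound[OF _ eventually_mono[OF eventually_ge_at_top[of t] mono]]) auto
  then show ?thesis by simp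
 qed
 define x y where "x = lvX V \<Phi>" and "y = lvY 1 V \<Phi>"
 have nz: "\<Phi> t ~= 0" for t using pos[of t] by simp
 have lv: "lv x y t" for t unfolding x_def y_def by (rule ef_imp_lv[OF e nz])
 have xp: "x t > 0" and yp: "y t > 0" for t
  using Vp[of t] pos[of t] K by (auto simp: x_def y_def lvX_def lvY_def psi_pos_iff)
 define P where "P = (%t. V t * \<Phi> t * (1 - x t - y t / sob))"
 have dP: "(P has_real_derivative V t * \<Phi> t * (y t * (Q / sob - 1))) (at t)" for t
 proof -
  have d1: "((%t. V t * \<Phi> t) has_real_derivative V t * \<Phi> t * (x t - y t)) (at t)"
   by (rule DERIV_cong[OF DERIV_mult[OF ef_derivatives[OF e nz]]]) (simp add: x_def y_def algebra_simps)
  have d2: "((%t. 1 - x t - y t / sob) has_real_derivative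
    - (x t * (1 - x t - y t / a)) - y t * (- Q + q * x t + y t) / sob) (at t)"
   using lv[of t] sb unfolding lv_def by (auto intro!: derivative_eq_intros)
  show ?thesis unfolding P_def
   by (rule DERIV_cong[OF DERIV_mult[OF d1 d2[unfolded lam_derivative]]])
     (use sb in \<open>simp add: divide_simps, simp add: algebra_simps\<close>)
 qed
 have Pinc: "P s < P t" if "s < t" for s t
 proof (rule DERIV_pos_imp_increasing[OF that])
  fix r
  have "V r * \<Phi> r * (y r * (Q / sob - 1)) > 0" using Vp[of r] pos[of r] yp[of r] sub sb by simp
  then show "\<exists>D. (P has_real_derivative D) (at r) \<and> 0 < D" using dP by blast
 qed
 have Vx: "V t * x t = exp t * psi (\<Phi> t)" and Vy: "\<Phi> t * y t = K * exp (- (Q * t)) * V t powr q" for t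
  using Vp[of t] nz[of t] by (auto simp: x_def y_def lvX_def lvY_def)
 have Plim: "(P \<longlongrightarrow> 0) at_top"
 proof -
  have l: "Q * (1 + 1 / a) - 1 > 0"
  proof -
   have "1 < Q * (1 / a)" using a aQ by simp
   then show ?thesis using Q0 by (simp add: algebra_simps)
  qed
  have psile: "psi (\<Phi> t) <= c powr (1 / a) * exp (- (Q * t) / a)" for t
  proof -
   have "psi (\<Phi> t) = \<Phi> t powr (1 / a)" by (rule psi_pos[OF pos])
   also have "\<dots> <= (c * exp (- (Q * t))) powr (1 / a)" using \<Phi>le[of t] pos[of t] a by (intro powr_mono2) auto
   also have "\<dots> = c powr (1 / a) * exp (- (Q * t) / a)" using c0 by (subst powr_mult) (auto simp: powr_def)
   finally show ?thesis .
  qed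
  have b1: "V t * \<Phi> t <= L * (c * exp (- (Q * t)))" for t
   using VL[of t] \<Phi>le[of t] Vp[of t] pos[of t] L0 by (intro mult_mono) auto
  have b2: "V t * \<Phi> t * x t <= c * c powr (1 / a) * exp (- ((Q * (1 + 1 / a) - 1) * t))" for t
  proof -
   have "V t * \<Phi> t * x t = exp t * (\<Phi> t * psi (\<Phi> t))" using Vx[of t] by (simp add: mult_ac)
   also have "\<dots> <= exp t * ((c * exp (- (Q * t))) * (c powr (1 / a) * exp (- (Q * t) / a)))"
    using \<Phi>le[of t] psile[of t] pos[of t] c0 psi_pos_iff[of "\<Phi> t"] by (intro mult_left_mono mult_mono) auto
   also have "\<dots> = c * c powr (1 / a) * (exp t * (exp (- (Q * t)) * exp (- (Q * t) / a)))" by (simp add: mult_ac)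
   also have "exp t * (exp (- (Q * t)) * exp (- (Q * t) / a)) = exp (- ((Q * (1 + 1 / a) - 1) * t))"
    unfolding exp_add[symmetric] by (simp add: algebra_simps)
   finally show ?thesis .
  qed
  have b3: "V t * \<Phi> t * y t <= L * (K * exp (- (Q * t)) * L powr q)" for t
  proof -
   have "V t * \<Phi> t * y t = V t * (K * exp (- (Q * t)) * V t powr q)" using Vy[of t] by (simp add: mult.assoc)
   also have "\<dots> <= L * (K * exp (- (Q * t)) * L powr q)"
    using VL[of t] Vp[of t] K L0 Q0 by (intro mult_mono mult_left_mono powr_mono2) auto
   finally show ?thesis .
  qed
  have z: "((%t. L * (c * exp (- (Q * t))) + c * c powr (1 / a) * exp (- ((Q * (1 + 1 / a) - 1) * t))
    + L * (K * exp (- (Q * t)) * L powr q) / sob) \<longlongrightarrow> L * (c * 0) + c * c powr (1 / a) * 0 + L * (K * 0 * L powr q) / sob) at_top"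
   using sb by (intro tendsto_intros exp_decay_at_top Q0 l) auto
  show ?thesis
  proof (rule Lim_null_comparison[OF always_eventually z[simplified]], intro allI)
   fix t
   have p: "V t * \<Phi> t > 0" "V t * \<Phi> t * x t > 0" "V t * \<Phi> t * y t / sob > 0" using Vp[of t] pos[of t] xp[of t] yp[of t] sb by auto
   have "P t = V t * \<Phi> t - V t * \<Phi> t * x t - V t * \<Phi> t * y t / sob" by (simp add: P_def right_diff_distrib)
   then have "\<bar>P t\<bar> <= V t * \<Phi> t + V t * \<Phi> t * x t + V t * \<Phi> t * y t / sob" using p by linarith
   also have "\<dots> <= L * (c * exp (- (Q * t))) + c * c powr (1 / a) * exp (- ((Q * (1 + 1 / a) - 1) * t))
    + L * (K * exp (- (Q * t)) * L powr q) / sob"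
    using b1[of t] b2[of t] divide_right_mono[OF b3[of t], of sob] sb by (intro add_mono) auto
   finally show "norm (P t) <= L * (c * exp (- (Q * t))) + c * c powr (1 / a) * exp (- ((Q * (1 + 1 / a) - 1) * t))
    + L * (K * exp (- (Q * t)) * L powr q) / sob" by simp
  qed
 qed
 have P0: "P 0 < 0"
 proof -
  have "P 1 <= 0"
   by (rule tendsto_lowerbound[OF Plim eventually_mono[OF eventually_gt_at_top[of 1] less_imp_le[OF Pinc]]]) auto
  then show ?thesis using Pinc[of 0 1] by simp
 qed
 have x1: "x t <= 1" for t
  using ef_concave[of t V \<Phi> t] e pos Vp[of t] by (simp add: x_def lvX_def divide_le_eq)
 have ybound: "y t <= exp Q" for t
 proof -
  obtain s where s: "s > t" "s < t + 1" "\<Phi> (t + 1) - \<Phi> t = (t + 1 - t) * (- 1 * K * exp (- (Q * s)) * V s powr q)"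
   using MVT2[of t "t + 1" \<Phi> "%s. - 1 * K * exp (- (Q * s)) * V s powr q"] e by (auto simp: ef_def)
  then have "K * exp (- (Q * s)) * V s powr q <= \<Phi> t" using pos[of "t + 1"] by simp
  moreover have "K * exp (- (Q * (t + 1))) * V t powr q <= K * exp (- (Q * s)) * V s powr q"
   using s Vmono[of t s] Vp[of t] K Q0 by (intro mult_mono mult_left_mono powr_mono2) auto
  ultimately have "K * exp (- (Q * (t + 1))) * V t powr q <= \<Phi> t" by simp
  moreover have "exp (- (Q * (t + 1))) = exp (- (Q * t)) * exp (- Q)" unfolding exp_add[symmetric] by (simp add: algebra_simps)
  ultimately have "\<Phi> t * y t * exp (- Q) <= \<Phi> t * 1" unfolding Vy by (simp add: mult_ac)
  then have "y t * exp (- Q) <= 1" using pos[of t] unfolding mult.assoc by (simp only: mult_le_cancel_left_pos)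
  then show ?thesis by (simp add: exp_minus field_simps)
 qed
 \<comment> \<open>Near \<open>- \<infinity>\<close>: \<open>V\<close> is at most of the order of the self-similar solution.\<close>
 define D where "D = (exp Q / K) powr (1 / (q - a))"
 have Vle: "V t <= D * exp (\<delta> * t)" for t
 proof -
  have "psi (\<Phi> t) = \<Phi> t powr (1 / a)" by (rule psi_pos[OF pos])
  then have "exp t * \<Phi> t powr (1 / a) <= V t" using x1[of t] Vx[of t] Vp[of t] by (metis mult_le_cancel_left1 not_le order_less_imp_le mult_right_le_one_le xp)
  then have "\<Phi> t powr (1 / a) <= V t * exp (- t)" by (simp add: exp_minus field_simps)
  then have "(\<Phi> t powr (1 / a)) powr a <= (V t * exp (- t)) powr a" using a by (intro powr_mono2) auto
  then have Ph: "\<Phi> t <= V t powr a * exp (- (a * t))"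
   using pos[of t] Vp[of t] a by (simp add: powr_powr powr_mult) (simp add: powr_def)
  have "K * exp (- (Q * t)) * V t powr q = \<Phi> t * y t" using Vy by simp
  also have "\<dots> <= V t powr a * exp (- (a * t)) * exp Q"
   using Ph ybound[of t] pos[of t] yp[of t] by (intro mult_mono) auto
  finally have 1: "K * exp (- (Q * t)) * V t powr q <= V t powr a * exp (- (a * t)) * exp Q" .
  have "V t powr q = V t powr a * V t powr (q - a)" by (simp flip: powr_add)
  then have "V t powr a * (K * exp (- (Q * t)) * V t powr (q - a)) <= V t powr a * (exp (- (a * t)) * exp Q)"
   using 1 by (simp add: mult_ac)
  then have "K * exp (- (Q * t)) * V t powr (q - a) <= exp (- (a * t)) * exp Q" using Vp[of t] by simp
  then have "exp (Q * t) * (K * exp (- (Q * t)) * V t powr (q - a)) <= exp (Q * t) * (exp (- (a * t)) * exp Q)"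
   by (rule mult_left_mono) simp
  moreover have "exp (Q * t) * (K * exp (- (Q * t)) * V t powr (q - a)) = K * V t powr (q - a)"
   by (simp add: exp_minus field_simps)
  moreover have "exp (Q * t) * (exp (- (a * t)) * exp Q) = exp Q * exp ((Q - a) * t)"
   unfolding exp_add[symmetric] by (simp add: algebra_simps)
  ultimately have "K * V t powr (q - a) <= exp Q * exp ((Q - a) * t)" by (simp only:)
  then have "V t powr (q - a) <= exp Q * exp ((Q - a) * t) / K" using K by (simp add: pos_le_divide_eq mult.commute)
  then have "V t powr (q - a) <= exp Q / K * exp ((Q - a) * t)" by simp
  then have "(V t powr (q - a)) powr (1 / (q - a)) <= (exp Q / K * exp ((Q - a) * t)) powr (1 / (q - a))"
   using aq by (intro powr_mono2) auto
  moreover have "(V t powr (q - a)) powr (1 / (q - a)) = V t" using aq Vp[of t] by (simp add: powr_powr)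
  moreover have "(exp Q / K * exp ((Q - a) * t)) powr (1 / (q - a)) = D * exp (\<delta> * t)"
  proof -
   have "exp ((Q - a) * t) powr (1 / (q - a)) = exp (\<delta> * t)" by (simp add: powr_def \<delta>_def)
   then show ?thesis unfolding D_def using K by (subst powr_mult) auto
  qed
  ultimately show ?thesis by simp
 qed
 have Dp: "D >= 0" by (simp add: D_def)
 define ee where "ee = \<delta> * (q + 1) - Q"
 have ee: "ee > 0"
 proof -
  have "ee * (q - a) = (\<delta> * (q - a)) * (q + 1) - Q * (q - a)" by (simp add: ee_def algebra_simps)
  also have "\<dots> = (a + 1) * (Q - sob)" unfolding \<delta>_eq sob_def using a by (simp add: field_simps)
  also have "\<dots> > 0" using sub a by simp
  finally show ?thesis using aq by (simp add: zero_less_mult_iff)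
 qed
 have Pge: "- P t <= K * D powr (q + 1) / sob * exp (ee * t)" for t
 proof -
  have "- P t <= V t * \<Phi> t * (y t / sob)"
  proof -
   have "V t * \<Phi> t * (x t + y t / sob - 1) <= V t * \<Phi> t * (y t / sob)"
    using x1[of t] Vp[of t] pos[of t] by (intro mult_left_mono) auto
   then show ?thesis by (simp add: P_def algebra_simps)
  qed
  also have "\<dots> = K * exp (- (Q * t)) * V t powr (q + 1) / sob"
   using Vy[of t] Vp[of t] by (simp add: powr_add mult_ac)
  also have "\<dots> <= K * exp (- (Q * t)) * (D * exp (\<delta> * t)) powr (q + 1) / sob"
   using Vle[of t] Vp[of t] K sb Q0 by (intro divide_right_mono mult_left_mono powr_mono2) auto
  also have "(D * exp (\<delta> * t)) powr (q + 1) = D powr (q + 1) * exp (\<delta> * t * (q + 1))"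
   using Dp by (subst powr_mult) (auto simp: powr_def mult.commute)
  also have "K * exp (- (Q * t)) * (D powr (q + 1) * exp (\<delta> * t * (q + 1))) / sob
    = K * D powr (q + 1) / sob * (exp (- (Q * t)) * exp (\<delta> * t * (q + 1)))" by (simp add: mult_ac)
  also have "exp (- (Q * t)) * exp (\<delta> * t * (q + 1)) = exp (ee * t)"
   unfolding exp_add[symmetric] by (simp add: ee_def algebra_simps)
  finally show ?thesis .
 qed
 have "((%t. K * D powr (q + 1) / sob * exp (ee * t)) \<longlongrightarrow> K * D powr (q + 1) / sob * 0) at_bot"
  by (intro tendsto_intros exp_decay_at_bot ee)
 then have "- P 0 <= K * D powr (q + 1) / sob * 0"
 proof (rule tendsto_lowerbound)
  show "\<forall>\<^sub>F t in at_bot. - P 0 <= K * D powr (q + 1) / sob * exp (ee * t)"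
   using eventually_gt_at_bot[of 0]
  proof eventually_elim
   case (elim t)
   then show ?case using Pinc[of t 0] Pge[of t] by simp
  qed
 qed simp
 then show False using P0 by simp
qed

end

section \<open>The radial equation in logarithmic variables\<close>

text \<open>The parameters of the radial equation, expressed through those of the autonomous system.\<close>

locale weighted_equation = emden_fowler +
 fixes N p \<sigma> \<beta> :: real
 assumes p_eq: "p = a + 1" and N_eq: "N = a + 1 - a * \<beta>" and \<sigma>_eq: "\<sigma> = a * \<beta> - a - 1 - Q * \<beta>"
  and \<beta>: "\<beta> > 0" and K_eq: "K = \<beta> powr (- a - 1)"
begin

lemma psi_inverse: "\<bar>psi z\<bar> powr (a - 1) * psi z = z"
proof (cases "z = 0")
 case False
 have "\<bar>psi z\<bar> powr (a - 1) * \<bar>psi z\<bar> = \<bar>psi z\<bar> powr a"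
  using False by (simp add: psi_def abs_mult abs_sgn_eq powr_diff)
 also have "\<dots> = \<bar>z\<bar>" using False a by (simp add: psi_def abs_mult abs_sgn_eq powr_powr)
 finally have "sgn z * (\<bar>psi z\<bar> powr (a - 1) * \<bar>psi z\<bar>) = sgn z * \<bar>z\<bar>" by simp
 moreover have "sgn z * \<bar>psi z\<bar> = psi z" using psi_sgn[of z] by (metis mult.commute abs_mult_sgn)
 ultimately show ?thesis by (metis mult.left_commute sgn_mult_abs)
qed (simp add: psi_def)

definition Vt :: "(real => real) => real => real" where
 "Vt w t = w (exp (t / \<beta>))"

definition Phit :: "(real => real) => real => real" where
 "Phit w t = \<beta> powr (- a) * exp ((N - 1) * (t / \<beta>)) * flux p w (exp (t / \<beta>))"

lemma exp_powr: "exp u powr v = exp (v * u)" for u v :: real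
 by (simp add: powr_def)

lemma N_minus_1: "(N - 1) * (t / \<beta>) = a * (t / \<beta> - t)"
 using \<beta> by (simp add: N_eq field_simps)

lemma psi_Phit: "psi (Phit w t) = exp (t / \<beta> - t) * deriv w (exp (t / \<beta>)) / \<beta>"
proof -
 have "psi (Phit w t) = (\<beta> powr (- a) * exp (a * (t / \<beta> - t))) powr (1 / a) * psi (flux p w (exp (t / \<beta>)))"
  unfolding Phit_def N_minus_1 by (rule psi_mult) (use \<beta> in simp)
 also have "psi (flux p w (exp (t / \<beta>))) = deriv w (exp (t / \<beta>))"
  using psi_eq[of "deriv w (exp (t / \<beta>))"] by (simp add: flux_def p_eq)
 also have "(\<beta> powr (- a) * exp (a * (t / \<beta> - t))) powr (1 / a) = exp (t / \<beta> - t) / \<beta>"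
 proof -
  have 1: "(\<beta> powr (- a)) powr (1 / a) = inverse \<beta>"
   unfolding powr_powr using \<beta> a by (simp add: powr_minus)
  have 2: "exp (a * (t / \<beta> - t)) powr (1 / a) = exp (t / \<beta> - t)"
   unfolding exp_powr using a by simp
  have "(\<beta> powr (- a) * exp (a * (t / \<beta> - t))) powr (1 / a) = inverse \<beta> * exp (t / \<beta> - t)"
   unfolding 1[symmetric] 2[symmetric] by (rule powr_mult)
  then show ?thesis by (simp add: divide_inverse mult.commute)
 qed
 finally show ?thesis by simp
qed

lemma solution_imp_ef:
 assumes sol: "pos_solution_on N p q \<sigma> \<epsilon> I w" and t: "exp (t / \<beta>) \<in> I"
 shows "ef \<epsilon> (Vt w) (Phit w) t"
proof -
 define r where "r = exp (t / \<beta>)"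
 have r: "r > 0" by (simp add: r_def)
 have w: "w r > 0" "w differentiable (at r)" "flux p w differentiable (at r)"
  and eq: "- deriv (flux p w) r - (N - 1) / r * flux p w r = \<epsilon> * r powr \<sigma> * w r powr q"
  using sol t by (auto simp: pos_solution_on_def r_def)
 have dw: "(w has_real_derivative deriv w r) (at r)" and dF: "(flux p w has_real_derivative deriv (flux p w) r) (at r)"
  using w by (metis DERIV_imp_deriv real_differentiableE)+
 have dr: "((%t. exp (t / \<beta>)) has_real_derivative r / \<beta>) (at t)"
  unfolding r_def by (rule derivative_eq_intros refl | use \<beta> in simp)+
 have dV: "(Vt w has_real_derivative deriv w r * (r / \<beta>)) (at t)"
  using DERIV_chain2[OF dw[unfolded r_def] dr] by (simp add: Vt_def[abs_def] r_def)
 have "exp t * psi (Phit w t) = deriv w r * (r / \<beta>)"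
  by (simp add: psi_Phit r_def exp_diff)
 moreover have "(Phit w has_real_derivative - \<epsilon> * K * exp (- (Q * t)) * Vt w t powr q) (at t)"
 proof -
  have de: "((%t. \<beta> powr (- a) * exp ((N - 1) * (t / \<beta>))) has_real_derivative
    \<beta> powr (- a) * exp ((N - 1) * (t / \<beta>)) * ((N - 1) / \<beta>)) (at t)"
   by (rule derivative_eq_intros refl | use \<beta> in simp)+
  define E where "E = \<beta> powr (- a) * exp ((N - 1) * (t / \<beta>))"
  have d0: "(Phit w has_real_derivative E * ((N - 1) / \<beta>) * flux p w r + deriv (flux p w) r * (r / \<beta>) * E) (at t)"
   using DERIV_mult[OF de DERIV_chain2[OF dF[unfolded r_def] dr]] unfolding Phit_def[abs_def] by (simp add: E_def r_def)
  have d1: "E * ((N - 1) / \<beta>) * flux p w r + deriv (flux p w) r * (r / \<beta>) * E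
   = - (E * (r / \<beta>)) * (- deriv (flux p w) r - (N - 1) / r * flux p w r)"
   using r \<beta> by (simp add: field_simps)
  have d2: "E * (r / \<beta>) * r powr \<sigma> = K * exp (- (Q * t))"
  proof -
   have 1: "\<beta> powr (- a) / \<beta> = K" using \<beta> by (simp add: K_eq powr_diff)
   have 2: "(N - 1) * (t / \<beta>) + (t / \<beta> + \<sigma> * (t / \<beta>)) = - (Q * t)"
    using \<beta> by (simp add: N_eq \<sigma>_eq field_simps)
   have "E * (r / \<beta>) * r powr \<sigma> = \<beta> powr (- a) / \<beta> * (exp ((N - 1) * (t / \<beta>)) * (exp (t / \<beta>) * exp (\<sigma> * (t / \<beta>))))"
    by (simp add: E_def r_def exp_powr mult_ac)
   then show ?thesis unfolding 1 exp_add[symmetric] 2 .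
  qed
  have "- (E * (r / \<beta>)) * (\<epsilon> * r powr \<sigma> * w r powr q) = - \<epsilon> * (E * (r / \<beta>) * r powr \<sigma>) * w r powr q"
   by simp
  then have "- (E * (r / \<beta>)) * (\<epsilon> * r powr \<sigma> * w r powr q) = - \<epsilon> * K * exp (- (Q * t)) * Vt w t powr q"
   unfolding d2 by (simp add: Vt_def r_def)
  then show ?thesis using DERIV_cong[OF d0 d1] unfolding eq by metis
 qed
 ultimately show ?thesis using w(1) dV by (simp add: ef_def Vt_def r_def)
qed

lemma ef_imp_solution:
 assumes S: "open S" and e: "!!t. t \<in> S ==> ef \<epsilon> V \<Phi> t" and w: "!!r. r > 0 ==> w r = V (\<beta> * ln r)"
 shows "pos_solution_on N p q \<sigma> \<epsilon> {r. r > 0 \<and> \<beta> * ln r \<in> S} w"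
  "r > 0 ==> \<beta> * ln r \<in> S ==> deriv w r = \<beta> / r * (r powr \<beta> * psi (\<Phi> (\<beta> * ln r)))"
proof -
 define U where "U = {r. r > 0 \<and> \<beta> * ln r \<in> S}"
 have U: "open U"
 proof -
  have "U = {0<..} \<inter> (%r. \<beta> * ln r) -` S" by (auto simp: U_def)
  moreover have "continuous_on {0<..} (%r::real. \<beta> * ln r)" by (intro continuous_intros) auto
  ultimately show ?thesis using continuous_on_open_vimage[of "{0<..}" "%r. \<beta> * ln r"] S by (simp add: Int_commute)
 qed
 have dl: "((%r. \<beta> * ln r) has_real_derivative \<beta> / r) (at r)" if "r > 0" for r
  by (rule derivative_eq_intros refl | use that in simp)+
 have pw: "exp (\<beta> * ln r) = r powr \<beta>" if "r > 0" for r using that by (simp add: powr_def)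
 have dw: "(w has_real_derivative \<beta> / r * (r powr \<beta> * psi (\<Phi> (\<beta> * ln r)))) (at r)" if r: "r \<in> U" for r
 proof -
  have r0: "r > 0" "\<beta> * ln r \<in> S" using r by (auto simp: U_def)
  have dV: "(V has_real_derivative r powr \<beta> * psi (\<Phi> (\<beta> * ln r))) (at (\<beta> * ln r))"
   using e[OF r0(2)] by (simp add: ef_def pw[OF r0(1)])
  have "((%r. V (\<beta> * ln r)) has_real_derivative \<beta> / r * (r powr \<beta> * psi (\<Phi> (\<beta> * ln r)))) (at r)"
   by (rule DERIV_cong[OF DERIV_chain2[OF dV dl[OF r0(1)]]]) simp
  then show ?thesis
   by (rule has_field_derivative_transform_within_open[OF _ U r]) (auto simp: w U_def)
 qed
 have deriv: "deriv w r = \<beta> / r * (r powr \<beta> * psi (\<Phi> (\<beta> * ln r)))" if "r \<in> U" for r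
  using dw[OF that] by (rule DERIV_imp_deriv)
 then show "r > 0 ==> \<beta> * ln r \<in> S ==> deriv w r = \<beta> / r * (r powr \<beta> * psi (\<Phi> (\<beta> * ln r)))"
  by (simp add: U_def)
 have Feq: "flux p w r = \<beta> powr a * r powr (1 - N) * \<Phi> (\<beta> * ln r)" if r: "r \<in> U" for r
 proof -
  have r0: "r > 0" using r by (simp add: U_def)
  define z where "z = psi (\<Phi> (\<beta> * ln r))"
  define k where "k = \<beta> * r powr (\<beta> - 1)"
  have k: "k > 0" using \<beta> r0 by (simp add: k_def)
  have d: "deriv w r = k * z" using r0 by (simp add: deriv[OF r] k_def z_def powr_diff)
  have "flux p w r = k powr (a - 1) * k * (\<bar>z\<bar> powr (a - 1) * z)"
   using k by (simp add: flux_def d p_eq abs_mult powr_mult)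
  also have "k powr (a - 1) * k = k powr a" using k by (simp add: powr_diff)
  also have "k powr a = \<beta> powr a * r powr (1 - N)"
  proof -
   have "(\<beta> - 1) * a = 1 - N" by (simp add: N_eq algebra_simps)
   then show ?thesis using \<beta> r0 by (simp add: k_def powr_mult powr_powr)
  qed
  finally show ?thesis by (simp add: z_def psi_inverse)
 qed
 have dF: "(flux p w has_real_derivative \<beta> powr a * ((1 - N) * r powr (- N) * \<Phi> (\<beta> * ln r)
   + r powr (1 - N) * (- \<epsilon> * K * exp (- (Q * (\<beta> * ln r))) * V (\<beta> * ln r) powr q * (\<beta> / r)))) (at r)" if r: "r \<in> U" for r
 proof -
  have r0: "r > 0" "\<beta> * ln r \<in> S" using r by (auto simp: U_def)
  have d\<Phi>: "(\<Phi> has_real_derivative - \<epsilon> * K * exp (- (Q * (\<beta> * ln r))) * V (\<beta> * ln r) powr q) (at (\<beta> * ln r))"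
   using e[OF r0(2)] by (simp add: ef_def)
  have dp: "((%r. \<beta> powr a * r powr (1 - N)) has_real_derivative \<beta> powr a * ((1 - N) * r powr (- N))) (at r)"
   by (rule derivative_eq_intros refl | use r0 in simp)+
  have "((%r. \<beta> powr a * r powr (1 - N) * \<Phi> (\<beta> * ln r)) has_real_derivative \<beta> powr a * ((1 - N) * r powr (- N) * \<Phi> (\<beta> * ln r)
   + r powr (1 - N) * (- \<epsilon> * K * exp (- (Q * (\<beta> * ln r))) * V (\<beta> * ln r) powr q * (\<beta> / r)))) (at r)"
   by (rule DERIV_cong[OF DERIV_mult[OF dp DERIV_chain2[OF d\<Phi> dl[OF r0(1)]]]]) (simp add: algebra_simps)
  then show ?thesis
   by (rule has_field_derivative_transform_within_open[OF _ U r]) (simp add: Feq)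
 qed
 have "w r > 0 \<and> w differentiable (at r) \<and> flux p w differentiable (at r) \<and>
    - deriv (flux p w) r - (N - 1) / r * flux p w r = \<epsilon> * r powr \<sigma> * w r powr q" if r: "r \<in> U" for r
 proof -
  have r0: "r > 0" "\<beta> * ln r \<in> S" using r by (auto simp: U_def)
  have V: "V (\<beta> * ln r) > 0" using e[OF r0(2)] by (simp add: ef_def)
  have pN: "r powr (1 - N) = r * r powr (- N)" using r0 by (simp add: powr_diff powr_minus divide_inverse)
  define G where "G = K * exp (- (Q * (\<beta> * ln r))) * V (\<beta> * ln r) powr q"
  have "- deriv (flux p w) r - (N - 1) / r * flux p w r = \<epsilon> * (\<beta> powr a * \<beta>) * (r powr (- N) * G)"
   using r0 by (simp add: DERIV_imp_deriv[OF dF[OF r]] Feq[OF r] pN G_def field_simps)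
  also have "\<beta> powr a * \<beta> = \<beta> powr (a + 1)" using \<beta> by (simp add: powr_add)
  also have "r powr (- N) * G = K * (r powr (- N) * r powr (- (Q * \<beta>))) * V (\<beta> * ln r) powr q"
   using r0 by (simp add: G_def powr_def mult_ac)
  also have "r powr (- N) * r powr (- (Q * \<beta>)) = r powr \<sigma>"
  proof -
   have "- N + - (Q * \<beta>) = \<sigma>" by (simp add: N_eq \<sigma>_eq)
   then show ?thesis by (metis powr_add)
  qed
  also have "\<epsilon> * \<beta> powr (a + 1) * (K * r powr \<sigma> * V (\<beta> * ln r) powr q) = \<epsilon> * r powr \<sigma> * V (\<beta> * ln r) powr q * (\<beta> powr (a + 1) * K)"
   by (simp add: mult_ac)
  also have "\<beta> powr (a + 1) * K = 1" using \<beta> by (simp add: K_eq flip: powr_add)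
  finally show ?thesis
   using V r0 dw[OF r] dF[OF r] by (auto simp: w real_differentiable_def)
 qed
 then show "pos_solution_on N p q \<sigma> \<epsilon> {r. r > 0 \<and> \<beta> * ln r \<in> S} w"
  by (simp add: pos_solution_on_def flip: U_def)
qed

lemma lv_imp_solution:
 assumes S: "open S" and lv: "!!t. t \<in> S ==> lv x y t \<and> \<epsilon> * (x t * y t) > 0" and \<epsilon>: "\<epsilon> = 1 \<or> \<epsilon> = - 1"
  and w: "!!r. r > 0 ==> w r = Vof x y (\<beta> * ln r)"
 shows "pos_solution_on N p q \<sigma> \<epsilon> {r. r > 0 \<and> \<beta> * ln r \<in> S} w"
  "r > 0 ==> \<beta> * ln r \<in> S ==> deriv w r = \<beta> / r * (Vof x y (\<beta> * ln r) * x (\<beta> * ln r))"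
proof -
 have e: "ef \<epsilon> (Vof x y) (Phiof \<epsilon> x y) t" "exp t * psi (Phiof \<epsilon> x y t) = Vof x y t * x t" if "t \<in> S" for t
  using lv_imp_ef[of x y t \<epsilon>] lv[OF that] \<epsilon> by auto
 show "pos_solution_on N p q \<sigma> \<epsilon> {r. r > 0 \<and> \<beta> * ln r \<in> S} w" by (rule ef_imp_solution(1)[OF S e(1) w])
 assume r: "r > 0" "\<beta> * ln r \<in> S"
 have "r powr \<beta> = exp (\<beta> * ln r)" using r by (simp add: powr_def)
 then show "deriv w r = \<beta> / r * (Vof x y (\<beta> * ln r) * x (\<beta> * ln r))"
  using e(2)[OF r(2)] by (subst ef_imp_solution(2)[OF S e(1) w r]) simp_all
qed

lemma ln_filterlims:
 "filterlim (%r. \<beta> * ln r) at_top at_top" "filterlim (%r. \<beta> * ln r) at_bot (at_right 0)"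
 by (intro filterlim_tendsto_pos_mult_at_top[OF tendsto_const \<beta> ln_at_top])
   (intro filterlim_tendsto_pos_mult_at_bot[OF tendsto_const \<beta> ln_at_0])

lemma exp_filterlims:
 "filterlim (%t. exp (t / \<beta>)) at_top at_top" "filterlim (%t. exp (t / \<beta>)) (at_right 0) at_bot"
proof -
 have b: "0 < 1 / \<beta>" using \<beta> by simp
 have l: "filterlim (%t. t / \<beta>) at_top at_top" "filterlim (%t. t / \<beta>) at_bot at_bot"
  using filterlim_tendsto_pos_mult_at_top[OF tendsto_const b filterlim_ident]
   filterlim_tendsto_pos_mult_at_bot[OF tendsto_const b filterlim_ident] by simp_all
 show "filterlim (%t. exp (t / \<beta>)) at_top at_top" by (rule filterlim_compose[OF exp_at_top l(1)])
 have "filterlim (exp :: real => real) (at_right 0) at_bot"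
  using exp_at_bot by (auto simp: filterlim_at)
 then show "filterlim (%t. exp (t / \<beta>)) (at_right 0) at_bot" by (rule filterlim_compose[OF _ l(2)])
qed

lemma pos_eventually: "\<forall>\<^sub>F r in at_top. r > (0::real)" "\<forall>\<^sub>F r in at_right 0. r > (0::real)"
 by (auto simp: eventually_gt_at_top eventually_at_right_less)

lemma limit_to_log:
 assumes f: "!!t. f t = g (exp (t / \<beta>))"
 shows "(g \<longlongrightarrow> L) at_top ==> (f \<longlongrightarrow> L) at_top" "(g \<longlongrightarrow> L) (at_right 0) ==> (f \<longlongrightarrow> L) at_bot"
 using filterlim_compose[OF _ exp_filterlims(1), of g "nhds L"] filterlim_compose[OF _ exp_filterlims(2), of g "nhds L"]
 by (simp_all flip: f)

lemma eventually_from_log: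
 assumes P: "!!r. r > 0 ==> P (\<beta> * ln r) ==> R r"
 shows "eventually P at_top ==> eventually R at_top" "eventually P at_bot ==> eventually R (at_right 0)"
proof -
 assume "eventually P at_top"
 from eventually_compose_filterlim[OF this ln_filterlims(1)] pos_eventually(1)
 show "eventually R at_top" by eventually_elim (rule P)
next
 assume "eventually P at_bot"
 from eventually_compose_filterlim[OF this ln_filterlims(2)] pos_eventually(2)
 show "eventually R (at_right 0)" by eventually_elim (rule P)
qed

lemma eventually_to_log:
 assumes P: "!!t. R (exp (t / \<beta>)) ==> P t"
 shows "eventually R at_top ==> eventually P at_top" "eventually R (at_right 0) ==> eventually P at_bot"
 using eventually_compose_filterlim[OF _ exp_filterlims(1), of R] eventually_compose_filterlim[OF _ exp_filterlims(2), of R]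
 by (auto elim: eventually_mono intro: P)

lemma exp_log_inverse: "r > 0 ==> exp (\<beta> * ln r / \<beta>) = r" "\<beta> * ln (exp (t / \<beta>)) = t"
 using \<beta> by auto

text \<open>The exponents of the radial problem in terms of \<open>\<beta>\<close>, \<open>\<delta>\<close> and \<open>Q\<close>.\<close>

lemma exponents:
 "(N - p) / (p - 1) = - \<beta>" "(N - 1) / (p - 1) = 1 - \<beta>" "- (\<sigma> + 1) / (p - 1) = Q * \<beta> / a + (1 - \<beta>)"
 "gam p q \<sigma> = - (\<beta> * \<delta>)" "(p - N) / (p - 1) = \<beta>" "p + \<sigma> = - (\<beta> * (Q - a))" "\<bar>p + \<sigma>\<bar> = \<beta> * (Q - a)" "N + \<sigma> = - (Q * \<beta>)"
 "q_crit N p \<sigma> = Q" "p - N = a * \<beta>" "q - p + 1 = q - a" "p - 2 = a - 1"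
proof -
 show ps: "p + \<sigma> = - (\<beta> * (Q - a))" by (simp add: p_eq \<sigma>_eq algebra_simps)
 show "(N - p) / (p - 1) = - \<beta>" "(N - 1) / (p - 1) = 1 - \<beta>" "- (\<sigma> + 1) / (p - 1) = Q * \<beta> / a + (1 - \<beta>)"
  "(p - N) / (p - 1) = \<beta>" using a by (simp_all add: p_eq N_eq \<sigma>_eq field_simps)
 show "gam p q \<sigma> = - (\<beta> * \<delta>)" unfolding gam_def ps by (simp add: \<delta>_def p_eq)
 show "\<bar>p + \<sigma>\<bar> = \<beta> * (Q - a)" unfolding ps using \<beta> aQ by (simp add: abs_mult)
 show ns: "N + \<sigma> = - (Q * \<beta>)" by (simp add: N_eq \<sigma>_eq)
 show "q_crit N p \<sigma> = Q" unfolding q_crit_def ns using a \<beta> by (simp add: N_eq p_eq)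
 show "p - N = a * \<beta>" "q - p + 1 = q - a" "p - 2 = a - 1" by (auto simp: p_eq N_eq)
qed

lemma q_sob_iff: "sob < Q \<longleftrightarrow> q < q_sob N p \<sigma>" "Q < sob \<longleftrightarrow> q_sob N p \<sigma> < q" "Q = sob \<longleftrightarrow> q = q_sob N p \<sigma>"
proof -
 have "N * (p - 1) + p + p * \<sigma> = - (a * \<beta>) * (((a + 1) * Q - a) / a)" using a by (simp add: p_eq N_eq \<sigma>_eq field_simps)
 moreover have "N - p = - (a * \<beta>)" by (simp add: p_eq N_eq)
 ultimately have s: "q_sob N p \<sigma> = ((a + 1) * Q - a) / a" unfolding q_sob_def using a \<beta> by simp
 have a1: "a + 1 > 0" using a by simp
 have "sob < Q \<longleftrightarrow> a * (q + 1) < Q * (a + 1)" unfolding sob_def by (rule pos_divide_less_eq[OF a1])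
 moreover have "Q < sob \<longleftrightarrow> Q * (a + 1) < a * (q + 1)" unfolding sob_def by (rule pos_less_divide_eq[OF a1])
 moreover have "q < q_sob N p \<sigma> \<longleftrightarrow> q * a < (a + 1) * Q - a" unfolding s by (rule pos_less_divide_eq[OF a])
 moreover have "q_sob N p \<sigma> < q \<longleftrightarrow> (a + 1) * Q - a < q * a" unfolding s by (rule pos_divide_less_eq[OF a])
 ultimately show 1: "sob < Q \<longleftrightarrow> q < q_sob N p \<sigma>" "Q < sob \<longleftrightarrow> q_sob N p \<sigma> < q" by (auto simp: algebra_simps)
 then show "Q = sob \<longleftrightarrow> q = q_sob N p \<sigma>" by (metis linorder_neq_iff)
qed

section \<open>Solutions built from orbits\<close>

definition log_filters :: "real filter => real filter => bool" where
 "log_filters F G \<longleftrightarrow> filterlim (%r. \<beta> * ln r) F G \<and> (\<forall>\<^sub>F r in G. r > 0)"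

lemma log_filters: "log_filters at_top at_top" "log_filters at_bot (at_right 0)"
 by (auto simp: log_filters_def ln_filterlims pos_eventually)

lemma log_limit:
 assumes FG: "log_filters F G" and f: "(f \<longlongrightarrow> L) F" and g: "\<forall>\<^sub>F t in F. g (exp (t / \<beta>)) = f t"
 shows "(g \<longlongrightarrow> L) G"
proof -
 have l: "filterlim (%r. \<beta> * ln r) F G" and p: "\<forall>\<^sub>F r in G. r > 0" using FG by (auto simp: log_filters_def)
 have "\<forall>\<^sub>F r in G. f (\<beta> * ln r) = g r"
  using eventually_compose_filterlim[OF g l] p by eventually_elim (simp only: exp_log_inverse)
 then show ?thesis by (rule Lim_transform_eventually[OF filterlim_compose[OF f l]])
qed

lemma pos_solution_on_subset: "pos_solution_on N p q \<sigma> \<epsilon> I w ==> J \<subseteq> I ==> pos_solution_on N p q \<sigma> \<epsilon> J w"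
 by (auto simp: pos_solution_on_def)

lemma log_domains:
 "exp (T / \<beta>) < r ==> r > 0 \<and> \<beta> * ln r > T" "0 < r ==> r < exp (T / \<beta>) ==> \<beta> * ln r < T"
proof -
 assume r: "exp (T / \<beta>) < r"
 then have r0: "r > 0" using exp_gt_zero less_trans by blast
 have "T / \<beta> < ln r" using r r0 by (metis exp_less_mono exp_ln less_le_not_le ln_exp ln_less_cancel_iff exp_gt_zero)
 then show "r > 0 \<and> \<beta> * ln r > T" using \<beta> r0 by (simp add: pos_divide_less_eq mult.commute)
next
 assume r: "0 < r" "r < exp (T / \<beta>)"
 have "ln r < T / \<beta>" using r by (metis ln_exp ln_less_cancel_iff exp_gt_zero)
 then show "\<beta> * ln r < T" using \<beta> by (simp add: pos_less_divide_eq mult.commute)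
qed

lemma near_infty_ef:
 assumes "sol_near_infty N p q \<sigma> \<epsilon> w"
 shows "\<exists>T. \<forall>t>T. ef \<epsilon> (Vt w) (Phit w) t"
proof -
 obtain r0 where r0: "r0 > 0" "pos_solution_on N p q \<sigma> \<epsilon> {r0<..} w" using assms by (auto simp: sol_near_infty_def)
 have "r0 < exp (t / \<beta>)" if "t > \<beta> * ln r0" for t
 proof -
  have "ln r0 < t / \<beta>" using that \<beta> by (simp add: pos_less_divide_eq mult.commute)
  then show ?thesis using r0 by (metis exp_less_mono exp_ln)
 qed
 then show ?thesis using solution_imp_ef[OF r0(2)] by (intro exI[of _ "\<beta> * ln r0"]) auto
qed

lemma near_zero_ef:
 assumes "sol_near_zero N p q \<sigma> \<epsilon> w"
 shows "\<exists>T. \<forall>t<T. ef \<epsilon> (Vt w) (Phit w) t"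
proof -
 obtain r0 where r0: "r0 > 0" "pos_solution_on N p q \<sigma> \<epsilon> {0<..<r0} w" using assms by (auto simp: sol_near_zero_def)
 have "exp (t / \<beta>) < r0" if "t < \<beta> * ln r0" for t
 proof -
  have "t / \<beta> < ln r0" using that \<beta> by (simp add: pos_divide_less_eq mult.commute)
  then show ?thesis using r0 by (metis exp_less_mono exp_ln)
 qed
 then show ?thesis using solution_imp_ef[OF r0(2)] by (intro exI[of _ "\<beta> * ln r0"]) auto
qed

lemma global_ef: "global_sol N p q \<sigma> \<epsilon> w ==> ef \<epsilon> (Vt w) (Phit w) t"
 by (rule solution_imp_ef[where I="{0<..}"]) (auto simp: global_sol_def)

definition lvsol :: "(real => real) => (real => real) => real => real" where
 "lvsol x y r = Vof x y (\<beta> * ln r)"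

text \<open>The sign condition says that \<open>y\<close> has the sign prescribed by its definition, since \<open>x\<close> has the sign of the flux.\<close>

definition good_orbit :: "real => real set => (real => real) => (real => real) => bool" where
 "good_orbit \<epsilon> S x y \<longleftrightarrow> (\<epsilon> = 1 \<or> \<epsilon> = - 1) \<and> (\<forall>t\<in>S. lv x y t \<and> \<epsilon> * (x t * y t) > 0)"

lemma good_orbit_shift: "good_orbit \<epsilon> S x y ==> (!!t. t \<in> S' ==> t + h \<in> S) ==> good_orbit \<epsilon> S' (%t. x (t + h)) (%t. y (t + h))"
 by (auto simp: good_orbit_def intro: lv_shift)

lemma good_orbit_nonzero: "good_orbit \<epsilon> S x y ==> t \<in> S ==> x t ~= 0 \<and> y t ~= 0"
 by (force simp: good_orbit_def)

lemma lvsol_solution: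
 shows "good_orbit \<epsilon> {T<..} x y ==> sol_near_infty N p q \<sigma> \<epsilon> (lvsol x y)"
  "good_orbit \<epsilon> {..<T} x y ==> sol_near_zero N p q \<sigma> \<epsilon> (lvsol x y)"
  "good_orbit \<epsilon> UNIV x y ==> global_sol N p q \<sigma> \<epsilon> (lvsol x y)"
proof -
 have s: "pos_solution_on N p q \<sigma> \<epsilon> {r. r > 0 \<and> \<beta> * ln r \<in> S} (lvsol x y)" if "good_orbit \<epsilon> S x y" "open S" for S
  by (rule lv_imp_solution(1)) (use that in \<open>auto simp: good_orbit_def lvsol_def\<close>)
 show "sol_near_infty N p q \<sigma> \<epsilon> (lvsol x y)" if "good_orbit \<epsilon> {T<..} x y"
  unfolding sol_near_infty_def
  by (intro exI[of _ "exp (T / \<beta>)"] conjI pos_solution_on_subset[OF s[OF that open_greaterThan]]) (use log_domains(1) in auto)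
 show "sol_near_zero N p q \<sigma> \<epsilon> (lvsol x y)" if "good_orbit \<epsilon> {..<T} x y"
  unfolding sol_near_zero_def
  by (intro exI[of _ "exp (T / \<beta>)"] conjI pos_solution_on_subset[OF s[OF that open_lessThan]]) (use log_domains(2) in auto)
 show "global_sol N p q \<sigma> \<epsilon> (lvsol x y)" if "good_orbit \<epsilon> UNIV x y"
  unfolding global_sol_def by (rule pos_solution_on_subset[OF s[OF that open_UNIV]]) auto
qed

lemma lvsol_exp: "lvsol x y (exp (t / \<beta>)) = Vof x y t"
 using \<beta> by (simp add: lvsol_def)

lemma deriv_lvsol:
 assumes g: "good_orbit \<epsilon> S x y" and S: "open S" "t \<in> S"
 shows "deriv (lvsol x y) (exp (t / \<beta>)) = \<beta> * exp (- (t / \<beta>)) * Vof x y t * x t"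
  "deriv (lvsol x y) (exp (t / \<beta>)) = \<beta> * exp (t - t / \<beta>) * psi (Phiof \<epsilon> x y t)"
proof -
 have "deriv (lvsol x y) (exp (t / \<beta>)) = \<beta> / exp (t / \<beta>) * (Vof x y (\<beta> * ln (exp (t / \<beta>))) * x (\<beta> * ln (exp (t / \<beta>))))"
  by (rule lv_imp_solution(2)[where S=S and \<epsilon>=\<epsilon>]) (use g S \<beta> in \<open>auto simp: good_orbit_def lvsol_def\<close>)
 then show d: "deriv (lvsol x y) (exp (t / \<beta>)) = \<beta> * exp (- (t / \<beta>)) * Vof x y t * x t"
  unfolding exp_log_inverse by (simp add: exp_minus divide_inverse)
 have "exp t * psi (Phiof \<epsilon> x y t) = Vof x y t * x t"
  by (rule lv_imp_ef(2)) (use g S in \<open>auto simp: good_orbit_def\<close>)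
 then show "deriv (lvsol x y) (exp (t / \<beta>)) = \<beta> * exp (t - t / \<beta>) * psi (Phiof \<epsilon> x y t)"
  unfolding d by (simp add: exp_diff exp_minus divide_inverse mult_ac)
qed

lemma weighted_derivative:
 assumes "D = \<beta> * exp (t - t / \<beta>) * psi z"
 shows "exp (t / \<beta>) powr ((N - 1) / (p - 1)) * D = \<beta> * psi z"
  "exp (t / \<beta>) powr (- (\<sigma> + 1) / (p - 1)) * D = \<beta> * psi (exp (Q * t) * z)"
proof -
 have e1: "(1 - \<beta>) * (t / \<beta>) + (t - t / \<beta>) = 0"
  and e2: "(Q * \<beta> / a + (1 - \<beta>)) * (t / \<beta>) + (t - t / \<beta>) = 1 / a * (Q * t)"
  using \<beta> a by (simp_all add: field_simps)
 have "exp (t / \<beta>) powr ((N - 1) / (p - 1)) * D = \<beta> * (exp ((1 - \<beta>) * (t / \<beta>)) * exp (t - t / \<beta>)) * psi z"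
  unfolding exponents exp_powr assms by (simp add: mult_ac)
 then show "exp (t / \<beta>) powr ((N - 1) / (p - 1)) * D = \<beta> * psi z"
  unfolding exp_add[symmetric] e1 by simp
 have "exp (t / \<beta>) powr (- (\<sigma> + 1) / (p - 1)) * D = \<beta> * (exp ((Q * \<beta> / a + (1 - \<beta>)) * (t / \<beta>)) * exp (t - t / \<beta>)) * psi z"
  unfolding exponents exp_powr assms by (simp add: mult_ac)
 also have "exp ((Q * \<beta> / a + (1 - \<beta>)) * (t / \<beta>)) * exp (t - t / \<beta>) = exp (Q * t) powr (1 / a)"
  unfolding exp_add[symmetric] e2 exp_powr ..
 finally show "exp (t / \<beta>) powr (- (\<sigma> + 1) / (p - 1)) * D = \<beta> * psi (exp (Q * t) * z)"
  by (simp add: psi_mult)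
qed

lemma weighted_derivative_Phit:
 "exp (t / \<beta>) powr ((N - 1) / (p - 1)) * deriv w (exp (t / \<beta>)) = \<beta> * psi (Phit w t)"
 "exp (t / \<beta>) powr (- (\<sigma> + 1) / (p - 1)) * deriv w (exp (t / \<beta>)) = \<beta> * psi (exp (Q * t) * Phit w t)"
proof -
 have "exp (t - t / \<beta>) * exp (t / \<beta> - t) = 1" by (simp flip: exp_add)
 then have d: "deriv w (exp (t / \<beta>)) = \<beta> * exp (t - t / \<beta>) * psi (Phit w t)"
  unfolding psi_Phit using \<beta> by (simp add: mult.assoc[symmetric])
 show "exp (t / \<beta>) powr ((N - 1) / (p - 1)) * deriv w (exp (t / \<beta>)) = \<beta> * psi (Phit w t)"
  by (rule weighted_derivative(1)[OF d])
 show "exp (t / \<beta>) powr (- (\<sigma> + 1) / (p - 1)) * deriv w (exp (t / \<beta>)) = \<beta> * psi (exp (Q * t) * Phit w t)"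
  by (rule weighted_derivative(2)[OF d])
qed

lemma slope_weight: "exp (t / \<beta>) powr ((N - p) / (p - 1)) = exp (- t)"
 unfolding exponents exp_powr using \<beta> by simp

lemma scale_weight: "exp (t / \<beta>) powr gam p q \<sigma> = exp (- (\<delta> * t))"
 unfolding exponents exp_powr using \<beta> by simp

lemma tendsto_psi: "(f \<longlongrightarrow> z) F ==> z ~= 0 ==> ((%t. psi (f t)) \<longlongrightarrow> psi z) F"
 unfolding psi_def by (intro tendsto_intros tendsto_sgn) auto

lemma tendsto_psi_imp:
 assumes f: "((%t. psi (f t)) \<longlongrightarrow> psi z) F" and z: "z ~= 0"
 shows "(f \<longlongrightarrow> z) F"
proof -
 have "sgn (psi z) ~= 0" unfolding psi_sgn using z by (simp add: sgn_zero_iff)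
 then have "psi z ~= 0" by auto
 then have "((%t. \<bar>psi (f t)\<bar> powr (a - 1) * psi (f t)) \<longlongrightarrow> \<bar>psi z\<bar> powr (a - 1) * psi z) F"
  by (intro tendsto_intros f) auto
 then show ?thesis by (simp add: psi_inverse)
qed

lemma shift_filterlims: "filterlim (%t. t + h) at_top at_top" "filterlim (%t. t + h) at_bot at_bot" for h :: real
proof -
 show "filterlim (%t. t + h) at_top at_top"
  unfolding filterlim_at_top
 proof
  fix Z show "\<forall>\<^sub>F t in at_top. Z <= t + h" using eventually_ge_at_top[of "Z - h"] by eventually_elim simp
 qed
 show "filterlim (%t. t + h) at_bot at_bot"
  unfolding filterlim_at_bot
 proof
  fix Z show "\<forall>\<^sub>F t in at_bot. t + h <= Z" using eventually_le_at_bot[of "Z - h"] by eventually_elim simp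
 qed
qed

lemma slope_limits:
 assumes FG: "log_filters F G" and g: "good_orbit \<epsilon> S x y" and S: "open S" "\<forall>\<^sub>F t in F. t \<in> S"
  and x: "(x \<longlongrightarrow> 1) F" and V: "((%t. Vof x y t * exp (- t)) \<longlongrightarrow> k) F"
 shows "((%r. r powr ((N - p) / (p - 1)) * lvsol x y r) \<longlongrightarrow> k) G"
  "((%r. r powr ((N - 1) / (p - 1)) * deriv (lvsol x y) r) \<longlongrightarrow> \<beta> * k) G"
proof -
 show "((%r. r powr ((N - p) / (p - 1)) * lvsol x y r) \<longlongrightarrow> k) G"
  by (rule log_limit[OF FG V]) (simp add: slope_weight lvsol_exp mult.commute)
 have Vx: "((%t. \<beta> * (Vof x y t * exp (- t) * x t)) \<longlongrightarrow> \<beta> * (k * 1)) F" by (intro tendsto_intros V x)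
 have "\<forall>\<^sub>F t in F. exp (t / \<beta>) powr ((N - 1) / (p - 1)) * deriv (lvsol x y) (exp (t / \<beta>)) = \<beta> * (Vof x y t * exp (- t) * x t)"
  using S(2)
 proof eventually_elim
  case (elim t)
  have "exp t * psi (Phiof \<epsilon> x y t) = Vof x y t * x t"
   by (rule lv_imp_ef(2)) (use g elim in \<open>auto simp: good_orbit_def\<close>)
  then show ?case unfolding weighted_derivative(1)[OF deriv_lvsol(2)[OF g S(1) elim]] by (simp add: exp_minus field_simps)
 qed
 from log_limit[OF FG Vx this] show "((%r. r powr ((N - 1) / (p - 1)) * deriv (lvsol x y) r) \<longlongrightarrow> \<beta> * k) G" by simp
qed

lemma Vof_shift_tendsto:
 assumes g: "good_orbit \<epsilon> S x y" and S: "\<forall>\<^sub>F t in F. t + h \<in> S"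
 shows "(f \<longlongrightarrow> L) F ==> \<forall>\<^sub>F t in F. f t = exp (- (\<delta> * h)) * Vof x y (t + h) * e t
  ==> ((%t. Vof (%t. x (t + h)) (%t. y (t + h)) t * e t) \<longlongrightarrow> L) F"
proof -
 assume f: "(f \<longlongrightarrow> L) F" "\<forall>\<^sub>F t in F. f t = exp (- (\<delta> * h)) * Vof x y (t + h) * e t"
 have "\<forall>\<^sub>F t in F. f t = Vof (%t. x (t + h)) (%t. y (t + h)) t * e t"
  using f(2) S by eventually_elim (use good_orbit_nonzero[OF g] in \<open>simp add: Vof_shift\<close>)
 then show ?thesis by (rule Lim_transform_eventually[OF f(1)])
qed

text \<open>A time shift changes the slope at the equilibrium \<open>(1, 0)\<close> by any prescribed factor.\<close>

lemma Vof_slope_shift: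
 assumes g: "good_orbit \<epsilon> S x y" and S: "\<forall>\<^sub>F t in F. t + h \<in> S" and F: "filterlim (%t. t + h) F F"
  and V: "((%t. Vof x y t * exp (- t)) \<longlongrightarrow> k0) F" and k: "k0 > 0" "k > 0" and \<delta>: "\<delta> ~= 1" and h: "h = ln (k / k0) / (1 - \<delta>)"
 shows "((%t. Vof (%t. x (t + h)) (%t. y (t + h)) t * exp (- t)) \<longlongrightarrow> k) F"
proof (rule Vof_shift_tendsto[OF g S])
 have "(1 - \<delta>) * h = ln (k / k0)" using \<delta> by (simp add: h)
 then have e: "exp ((1 - \<delta>) * h) * k0 = k" using k by simp
 show "((%t. exp ((1 - \<delta>) * h) * (Vof x y (t + h) * exp (- (t + h)))) \<longlongrightarrow> k) F"
  unfolding e[symmetric] by (intro tendsto_intros filterlim_compose[OF V F])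
 show "\<forall>\<^sub>F t in F. exp ((1 - \<delta>) * h) * (Vof x y (t + h) * exp (- (t + h))) = exp (- (\<delta> * h)) * Vof x y (t + h) * exp (- t)"
 proof (intro always_eventually allI)
  fix t
  have "exp ((1 - \<delta>) * h) * exp (- (t + h)) = exp (- (\<delta> * h)) * exp (- t)" unfolding exp_add[symmetric] by (simp add: algebra_simps)
  then have "exp ((1 - \<delta>) * h) * exp (- (t + h)) * Vof x y (t + h) = exp (- (\<delta> * h)) * exp (- t) * Vof x y (t + h)" by (rule arg_cong)
  then show "exp ((1 - \<delta>) * h) * (Vof x y (t + h) * exp (- (t + h))) = exp (- (\<delta> * h)) * Vof x y (t + h) * exp (- t)" by (simp only: mult_ac)
 qed
qed

lemma Vof_limit_shift:
 assumes g: "good_orbit \<epsilon> S x y" and S: "\<forall>\<^sub>F t in at_top. t + h \<in> S"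
  and V: "(Vof x y \<longlongrightarrow> C0) at_top" and C: "C0 > 0" "C > 0" and h: "h = ln (C0 / C) / \<delta>"
 shows "(Vof (%t. x (t + h)) (%t. y (t + h)) \<longlongrightarrow> C) at_top"
proof -
 have "((%t. Vof (%t. x (t + h)) (%t. y (t + h)) t * 1) \<longlongrightarrow> C) at_top"
 proof (rule Vof_shift_tendsto[OF g S])
  have "\<delta> * h = ln (C0 / C)" using \<delta>_pos by (simp add: h)
  then have e: "exp (- (\<delta> * h)) * C0 = C" using C by (simp add: exp_minus)
  show "((%t. exp (- (\<delta> * h)) * Vof x y (t + h)) \<longlongrightarrow> C) at_top"
   unfolding e[symmetric] by (intro tendsto_intros filterlim_compose[OF V shift_filterlims(1)])
 qed simp
 then show ?thesis by simp
qed

lemma lvsol_eq_imp: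
 assumes g: "good_orbit \<epsilon> S x y" "good_orbit \<epsilon> S x' y'" and x: "!!t. t \<in> S ==> x t > 0 \<and> x' t > 0"
 shows "S = {T<..} ==> \<forall>\<^sub>F r in at_top. lvsol x y r = lvsol x' y' r ==> \<exists>T'. \<forall>t>T'. x t = x' t \<and> y t = y' t"
  "S = {..<T} ==> \<forall>\<^sub>F r in at_right 0. lvsol x y r = lvsol x' y' r ==> \<exists>T'. \<forall>t<T'. x t = x' t \<and> y t = y' t"
proof -
 have inj: "x t = x' t \<and> y t = y' t" if U: "open U" "U \<subseteq> S" "t \<in> U" and eq: "!!t. t \<in> U ==> Vof x y t = Vof x' y' t" for U t
 proof -
  have t: "t \<in> S" using U by auto
  have lv: "lv x y t" "lv x' y' t" and s: "\<epsilon> * (x t * y t) > 0" "\<epsilon> * (x' t * y' t) > 0" and xp: "x t > 0" "x' t > 0"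
   using g x t by (auto simp: good_orbit_def)
  have "\<epsilon> * y t > 0" "\<epsilon> * y' t > 0" using s xp by (auto simp: zero_less_mult_iff mult.left_commute[of \<epsilon>])
  then show ?thesis using Vof_inj[OF U(1,3) eq lv, of \<epsilon>] xp by auto
 qed
 {
  assume S: "S = {T<..}" and e: "\<forall>\<^sub>F r in at_top. lvsol x y r = lvsol x' y' r"
  have "\<forall>\<^sub>F t in at_top. Vof x y t = Vof x' y' t" by (rule eventually_to_log(1)[OF _ e]) (simp add: lvsol_exp)
  then obtain T1 where T1: "!!t. t > T1 ==> Vof x y t = Vof x' y' t" by (auto simp: eventually_at_top_dense)
  show "\<exists>T'. \<forall>t>T'. x t = x' t \<and> y t = y' t"
   by (intro exI[of _ "max T T1"] allI impI inj[of "{max T T1<..}"]) (auto simp: S T1)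
 next
  assume S: "S = {..<T}" and e: "\<forall>\<^sub>F r in at_right 0. lvsol x y r = lvsol x' y' r"
  have "\<forall>\<^sub>F t in at_bot. Vof x y t = Vof x' y' t" by (rule eventually_to_log(2)[OF _ e]) (simp add: lvsol_exp)
  then obtain T1 where T1: "!!t. t < T1 ==> Vof x y t = Vof x' y' t" by (auto simp: eventually_at_bot_dense)
  show "\<exists>T'. \<forall>t<T'. x t = x' t \<and> y t = y' t"
   by (intro exI[of _ "min T T1"] allI impI inj[of "{..<min T T1}"]) (auto simp: S T1)
 }
qed

lemma infinitely_many_germs_sequence:
 fixes W :: "nat => real => real"
 assumes P: "!!n. P (W n)" and d: "!!m n. \<forall>\<^sub>F r in F. W m r = W n r ==> m = n"
 shows "infinitely_many_germs F P"
proof -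
 have "inj W" by (rule injI) (rule d, simp)
 then have "infinite (range W)" by (rule range_inj_infinite)
 moreover have "pairwise (%u v. \<not> (\<forall>\<^sub>F r in F. u r = v r)) (range W)"
  by (auto simp: pairwise_def dest: d)
 ultimately show ?thesis unfolding infinitely_many_germs_def using P by blast
qed

section \<open>Solutions with a finite limit at infinity\<close>

text \<open>The stable curve of \<open>(0, Q)\<close> gives one solution, and a translation in \<open>t\<close> gives every limit \<open>C\<close>. The limit
 of the weighted derivative is that of \<open>(exp (Q t) \<Phi>)\<^sup>1\<^sup>/\<^sup>a\<close>, which \<open>y \<rightarrow> Q\<close> determines from \<open>C\<close>.\<close>

theorem regular_at_infinity:
 "\<exists>d. \<forall>C>0. d C > 0 \<and>
   (\<forall>\<epsilon>\<in>{1, -1}. unique_germ at_top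
     (%w. sol_near_infty N p q \<sigma> \<epsilon> w \<and>
       (w \<longlongrightarrow> C) at_top \<and>
       ((%r. r powr (- (\<sigma> + 1) / (p - 1)) * deriv w r) \<longlongrightarrow> \<epsilon> * d C) at_top))"
proof -
 have Q0: "Q > 0" using a aQ by simp
 define c0 where "c0 = (%C. K * C powr q / Q)"
 define d where "d = (%C. \<beta> * psi (c0 C))"
 have c0: "c0 C > 0" if "C > 0" for C using that K Q0 by (simp add: c0_def)
 have d: "d C > 0" if "C > 0" for C using c0[OF that] \<beta> by (simp add: d_def psi_pos_iff)
 have psie: "psi (\<epsilon> * z) = \<epsilon> * psi z" if "\<epsilon> \<in> {1, - 1}" for \<epsilon> z using that by (auto simp: psi_minus)
 have "unique_germ at_top (%w. sol_near_infty N p q \<sigma> \<epsilon> w \<and> (w \<longlongrightarrow> C) at_top \<and>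
   ((%r. r powr (- (\<sigma> + 1) / (p - 1)) * deriv w r) \<longlongrightarrow> \<epsilon> * d C) at_top)" if \<epsilon>: "\<epsilon> \<in> {1, -1}" and C: "C > 0" for \<epsilon> C
  unfolding unique_germ_def
 proof (intro conjI allI impI)
  have \<epsilon>': "\<epsilon> = 1 \<or> \<epsilon> = - 1" using \<epsilon> by auto
  obtain x y l c where l: "l > 0" and o: "!!t. t >= 0 ==> lv x y t \<and> 0 < \<epsilon> * x t \<and> \<epsilon> * x t <= c * exp (- (l * t)) \<and> y t > 0"
   and y: "(y \<longlongrightarrow> Q) at_top" using exists_curve_entering_zero_Q[OF \<epsilon>'] by blast
  obtain C0 where C0: "C0 > 0" "(Vof x y \<longlongrightarrow> C0) at_top"
   using Vof_finite_limit[of x y \<epsilon> c l, OF _ \<epsilon>' _ l] o by blast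
  have g0: "good_orbit \<epsilon> {0<..} x y" unfolding good_orbit_def using \<epsilon>' o by (auto simp flip: mult.assoc)
  define h where "h = ln (C0 / C) / \<delta>"
  define x' y' where "x' = (%t. x (t + h))" and "y' = (%t. y (t + h))"
  have g: "good_orbit \<epsilon> {- h<..} x' y'" unfolding x'_def y'_def by (rule good_orbit_shift[OF g0]) auto
  have V: "(Vof x' y' \<longlongrightarrow> C) at_top" unfolding x'_def y'_def
   by (rule Vof_limit_shift[OF g0 _ C0(2,1) C h_def]) (use eventually_gt_at_top[of "- h"] in \<open>eventually_elim, simp\<close>)
  have y': "(y' \<longlongrightarrow> Q) at_top" unfolding y'_def by (rule filterlim_compose[OF y shift_filterlims(1)])
  have "((%t. \<beta> * psi (exp (Q * t) * Phiof \<epsilon> x' y' t)) \<longlongrightarrow> \<beta> * psi (\<epsilon> * c0 C)) at_top"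
   unfolding c0_def by (intro tendsto_intros tendsto_psi Phiof_limit[OF V C y']) (use \<epsilon> c0[OF C] in \<open>auto simp: c0_def\<close>)
  then have L: "((%t. \<beta> * psi (exp (Q * t) * Phiof \<epsilon> x' y' t)) \<longlongrightarrow> \<epsilon> * d C) at_top"
   by (simp add: psie[OF \<epsilon>] d_def mult.left_commute)
  have "\<forall>\<^sub>F t in at_top. exp (t / \<beta>) powr (- (\<sigma> + 1) / (p - 1)) * deriv (lvsol x' y') (exp (t / \<beta>)) = \<beta> * psi (exp (Q * t) * Phiof \<epsilon> x' y' t)"
   using eventually_gt_at_top[of "- h"]
   by eventually_elim (rule weighted_derivative(2)[OF deriv_lvsol(2)[OF g]], auto)
  from log_limit[OF log_filters(1) L this]
  show "\<exists>w. sol_near_infty N p q \<sigma> \<epsilon> w \<and> (w \<longlongrightarrow> C) at_top \<and>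
    ((%r. r powr (- (\<sigma> + 1) / (p - 1)) * deriv w r) \<longlongrightarrow> \<epsilon> * d C) at_top"
   using lvsol_solution(1)[OF g] log_limit[OF log_filters(1) V, of "lvsol x' y'"]
   by (intro exI[of _ "lvsol x' y'"] conjI) (auto simp: lvsol_exp)
 next
  fix u v
  assume P: "(sol_near_infty N p q \<sigma> \<epsilon> u \<and> (u \<longlongrightarrow> C) at_top \<and>
     ((%r. r powr (- (\<sigma> + 1) / (p - 1)) * deriv u r) \<longlongrightarrow> \<epsilon> * d C) at_top) \<and>
    sol_near_infty N p q \<sigma> \<epsilon> v \<and> (v \<longlongrightarrow> C) at_top \<and>
     ((%r. r powr (- (\<sigma> + 1) / (p - 1)) * deriv v r) \<longlongrightarrow> \<epsilon> * d C) at_top"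
  obtain T1 T2 where T: "!!t. t > T1 ==> ef \<epsilon> (Vt u) (Phit u) t" "!!t. t > T2 ==> ef \<epsilon> (Vt v) (Phit v) t"
   using P near_infty_ef by blast
  have V: "(Vt w \<longlongrightarrow> C) at_top" if "(w \<longlongrightarrow> C) at_top" for w by (rule limit_to_log(1)[OF _ that]) (simp add: Vt_def)
  have \<Phi>: "((%t. exp (Q * t) * Phit w t) \<longlongrightarrow> \<epsilon> * c0 C) at_top"
   if "((%r. r powr (- (\<sigma> + 1) / (p - 1)) * deriv w r) \<longlongrightarrow> \<epsilon> * d C) at_top" for w
  proof (rule tendsto_psi_imp)
   have "((%t. \<beta> * psi (exp (Q * t) * Phit w t)) \<longlongrightarrow> \<epsilon> * d C) at_top"
    by (rule limit_to_log(1)[OF _ that]) (simp only: weighted_derivative_Phit)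
   then have "((%t. \<beta> * psi (exp (Q * t) * Phit w t) / \<beta>) \<longlongrightarrow> \<epsilon> * d C / \<beta>) at_top"
    by (rule tendsto_divide[OF _ tendsto_const]) (use \<beta> in simp)
   then show "((%t. psi (exp (Q * t) * Phit w t)) \<longlongrightarrow> psi (\<epsilon> * c0 C)) at_top"
    using \<beta> by (simp add: psie[OF \<epsilon>] d_def)
   show "\<epsilon> * c0 C ~= 0" using \<epsilon> c0[OF C] by auto
  qed
  have "\<forall>\<^sub>F t in at_top. Vt u t = Vt v t"
   by (rule unique_at_top[of \<epsilon> C "c0 C" "max T1 T2" _ "Phit u" _ "Phit v"]) (use \<epsilon> C c0 T V \<Phi> P in auto)
  then show "\<forall>\<^sub>F r in at_top. u r = v r"
   by (rule eventually_from_log(1)[rotated]) (simp only: Vt_def exp_log_inverse)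
 qed
 then show ?thesis using d by (intro exI[of _ d]) blast
qed

section \<open>Below the critical exponent\<close>

text \<open>For \<open>q < Q\<close> the equilibrium \<open>(1, 0)\<close> attracts a full neighbourhood on either side of the \<open>x\<close>-axis. Each of
 infinitely many orbits is translated to give the same constant \<open>k\<close>.\<close>

theorem singular_at_infinity:
 assumes qQ: "q < Q"
 shows "\<exists>c. \<forall>k>0. c k > 0 \<and>
    (\<forall>\<epsilon>\<in>{1, -1}. infinitely_many_germs at_top
      (%w. sol_near_infty N p q \<sigma> \<epsilon> w \<and>
        ((%r. r powr ((N - p) / (p - 1)) * w r) \<longlongrightarrow> k) at_top \<and>
        ((%r. r powr ((N - 1) / (p - 1)) * deriv w r) \<longlongrightarrow> c k) at_top))"
proof -
 have \<delta>1: "\<delta> ~= 1" using \<delta>_eq qQ by auto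
 have "infinitely_many_germs at_top
      (%w. sol_near_infty N p q \<sigma> \<epsilon> w \<and>
        ((%r. r powr ((N - p) / (p - 1)) * w r) \<longlongrightarrow> k) at_top \<and>
        ((%r. r powr ((N - 1) / (p - 1)) * deriv w r) \<longlongrightarrow> \<beta> * k) at_top)"
  if \<epsilon>: "\<epsilon> \<in> {1, -1}" and k: "k > 0" for \<epsilon> k
 proof -
  have \<epsilon>': "\<epsilon> = 1 \<or> \<epsilon> = - 1" using \<epsilon> by auto
  obtain X Y l c where l: "l > 0"
   and o: "!!n t. t >= 0 ==> lv (X n) (Y n) t \<and> X n t > 0 \<and> 0 < \<epsilon> * Y n t \<and> \<epsilon> * Y n t <= c * exp (- (l * t))"
   and X: "!!n. (X n \<longlongrightarrow> 1) at_top"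
   and dist: "!!m n h T. (\<forall>t\<ge>T. X m (t + h) = X n t \<and> Y m (t + h) = Y n t) ==> m = (n::nat)"
   using exists_orbits_entering_one_zero[OF qQ \<epsilon>'] by blast
  have "\<exists>k0>0. ((%t. Vof (X n) (Y n) t * exp (- t)) \<longlongrightarrow> k0) at_top" for n
   by (rule Vof_slope_limit_at_top[of "X n" "Y n" \<epsilon> l c]) (use o X \<epsilon>' l in auto)
  then obtain k0 where k0: "!!n. k0 n > 0" "!!n. ((%t. Vof (X n) (Y n) t * exp (- t)) \<longlongrightarrow> k0 n) at_top" by metis
  define h where "h = (%n. ln (k / k0 n) / (1 - \<delta>))"
  define x y where "x = (%n t. X n (t + h n))" and "y = (%n t. Y n (t + h n))"
  have g0: "good_orbit \<epsilon> {0<..} (X n) (Y n)" for n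
   unfolding good_orbit_def using \<epsilon>' o[of _ n] by (auto simp: mult.left_commute[of \<epsilon>])
  have ev: "\<forall>\<^sub>F t in at_top. t + h n \<in> {0<..}" for n using eventually_gt_at_top[of "- h n"] by eventually_elim simp
  have g: "good_orbit \<epsilon> {- h n<..} (x n) (y n)" for n unfolding x_def y_def by (rule good_orbit_shift[OF g0]) auto
  have V: "((%t. Vof (x n) (y n) t * exp (- t)) \<longlongrightarrow> k) at_top" for n unfolding x_def y_def
   by (rule Vof_slope_shift[OF g0 ev shift_filterlims(1) k0(2,1) k \<delta>1]) (simp add: h_def)
  have x1: "(x n \<longlongrightarrow> 1) at_top" for n unfolding x_def by (rule filterlim_compose[OF X shift_filterlims(1)])
  show ?thesis
  proof (rule infinitely_many_germs_sequence[where W="%n. lvsol (x n) (y n)"])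
   fix n
   show "sol_near_infty N p q \<sigma> \<epsilon> (lvsol (x n) (y n)) \<and>
        ((%r. r powr ((N - p) / (p - 1)) * lvsol (x n) (y n) r) \<longlongrightarrow> k) at_top \<and>
        ((%r. r powr ((N - 1) / (p - 1)) * deriv (lvsol (x n) (y n)) r) \<longlongrightarrow> \<beta> * k) at_top"
    using lvsol_solution(1)[OF g] slope_limits[OF log_filters(1) g open_greaterThan _ x1 V] eventually_gt_at_top[of "- h n"] by auto
  next
   fix m n assume e: "\<forall>\<^sub>F r in at_top. lvsol (x m) (y m) r = lvsol (x n) (y n) r"
   define T where "T = max (- h m) (- h n)"
   have gT: "good_orbit \<epsilon> {T<..} (x m) (y m)" "good_orbit \<epsilon> {T<..} (x n) (y n)"
    using g[of m] g[of n] by (auto simp: good_orbit_def T_def)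
   have "x m t > 0 \<and> x n t > 0" if "t \<in> {T<..}" for t
    using o[of "t + h m" m] o[of "t + h n" n] that by (auto simp: x_def T_def)
   from lvsol_eq_imp(1)[OF gT this refl e] obtain T' where T': "!!t. t > T' ==> x m t = x n t \<and> y m t = y n t" by blast
   show "m = n"
   proof (rule dist[of "T' + h n + 1" m "h m - h n" n], intro allI impI)
    fix t assume "T' + h n + 1 <= t"
    then show "X m (t + (h m - h n)) = X n t \<and> Y m (t + (h m - h n)) = Y n t"
     using T'[of "t - h n"] by (simp add: x_def y_def algebra_simps)
   qed
  qed
 qed
 then show ?thesis using \<beta> by (intro exI[of _ "%k. \<beta> * k"]) auto
qed

theorem no_solution_near_zero: "q <= Q ==> \<not> (\<exists>w. sol_near_zero N p q \<sigma> 1 w)"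
 using near_zero_ef no_solution_near_bot by blast

section \<open>The self-similar solution\<close>

lemma a_star_eq:
 assumes \<epsilon>: "\<epsilon> * (1 - \<delta>) > 0" "\<epsilon> = 1 \<or> \<epsilon> = - 1"
 shows "a_star N p q \<sigma> \<epsilon> = (\<bar>\<delta>\<bar> powr a * \<bar>a * (1 - \<delta>)\<bar> / K) powr (1 / (q - a))"
proof -
 define R where "R = \<bar>\<delta>\<bar> powr a * \<bar>a * (1 - \<delta>)\<bar> / K"
 have R: "R > 0" using \<epsilon> a K \<delta>_pos by (auto simp: R_def)
 have q: "q - a > 0" using aq by simp
 have "\<epsilon> * \<bar>gam p q \<sigma>\<bar> powr (p - 2) * gam p q \<sigma> * (N - p - (p - 1) * gam p q \<sigma>) = R"
 proof -
  have g: "gam p q \<sigma> = - (\<beta> * \<delta>)" by (rule exponents)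
  have ab: "\<bar>- (\<beta> * \<delta>)\<bar> = \<beta> * \<delta>" using \<beta> \<delta>_pos by simp
  have np: "N - p - (p - 1) * - (\<beta> * \<delta>) = - (a * \<beta> * (1 - \<delta>))" by (simp add: p_eq N_eq algebra_simps)
  have "\<epsilon> * (\<beta> * \<delta>) powr (p - 2) * - (\<beta> * \<delta>) * - (a * \<beta> * (1 - \<delta>))
    = ((\<beta> * \<delta>) powr (a - 1) * (\<beta> * \<delta>)) * \<beta> * (\<epsilon> * (a * (1 - \<delta>)))"
   by (simp add: p_eq)
  also have "(\<beta> * \<delta>) powr (a - 1) * (\<beta> * \<delta>) = (\<beta> * \<delta>) powr a" using \<beta> \<delta>_pos by (simp add: powr_diff)
  also have "\<epsilon> * (a * (1 - \<delta>)) = \<bar>a * (1 - \<delta>)\<bar>" using \<epsilon> a by (auto simp: abs_mult)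
  also have "(\<beta> * \<delta>) powr a * \<beta> = \<beta> powr (a + 1) * \<delta> powr a" using \<beta> \<delta>_pos by (simp add: powr_mult powr_add)
  also have "\<beta> powr (a + 1) = 1 / K"
  proof -
   have "- a - 1 = - (a + 1)" by simp
   then show ?thesis unfolding K_eq by (metis inverse_eq_divide inverse_inverse_eq powr_minus)
  qed
  finally show ?thesis unfolding g ab np using \<delta>_pos by (simp add: R_def)
 qed
 then have "a_star N p q \<sigma> \<epsilon> = (THE b. b > 0 \<and> b powr (q - a) = R)"
  unfolding a_star_def exponents(11) by simp
 also have "\<dots> = R powr (1 / (q - a))"
 proof (rule the_equality)
  show "0 < R powr (1 / (q - a)) \<and> (R powr (1 / (q - a))) powr (q - a) = R" using R q by (simp add: powr_powr)
  show "b = R powr (1 / (q - a))" if "0 < b \<and> b powr (q - a) = R" for b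
   using that q by (auto simp: powr_powr)
 qed
 finally show ?thesis by (simp add: R_def)
qed

lemma interior_equilibrium:
 assumes "\<epsilon> * (1 - \<delta>) > 0" "\<epsilon> = 1 \<or> \<epsilon> = - 1"
 shows "good_orbit \<epsilon> UNIV (%_. \<delta>) (%_. a * (1 - \<delta>))"
proof -
 have z: "a * (1 - \<delta>) * (- Q + q * \<delta> + a * (1 - \<delta>)) = 0" using \<delta>_eq by (simp add: algebra_simps)
 have "lv (%_. \<delta>) (%_. a * (1 - \<delta>)) t" for t
  unfolding lv_def z using a by simp
 moreover have "\<epsilon> * (\<delta> * (a * (1 - \<delta>))) = (\<epsilon> * (1 - \<delta>)) * (\<delta> * a)" by simp
 then have "\<epsilon> * (\<delta> * (a * (1 - \<delta>))) > 0" using assms(1) \<delta>_pos a by (simp only: mult_pos_pos)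
 ultimately show ?thesis using assms(2) by (simp add: good_orbit_def)
qed

theorem w_star_solution:
 assumes \<epsilon>: "\<epsilon> * (1 - \<delta>) > 0" "\<epsilon> = 1 \<or> \<epsilon> = - 1"
 shows "global_sol N p q \<sigma> \<epsilon> (w_star N p q \<sigma> \<epsilon>)"
proof -
 have "w_star N p q \<sigma> \<epsilon> r = Vof (%_. \<delta>) (%_. a * (1 - \<delta>)) (\<beta> * ln r)" if r: "r > 0" for r
 proof -
  define A where "A = \<bar>\<delta>\<bar> powr a * \<bar>a * (1 - \<delta>)\<bar> / K"
  have A: "A >= 0" using K by (simp add: A_def)
  have "Vof (%_. \<delta>) (%_. a * (1 - \<delta>)) (\<beta> * ln r) = (A * exp ((Q - a) * (\<beta> * ln r))) powr (1 / (q - a))"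
   by (simp add: Vof_def A_def)
  also have "\<dots> = A powr (1 / (q - a)) * exp ((Q - a) * (\<beta> * ln r)) powr (1 / (q - a))"
   by (rule powr_mult)
  also have "exp ((Q - a) * (\<beta> * ln r)) powr (1 / (q - a)) = r powr (- gam p q \<sigma>)"
   using r unfolding exponents exp_powr by (simp add: \<delta>_def powr_def mult_ac)
  also have "A powr (1 / (q - a)) = a_star N p q \<sigma> \<epsilon>" unfolding A_def by (rule a_star_eq[OF \<epsilon>, symmetric])
  finally show ?thesis by (simp add: w_star_def)
 qed
 from lv_imp_solution(1)[OF open_UNIV _ \<epsilon>(2) this] interior_equilibrium[OF \<epsilon>]
 have "pos_solution_on N p q \<sigma> \<epsilon> {r. r > 0 \<and> \<beta> * ln r \<in> UNIV} (w_star N p q \<sigma> \<epsilon>)" by (auto simp: good_orbit_def)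
 then show ?thesis unfolding global_sol_def by (rule pos_solution_on_subset) auto
qed

lemma self_similar_limit:
 assumes FG: "log_filters F G" and x: "(x \<longlongrightarrow> \<delta>) F" and y: "(y \<longlongrightarrow> a * (1 - \<delta>)) F"
  and \<epsilon>: "\<epsilon> * (1 - \<delta>) > 0" "\<epsilon> = 1 \<or> \<epsilon> = - 1"
 shows "((%r. r powr gam p q \<sigma> * lvsol x y r) \<longlongrightarrow> a_star N p q \<sigma> \<epsilon>) G"
proof -
 have nz: "\<delta> ~= 0" "a * (1 - \<delta>) ~= 0" using \<delta>_pos a \<epsilon> by auto
 show ?thesis
  by (rule log_limit[OF FG Vof_self_similar_limit[OF x nz(1) y nz(2)], folded a_star_eq[OF \<epsilon>]])
    (simp add: scale_weight lvsol_exp)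
qed

theorem connection_to_singular_at_infinity:
 assumes qQ: "q < Q" and k: "k > 0"
 shows "\<exists>w. global_sol N p q \<sigma> (-1) w \<and>
      ((%r. r powr ((N - p) / (p - 1)) * w r) \<longlongrightarrow> k) at_top \<and>
      ((%r. r powr gam p q \<sigma> * w r) \<longlongrightarrow> a_star N p q \<sigma> (-1)) (at_right 0)"
proof -
 have \<delta>1: "\<delta> > 1"
 proof -
  have "(\<delta> - 1) * (q - a) > 0" using \<delta>_eq qQ by (simp add: algebra_simps)
  then show ?thesis using aq by (simp add: zero_less_mult_iff)
 qed
 obtain x y where o: "!!t. lv x y t \<and> x t > 0 \<and> y t < 0" and lim: "(x \<longlongrightarrow> 1) at_top" "(y \<longlongrightarrow> 0) at_top"
   "(x \<longlongrightarrow> \<delta>) at_bot" "(y \<longlongrightarrow> a * (1 - \<delta>)) at_bot"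
  using exists_connection_interior_one_zero[OF qQ] by blast
 define l where "l = (Q - q) / 2"
 have l: "l > 0" using qQ by (simp add: l_def)
 \<comment> \<open>Along the connection \<open>y\<close> decays at a rate close to the eigenvalue \<open>q - Q\<close>.\<close>
 have "((%t. - Q + q * x t + y t) \<longlongrightarrow> - Q + q * 1 + 0) at_top" by (intro tendsto_intros lim)
 moreover have "- Q + q * 1 + 0 < - l" using qQ by (simp add: l_def field_simps)
 ultimately have "\<forall>\<^sub>F t in at_top. - Q + q * x t + y t < - l" by (rule order_tendstoD(2))
 then obtain T where T: "!!t. t >= T ==> - Q + q * x t + y t < - l" by (auto simp: eventually_at_top_linorder)
 have decay: "- y t <= - y T * exp (- l * (t - T))" if "t >= T" for t
 proof (rule exponential_decay_bound[where g="%t. - Q + q * x t + y t" and y="%t. - y t"])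
  fix t assume t: "T <= t"
  show "((%t. - y t) has_real_derivative - y t * (- Q + q * x t + y t)) (at t)"
   using DERIV_minus[of y] o[of t] by (simp add: lv_def)
  show "- Q + q * x t + y t <= - l" using T[OF t] by simp
 qed (use o that in auto)
 have g0: "good_orbit (- 1) UNIV x y"
  unfolding good_orbit_def using o by (auto intro: mult_pos_neg)
 define x1 y1 where "x1 = (%t. x (t + T))" and "y1 = (%t. y (t + T))"
 have g1: "good_orbit (- 1) UNIV x1 y1" unfolding x1_def y1_def by (rule good_orbit_shift[OF g0]) simp
 have x11: "(x1 \<longlongrightarrow> 1) at_top" unfolding x1_def by (rule filterlim_compose[OF lim(1) shift_filterlims(1)])
 have "\<exists>k0>0. ((%t. Vof x1 y1 t * exp (- t)) \<longlongrightarrow> k0) at_top"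
 proof (rule Vof_slope_limit_at_top[of x1 y1 "- 1" l "- y T"])
  fix t :: real assume t: "t >= 0"
  show "lv x1 y1 t" using g1 by (simp add: good_orbit_def)
  show "x1 t > 0 \<and> 0 < - 1 * y1 t \<and> - 1 * y1 t <= - y T * exp (- (l * t))"
   using o[of "t + T"] decay[of "t + T"] t by (simp add: x1_def y1_def)
 qed (use l x11 in auto)
 then obtain k0 where k0: "k0 > 0" "((%t. Vof x1 y1 t * exp (- t)) \<longlongrightarrow> k0) at_top" by blast
 define h where "h = ln (k / k0) / (1 - \<delta>)"
 define x2 y2 where "x2 = (%t. x1 (t + h))" and "y2 = (%t. y1 (t + h))"
 have g2: "good_orbit (- 1) UNIV x2 y2" unfolding x2_def y2_def by (rule good_orbit_shift[OF g1]) simp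
 have V: "((%t. Vof x2 y2 t * exp (- t)) \<longlongrightarrow> k) at_top" unfolding x2_def y2_def
  by (rule Vof_slope_shift[OF g1 _ shift_filterlims(1) k0(2,1) k _ h_def]) (use \<delta>1 in auto)
 have x2t: "(x2 \<longlongrightarrow> 1) at_top" unfolding x2_def by (rule filterlim_compose[OF x11 shift_filterlims(1)])
 have x2b: "(x2 \<longlongrightarrow> \<delta>) at_bot" unfolding x2_def x1_def
  by (rule filterlim_compose[OF filterlim_compose[OF lim(3) shift_filterlims(2)] shift_filterlims(2)])
 have y2b: "(y2 \<longlongrightarrow> a * (1 - \<delta>)) at_bot" unfolding y2_def y1_def
  by (rule filterlim_compose[OF filterlim_compose[OF lim(4) shift_filterlims(2)] shift_filterlims(2)])
 show ?thesis
  using lvsol_solution(3)[OF g2] slope_limits(1)[OF log_filters(1) g2 open_UNIV _ x2t V]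
   self_similar_limit[OF log_filters(2) x2b y2b, of "- 1"] \<delta>1
  by (intro exI[of _ "lvsol x2 y2"]) auto
qed

section \<open>Above the critical exponent\<close>

lemma \<delta>_less_1: "Q < q ==> \<delta> < 1"
proof -
 assume "Q < q"
 then have "(1 - \<delta>) * (q - a) > 0" using \<delta>_eq by (simp add: algebra_simps)
 then show ?thesis using aq by (simp add: zero_less_mult_iff)
qed

text \<open>For \<open>q > Q\<close> the equilibrium \<open>(1, 0)\<close> is a saddle, so that up to translation a single orbit leaves it on each side. A
 translation turns the constant \<open>k\<close> into \<open>l\<close>, after which \<open>unique_at_bot\<close> applies.\<close>

theorem singular_at_zero:
 assumes qQ: "Q < q"
 shows "\<exists>c. (\<forall>k>0. c k > 0) \<and>
    (\<forall>\<epsilon>\<in>{1, -1}.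
     let P = (%k w. sol_near_zero N p q \<sigma> \<epsilon> w \<and>
           ((%r. r powr ((N - p) / (p - 1)) * w r) \<longlongrightarrow> k) (at_right 0) \<and>
           ((%r. r powr ((N - 1) / (p - 1)) * deriv w r) \<longlongrightarrow> c k) (at_right 0))
     in (\<forall>k>0. \<exists>w. P k w) \<and>
       (\<forall>k>0. \<forall>l>0. \<forall>u v. P k u \<and> P l v -->
        (\<exists>\<mu>>0. \<forall>\<^sub>F r in at_right 0. v r = scaling (gam p q \<sigma>) \<mu> u r)))"
proof -
 have \<delta>1: "\<delta> < 1" by (rule \<delta>_less_1[OF qQ])
 define P where "P = (%\<epsilon> k w. sol_near_zero N p q \<sigma> \<epsilon> w \<and>
           ((%r. r powr ((N - p) / (p - 1)) * w r) \<longlongrightarrow> k) (at_right 0) \<and>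
           ((%r. r powr ((N - 1) / (p - 1)) * deriv w r) \<longlongrightarrow> \<beta> * k) (at_right 0))"
 have ex: "\<exists>w. P \<epsilon> k w" if \<epsilon>: "\<epsilon> \<in> {1, -1}" and k: "k > 0" for \<epsilon> k
 proof -
  have \<epsilon>': "\<epsilon> = 1 \<or> \<epsilon> = - 1" using \<epsilon> by auto
  obtain x y l c where l: "l > 0" and o: "!!t. t <= 0 ==> lv x y t \<and> x t > 0 \<and> 0 < \<epsilon> * y t \<and> \<epsilon> * y t <= c * exp (l * t)"
   and x: "(x \<longlongrightarrow> 1) at_bot" using exists_curve_leaving_one_zero[OF qQ \<epsilon>'] by blast
  have "\<exists>k0>0. ((%t. Vof x y t * exp (- t)) \<longlongrightarrow> k0) at_bot"
   by (rule Vof_slope_limit_at_bot[of x y \<epsilon> l c]) (use o x \<epsilon>' l in auto)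
  then obtain k0 where k0: "k0 > 0" "((%t. Vof x y t * exp (- t)) \<longlongrightarrow> k0) at_bot" by blast
  define h where "h = ln (k / k0) / (1 - \<delta>)"
  define x' y' where "x' = (%t. x (t + h))" and "y' = (%t. y (t + h))"
  have g0: "good_orbit \<epsilon> {..<0} x y"
   unfolding good_orbit_def using \<epsilon>' o by (auto simp: mult.left_commute[of \<epsilon>])
  have ev: "\<forall>\<^sub>F t in at_bot. t + h \<in> {..<0}" using eventually_gt_at_bot[of "- h"] by eventually_elim simp
  have g: "good_orbit \<epsilon> {..<- h} x' y'" unfolding x'_def y'_def by (rule good_orbit_shift[OF g0]) auto
  have V: "((%t. Vof x' y' t * exp (- t)) \<longlongrightarrow> k) at_bot" unfolding x'_def y'_def
   by (rule Vof_slope_shift[OF g0 ev shift_filterlims(2) k0(2,1) k _ h_def]) (use \<delta>1 in auto)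
  have x1: "(x' \<longlongrightarrow> 1) at_bot" unfolding x'_def by (rule filterlim_compose[OF x shift_filterlims(2)])
  show ?thesis unfolding P_def
   using lvsol_solution(2)[OF g] slope_limits[OF log_filters(2) g open_lessThan _ x1 V] eventually_gt_at_bot[of "- h"]
   by (intro exI[of _ "lvsol x' y'"]) auto
 qed
 have un: "\<exists>\<mu>>0. \<forall>\<^sub>F r in at_right 0. v r = scaling (gam p q \<sigma>) \<mu> u r"
  if \<epsilon>: "\<epsilon> \<in> {1, -1}" and kl: "k > 0" "l > 0" and uv: "P \<epsilon> k u" "P \<epsilon> l v" for \<epsilon> k l u v
 proof -
  have V: "((%t. Vt w t * exp (- t)) \<longlongrightarrow> k) at_bot" and \<Phi>: "((%t. psi (Phit w t)) \<longlongrightarrow> k) at_bot" if w: "P \<epsilon> k w" for k w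
  proof -
   show "((%t. Vt w t * exp (- t)) \<longlongrightarrow> k) at_bot"
    by (rule limit_to_log(2)[where g="%r. r powr ((N - p) / (p - 1)) * w r"])
      (use w in \<open>auto simp: P_def slope_weight Vt_def\<close>)
   have d: "((%r. r powr ((N - 1) / (p - 1)) * deriv w r) \<longlongrightarrow> \<beta> * k) (at_right 0)" using w by (simp add: P_def)
   have "((%t. \<beta> * psi (Phit w t)) \<longlongrightarrow> \<beta> * k) at_bot"
    by (rule limit_to_log(2)[OF _ d]) (simp only: weighted_derivative_Phit)
   then have "((%t. \<beta> * psi (Phit w t) / \<beta>) \<longlongrightarrow> \<beta> * k / \<beta>) at_bot"
    by (rule tendsto_divide[OF _ tendsto_const]) (use \<beta> in simp)
   then show "((%t. psi (Phit w t)) \<longlongrightarrow> k) at_bot" using \<beta> by simp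
  qed
  have "\<exists>T. \<forall>t<T. ef \<epsilon> (Vt u) (Phit u) t" "\<exists>T. \<forall>t<T. ef \<epsilon> (Vt v) (Phit v) t"
   using uv by (auto simp: P_def intro: near_zero_ef)
  then obtain T1 T2 where T: "!!t. t < T1 ==> ef \<epsilon> (Vt u) (Phit u) t" "!!t. t < T2 ==> ef \<epsilon> (Vt v) (Phit v) t" by blast
  define h where "h = ln (l / k) / (1 - \<delta>)"
  have "(1 - \<delta>) * h = ln (l / k)" using \<delta>1 by (simp add: h_def)
  then have e: "exp ((1 - \<delta>) * h) * k = l" using kl by simp
  define U F where "U = (%t. exp (- (\<delta> * h)) * Vt u (t + h))" and "F = (%t. exp (a * (1 - \<delta>) * h) * Phit u (t + h))"
  have efU: "ef \<epsilon> U F t" if "t < min (T1 - h) T2" for t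
   unfolding U_def F_def by (rule ef_scale) (use that T(1) in auto)
  have UV: "((%t. U t * exp (- t)) \<longlongrightarrow> l) at_bot"
  proof -
   have "((%t. exp ((1 - \<delta>) * h) * (Vt u (t + h) * exp (- (t + h)))) \<longlongrightarrow> exp ((1 - \<delta>) * h) * k) at_bot"
    by (intro tendsto_intros filterlim_compose[OF V[OF uv(1)] shift_filterlims(2)])
   moreover have "exp ((1 - \<delta>) * h) * (Vt u (t + h) * exp (- (t + h))) = U t * exp (- t)" for t
   proof -
    have "exp ((1 - \<delta>) * h) * exp (- (t + h)) = exp (- (\<delta> * h)) * exp (- t)" unfolding exp_add[symmetric] by (simp add: algebra_simps)
    then have "exp ((1 - \<delta>) * h) * exp (- (t + h)) * Vt u (t + h) = exp (- (\<delta> * h)) * exp (- t) * Vt u (t + h)" by (rule arg_cong)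
    then show ?thesis unfolding U_def by (simp only: mult_ac)
   qed
   ultimately show ?thesis by (simp add: e)
  qed
  have UF: "((%t. psi (F t)) \<longlongrightarrow> l) at_bot"
  proof -
   have "psi (F t) = exp ((1 - \<delta>) * h) * psi (Phit u (t + h))" for t
    unfolding F_def using a by (subst psi_mult) (simp_all add: exp_powr)
   moreover have "((%t. exp ((1 - \<delta>) * h) * psi (Phit u (t + h))) \<longlongrightarrow> exp ((1 - \<delta>) * h) * k) at_bot"
    by (intro tendsto_intros filterlim_compose[OF \<Phi>[OF uv(1)] shift_filterlims(2)])
   ultimately show ?thesis by (simp add: e)
  qed
  have "\<forall>\<^sub>F t in at_bot. Vt v t = U t"
   by (rule unique_at_bot[of \<epsilon> l "min (T1 - h) T2" _ "Phit v" _ F])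
     (use qQ \<epsilon> kl efU T(2) V[OF uv(2)] \<Phi>[OF uv(2)] UV UF in auto)
  then have "\<forall>\<^sub>F r in at_right 0. v r = scaling (gam p q \<sigma>) (exp (h / \<beta>)) u r"
  proof (rule eventually_from_log(2)[rotated])
   fix r :: real assume r: "r > 0" "Vt v (\<beta> * ln r) = U (\<beta> * ln r)"
   have "exp ((\<beta> * ln r + h) / \<beta>) = exp (h / \<beta>) * r"
    using r \<beta> by (simp add: add_divide_distrib exp_add mult.commute)
   then show "v r = scaling (gam p q \<sigma>) (exp (h / \<beta>)) u r"
    using r unfolding Vt_def U_def scaling_def scale_weight exp_log_inverse(1)[OF r(1)] by simp
  qed
  then show ?thesis by (intro exI[of _ "exp (h / \<beta>)"]) simp
 qed
 show ?thesis
  unfolding Let_def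
  by (rule exI[of _ "%k. \<beta> * k"], intro conjI ballI)
    (use \<beta> in simp, use ex[unfolded P_def] in blast, use un[unfolded P_def] in blast)
qed

theorem absorption_at_infinity:
 assumes qQ: "Q < q" and r0: "r0 > 0" and w: "pos_solution_on N p q \<sigma> (-1) {r0<..} w"
 shows "\<exists>L. (w \<longlongrightarrow> L) at_top" "\<not> global_sol N p q \<sigma> (-1) v"
proof -
 have "sol_near_infty N p q \<sigma> (-1) w" using r0 w by (auto simp: sol_near_infty_def)
 then obtain T where T: "!!t. t > T ==> ef (-1) (Vt w) (Phit w) t" using near_infty_ef by blast
 have "\<exists>L. (Vt w \<longlongrightarrow> L) at_top"
  by (rule decreasing_solution_converges[OF T flux_nonpositive[OF qQ T]])
 then obtain L where "(Vt w \<longlongrightarrow> L) at_top" by blast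
 from log_limit[OF log_filters(1) this, of w] show "\<exists>L. (w \<longlongrightarrow> L) at_top" by (auto simp: Vt_def)
 show "\<not> global_sol N p q \<sigma> (-1) v"
  using no_global_solution_absorption[OF qQ] global_ef by blast
qed

theorem no_global_solution_subcritical:
 assumes qQ: "Q < q" and sub: "q < q_sob N p \<sigma>"
 shows "\<not> (\<exists>w L. global_sol N p q \<sigma> 1 w \<and> (w \<longlongrightarrow> L) at_top)"
proof (clarify)
 fix w L assume w: "global_sol N p q \<sigma> 1 w" "(w \<longlongrightarrow> L) at_top"
 have "(Vt w \<longlongrightarrow> L) at_top" by (rule limit_to_log(1)[OF _ w(2)]) (simp add: Vt_def)
 then show False using no_global_solution_with_limit[OF qQ _ global_ef[OF w(1)]] sub q_sob_iff by blast
qed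

theorem connection_from_singular_at_zero:
 assumes qQ: "Q < q" and sub: "q < q_sob N p \<sigma>" and k: "k > 0"
 shows "\<exists>w. global_sol N p q \<sigma> 1 w \<and>
        ((%r. r powr gam p q \<sigma> * w r) \<longlongrightarrow> a_star N p q \<sigma> 1) at_top \<and>
        ((%r. r powr ((N - p) / (p - 1)) * w r) \<longlongrightarrow> k) (at_right 0)"
proof -
 have \<delta>1: "\<delta> < 1" by (rule \<delta>_less_1[OF qQ])
 have s: "sob < Q" using sub q_sob_iff by simp
 obtain x y l c where l: "l > 0" and o: "!!t. lv x y t \<and> x t > 0 \<and> y t > 0" and b: "!!t. t <= 0 ==> y t <= c * exp (l * t)"
  and lim: "(x \<longlongrightarrow> 1) at_bot" "(x \<longlongrightarrow> \<delta>) at_top" "(y \<longlongrightarrow> a * (1 - \<delta>)) at_top"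
  using exists_connection_one_zero_interior[OF qQ s] by blast
 have "\<exists>k0>0. ((%t. Vof x y t * exp (- t)) \<longlongrightarrow> k0) at_bot"
  by (rule Vof_slope_limit_at_bot[of x y 1 l c]) (use o b lim l in auto)
 then obtain k0 where k0: "k0 > 0" "((%t. Vof x y t * exp (- t)) \<longlongrightarrow> k0) at_bot" by blast
 define h where "h = ln (k / k0) / (1 - \<delta>)"
 define x' y' where "x' = (%t. x (t + h))" and "y' = (%t. y (t + h))"
 have g0: "good_orbit 1 UNIV x y" unfolding good_orbit_def using o by auto
 have g: "good_orbit 1 UNIV x' y'" unfolding x'_def y'_def by (rule good_orbit_shift[OF g0]) auto
 have V: "((%t. Vof x' y' t * exp (- t)) \<longlongrightarrow> k) at_bot" unfolding x'_def y'_def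
  by (rule Vof_slope_shift[OF g0 _ shift_filterlims(2) k0(2,1) k _ h_def]) (use \<delta>1 in auto)
 have l': "(x' \<longlongrightarrow> 1) at_bot" "(x' \<longlongrightarrow> \<delta>) at_top" "(y' \<longlongrightarrow> a * (1 - \<delta>)) at_top"
  unfolding x'_def y'_def
  by (rule filterlim_compose[OF lim(1) shift_filterlims(2)] filterlim_compose[OF lim(2) shift_filterlims(1)] filterlim_compose[OF lim(3) shift_filterlims(1)])+
 show ?thesis
  using lvsol_solution(3)[OF g] slope_limits(1)[OF log_filters(2) g open_UNIV _ l'(1) V]
   self_similar_limit[OF log_filters(1) l'(2,3), of 1] \<delta>1
  by (intro exI[of _ "lvsol x' y'"]) auto
qed

theorem connection_to_regular_at_infinity:
 assumes qQ: "Q < q" and super: "q_sob N p \<sigma> < q" and C: "C > 0"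
 shows "\<exists>w. global_sol N p q \<sigma> 1 w \<and> (w \<longlongrightarrow> C) at_top \<and>
        ((%r. r powr gam p q \<sigma> * w r) \<longlongrightarrow> a_star N p q \<sigma> 1) (at_right 0)"
proof -
 have \<delta>1: "\<delta> < 1" by (rule \<delta>_less_1[OF qQ])
 have s: "Q < sob" using super q_sob_iff by simp
 obtain x y l c where l: "l > 0" and o: "!!t. lv x y t \<and> x t > 0 \<and> y t > 0" and b: "!!t. t >= 0 ==> x t <= c * exp (- (l * t))"
  and lim: "(x \<longlongrightarrow> \<delta>) at_bot" "(y \<longlongrightarrow> a * (1 - \<delta>)) at_bot"
  using exists_connection_interior_zero_Q[OF qQ s] by blast
 obtain C0 where C0: "C0 > 0" "(Vof x y \<longlongrightarrow> C0) at_top"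
  using Vof_finite_limit[of x y 1 c l] o b l by auto
 define h where "h = ln (C0 / C) / \<delta>"
 define x' y' where "x' = (%t. x (t + h))" and "y' = (%t. y (t + h))"
 have g0: "good_orbit 1 UNIV x y" unfolding good_orbit_def using o by auto
 have g: "good_orbit 1 UNIV x' y'" unfolding x'_def y'_def by (rule good_orbit_shift[OF g0]) auto
 have V: "(Vof x' y' \<longlongrightarrow> C) at_top" unfolding x'_def y'_def
  by (rule Vof_limit_shift[OF g0 _ C0(2,1) C h_def]) auto
 have l': "(x' \<longlongrightarrow> \<delta>) at_bot" "(y' \<longlongrightarrow> a * (1 - \<delta>)) at_bot"
  unfolding x'_def y'_def
  by (rule filterlim_compose[OF lim(1) shift_filterlims(2)] filterlim_compose[OF lim(2) shift_filterlims(2)])+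
 show ?thesis
  using lvsol_solution(3)[OF g] log_limit[OF log_filters(1) V, of "lvsol x' y'"]
   self_similar_limit[OF log_filters(2) l', of 1] \<delta>1
  by (intro exI[of _ "lvsol x' y'"]) (auto simp: lvsol_exp)
qed

text \<open>For \<open>Q = sob\<close> the Pohozaev line itself is the orbit \<open>y = Q (1 - x)\<close> from \<open>(1, 0)\<close> to \<open>(0, Q)\<close>, on which \<open>x\<close> satisfies the
 logistic equation \<open>x' = - e x (1 - x)\<close>.\<close>

theorem explicit_solution:
 assumes qs: "q = q_sob N p \<sigma>" and c: "c > 0"
  and d: "d = c powr (q - p + 1) * inverse \<bar>N + \<sigma>\<bar> * ((p - N) / (p - 1)) powr (1 - p)"
  and w: "w = (%r. c * (d + r powr ((p + \<sigma>) / (p - 1))) powr ((p - N) / (p + \<sigma>)))"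
 shows "global_sol N p q \<sigma> 1 w" "(w \<longlongrightarrow> 0) (at_right 0)" "w \<sim>[at_right 0] (%r. c * r powr ((p - N) / (p - 1)))"
  "(w \<longlongrightarrow> c * d powr ((p - N) / (p + \<sigma>))) at_top"
proof -
 have Qs: "Q = sob" using qs q_sob_iff by simp
 have Q0: "Q > 0" using a aQ by simp
 define e where "e = (Q - a) / a"
 have e: "e > 0" using a aQ by (simp add: e_def)
 have Qe: "Q - a = a * e" using a by (simp add: e_def)
 have qe: "q - a = (a + 1) * e"
 proof -
  have "a * ((a + 1) * e) = (a + 1) * (Q - a)" unfolding Qe by simp
  also have "\<dots> = a * (q - a)" unfolding Qs sob_def using a by (simp add: field_simps)
  finally show ?thesis using a by simp
 qed
 have qQe: "q - Q = e" using Qe qe by (simp add: algebra_simps)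
 have d': "d = c powr (q - a) * K / Q"
 proof -
  have "1 - p = - a" by (simp add: p_eq)
  moreover have "\<beta> powr (- a) = K * \<beta>" using \<beta> by (simp add: K_eq powr_diff)
  ultimately show ?thesis unfolding d exponents(5,8,11) using \<beta> Q0 by (simp, simp add: field_simps)
 qed
 have d0: "d > 0" unfolding d' using c K Q0 by simp
 have ex: "(p + \<sigma>) / (p - 1) = - (\<beta> * e)" "(p - N) / (p + \<sigma>) = - (1 / e)"
  unfolding exponents Qe using a \<beta> e by (auto simp: p_eq)
 define x y where "x = (%t. 1 / (1 + d * exp (e * t)))" and "y = (%t. Q * (1 - x t))"
 have den: "1 + d * exp (e * t) > 0" for t using d0 by (simp add: add_pos_pos)
 have x01: "0 < x t" "x t < 1" for t using den[of t] d0 by (auto simp: x_def)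
 have x1: "1 - x t = d * exp (e * t) * x t" for t using den[of t] by (simp add: x_def field_simps)
 have dx: "(x has_real_derivative - e * (x t * (1 - x t))) (at t)" for t
 proof -
  have "(x has_real_derivative - (d * (exp (e * t) * e)) / (1 + d * exp (e * t))\<^sup>2) (at t)"
   unfolding x_def by (rule derivative_eq_intros refl | use den[of t] in \<open>simp add: power2_eq_square\<close>)+
  moreover have "- (d * (exp (e * t) * e)) / (1 + d * exp (e * t))\<^sup>2 = - e * (x t * (1 - x t))"
   unfolding x1 by (simp add: x_def power2_eq_square)
  ultimately show ?thesis by simp
 qed
 have dy: "(y has_real_derivative Q * e * (x t * (1 - x t))) (at t)" for t
  unfolding y_def by (rule derivative_eq_intros dx refl | simp)+
 have "lv x y t" for t
 proof -
  have "x t * (1 - x t - y t / a) = x t * (1 - x t) * (1 - Q / a)" using a by (simp add: y_def field_simps)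
  also have "1 - Q / a = - e" using a by (simp add: e_def diff_divide_distrib)
  finally have 1: "x t * (1 - x t - y t / a) = - e * (x t * (1 - x t))" by simp
  have "y t * (- Q + q * x t + y t) = Q * (q - Q) * (x t * (1 - x t))" by (simp add: y_def algebra_simps)
  then have 2: "y t * (- Q + q * x t + y t) = Q * e * (x t * (1 - x t))" unfolding qQe .
  show ?thesis unfolding lv_def 1 2 using dx dy by simp
 qed
 then have g: "good_orbit 1 UNIV x y" using x01 Q0 by (simp add: good_orbit_def y_def)
 have V: "Vof x y t = c * (x t powr (1 / e) * exp t)" for t
 proof -
  have "\<bar>x t\<bar> powr a * \<bar>y t\<bar> * exp ((Q - a) * t) / K
    = x t powr a * x t * (Q * d / K) * (exp (e * t) * exp ((Q - a) * t))"
   using x01[of t] Q0 x1[of t] d0 by (simp add: y_def abs_mult)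
  also have "Q * d / K = c powr (q - a)" unfolding d' using Q0 K by simp
  also have "x t powr a * x t = x t powr (a + 1)" using x01[of t] by (simp add: powr_add)
  also have "exp (e * t) * exp ((Q - a) * t) = exp t powr (q - a)"
   unfolding exp_add[symmetric] exp_powr Qe qe by (simp add: algebra_simps)
  also have "x t powr (a + 1) = (x t powr (1 / e)) powr (q - a)" unfolding powr_powr qe using e by simp
  also have "(x t powr (1 / e)) powr (q - a) * c powr (q - a) * exp t powr (q - a) = (c * (x t powr (1 / e) * exp t)) powr (q - a)"
   by (simp add: powr_mult)
  finally show ?thesis unfolding Vof_def using aq c by (simp add: powr_powr)
 qed
 have wV: "w r = Vof x y (\<beta> * ln r)" if r: "r > 0" for r
 proof -
  define t where "t = \<beta> * ln r"
  define E where "E = exp (- (e * t))"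
  have E: "E > 0" by (simp add: E_def)
  have e1: "exp (e * t) = 1 / E" by (simp add: E_def exp_minus divide_inverse)
  have "1 + d * exp (e * t) = (d + E) / E" unfolding e1 using E by (simp add: field_simps)
  then have "x t = E / (d + E)" by (simp add: x_def)
  then have "x t powr (1 / e) = E powr (1 / e) / (d + E) powr (1 / e)"
   using E d0 by (simp add: powr_divide)
  then have "x t powr (1 / e) = E powr (1 / e) * (d + E) powr (- (1 / e))"
   by (simp only: powr_minus divide_inverse)
  moreover have "E powr (1 / e) * exp t = 1" using e unfolding E_def exp_powr by (simp flip: exp_add)
  ultimately have "x t powr (1 / e) * exp t = (d + E) powr (- (1 / e))" by (metis mult.commute mult.left_commute mult.right_neutral)
  moreover have "E = r powr (- (\<beta> * e))" using r by (simp add: E_def t_def powr_def mult_ac)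
  ultimately show ?thesis unfolding w ex by (simp add: V flip: t_def)
 qed
 have "pos_solution_on N p q \<sigma> 1 {r. r > 0 \<and> \<beta> * ln r \<in> UNIV} w"
  by (rule lv_imp_solution(1)[OF open_UNIV _ _ wV]) (use g in \<open>auto simp: good_orbit_def\<close>)
 then show "global_sol N p q \<sigma> 1 w" unfolding global_sol_def by (rule pos_solution_on_subset) auto
 have xb: "(x \<longlongrightarrow> 1) at_bot"
 proof -
  have "((%t. 1 / (1 + d * exp (e * t))) \<longlongrightarrow> 1 / (1 + d * 0)) at_bot"
   by (intro tendsto_intros exp_decay_at_bot e) auto
  then show ?thesis by (simp add: x_def)
 qed
 have xe: "((%t. x t powr (1 / e)) \<longlongrightarrow> 1 powr (1 / e)) at_bot" by (intro tendsto_intros xb) auto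
 have "((%t. c * (x t powr (1 / e) * exp t)) \<longlongrightarrow> c * (1 powr (1 / e) * 0)) at_bot"
  by (intro tendsto_intros xe exp_at_bot)
 from log_limit[OF log_filters(2) this, of w] show "(w \<longlongrightarrow> 0) (at_right 0)"
  using \<beta> by (simp add: wV V)
 show "w \<sim>[at_right 0] (%r. c * r powr ((p - N) / (p - 1)))"
 proof (rule asymp_equivI')
  have "exp (t / \<beta>) powr \<beta> = exp t" for t using \<beta> by (simp add: exp_powr)
  then have "w (exp (t / \<beta>)) / (c * exp (t / \<beta>) powr ((p - N) / (p - 1))) = x t powr (1 / e)" for t
   unfolding exponents(5) using \<beta> c by (simp add: wV V)
  then show "((%r. w r / (c * r powr ((p - N) / (p - 1)))) \<longlongrightarrow> 1) (at_right 0)"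
   using log_limit[OF log_filters(2) xe, of "%r. w r / (c * r powr ((p - N) / (p - 1)))"] by simp
 qed
 have "((%t. c * (d + exp (- (e * t))) powr (- (1 / e))) \<longlongrightarrow> c * (d + 0) powr (- (1 / e))) at_top"
  by (intro tendsto_intros exp_decay_at_top e) (use d0 in auto)
 moreover have "w (exp (t / \<beta>)) = c * (d + exp (- (e * t))) powr (- (1 / e))" for t
  unfolding w ex exp_powr using \<beta> by simp
 ultimately show "(w \<longlongrightarrow> c * d powr ((p - N) / (p + \<sigma>))) at_top"
  using log_limit[OF log_filters(1), of _ _ w] unfolding ex by simp
qed

section \<open>At the critical exponent\<close>

lemma kap_eq: "kap N p \<sigma> = (\<beta> powr p / (\<beta> * (Q - a) / a)) powr (1 / (Q - a))"
proof -
 have "(p - N) / ((p - 1) * \<bar>p + \<sigma>\<bar>) = \<beta> / (\<beta> * (Q - a))" unfolding exponents(7,10) using a by (simp add: p_eq)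
 also have "\<dots> = 1 / (Q - a)" using \<beta> by simp
 finally have e: "(p - N) / ((p - 1) * \<bar>p + \<sigma>\<bar>) = 1 / (Q - a)" .
 have p1: "p - 1 = a" by (simp add: p_eq)
 show ?thesis unfolding kap_def e unfolding exponents(5,7) unfolding p1 by simp
qed

text \<open>For \<open>q = Q\<close> one has \<open>V exp (- t) = (|x|\<^sup>a |y| / K)\<^sup>1\<^sup>/\<^sup>(\<^sup>Q\<^sup>-\<^sup>a\<^sup>)\<close>, and \<open>y\<close> decays like \<open>a / ((Q - a) t)\<close>.\<close>

lemma critical_limits:
 assumes qQ: "q = Q" and FG: "log_filters F G" and F: "\<forall>\<^sub>F t in F. t \<in> S \<and> t ~= 0" and S: "open S"
  and g: "good_orbit \<epsilon> S x y" and x: "(x \<longlongrightarrow> 1) F" and y: "((%t. y t * t) \<longlongrightarrow> a / (Q - a)) F"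
 shows "((%r. (inverse r * \<bar>ln r\<bar> powr (1 / \<bar>p + \<sigma>\<bar>)) powr ((p - N) / (p - 1)) * lvsol x y r) \<longlongrightarrow> kap N p \<sigma>) G"
  "((%r. r powr ((N - 1) / (p - 1)) * \<bar>ln r\<bar> powr ((p - N) / (\<bar>p + \<sigma>\<bar> * (p - 1))) * deriv (lvsol x y) r)
    \<longlongrightarrow> (p - N) / (p - 1) * kap N p \<sigma>) G"
proof -
 define m where "m = 1 / (q - a)"
 have mQ: "m = 1 / (Q - a)" using qQ by (simp add: m_def)
 have m1: "1 / \<bar>p + \<sigma>\<bar> * \<beta> = m" and m2: "(p - N) / (\<bar>p + \<sigma>\<bar> * (p - 1)) = m"
  unfolding exponents(7,10) mQ using \<beta> a by (auto simp: p_eq)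
 have Vm: "Vof x y t = (\<bar>x t\<bar> powr a * \<bar>y t\<bar> / K) powr m * exp t" for t
 proof -
  have "Vof x y t = (\<bar>x t\<bar> powr a * \<bar>y t\<bar> / K * exp ((Q - a) * t)) powr m" by (simp add: Vof_def m_def)
  also have "\<dots> = (\<bar>x t\<bar> powr a * \<bar>y t\<bar> / K) powr m * exp ((Q - a) * t) powr m" by (rule powr_mult)
  also have "exp ((Q - a) * t) powr m = exp t" unfolding exp_powr mQ using aQ by simp
  finally show ?thesis .
 qed
 define k where "k = (1 powr a * (a / (Q - a)) / K / \<beta>) powr m"
 have k: "k = kap N p \<sigma>"
 proof -
  have b: "\<beta> powr p = (\<beta> powr (- a - 1)) powr (- 1)" unfolding powr_powr by (simp add: p_eq add.commute)
  have "\<beta> powr p = 1 / K" unfolding b K_eq by (simp add: powr_minus divide_inverse)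
  then show ?thesis unfolding k_def kap_eq mQ by (simp add: field_simps)
 qed
 have lim: "((%t. (\<bar>x t\<bar> powr a * \<bar>y t * t\<bar> / K / \<beta>) powr m) \<longlongrightarrow> k) F"
 proof -
  have "((%t. (\<bar>x t\<bar> powr a * \<bar>y t * t\<bar> / K / \<beta>) powr m) \<longlongrightarrow> (\<bar>1\<bar> powr a * \<bar>a / (Q - a)\<bar> / K / \<beta>) powr m) F"
   by (intro tendsto_intros x y) (use a aQ K \<beta> in auto)
  then show ?thesis using a aQ by (simp add: k_def)
 qed
 have weight: "(\<bar>t\<bar> / \<beta>) powr m * (\<bar>x t\<bar> powr a * \<bar>y t\<bar> / K) powr m = (\<bar>x t\<bar> powr a * \<bar>y t * t\<bar> / K / \<beta>) powr m" for t
  by (simp add: abs_mult mult_ac flip: powr_mult)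
 have lnexp: "\<bar>ln (exp (t / \<beta>))\<bar> = \<bar>t\<bar> / \<beta>" for t using \<beta> by simp
 have inv: "(inverse (exp (t / \<beta>)) * \<bar>ln (exp (t / \<beta>))\<bar> powr (1 / \<bar>p + \<sigma>\<bar>)) powr ((p - N) / (p - 1)) = exp (- t) * (\<bar>t\<bar> / \<beta>) powr m" for t
 proof -
  have "(inverse (exp (t / \<beta>)) * (\<bar>t\<bar> / \<beta>) powr (1 / \<bar>p + \<sigma>\<bar>)) powr \<beta>
    = inverse (exp (t / \<beta>)) powr \<beta> * ((\<bar>t\<bar> / \<beta>) powr (1 / \<bar>p + \<sigma>\<bar>)) powr \<beta>" by (rule powr_mult)
  also have "((\<bar>t\<bar> / \<beta>) powr (1 / \<bar>p + \<sigma>\<bar>)) powr \<beta> = (\<bar>t\<bar> / \<beta>) powr m" unfolding powr_powr m1 ..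
  also have "inverse (exp (t / \<beta>)) powr \<beta> = exp (- t)" using \<beta> by (simp add: exp_powr flip: exp_minus)
  finally show ?thesis unfolding exponents(5) lnexp .
 qed
 show "((%r. (inverse r * \<bar>ln r\<bar> powr (1 / \<bar>p + \<sigma>\<bar>)) powr ((p - N) / (p - 1)) * lvsol x y r) \<longlongrightarrow> kap N p \<sigma>) G"
 proof (rule log_limit[OF FG lim[unfolded k] always_eventually], rule allI)
  fix t
  have "exp (- t) * (\<bar>t\<bar> / \<beta>) powr m * ((\<bar>x t\<bar> powr a * \<bar>y t\<bar> / K) powr m * exp t) = (exp (- t) * exp t) * ((\<bar>t\<bar> / \<beta>) powr m * (\<bar>x t\<bar> powr a * \<bar>y t\<bar> / K) powr m)"
   by (simp only: mult_ac)
  then show "(inverse (exp (t / \<beta>)) * \<bar>ln (exp (t / \<beta>))\<bar> powr (1 / \<bar>p + \<sigma>\<bar>)) powr ((p - N) / (p - 1)) * lvsol x y (exp (t / \<beta>))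
   = (\<bar>x t\<bar> powr a * \<bar>y t * t\<bar> / K / \<beta>) powr m"
   unfolding inv lvsol_exp Vm weight by (simp flip: exp_add)
 qed
 have lim2: "((%t. \<beta> * ((\<bar>x t\<bar> powr a * \<bar>y t * t\<bar> / K / \<beta>) powr m * x t)) \<longlongrightarrow> \<beta> * (k * 1)) F"
  by (intro tendsto_intros lim x)
 have "\<forall>\<^sub>F t in F. exp (t / \<beta>) powr ((N - 1) / (p - 1)) * \<bar>ln (exp (t / \<beta>))\<bar> powr ((p - N) / (\<bar>p + \<sigma>\<bar> * (p - 1))) * deriv (lvsol x y) (exp (t / \<beta>))
   = \<beta> * ((\<bar>x t\<bar> powr a * \<bar>y t * t\<bar> / K / \<beta>) powr m * x t)"
  using F
 proof eventually_elim
  case (elim t)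
  have "exp t * psi (Phiof \<epsilon> x y t) = Vof x y t * x t"
   by (rule lv_imp_ef(2)) (use g elim in \<open>auto simp: good_orbit_def\<close>)
  then have ps: "psi (Phiof \<epsilon> x y t) = (\<bar>x t\<bar> powr a * \<bar>y t\<bar> / K) powr m * x t" unfolding Vm by simp
  have "exp (t / \<beta>) powr ((N - 1) / (p - 1)) * deriv (lvsol x y) (exp (t / \<beta>)) = \<beta> * ((\<bar>x t\<bar> powr a * \<bar>y t\<bar> / K) powr m * x t)"
   using weighted_derivative(1)[OF deriv_lvsol(2)[OF g S]] elim by (simp add: ps)
  then have "(\<bar>t\<bar> / \<beta>) powr m * (exp (t / \<beta>) powr ((N - 1) / (p - 1)) * deriv (lvsol x y) (exp (t / \<beta>)))
    = (\<bar>t\<bar> / \<beta>) powr m * (\<beta> * ((\<bar>x t\<bar> powr a * \<bar>y t\<bar> / K) powr m * x t))" by (rule arg_cong)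
  also have "\<dots> = \<beta> * (((\<bar>t\<bar> / \<beta>) powr m * (\<bar>x t\<bar> powr a * \<bar>y t\<bar> / K) powr m) * x t)" by (simp only: mult_ac)
  finally show ?case unfolding lnexp m2 weight by (simp only: mult_ac)
 qed
 from log_limit[OF FG lim2 this]
 show "((%r. r powr ((N - 1) / (p - 1)) * \<bar>ln r\<bar> powr ((p - N) / (\<bar>p + \<sigma>\<bar> * (p - 1))) * deriv (lvsol x y) r)
    \<longlongrightarrow> (p - N) / (p - 1) * kap N p \<sigma>) G"
  unfolding exponents(5) k by simp
qed

text \<open>The asymptotics \<open>y t \<sim> a / ((Q - a) t)\<close> do not distinguish the time shifts of an orbit, which is why there are infinitely many
 solutions with the same leading term.\<close>

lemma shifted_reciprocal_limit:
 fixes y :: "real => real"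
 assumes y: "((%t. y t * t) \<longlongrightarrow> L) F" and F: "filterlim (%t. t + h) F F" and i: "((%t::real. inverse t) \<longlongrightarrow> 0) F" and nz: "\<forall>\<^sub>F t in F. t ~= 0"
 shows "((%t. y (t + h) * t) \<longlongrightarrow> L) F"
proof -
 have "((%t. y t * t * inverse t) \<longlongrightarrow> L * 0) F" by (rule tendsto_mult[OF y i])
 moreover have "\<forall>\<^sub>F t in F. y t * t * inverse t = y t" using nz by eventually_elim simp
 ultimately have y0: "(y \<longlongrightarrow> 0) F" by (simp add: tendsto_cong)
 have "((%t. y (t + h) * (t + h) - y (t + h) * h) \<longlongrightarrow> L - 0 * h) F"
  by (intro tendsto_intros filterlim_compose[OF y F] filterlim_compose[OF y0 F])
 then show ?thesis by (simp add: algebra_simps)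
qed

theorem critical_at_infinity:
 assumes qQ: "q = Q"
 shows "infinitely_many_germs at_top
    (%w. sol_near_infty N p q \<sigma> 1 w \<and>
       ((%r. (inverse r * \<bar>ln r\<bar> powr (1 / \<bar>p + \<sigma>\<bar>)) powr ((p - N) / (p - 1)) * w r)
        \<longlongrightarrow> kap N p \<sigma>) at_top \<and>
       ((%r. r powr ((N - 1) / (p - 1)) * \<bar>ln r\<bar> powr ((p - N) / (\<bar>p + \<sigma>\<bar> * (p - 1)))
           * deriv w r)
        \<longlongrightarrow> (p - N) / (p - 1) * kap N p \<sigma>) at_top)"
proof -
 obtain x y where o: "!!t. t >= 0 ==> lv x y t \<and> x t > 0 \<and> y t > 0" and anti: "strict_antimono_on {0..} y"
  and lim: "(x \<longlongrightarrow> 1) at_top" "((%t. y t * t) \<longlongrightarrow> a / (Q - a)) at_top"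
  using exists_orbit_entering_degenerate[OF qQ] by blast
 define X Y where "X = (%(n::nat) t. x (t + real n))" and "Y = (%(n::nat) t. y (t + real n))"
 have g0: "good_orbit 1 {0<..} x y" using o by (auto simp: good_orbit_def)
 have g: "good_orbit 1 {0<..} (X n) (Y n)" for n unfolding X_def Y_def by (rule good_orbit_shift[OF g0]) auto
 have ev: "\<forall>\<^sub>F t in at_top. t \<in> {0<..} \<and> t ~= (0::real)" using eventually_gt_at_top[of "0::real"] by eventually_elim simp
 have Xl: "(X n \<longlongrightarrow> 1) at_top" for n unfolding X_def by (rule filterlim_compose[OF lim(1) shift_filterlims(1)])
 have Yl: "((%t. Y n t * t) \<longlongrightarrow> a / (Q - a)) at_top" for n unfolding Y_def
  by (rule shifted_reciprocal_limit[OF lim(2) shift_filterlims(1) tendsto_inverse_0_at_top[OF filterlim_ident]])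
    (use ev in \<open>auto elim: eventually_mono\<close>)
 show ?thesis
 proof (rule infinitely_many_germs_sequence[where W="%n. lvsol (X n) (Y n)"])
  fix n
  show "sol_near_infty N p q \<sigma> 1 (lvsol (X n) (Y n)) \<and>
       ((%r. (inverse r * \<bar>ln r\<bar> powr (1 / \<bar>p + \<sigma>\<bar>)) powr ((p - N) / (p - 1)) * lvsol (X n) (Y n) r)
        \<longlongrightarrow> kap N p \<sigma>) at_top \<and>
       ((%r. r powr ((N - 1) / (p - 1)) * \<bar>ln r\<bar> powr ((p - N) / (\<bar>p + \<sigma>\<bar> * (p - 1)))
           * deriv (lvsol (X n) (Y n)) r)
        \<longlongrightarrow> (p - N) / (p - 1) * kap N p \<sigma>) at_top"
   by (intro conjI lvsol_solution(1)[OF g] critical_limits[OF qQ log_filters(1) ev open_greaterThan g Xl Yl])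
 next
  fix m n assume e: "\<forall>\<^sub>F r in at_top. lvsol (X m) (Y m) r = lvsol (X n) (Y n) r"
  have "X m t > 0 \<and> X n t > 0" if "t \<in> {0<..}" for t
   using o[of "t + real m"] o[of "t + real n"] that by (auto simp: X_def)
  from lvsol_eq_imp(1)[OF g g this refl e] obtain T' where T': "!!t. t > T' ==> Y m t = Y n t" by blast
  define t where "t = max T' 0 + 1"
  have yy: "y (t + real m) = y (t + real n)" using T'[of t] by (simp add: Y_def t_def)
  have inj: "inj_on y {0..}"
   by (rule inj_onI) (metis anti linorder_less_linear monotone_onD order_less_irrefl)
  have "t + real m = t + real n" by (rule inj_onD[OF inj yy]) (auto simp: t_def)
  then show "m = n" by simp
 qed
qed

theorem critical_at_zero:
 assumes qQ: "q = Q"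
 shows "infinitely_many_germs (at_right 0)
    (%w. sol_near_zero N p q \<sigma> (-1) w \<and>
       ((%r. (inverse r * \<bar>ln r\<bar> powr (1 / \<bar>p + \<sigma>\<bar>)) powr ((p - N) / (p - 1)) * w r)
        \<longlongrightarrow> kap N p \<sigma>) (at_right 0) \<and>
       ((%r. r powr ((N - 1) / (p - 1)) * \<bar>ln r\<bar> powr ((p - N) / (\<bar>p + \<sigma>\<bar> * (p - 1)))
           * \<bar>deriv w r\<bar>)
        \<longlongrightarrow> (p - N) / (p - 1) * kap N p \<sigma>) (at_right 0))"
proof -
 obtain x y where o: "!!t. t <= 0 ==> lv x y t \<and> x t > 0 \<and> y t < 0" and anti: "strict_antimono_on {..0} y"
  and lim: "(x \<longlongrightarrow> 1) at_bot" "((%t. y t * t) \<longlongrightarrow> a / (Q - a)) at_bot"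
  using exists_orbit_leaving_degenerate[OF qQ] by blast
 define X Y where "X = (%(n::nat) t. x (t + - real n))" and "Y = (%(n::nat) t. y (t + - real n))"
 have g0: "good_orbit (- 1) {..<0} x y" using o by (auto simp: good_orbit_def intro!: mult_pos_neg)
 have g: "good_orbit (- 1) {..<0} (X n) (Y n)" for n unfolding X_def Y_def by (rule good_orbit_shift[OF g0]) auto
 have ev: "\<forall>\<^sub>F t in at_bot. t \<in> {..<0} \<and> t ~= (0::real)" using eventually_gt_at_bot[of "0::real"] by eventually_elim simp
 have Xl: "(X n \<longlongrightarrow> 1) at_bot" for n unfolding X_def by (rule filterlim_compose[OF lim(1) shift_filterlims(2)])
 have inv: "((%t::real. inverse t) \<longlongrightarrow> 0) at_bot" using tendsto_inverse_0[where 'a=real] at_bot_le_at_infinity by (rule tendsto_mono[rotated])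
 have Yl: "((%t. Y n t * t) \<longlongrightarrow> a / (Q - a)) at_bot" for n unfolding Y_def
  by (rule shifted_reciprocal_limit[OF lim(2) shift_filterlims(2) inv])
    (use ev in \<open>auto elim: eventually_mono\<close>)
 show ?thesis
 proof (rule infinitely_many_germs_sequence[where W="%n. lvsol (X n) (Y n)"])
  fix n
  note L = critical_limits[OF qQ log_filters(2) ev open_lessThan g[of n] Xl Yl]
  have "((%r. \<bar>r powr ((N - 1) / (p - 1)) * \<bar>ln r\<bar> powr ((p - N) / (\<bar>p + \<sigma>\<bar> * (p - 1))) * deriv (lvsol (X n) (Y n)) r\<bar>)
        \<longlongrightarrow> \<bar>(p - N) / (p - 1) * kap N p \<sigma>\<bar>) (at_right 0)"
   by (rule tendsto_rabs[OF L(2)])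
  moreover have nn: "\<bar>(p - N) / (p - 1) * kap N p \<sigma>\<bar> = (p - N) / (p - 1) * kap N p \<sigma>"
   unfolding exponents(5) using \<beta> by (simp add: kap_def)
  moreover have ab: "\<bar>A * \<bar>l\<bar> powr B * D\<bar> = A * \<bar>l\<bar> powr B * \<bar>D\<bar>" if "A >= 0" for A B D l :: real
   using that by (simp add: abs_mult)
  ultimately have "((%r. r powr ((N - 1) / (p - 1)) * \<bar>ln r\<bar> powr ((p - N) / (\<bar>p + \<sigma>\<bar> * (p - 1))) * \<bar>deriv (lvsol (X n) (Y n)) r\<bar>)
        \<longlongrightarrow> (p - N) / (p - 1) * kap N p \<sigma>) (at_right 0)" by (simp only: nn ab powr_ge_zero)
  then show "sol_near_zero N p q \<sigma> (-1) (lvsol (X n) (Y n)) \<and>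
       ((%r. (inverse r * \<bar>ln r\<bar> powr (1 / \<bar>p + \<sigma>\<bar>)) powr ((p - N) / (p - 1)) * lvsol (X n) (Y n) r)
        \<longlongrightarrow> kap N p \<sigma>) (at_right 0) \<and>
       ((%r. r powr ((N - 1) / (p - 1)) * \<bar>ln r\<bar> powr ((p - N) / (\<bar>p + \<sigma>\<bar> * (p - 1)))
           * \<bar>deriv (lvsol (X n) (Y n)) r\<bar>)
        \<longlongrightarrow> (p - N) / (p - 1) * kap N p \<sigma>) (at_right 0)"
   by (intro conjI lvsol_solution(2)[OF g] L(1))
 next
  fix m n assume e: "\<forall>\<^sub>F r in at_right 0. lvsol (X m) (Y m) r = lvsol (X n) (Y n) r"
  have "X m t > 0 \<and> X n t > 0" if "t \<in> {..<0}" for t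
   using o[of "t + - real m"] o[of "t + - real n"] that by (auto simp: X_def)
  from lvsol_eq_imp(2)[OF g g this refl e] obtain T' where T': "!!t. t < T' ==> Y m t = Y n t" by blast
  define t where "t = min T' 0 - 1"
  have yy: "y (t + - real m) = y (t + - real n)" using T'[of t] by (simp add: Y_def t_def)
  have inj: "inj_on y {..0}"
   by (rule inj_onI) (metis anti linorder_less_linear monotone_onD order_less_irrefl)
  have "t + - real m = t + - real n" by (rule inj_onD[OF inj yy]) (auto simp: t_def)
  then show "m = n" by simp
 qed
qed

end

theorem theorem4p12:
  fixes N p q \<sigma> :: real
  assumes "q > p - 1" and "p - 1 > 0" and "- \<sigma> > p" and "p > N"
  shows
   "(\<exists>d. \<forall>C>0. d C > 0 \<and>
      (\<forall>\<epsilon>\<in>{1, -1}. unique_germ at_top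
         (\<lambda>w. sol_near_infty N p q \<sigma> \<epsilon> w \<and>
              (w \<longlongrightarrow> C) at_top \<and>
              ((\<lambda>r. r powr (- (\<sigma> + 1) / (p - 1)) * deriv w r) \<longlongrightarrow> \<epsilon> * d C) at_top)))
  \<and>
    (q < q_crit N p \<sigma> \<longrightarrow>
      (\<exists>c. \<forall>k>0. c k > 0 \<and>
        (\<forall>\<epsilon>\<in>{1, -1}. infinitely_many_germs at_top
           (\<lambda>w. sol_near_infty N p q \<sigma> \<epsilon> w \<and>
                ((\<lambda>r. r powr ((N - p) / (p - 1)) * w r) \<longlongrightarrow> k) at_top \<and>
                ((\<lambda>r. r powr ((N - 1) / (p - 1)) * deriv w r) \<longlongrightarrow> c k) at_top)))
      \<and> \<not> (\<exists>w. sol_near_zero N p q \<sigma> 1 w)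
      \<and> global_sol N p q \<sigma> (-1) (w_star N p q \<sigma> (-1))
      \<and> (\<forall>k>0. \<exists>w. global_sol N p q \<sigma> (-1) w \<and>
            ((\<lambda>r. r powr ((N - p) / (p - 1)) * w r) \<longlongrightarrow> k) at_top \<and>
            ((\<lambda>r. r powr gam p q \<sigma> * w r) \<longlongrightarrow> a_star N p q \<sigma> (-1)) (at_right 0)))
  \<and>
    (q > q_crit N p \<sigma> \<longrightarrow>
      (\<exists>c. (\<forall>k>0. c k > 0) \<and>
        (\<forall>\<epsilon>\<in>{1, -1}.
          let P = (\<lambda>k w. sol_near_zero N p q \<sigma> \<epsilon> w \<and>
                     ((\<lambda>r. r powr ((N - p) / (p - 1)) * w r) \<longlongrightarrow> k) (at_right 0) \<and>
                     ((\<lambda>r. r powr ((N - 1) / (p - 1)) * deriv w r) \<longlongrightarrow> c k) (at_right 0))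
          in (\<forall>k>0. \<exists>w. P k w) \<and>
             (\<forall>k>0. \<forall>l>0. \<forall>u v. P k u \<and> P l v \<longrightarrow>
                (\<exists>\<mu>>0. \<forall>\<^sub>F r in at_right 0. v r = scaling (gam p q \<sigma>) \<mu> u r))))
      \<and> (\<forall>w. \<forall>r0>0. pos_solution_on N p q \<sigma> (-1) {r0<..} w \<longrightarrow>
            (\<exists>L. (w \<longlongrightarrow> L) at_top) \<and>
            \<not> (\<exists>v. global_sol N p q \<sigma> (-1) v \<and> (\<forall>r>r0. v r = w r)))
      \<and> global_sol N p q \<sigma> 1 (w_star N p q \<sigma> 1)
      \<and> (q < q_sob N p \<sigma> \<longrightarrow>
            \<not> (\<exists>w L. global_sol N p q \<sigma> 1 w \<and> (w \<longlongrightarrow> L) at_top) \<and>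
            (\<forall>k>0. \<exists>w. global_sol N p q \<sigma> 1 w \<and>
               ((\<lambda>r. r powr gam p q \<sigma> * w r) \<longlongrightarrow> a_star N p q \<sigma> 1) at_top \<and>
               ((\<lambda>r. r powr ((N - p) / (p - 1)) * w r) \<longlongrightarrow> k) (at_right 0)))
      \<and> (q > q_sob N p \<sigma> \<longrightarrow>
            (\<forall>C>0. \<exists>w. global_sol N p q \<sigma> 1 w \<and>
               (w \<longlongrightarrow> C) at_top \<and>
               ((\<lambda>r. r powr gam p q \<sigma> * w r) \<longlongrightarrow> a_star N p q \<sigma> 1) (at_right 0)))
      \<and> (q = q_sob N p \<sigma> \<longrightarrow>
            (\<forall>c>0.
              let d = c powr (q - p + 1) * inverse \<bar>N + \<sigma>\<bar> * ((p - N) / (p - 1)) powr (1 - p);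
                  w = (\<lambda>r. c * (d + r powr ((p + \<sigma>) / (p - 1))) powr ((p - N) / (p + \<sigma>)))
              in global_sol N p q \<sigma> 1 w \<and>
                 (w \<longlongrightarrow> 0) (at_right 0) \<and>
                 w \<sim>[at_right 0] (\<lambda>r. c * r powr ((p - N) / (p - 1))) \<and>
                 (w \<longlongrightarrow> c * d powr ((p - N) / (p + \<sigma>))) at_top)))
  \<and>
    (q = q_crit N p \<sigma> \<longrightarrow>
      infinitely_many_germs at_top
        (\<lambda>w. sol_near_infty N p q \<sigma> 1 w \<and>
             ((\<lambda>r. (inverse r * \<bar>ln r\<bar> powr (1 / \<bar>p + \<sigma>\<bar>)) powr ((p - N) / (p - 1)) * w r)
                \<longlongrightarrow> kap N p \<sigma>) at_top \<and>
             ((\<lambda>r. r powr ((N - 1) / (p - 1)) * \<bar>ln r\<bar> powr ((p - N) / (\<bar>p + \<sigma>\<bar> * (p - 1)))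
                     * deriv w r)
                \<longlongrightarrow> (p - N) / (p - 1) * kap N p \<sigma>) at_top)
      \<and> \<not> (\<exists>w. sol_near_zero N p q \<sigma> 1 w)
      \<and> infinitely_many_germs (at_right 0)
        (\<lambda>w. sol_near_zero N p q \<sigma> (-1) w \<and>
             ((\<lambda>r. (inverse r * \<bar>ln r\<bar> powr (1 / \<bar>p + \<sigma>\<bar>)) powr ((p - N) / (p - 1)) * w r)
                \<longlongrightarrow> kap N p \<sigma>) (at_right 0) \<and>
             ((\<lambda>r. r powr ((N - 1) / (p - 1)) * \<bar>ln r\<bar> powr ((p - N) / (\<bar>p + \<sigma>\<bar> * (p - 1)))
                     * \<bar>deriv w r\<bar>)
                \<longlongrightarrow> (p - N) / (p - 1) * kap N p \<sigma>) (at_right 0)))"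
proof -
 define a \<beta> Q K where "a = p - 1" and "\<beta> = (p - N) / (p - 1)" and "Q = q_crit N p \<sigma>" and "K = \<beta> powr (- a - 1)"
 have a: "a > 0" using assms by (simp add: a_def)
 have b: "\<beta> > 0" using assms by (simp add: \<beta>_def)
 have ab: "a * \<beta> = p - N" using assms by (simp add: a_def \<beta>_def)
 have Qb: "Q * \<beta> = - (N + \<sigma>)"
 proof -
  have "Q * \<beta> = (N + \<sigma>) * ((p - N) / (N - p))" using assms by (simp add: Q_def \<beta>_def q_crit_def)
  also have "(p - N) / (N - p) = - 1" using assms by (simp add: field_simps)
  finally show ?thesis by simp
 qed
 interpret weighted_equation a q Q K N p \<sigma> \<beta>
 proof unfold_locales
  show "0 < a" by (rule a)
  show "a < q" using assms by (simp add: a_def)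
  have "a * \<beta> < Q * \<beta>" unfolding ab Qb using assms by simp
  then show "a < Q" using b by simp
  show "0 < K" using b by (simp add: K_def)
  show "p = a + 1" by (simp add: a_def)
  show "N = a + 1 - a * \<beta>" unfolding ab by (simp add: a_def)
  show "\<sigma> = a * \<beta> - a - 1 - Q * \<beta>" unfolding ab Qb by (simp add: a_def)
  show "0 < \<beta>" by (rule b)
  show "K = \<beta> powr (- a - 1)" by (rule K_def)
 qed
 have \<delta>1: "- 1 * (1 - \<delta>) > 0 \<longleftrightarrow> q < Q" "1 * (1 - \<delta>) > 0 \<longleftrightarrow> Q < q"
  using aq by (simp_all add: \<delta>_def pos_less_divide_eq pos_divide_less_eq)
 show ?thesis
  unfolding Q_def[symmetric]
 proof (intro conjI impI, goal_cases)
  case 1 show ?case by (rule regular_at_infinity)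
 next
  case 2 then show ?case by (rule singular_at_infinity)
 next
  case 3 then show ?case by (intro no_solution_near_zero less_imp_le)
 next
  case 4 then show ?case by (intro w_star_solution) (simp_all only: \<delta>1 simp_thms)
 next
  case 5 then show ?case by (intro allI impI connection_to_singular_at_infinity)
 next
  case 6 then show ?case by (rule singular_at_zero)
 next
  case 7 then show ?case using absorption_at_infinity by blast
 next
  case 8 then show ?case by (intro w_star_solution) (simp_all only: \<delta>1 simp_thms)
 next
  case 9 then show ?case by (rule no_global_solution_subcritical)
 next
  case 10 then show ?case by (intro allI impI connection_from_singular_at_zero)
 next
  case 11 then show ?case by (intro allI impI connection_to_regular_at_infinity)
 next
  case 12
  show ?case unfolding Let_def by (intro allI impI conjI explicit_solution[OF 12(2) _ refl refl])
 next
  case 13 then show ?case by (rule critical_at_infinity)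
 next
  case 14 then show ?case by (intro no_solution_near_zero eq_refl)
 next
  case 15 then show ?case by (rule critical_at_zero)
 qed
qed

end
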